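(* Let $Q$ be a singular measured space of finite type and $\tilde\Sigma$ a uniformly locally finite $2$-dimensional $Q$-periodic simplicial complex. Let $(X,R)$ be the space of vertices of the associated lamination $\Sigma$ with its leaf relation $R$, fix a quasi-invariant probability measure $\mu$ on $X$, let $\delta$ be the associated Radon–Nikodym cocycle, and let $\delta_\mu\ge1$ be a real number such that $$\delta_\mu^{-1}\le\delta(y,z)\le\delta_\mu$$ for almost every edge $(y,z)$. Suppose that almost every link $L$ is connected and satisfies $\lambda_1(L)\ge\lambda$, where $\lambda$ is a real number with $$\lambda>\delta_\mu^3/2 .$$ Then $Q$ has Kazhdan's property T.
   Context: A probability space $(X,\mu)$ is a standard Borel space with an atomless Borel probability measure. A measured equivalence relation $R$ on $(X,\mu)$ is an equivalence relation with countable classes whose graph is Borel and for which $\mu$ is quasi-invariant (saturations of null Borel sets are null). On $R$ put $\mathfrak h(K)=\int_X \#\{y : (x,y)\in K\}\,d\mu(x)$; $\mathfrak h^{-1}$ is its image under $(x,y)\mapsto(y,x)$, and $\delta=d\mathfrak h/d\mathfrak h^{-1}$ is the Radon–Nikodym cocycle of $\mu$. Everything is understood up to null sets. Two measured equivalence relations are stably isomorphic if their restrictions to some Borel sets meeting almost every class are isomorphic via a Borel isomorphism preserving measure classes. A singular measured space is the quotient $Q=X_0/R_0$ of a measured equivalence relation $(X_0,\mu_0,R_0)$; a discrete desingularization of $Q$ is a measured equivalence relation $(X,\mu,R)$ on a probability space stably isomorphic to it. $Q$ is of finite type if some discrete desingularization $R$ has a uniformly locally finite symmetric graphing (symmetric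 Borel $K\subset R$ generating $R$ with $\sup_x\#\{y:(x,y)\in K\}<\infty$); this is automatic when $\tilde\Sigma$ as below exists. A uniformly locally finite $2$-dimensional $Q$-periodic simplicial complex is given concretely by a discrete desingularization $(X,\mu,R)$ of $Q$ together with a Borel family $\Sigma$ of simplices on the vertex set $X$, i.e. an (abstract) simplicial complex of dimension $2$ with vertex set $X$, each simplex (edge, triangle) being contained in a single $R$-class, the set of edges $\Sigma^{(1)}\subset R$ and the set of triangles being Borel, the number of simplices containing a vertex being bounded uniformly, and the $1$-skeleton $\Sigma^{(1)}$ generating $R$ (so each leaf, i.e. the subcomplex carried by an $R$-class, is connected). The link $L=L_x$ of a vertex $x$ is the finite graph whose vertices are the edges of $\Sigma$ containing $x$ and whose edges are the triangles of $\Sigma$ containing $x$. For a finite connected graph $L$ (with at least one edge), $\tau(y)$ denoting the valency of a vertex $y$, let $D_Lf(y)=\frac1{\tau(y)}\sum_{z\sim y}f(z)$ on functions on the vertices; $\lambda_1(L)$ is the smallest nonzero eigenvalue of $\Delta_L=\mathrm{Id}-D_L$. A (unitary) representation $\pi$ of $R$ on a measurable field $H=(H_x)_{x\in X}$ of separable Hilbert spaces is a family of unitaries $\pi(x,y):H_y\to H_x$, $(x,y)\in R$, with $\pi(x,x)=\mathrm{Id}$, $\pi(x,z)=\pi(x,y)\pi(y,z)$, and with $(x,y)\mapsto\langle\pi(x,y)\xi_y\mid\eta_x\rangle$ measurable for all measurable sections $\xi,\eta$. $R$ has property T if every representation for which there exist measurable sections $\xi^n$ with $\|\xi^n_x\|=1$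 a.e., increasing Borel sets $K_n\subset R$ with $\bigcup K_n=R$ up to a null set, and $\varepsilon_n\to0$ with $\|\pi(x,y)\xi^n_y-\xi^n_x\|\le\varepsilon_n$ for a.e. $(x,y)\in K_n$, has a section $\xi$ with $\|\xi_x\|=1$ a.e. and $\pi(x,y)\xi_y=\xi_x$ for a.e. $(x,y)\in R$. $Q$ has property T if all its discrete desingularizations have it. *)

theory Defs
  imports "HOL-Analysis.Analysis"
begin

section \<open>Measured equivalence relations\<close>

definition standard_borel :: "'a measure \<Rightarrow> bool" where
  "standard_borel M \<longleftrightarrow>
     (\<exists>T. topspace T = space M \<and> completely_metrizable_space T \<and> separable_space T \<and>
          sets M = sigma_sets (space M) {U. openin T U})"

definition atomless :: "'a measure \<Rightarrow> bool" where
  "atomless M \<longleftrightarrow>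
     (\<forall>A\<in>sets M. emeasure M A > 0 \<longrightarrow>
        (\<exists>B\<in>sets M. B \<subseteq> A \<and> 0 < emeasure M B \<and> emeasure M B < emeasure M A))"

definition standard_prob_space :: "'a measure \<Rightarrow> bool" where
  "standard_prob_space M \<longleftrightarrow> standard_borel M \<and> emeasure M (space M) = 1 \<and> atomless M"

definition measured_eqrel :: "'a measure \<Rightarrow> 'a rel \<Rightarrow> bool" where
  "measured_eqrel M R \<longleftrightarrow>
     standard_prob_space M \<and>
     equiv (space M) R \<and>
     (\<forall>x\<in>space M. countable (R `` {x})) \<and>
     R \<in> sets (M \<Otimes>\<^sub>M M) \<and>
     (\<forall>N\<in>null_sets M. R `` N \<in> null_sets M)"

definition rel_measure :: "'a measure \<Rightarrow> 'a rel \<Rightarrow> ('a \<times> 'a) measure" where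
  "rel_measure M R =
     measure_of R (sets (restrict_space (M \<Otimes>\<^sub>M M) R))
       (\<lambda>K. \<integral>\<^sup>+ x. emeasure (count_space UNIV) {y. (x, y) \<in> K} \<partial>M)"

definition rel_measure_inv :: "'a measure \<Rightarrow> 'a rel \<Rightarrow> ('a \<times> 'a) measure" where
  "rel_measure_inv M R = distr (rel_measure M R) (rel_measure M R) prod.swap"

text \<open>\<open>RN_deriv N L\<close> is the density of \<open>L\<close> with respect to \<open>N\<close>, i.e. \<open>dL/dN\<close>.\<close>

definition RN_cocycle :: "'a measure \<Rightarrow> 'a rel \<Rightarrow> 'a \<times> 'a \<Rightarrow> ennreal" where
  "RN_cocycle M R = RN_deriv (rel_measure_inv M R) (rel_measure M R)"

definition generates :: "'a set \<Rightarrow> 'a rel \<Rightarrow> 'a rel \<Rightarrow> bool" where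
  "generates X K R \<longleftrightarrow> R = (K \<union> K\<inverse>)\<^sup>* \<inter> (X \<times> X)"

definition ulf_symmetric_graphing :: "'a measure \<Rightarrow> 'a rel \<Rightarrow> 'a rel \<Rightarrow> bool" where
  "ulf_symmetric_graphing M R K \<longleftrightarrow>
     K \<subseteq> R \<and> K \<in> sets (M \<Otimes>\<^sub>M M) \<and> sym K \<and> generates (space M) K R \<and>
     (\<exists>n. \<forall>x\<in>space M. finite {y. (x, y) \<in> K} \<and> card {y. (x, y) \<in> K} \<le> n)"


section \<open>Singular measured spaces\<close>

text \<open>The quotient \<open>X\<^sub>0/R\<^sub>0\<close> is represented by the measured equivalence relation
  \<open>(M\<^sub>0, R\<^sub>0)\<close> itself.\<close>

definition meets_almost_every_class :: "'a measure \<Rightarrow> 'a rel \<Rightarrow> 'a set \<Rightarrow> bool" where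
  "meets_almost_every_class M R A \<longleftrightarrow> (AE x in M. R `` {x} \<inter> A \<noteq> {})"

definition stably_isomorphic ::
  "'a measure \<Rightarrow> 'a rel \<Rightarrow> 'b measure \<Rightarrow> 'b rel \<Rightarrow> bool" where
  "stably_isomorphic M R N S \<longleftrightarrow>
     (\<exists>A\<in>sets M. \<exists>B\<in>sets N. \<exists>\<phi>.
        meets_almost_every_class M R A \<and> meets_almost_every_class N S B \<and>
        bij_betw \<phi> A B \<and>
        \<phi> \<in> measurable (restrict_space M A) (restrict_space N B) \<and>
        the_inv_into A \<phi> \<in> measurable (restrict_space N B) (restrict_space M A) \<and>
        (\<forall>E\<in>sets M. E \<subseteq> A \<longrightarrow> (E \<in> null_sets M \<longleftrightarrow> \<phi> ` E \<in> null_sets N)) \<and>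
        (\<forall>x\<in>A. \<forall>y\<in>A. (x, y) \<in> R \<longleftrightarrow> (\<phi> x, \<phi> y) \<in> S))"

definition discrete_desingularization ::
  "'a measure \<Rightarrow> 'a rel \<Rightarrow> 'c measure \<Rightarrow> 'c rel \<Rightarrow> bool" where
  "discrete_desingularization M R M\<^sub>0 R\<^sub>0 \<longleftrightarrow>
     measured_eqrel M R \<and> stably_isomorphic M R M\<^sub>0 R\<^sub>0"

text \<open>The type argument says on which type the desingularization is to be found. As a
  hypothesis of a theorem that does not otherwise mention this type variable, it amounts to
  the existence of a desingularization on an arbitrary type.\<close>

definition finite_type :: "'d itself \<Rightarrow> 'c measure \<Rightarrow> 'c rel \<Rightarrow> bool" where
  "finite_type (_ :: 'd itself) M\<^sub>0 R\<^sub>0 \<longleftrightarrow>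
     (\<exists>(M :: 'd measure) R K.
        discrete_desingularization M R M\<^sub>0 R\<^sub>0 \<and> ulf_symmetric_graphing M R K)"


section \<open>Periodic simplicial complexes\<close>

definition edge_set :: "'a set set \<Rightarrow> 'a rel" where
  "edge_set \<Sigma> = {(x, y). x \<noteq> y \<and> {x, y} \<in> \<Sigma>}"

definition triangle_set :: "'a set set \<Rightarrow> ('a \<times> 'a \<times> 'a) set" where
  "triangle_set \<Sigma> = {(x, y, z). x \<noteq> y \<and> y \<noteq> z \<and> x \<noteq> z \<and> {x, y, z} \<in> \<Sigma>}"

definition simplicial_complex_2 :: "'a set \<Rightarrow> 'a set set \<Rightarrow> bool" where
  "simplicial_complex_2 X \<Sigma> \<longleftrightarrow>
     \<Union>\<Sigma> = X \<and>
     (\<forall>s\<in>\<Sigma>. s \<noteq> {} \<and> finite s \<and> card s \<le> 3) \<and>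
     (\<exists>s\<in>\<Sigma>. card s = 3) \<and>
     (\<forall>s\<in>\<Sigma>. \<forall>t. t \<noteq> {} \<and> t \<subseteq> s \<longrightarrow> t \<in> \<Sigma>)"

definition ulf_periodic_complex_2 :: "'a measure \<Rightarrow> 'a rel \<Rightarrow> 'a set set \<Rightarrow> bool" where
  "ulf_periodic_complex_2 M R \<Sigma> \<longleftrightarrow>
     simplicial_complex_2 (space M) \<Sigma> \<and>
     (\<forall>s\<in>\<Sigma>. s \<times> s \<subseteq> R) \<and>
     edge_set \<Sigma> \<in> sets (M \<Otimes>\<^sub>M M) \<and>
     triangle_set \<Sigma> \<in> sets (M \<Otimes>\<^sub>M (M \<Otimes>\<^sub>M M)) \<and>
     (\<exists>n. \<forall>x\<in>space M. finite {s\<in>\<Sigma>. x \<in> s} \<and> card {s\<in>\<Sigma>. x \<in> s} \<le> n) \<and>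
     generates (space M) (edge_set \<Sigma>) R"


section \<open>Links and their first eigenvalue\<close>

text \<open>A graph is given by its vertex set and its adjacency relation.\<close>

definition graph_connected :: "'v set \<Rightarrow> ('v \<Rightarrow> 'v \<Rightarrow> bool) \<Rightarrow> bool" where
  "graph_connected V adj \<longleftrightarrow>
     V \<noteq> {} \<and> (\<forall>u\<in>V. \<forall>v\<in>V. (u, v) \<in> {(y, z). y \<in> V \<and> z \<in> V \<and> adj y z}\<^sup>*)"

definition valency :: "'v set \<Rightarrow> ('v \<Rightarrow> 'v \<Rightarrow> bool) \<Rightarrow> 'v \<Rightarrow> nat" where
  "valency V adj y = card {z\<in>V. adj y z}"

definition graph_diffusion ::
  "'v set \<Rightarrow> ('v \<Rightarrow> 'v \<Rightarrow> bool) \<Rightarrow> ('v \<Rightarrow> real) \<Rightarrow> 'v \<Rightarrow> real" where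
  "graph_diffusion V adj f y = 1 / real (valency V adj y) * (\<Sum>z\<in>{z\<in>V. adj y z}. f z)"

definition graph_laplacian ::
  "'v set \<Rightarrow> ('v \<Rightarrow> 'v \<Rightarrow> bool) \<Rightarrow> ('v \<Rightarrow> real) \<Rightarrow> 'v \<Rightarrow> real" where
  "graph_laplacian V adj f y = f y - graph_diffusion V adj f y"

definition laplacian_eigenvalue :: "'v set \<Rightarrow> ('v \<Rightarrow> 'v \<Rightarrow> bool) \<Rightarrow> real \<Rightarrow> bool" where
  "laplacian_eigenvalue V adj c \<longleftrightarrow>
     (\<exists>f. (\<exists>y\<in>V. f y \<noteq> 0) \<and> (\<forall>y\<in>V. graph_laplacian V adj f y = c * f y))"

definition graph_lambda1 :: "'v set \<Rightarrow> ('v \<Rightarrow> 'v \<Rightarrow> bool) \<Rightarrow> real" where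
  "graph_lambda1 V adj = Min {c. c \<noteq> 0 \<and> laplacian_eigenvalue V adj c}"

text \<open>Two distinct edges at \<open>x\<close> are adjacent in the link when they lie in a common triangle;
  that triangle is necessarily their union.\<close>

definition link_vertices :: "'a set set \<Rightarrow> 'a \<Rightarrow> 'a set set" where
  "link_vertices \<Sigma> x = {e\<in>\<Sigma>. card e = 2 \<and> x \<in> e}"

definition link_adj :: "'a set set \<Rightarrow> 'a \<Rightarrow> 'a set \<Rightarrow> 'a set \<Rightarrow> bool" where
  "link_adj \<Sigma> x e f \<longleftrightarrow>
     e \<in> link_vertices \<Sigma> x \<and> f \<in> link_vertices \<Sigma> x \<and> e \<noteq> f \<and> e \<union> f \<in> \<Sigma>"

definition link_connected :: "'a set set \<Rightarrow> 'a \<Rightarrow> bool" where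
  "link_connected \<Sigma> x \<longleftrightarrow> graph_connected (link_vertices \<Sigma> x) (link_adj \<Sigma> x)"

definition link_lambda1 :: "'a set set \<Rightarrow> 'a \<Rightarrow> real" where
  "link_lambda1 \<Sigma> x = graph_lambda1 (link_vertices \<Sigma> x) (link_adj \<Sigma> x)"


section \<open>Complex Hilbert spaces and measurable fields\<close>

text \<open>The complex inner product is linear in its first argument.\<close>

class chilbert_space = real_inner + complete_space +
  fixes scaleC :: "complex \<Rightarrow> 'a \<Rightarrow> 'a"
    and cinner :: "'a \<Rightarrow> 'a \<Rightarrow> complex"
  assumes scaleC_add_right: "scaleC a (x + y) = scaleC a x + scaleC a y"
    and scaleC_add_left: "scaleC (a + b) x = scaleC a x + scaleC b x"
    and scaleC_scaleC: "scaleC a (scaleC b x) = scaleC (a * b) x"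
    and scaleC_of_real: "scaleC (complex_of_real r) x = scaleR r x"
    and cinner_commute: "cinner x y = cnj (cinner y x)"
    and cinner_add_left: "cinner (x + y) z = cinner x z + cinner y z"
    and cinner_scaleC_left: "cinner (scaleC a x) y = a * cinner x y"
    and Re_cinner: "Re (cinner x y) = inner x y"

instantiation complex :: chilbert_space
begin

definition "scaleC_complex (a :: complex) (x :: complex) = a * x"
definition "cinner_complex (x :: complex) (y :: complex) = x * cnj y"

instance
  by standard
    (auto simp: scaleC_complex_def cinner_complex_def algebra_simps scaleR_conv_of_real
      inner_complex_def)

end

definition closed_csubspace :: "'h::chilbert_space set \<Rightarrow> bool" where
  "closed_csubspace W \<longleftrightarrow>
     closed W \<and> 0 \<in> W \<and> (\<forall>u\<in>W. \<forall>v\<in>W. u + v \<in> W) \<and> (\<forall>a. \<forall>u\<in>W. scaleC a u \<in> W)"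

text \<open>Measurable fields in the sense of Dixmier: \<open>S\<close> is the space of measurable sections and is
  part of the structure. The fibres are closed subspaces of an arbitrary, not necessarily
  separable, ambient Hilbert space, whose own structure plays no role across fibres; any family
  of Hilbert spaces is of this form inside its Hilbert sum. The total sequence
  makes each fibre separable.\<close>

definition measurable_field ::
  "'a measure \<Rightarrow> ('a \<Rightarrow> 'h::chilbert_space set) \<Rightarrow> ('a \<Rightarrow> 'h) set \<Rightarrow> bool" where
  "measurable_field M H S \<longleftrightarrow>
     (\<forall>x\<in>space M. closed_csubspace (H x)) \<and>
     S \<subseteq> Pi (space M) H \<and>
     (\<forall>s\<in>S. \<forall>t\<in>S. (\<lambda>x. s x + t x) \<in> S) \<and>
     (\<forall>a. \<forall>s\<in>S. (\<lambda>x. scaleC a (s x)) \<in> S) \<and>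
     (\<forall>s\<in>S. (\<lambda>x. norm (s x)) \<in> borel_measurable M) \<and>
     (\<forall>t\<in>Pi (space M) H.
        (\<forall>s\<in>S. (\<lambda>x. cinner (t x) (s x)) \<in> borel_measurable M) \<longrightarrow> t \<in> S) \<and>
     (\<exists>e :: nat \<Rightarrow> 'a \<Rightarrow> 'h. (\<forall>n. e n \<in> S) \<and>
        (\<forall>x\<in>space M. closed_csubspace hull (range (\<lambda>n. e n x)) = H x))"

definition unitary_between ::
  "'h::chilbert_space set \<Rightarrow> 'h set \<Rightarrow> ('h \<Rightarrow> 'h) \<Rightarrow> bool" where
  "unitary_between V W U \<longleftrightarrow>
     bij_betw U V W \<and>
     (\<forall>u\<in>V. \<forall>v\<in>V. U (u + v) = U u + U v) \<and>
     (\<forall>a. \<forall>u\<in>V. U (scaleC a u) = scaleC a (U u)) \<and>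
     (\<forall>u\<in>V. \<forall>v\<in>V. cinner (U u) (U v) = cinner u v)"


section \<open>Representations and property T\<close>

definition representation ::
  "'a measure \<Rightarrow> 'a rel \<Rightarrow> ('a \<Rightarrow> 'h::chilbert_space set) \<Rightarrow> ('a \<Rightarrow> 'h) set \<Rightarrow>
   ('a \<Rightarrow> 'a \<Rightarrow> 'h \<Rightarrow> 'h) \<Rightarrow> bool" where
  "representation M R H S \<pi> \<longleftrightarrow>
     measurable_field M H S \<and>
     (\<forall>(x, y)\<in>R. unitary_between (H y) (H x) (\<pi> x y)) \<and>
     (\<forall>x\<in>space M. \<forall>u\<in>H x. \<pi> x x u = u) \<and>
     (\<forall>x y z. (x, y) \<in> R \<longrightarrow> (y, z) \<in> R \<longrightarrow> (\<forall>u\<in>H z. \<pi> x z u = \<pi> x y (\<pi> y z u))) \<and>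
     (\<forall>\<xi>\<in>S. \<forall>\<eta>\<in>S. (\<lambda>(x, y). cinner (\<pi> x y (\<xi> y)) (\<eta> x))
        \<in> borel_measurable (restrict_space (M \<Otimes>\<^sub>M M) R))"

definition has_almost_invariant_unit_sections ::
  "'a measure \<Rightarrow> 'a rel \<Rightarrow> ('a \<Rightarrow> 'h::chilbert_space) set \<Rightarrow>
   ('a \<Rightarrow> 'a \<Rightarrow> 'h \<Rightarrow> 'h) \<Rightarrow> bool" where
  "has_almost_invariant_unit_sections M R S \<pi> \<longleftrightarrow>
     (\<exists>(\<xi> :: nat \<Rightarrow> 'a \<Rightarrow> 'h) (K :: nat \<Rightarrow> 'a rel) (\<epsilon> :: nat \<Rightarrow> real).
        (\<forall>n. \<xi> n \<in> S \<and> (AE x in M. norm (\<xi> n x) = 1)) \<and>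
        (\<forall>n. K n \<in> sets (M \<Otimes>\<^sub>M M) \<and> K n \<subseteq> R) \<and> incseq K \<and>
        R - (\<Union>n. K n) \<in> null_sets (rel_measure M R) \<and>
        \<epsilon> \<longlonglongrightarrow> 0 \<and>
        (\<forall>n. AE (x, y) in rel_measure M R.
           (x, y) \<in> K n \<longrightarrow> norm (\<pi> x y (\<xi> n y) - \<xi> n x) \<le> \<epsilon> n))"

definition has_invariant_unit_section ::
  "'a measure \<Rightarrow> 'a rel \<Rightarrow> ('a \<Rightarrow> 'h::chilbert_space) set \<Rightarrow>
   ('a \<Rightarrow> 'a \<Rightarrow> 'h \<Rightarrow> 'h) \<Rightarrow> bool" where
  "has_invariant_unit_section M R S \<pi> \<longleftrightarrow>
     (\<exists>\<xi>\<in>S. (AE x in M. norm (\<xi> x) = 1) \<and>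
        (AE (x, y) in rel_measure M R. \<pi> x y (\<xi> y) = \<xi> x))"

text \<open>The type argument is the ambient Hilbert space of the fields over which the representations
  range; property T itself is the assertion for all types of class \<open>chilbert_space\<close>.\<close>

definition property_T :: "'h::chilbert_space itself \<Rightarrow> 'a measure \<Rightarrow> 'a rel \<Rightarrow> bool" where
  "property_T (_ :: 'h itself) M R \<longleftrightarrow>
     (\<forall>(H :: 'a \<Rightarrow> 'h set) S \<pi>.
        representation M R H S \<pi> \<longrightarrow>
        has_almost_invariant_unit_sections M R S \<pi> \<longrightarrow>
        has_invariant_unit_section M R S \<pi>)"

text \<open>Likewise \<open>'b\<close> is the type carrying the desingularizations; the full notion is the assertion
  for all types \<open>'b\<close> and \<open>'h\<close>.\<close>

definition singular_property_T ::
  "'b itself \<Rightarrow> 'h::chilbert_space itself \<Rightarrow> 'c measure \<Rightarrow> 'c rel \<Rightarrow> bool" where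
  "singular_property_T (_ :: 'b itself) (_ :: 'h itself) M\<^sub>0 R\<^sub>0 \<longleftrightarrow>
     (\<forall>(M :: 'b measure) R.
        discrete_desingularization M R M\<^sub>0 R\<^sub>0 \<longrightarrow> property_T TYPE('h) M R)"

end

theory Submission
  imports Defs
begin

text \<open>Given a section \<open>\<xi>\<close> of a representation, consider its energy, the integral of
  \<open>\<tau>(x, y) |\<pi>(x, y) \<xi>(y) - \<xi>(x)|\<^sup>2\<close> over the edges, where \<open>\<tau>\<close> counts the triangles containing an edge.
  The spectral inequality in the links (Garland's method), integrated over the vertices and
  transported along the edges with the cocycle, bounds the energy by a constant times the squared
  norm of its gradient for a weight that makes the edge measure invariant under the flip. Following
  the gradient then decreases the energy geometrically, so a section of small energy is close in
  \<open>L\<^sup>1\<close> to an invariant one. Invariant sections close to almost invariant unit sections are nonzero on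
  invariant sets of measure close to 1 and can be normalized and glued.

  Property T is moved between desingularizations by pulling the representation back along a Borel
  map that sends classes to classes. Such maps, and the fact that the counting measure of a measured
  equivalence relation is a measure at all, rest on measurable selection for Borel sets in products
  of standard Borel spaces, which is proved by a capacity argument.\<close>


section \<open>Analytic sets and measurable selection\<close>

text \<open>The measure is only quasi-invariant, so two weights compete. The link inequality carries
  the weight \<tau>, while summation by parts needs a flip-invariant weight, and \<open>w\<close> =
  \<tau> (1 + g) / 2 is the average of \<tau> with its flip. Passing from \<open>w\<close> to \<tau>
  costs the factor (1 + \<delta>) / 2, and moving a triangle sum from one end of an edge to the
  other costs \<delta>. The descent therefore works once l > \<delta> (1 + \<delta>) / 4, which l >
  \<delta>^3 / 2 implies. Almost invariance is available only pointwise on the relation, so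
  everything is kept uniformly bounded: a descent step averages transported values and preserves a
  sup bound, and dominated convergence turns pointwise statements into statements on energies. The
  field over another desingularization is never rebuilt over the vertices; sections of it along the
  map \<Phi> are used instead. Measurability is needed only up to null sets, so selection may stop
  at compact sets that exhaust a projection in outer measure.\<close>

definition analytic_in :: "'a topology \<Rightarrow> 'a set \<Rightarrow> bool" where
  "analytic_in T A \<longleftrightarrow>
     (\<exists>F. closedin (prod_topology T (euclidean :: (nat \<Rightarrow> nat) topology)) F \<and> fst ` F = A)"

lemma analytic_in_closed:
  assumes "closedin T A"
  shows "analytic_in T A"
proof -
  have "closedin (prod_topology T (euclidean :: (nat \<Rightarrow> nat) topology)) (A \<times> UNIV)"
    using assms by (simp add: closedin_prod_Times_iff)
  moreover have "fst ` (A \<times> (UNIV :: (nat \<Rightarrow> nat) set)) = A" by simp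
  ultimately show ?thesis unfolding analytic_in_def by blast
qed

lemma continuous_map_snd_component:
  "continuous_map (prod_topology T (euclidean :: (nat \<Rightarrow> nat) topology)) (prod_topology T euclidean)
     (\<lambda>(x, \<alpha>). (x, \<lambda>k. \<alpha> (h k)))"
proof -
  have "continuous_map euclidean euclidean (\<lambda>\<alpha> :: nat \<Rightarrow> nat. \<lambda>k. \<alpha> (h k))"
    unfolding continuous_map_iff_continuous2
    by (intro continuous_on_coordinatewise_then_product continuous_on_product_coordinates)
  then have "continuous_map (prod_topology T (euclidean :: (nat \<Rightarrow> nat) topology)) euclidean
      ((\<lambda>\<alpha> :: nat \<Rightarrow> nat. \<lambda>k. \<alpha> (h k)) \<circ> snd)"
    using continuous_map_compose continuous_map_snd by blast
  then show ?thesis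
    by (auto simp: continuous_map_pairwise case_prod_unfold o_def continuous_map_fst)
qed

text \<open>Reindexing the parameter is how unions and intersections are coded: \<open>Suc\<close>
  forgets the leading entry, and \<open>\<lambda>k. prod_encode (i, k)\<close> extracts the i-th
  row.\<close>

lemma closedin_reindex:
  assumes "closedin (prod_topology T (euclidean :: (nat \<Rightarrow> nat) topology)) F"
  shows "closedin (prod_topology T (euclidean :: (nat \<Rightarrow> nat) topology))
    {p \<in> topspace T \<times> UNIV. (fst p, \<lambda>k. snd p (h k)) \<in> F}"
  using closedin_continuous_map_preimage[OF continuous_map_snd_component assms, of h]
  by (simp add: case_prod_unfold)

text \<open>The leading entry of the parameter names a member of the union, the remaining entries
  are its witness. \<open>G i\<close> imposes nothing unless the leading entry is i, so the
  intersection over all i imposes a single condition and is still closed.\<close>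

lemma analytic_in_UN:
  assumes "\<And>i :: nat. analytic_in T (A i)"
  shows "analytic_in T (\<Union>i. A i)"
proof -
  let ?P = "prod_topology T (euclidean :: (nat \<Rightarrow> nat) topology)"
  obtain F where F: "\<And>i. closedin ?P (F i)" "\<And>i. fst ` F i = A i"
    using assms unfolding analytic_in_def by metis
  define G where "G i = (topspace T \<times> {\<alpha> :: nat \<Rightarrow> nat. \<alpha> 0 \<noteq> i}) \<union>
    {p \<in> topspace T \<times> UNIV. (fst p, \<lambda>k. snd p (Suc k)) \<in> F i}" for i
  have "closed {\<alpha> :: nat \<Rightarrow> nat. \<alpha> 0 \<noteq> i}" for i
  proof -
    have "open ((\<lambda>\<alpha> :: nat \<Rightarrow> nat. \<alpha> 0) -` {i})"
      by (rule open_vimage) (auto intro: continuous_on_product_coordinates open_discrete)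
    moreover have "{\<alpha> :: nat \<Rightarrow> nat. \<alpha> 0 \<noteq> i} = - ((\<lambda>\<alpha> :: nat \<Rightarrow> nat. \<alpha> 0) -` {i})" by auto
    ultimately show ?thesis by (simp add: closed_def)
  qed
  then have "closedin ?P (topspace T \<times> {\<alpha> :: nat \<Rightarrow> nat. \<alpha> 0 \<noteq> i})" for i
    by (simp add: closedin_prod_Times_iff)
  then have "closedin ?P (G i)" for i
    unfolding G_def by (intro closedin_Un closedin_reindex F)
  then have "closedin ?P (\<Inter>i. G i)" by (intro closedin_INT) auto
  moreover have "fst ` (\<Inter>i. G i) = (\<Union>i. A i)"
  proof (intro equalityI subsetI)
    fix x assume "x \<in> fst ` (\<Inter>i. G i)"
    then obtain \<alpha> where "\<forall>i. (x, \<alpha>) \<in> G i" by auto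
    from spec[OF this, of "\<alpha> 0"] have "(x, \<lambda>k. \<alpha> (Suc k)) \<in> F (\<alpha> 0)" by (auto simp: G_def)
    then show "x \<in> (\<Union>i. A i)" using F(2) by force
  next
    fix x assume "x \<in> (\<Union>i. A i)"
    then obtain i \<beta> where i: "(x, \<beta>) \<in> F i" using F(2) by force
    then have x: "x \<in> topspace T" using closedin_subset[OF F(1)[of i]] by auto
    have "(x, \<lambda>n. case n of 0 \<Rightarrow> i | Suc k \<Rightarrow> \<beta> k) \<in> G j" for j
      using i x by (cases "i = j") (auto simp: G_def)
    then have "(x, \<lambda>n. case n of 0 \<Rightarrow> i | Suc k \<Rightarrow> \<beta> k) \<in> (\<Inter>i. G i)" by (rule INT_I)
    then show "x \<in> fst ` (\<Inter>i. G i)" by (metis fst_conv imageI)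
  qed
  ultimately show ?thesis unfolding analytic_in_def by blast
qed

text \<open>One parameter holds witnesses for all the sets at once, arranged as the rows of a matrix
  through \<open>prod_encode\<close>.\<close>

lemma analytic_in_INT:
  assumes "\<And>i :: nat. analytic_in T (A i)"
  shows "analytic_in T (\<Inter>i. A i)"
proof -
  let ?P = "prod_topology T (euclidean :: (nat \<Rightarrow> nat) topology)"
  obtain F where F: "\<And>i. closedin ?P (F i)" "\<And>i. fst ` F i = A i"
    using assms unfolding analytic_in_def by metis
  define G where "G i = {p \<in> topspace T \<times> UNIV. (fst p, \<lambda>k. snd p (prod_encode (i, k))) \<in> F i}" for i
  have "closedin ?P (G i)" for i
    unfolding G_def by (intro closedin_reindex F)
  then have "closedin ?P (\<Inter>i. G i)" by (intro closedin_INT) auto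
  moreover have "fst ` (\<Inter>i. G i) = (\<Inter>i. A i)"
  proof (intro equalityI subsetI)
    fix x assume "x \<in> fst ` (\<Inter>i. G i)"
    then obtain \<alpha> where "\<forall>i. (x, \<alpha>) \<in> G i" by auto
    then have "(x, \<lambda>k. \<alpha> (prod_encode (i, k))) \<in> F i" for i by (auto simp: G_def)
    then show "x \<in> (\<Inter>i. A i)" using F(2) by force
  next
    fix x assume "x \<in> (\<Inter>i. A i)"
    then have "\<forall>i. \<exists>\<beta>. (x, \<beta>) \<in> F i" using F(2) by force
    then obtain \<beta> where i: "\<And>i. (x, \<beta> i) \<in> F i" by metis
    then have x: "x \<in> topspace T" using closedin_subset[OF F(1)[of 0]] by auto
    have "(x, \<lambda>n. \<beta> (fst (prod_decode n)) (snd (prod_decode n))) \<in> G j" for j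
      using i x unfolding G_def by simp
    then have "(x, \<lambda>n. \<beta> (fst (prod_decode n)) (snd (prod_decode n))) \<in> (\<Inter>i. G i)" by (rule INT_I)
    then show "x \<in> fst ` (\<Inter>i. G i)" by (metis fst_conv imageI)
  qed
  ultimately show ?thesis unfolding analytic_in_def by blast
qed

lemma analytic_in_open:
  assumes "metrizable_space T" "openin T U"
  shows "analytic_in T U"
proof -
  obtain C :: "nat \<Rightarrow> 'a set" where "\<And>n. closedin T (C n)" "\<Union> (range C) = U"
    using open_imp_fsigma_in[OF assms] unfolding fsigma_in_ascending by blast
  then show ?thesis using analytic_in_UN[of T C] analytic_in_closed by metis
qed

lemma analytic_in_borel:
  assumes T: "metrizable_space T"
    and A: "A \<in> sigma_sets (topspace T) {U. openin T U}"
  shows "analytic_in T A"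
proof -
  \<comment> \<open>Analytic sets are in general not closed under complements, so the induction
    carries the complement along; the complement case then merely exchanges the two halves.\<close>
  have "analytic_in T A \<and> analytic_in T (topspace T - A)"
    using A
  proof (induction rule: sigma_sets.induct)
    case (Basic U)
    then show ?case using T by (auto intro: analytic_in_open analytic_in_closed)
  next
    case Empty
    then show ?case by (auto intro: analytic_in_closed)
  next
    case (Compl A)
    moreover have "A \<subseteq> topspace T" using sigma_sets_into_sp[OF _ Compl(1)] openin_subset by auto
    ultimately show ?case by (simp add: double_diff)
  next
    case (Union A)
    moreover have "topspace T - (\<Union>i. A i) = (\<Inter>i :: nat. topspace T - A i)" by auto
    ultimately show ?case using analytic_in_UN[of T A] analytic_in_INT[of T "\<lambda>i. topspace T - A i"]
      by auto
  qed
  then show ?thesis by blast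
qed

section \<open>Borel sets as continuous images of closed subsets of Baire space\<close>

lemma separable_space_prod_topology:
  assumes "separable_space S" "separable_space T"
  shows "separable_space (prod_topology S T)"
proof -
  obtain C D where "countable C" "C \<subseteq> topspace S" "S closure_of C = topspace S"
    "countable D" "D \<subseteq> topspace T" "T closure_of D = topspace T"
    using assms unfolding separable_space_def by metis
  then show ?thesis unfolding separable_space_def
    by (intro exI[of _ "C \<times> D"]) (auto simp: closure_of_Times)
qed

text \<open>The sequence \<open>\<alpha>\<close> codes the limit of a fast Cauchy sequence of points of a countable dense
  set.\<close>

lemma polish_image_of_baire:
  assumes "completely_metrizable_space T" "separable_space T"
  shows "\<exists>(F :: (nat \<Rightarrow> nat) set) f. closed F \<and> continuous_map (top_of_set F) T f \<and> f ` F = topspace T"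
proof (cases "topspace T = {}")
  case True
  then show ?thesis by (intro exI[of _ "{}"]) auto
next
  case False
  obtain X d where Xd: "Metric_space X d" "Metric_space.mcomplete X d" "T = Metric_space.mtopology X d"
    using assms(1) unfolding completely_metrizable_space_def by blast
  interpret Metric_space X d by fact
  have tX: "topspace T = X" using Xd(3) by simp
  obtain D where D: "countable D" "D \<subseteq> X" "T closure_of D = X"
    using assms(2) tX unfolding separable_space_def by metis
  have "D \<noteq> {}" using D False tX by auto
  define q where "q = from_nat_into D"
  have q: "q n \<in> X" for n using D \<open>D \<noteq> {}\<close> from_nat_into[of D n] by (auto simp: q_def)
  have dense: "\<exists>n. d (q n) x < e" if "x \<in> X" "e > 0" for x e
  proof -
    have "x \<in> mtopology closure_of D" using D that Xd by auto
    then have "\<exists>y\<in>D. y \<in> mball x e" using that unfolding metric_closure_of by simp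
    then obtain y where y: "y \<in> D" "d x y < e" by auto
    obtain n where "q n = y" using from_nat_into_surj[OF D(1) y(1)] by (auto simp: q_def)
    then show ?thesis using y commute[of x y] by (intro exI[of _ n]) simp
  qed
  \<comment> \<open>Each condition involves two adjacent entries only, which makes F closed. It
    dominates the tails by a geometric series, so the coded sequences are Cauchy with a rate common
    to all of F, and the limit depends continuously on the code.\<close>
  define F where "F = {\<alpha> :: nat \<Rightarrow> nat. \<forall>k. d (q (\<alpha> k)) (q (\<alpha> (Suc k))) \<le> 1 / 2 ^ k}"
  have tail: "d (q (\<alpha> k)) (q (\<alpha> (k + j))) \<le> 2 / 2 ^ k - 2 / 2 ^ (k + j)" if "\<alpha> \<in> F" for \<alpha> k j
  proof (induction j)
    case 0
    then show ?case using q by simp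
  next
    case (Suc j)
    have "d (q (\<alpha> k)) (q (\<alpha> (k + Suc j))) \<le>
        d (q (\<alpha> k)) (q (\<alpha> (k + j))) + d (q (\<alpha> (k + j))) (q (\<alpha> (Suc (k + j))))"
      using triangle q by simp
    also have "\<dots> \<le> 2 / 2 ^ k - 2 / 2 ^ (k + j) + 1 / 2 ^ (k + j)"
      using Suc that by (intro add_mono) (auto simp: F_def)
    also have "\<dots> = 2 / 2 ^ k - 2 / 2 ^ (k + Suc j)" by (simp add: field_simps)
    finally show ?case .
  qed
  have tail2: "d (q (\<alpha> k)) (q (\<alpha> n)) \<le> 2 / 2 ^ k" if "\<alpha> \<in> F" "k \<le> n" for \<alpha> k n
  proof -
    have "d (q (\<alpha> k)) (q (\<alpha> n)) \<le> 2 / 2 ^ k - 2 / 2 ^ n"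
      using tail[OF that(1), of k "n - k"] that(2) by simp
    then show ?thesis by (smt (verit) zero_less_divide_iff zero_less_power)
  qed
  have small: "\<exists>k. 2 / 2 ^ k < e" if "e > 0" for e :: real
  proof -
    have "\<exists>k. (1/2) ^ k < e / 2" using that by (intro real_arch_pow_inv) auto
    then obtain k where "(1/2) ^ k < e / 2" by blast
    then show ?thesis by (intro exI[of _ k]) (auto simp: field_simps power_one_over)
  qed
  have "\<exists>x. limitin mtopology (\<lambda>n. q (\<alpha> n)) x sequentially" if a: "\<alpha> \<in> F" for \<alpha>
  proof -
    have "MCauchy (\<lambda>n. q (\<alpha> n))"
      unfolding MCauchy_def
    proof (intro conjI allI impI)
      show "range (\<lambda>n. q (\<alpha> n)) \<subseteq> X" using q by auto
      fix e :: real assume "e > 0"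
      then obtain k where k: "2 / 2 ^ k < e / 2" using small[of "e/2"] by auto
      show "\<exists>N. \<forall>n n'. N \<le> n \<longrightarrow> N \<le> n' \<longrightarrow> d (q (\<alpha> n)) (q (\<alpha> n')) < e"
      proof (intro exI allI impI)
        fix n n' assume "k \<le> n" "k \<le> n'"
        then have "d (q (\<alpha> k)) (q (\<alpha> n)) < e / 2" "d (q (\<alpha> k)) (q (\<alpha> n')) < e / 2"
          using tail2[OF a] k by fastforce+
        moreover have "d (q (\<alpha> n)) (q (\<alpha> n')) \<le> d (q (\<alpha> n)) (q (\<alpha> k)) + d (q (\<alpha> k)) (q (\<alpha> n'))"
          using triangle q by blast
        ultimately show "d (q (\<alpha> n)) (q (\<alpha> n')) < e" by (simp add: commute)
      qed
    qed
    then show ?thesis using Xd(2) unfolding mcomplete_def by blast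
  qed
  then obtain f where f: "\<And>\<alpha>. \<alpha> \<in> F \<Longrightarrow> limitin mtopology (\<lambda>n. q (\<alpha> n)) (f \<alpha>) sequentially"
    by metis
  have fX: "f \<alpha> \<in> X" if "\<alpha> \<in> F" for \<alpha> using f[OF that] by (simp add: limit_metric_sequentially)
  have lim: "d (q (\<alpha> k)) (f \<alpha>) \<le> 2 / 2 ^ k" if a: "\<alpha> \<in> F" for \<alpha> k
  proof (rule field_le_epsilon)
    fix e :: real assume "e > 0"
    then obtain N where N: "\<And>n. n \<ge> N \<Longrightarrow> d (q (\<alpha> n)) (f \<alpha>) < e"
      using f[OF a] unfolding limit_metric_sequentially by blast
    have "d (q (\<alpha> k)) (f \<alpha>) \<le> d (q (\<alpha> k)) (q (\<alpha> (max k N))) + d (q (\<alpha> (max k N))) (f \<alpha>)"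
      using triangle q fX[OF a] by blast
    also have "\<dots> \<le> 2 / 2 ^ k + e"
      using tail2[OF a, of k "max k N"] N[of "max k N"] by auto
    finally show "d (q (\<alpha> k)) (f \<alpha>) \<le> 2 / 2 ^ k + e" .
  qed
  have coord_open: "open {\<beta> :: nat \<Rightarrow> nat. \<beta> k = a}" for k a
  proof -
    have "open ((\<lambda>\<beta> :: nat \<Rightarrow> nat. \<beta> k) -` {a})"
      by (rule open_vimage) (auto intro: continuous_on_product_coordinates open_discrete)
    then show ?thesis by (simp add: vimage_def)
  qed
  have "closed F"
  proof -
    have "closed {\<alpha> :: nat \<Rightarrow> nat. d (q (\<alpha> k)) (q (\<alpha> (Suc k))) \<le> 1 / 2 ^ k}" for k
    proof -
      have "- {\<alpha> :: nat \<Rightarrow> nat. d (q (\<alpha> k)) (q (\<alpha> (Suc k))) \<le> 1 / 2 ^ k} =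
        (\<Union>(a, b)\<in>{(a, b). \<not> d (q a) (q b) \<le> 1 / 2 ^ k}. {\<beta>. \<beta> k = a} \<inter> {\<beta>. \<beta> (Suc k) = b})"
        by auto
      moreover have "open \<dots>" by (intro open_UN ballI) (auto intro!: open_Int coord_open)
      ultimately show ?thesis by (simp add: closed_def)
    qed
    moreover have "F = (\<Inter>k. {\<alpha>. d (q (\<alpha> k)) (q (\<alpha> (Suc k))) \<le> 1 / 2 ^ k})" by (auto simp: F_def)
    ultimately show ?thesis by auto
  qed
  moreover have "continuous_map (top_of_set F) T f"
    unfolding continuous_map_def
  proof (intro conjI allI impI)
    show "f \<in> topspace (top_of_set F) \<rightarrow> topspace T" using fX tX by auto
    fix U assume "openin T U"
    show "openin (top_of_set F) {\<alpha> \<in> topspace (top_of_set F). f \<alpha> \<in> U}"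
    proof (subst openin_subopen, intro ballI)
      fix \<alpha> assume "\<alpha> \<in> {\<alpha> \<in> topspace (top_of_set F). f \<alpha> \<in> U}"
      then have \<alpha>: "\<alpha> \<in> F" "f \<alpha> \<in> U" by auto
      then obtain e where e: "e > 0" "mball (f \<alpha>) e \<subseteq> U"
        using \<open>openin T U\<close> Xd openin_mtopology by metis
      obtain k where k: "2 / 2 ^ k < e / 2" using small[of "e/2"] e by auto
      have "f \<beta> \<in> U" if b: "\<beta> \<in> F" "\<beta> k = \<alpha> k" for \<beta>
      proof -
        have "d (f \<alpha>) (f \<beta>) \<le> d (f \<alpha>) (q (\<alpha> k)) + d (q (\<alpha> k)) (f \<beta>)"
          using triangle fX q \<alpha> b by blast
        also have "\<dots> < e" using lim[OF \<alpha>(1), of k] lim[OF b(1), of k] b(2) k by (simp add: commute)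
        finally show ?thesis using e fX \<alpha> b by auto
      qed
      then show "\<exists>V. openin (top_of_set F) V \<and> \<alpha> \<in> V \<and> V \<subseteq> {\<alpha> \<in> topspace (top_of_set F). f \<alpha> \<in> U}"
        using \<alpha> by (intro exI[of _ "F \<inter> {\<beta>. \<beta> k = \<alpha> k}"]) (auto intro: openin_open_Int coord_open)
    qed
  qed
  moreover have "f ` F = topspace T"
  proof
    show "f ` F \<subseteq> topspace T" using fX tX by auto
    show "topspace T \<subseteq> f ` F"
    proof
      fix x assume "x \<in> topspace T"
      then have x: "x \<in> X" using tX by simp
      \<comment> \<open>The tolerance is half the step that F permits, so two consecutive
        approximations of x are close enough to each other through x.\<close>
      then have "\<forall>k. \<exists>n. d (q n) x < 1 / (2 * 2 ^ k)" using dense[of x] by auto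
      then obtain \<alpha> where \<alpha>: "\<And>k :: nat. d (q (\<alpha> k)) x < 1 / (2 * 2 ^ k)" by metis
      have "d (q (\<alpha> k)) (q (\<alpha> (Suc k))) \<le> 1 / 2 ^ k" for k
      proof -
        have "d (q (\<alpha> k)) (q (\<alpha> (Suc k))) \<le> d (q (\<alpha> k)) x + d (q (\<alpha> (Suc k))) x"
          using triangle[OF q x q] by (simp add: commute)
        also have "\<dots> \<le> 1 / (2 * 2 ^ k) + 1 / (2 * 2 ^ Suc k)"
          using \<alpha>[of k] \<alpha>[of "Suc k"] by simp
        also have "\<dots> \<le> 1 / 2 ^ k" by (simp add: field_simps)
        finally show ?thesis .
      qed
      then have aF: "\<alpha> \<in> F" by (simp add: F_def)
      have "d x (f \<alpha>) \<le> 0"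
      proof (rule field_le_epsilon)
        fix e :: real assume "e > 0"
        then obtain k where k: "2 / 2 ^ k < e / 2" using small[of "e/2"] by auto
        have "d x (f \<alpha>) \<le> d (q (\<alpha> k)) x + d (q (\<alpha> k)) (f \<alpha>)"
          using triangle[OF x q fX[OF aF], of "\<alpha> k"] by (simp add: commute)
        also have "\<dots> \<le> 1 / (2 * 2 ^ k) + 2 / 2 ^ k" using \<alpha>[of k] lim[OF aF, of k] by simp
        also have "\<dots> \<le> 2 * (2 / 2 ^ k)" by (simp add: field_simps)
        finally show "d x (f \<alpha>) \<le> 0 + e" using k by simp
      qed
      then have "x = f \<alpha>" using x fX[OF aF] by (smt (verit) nonneg zero)
      then show "x \<in> f ` F" using aF by blast
    qed
  qed
  ultimately show ?thesis by blast
qed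

text \<open>K is the projection of a closed G in the product with Baire space, and T is the image of
  a closed F0. A sequence of coded pairs carries both a name of the point (\<open>a\<close>) and its
  witness in G (\<open>b\<close>), and the conditions on both are closed.\<close>

lemma borel_image_of_baire:
  assumes T: "completely_metrizable_space T" "separable_space T"
    and K: "K \<in> sigma_sets (topspace T) {U. openin T U}"
  shows "\<exists>(F :: (nat \<Rightarrow> nat) set) f. closed F \<and> continuous_map (top_of_set F) T f \<and> f ` F = K"
proof -
  let ?P = "prod_topology T (euclidean :: (nat \<Rightarrow> nat) topology)"
  obtain G where G: "closedin ?P G" "fst ` G = K"
    using analytic_in_borel[OF completely_metrizable_imp_metrizable_space[OF T(1)] K]
    unfolding analytic_in_def by blast
  obtain F0 :: "(nat \<Rightarrow> nat) set" and h where h: "closed F0" "continuous_map (top_of_set F0) T h" "h ` F0 = topspace T"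
    using polish_image_of_baire[OF T] by blast
  define a where "a = (\<lambda>(\<gamma> :: nat \<Rightarrow> nat) k. fst (prod_decode (\<gamma> k)))"
  define b where "b = (\<lambda>(\<gamma> :: nat \<Rightarrow> nat) k. snd (prod_decode (\<gamma> k)))"
  have ca: "continuous_on A (\<lambda>\<gamma> :: nat \<Rightarrow> nat. \<lambda>k. (u (\<gamma> k) :: nat))" for u A
    by (intro continuous_on_coordinatewise_then_product
        continuous_on_compose2[OF Topological_Spaces.continuous_on_discrete[of UNIV u]] continuous_on_subset[OF continuous_on_product_coordinates]) auto
  define F1 where "F1 = a -` F0"
  have F1: "closed F1"
    unfolding F1_def using ca[of UNIV "\<lambda>n. fst (prod_decode n)"] h(1) by (intro closed_vimage) (auto simp: a_def)
  have "continuous_map (top_of_set F1) (top_of_set F0) a"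
    using ca[of F1 "\<lambda>n. fst (prod_decode n)"] by (auto simp: a_def F1_def)
  then have cha: "continuous_map (top_of_set F1) T (h \<circ> a)"
    using h(2) by (rule continuous_map_compose)
  moreover have "continuous_map (top_of_set F1) euclidean b"
    using ca[of F1 "\<lambda>n. snd (prod_decode n)"] by (auto simp: b_def)
  ultimately have "continuous_map (top_of_set F1) ?P (\<lambda>\<gamma>. (h (a \<gamma>), b \<gamma>))"
    by (simp add: continuous_map_pairwise o_def)
  from closedin_continuous_map_preimage[OF this G(1)]
  have cl: "closed {\<gamma> \<in> F1. (h (a \<gamma>), b \<gamma>) \<in> G}" (is "closed ?F")
    using F1 closedin_closed_trans by fastforce
  moreover have "continuous_map (top_of_set ?F) T (h \<circ> a)"
    using cha by (rule continuous_map_from_subtopology_mono) auto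
  moreover have "(h \<circ> a) ` ?F = K"
  proof (intro equalityI subsetI)
    fix x assume "x \<in> (h \<circ> a) ` ?F"
    then show "x \<in> K" using G(2) by force
  next
    fix x assume "x \<in> K"
    then obtain \<beta> where \<beta>: "(x, \<beta>) \<in> G" using G(2) by force
    then have "x \<in> topspace T" using closedin_subset[OF G(1)] by auto
    then obtain \<alpha> where \<alpha>: "\<alpha> \<in> F0" "h \<alpha> = x" using h(3) by (metis imageE)
    define \<gamma> where "\<gamma> = (\<lambda>k. prod_encode (\<alpha> k, \<beta> k))"
    have "a \<gamma> = \<alpha>" "b \<gamma> = \<beta>" by (auto simp: a_def b_def \<gamma>_def)
    then have "\<gamma> \<in> ?F" "(h \<circ> a) \<gamma> = x" using \<alpha> \<beta> by (auto simp: F1_def)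
    then show "x \<in> (h \<circ> a) ` ?F" by blast
  qed
  ultimately show ?thesis by blast
qed

section \<open>Compact approximation from within\<close>

lemma compact_bounded_sequences: "compact {\<alpha> :: nat \<Rightarrow> nat. \<forall>i. \<alpha> i \<le> b i}"
proof -
  have "compactin (product_topology (\<lambda>_. euclidean) UNIV) (PiE UNIV (\<lambda>i. {.. b i}))"
    by (simp add: compactin_PiE finite_imp_compact)
  then have "compact (PiE UNIV (\<lambda>i. {.. b i}))"
    by (simp add: euclidean_product_topology)
  moreover have "PiE UNIV (\<lambda>i. {.. b i}) = {\<alpha> :: nat \<Rightarrow> nat. \<forall>i. \<alpha> i \<le> b i}"
    by (auto simp: PiE_def Pi_def)
  ultimately show ?thesis by simp
qed

lemma closed_prefix: "closed {\<alpha> :: nat \<Rightarrow> nat. \<forall>i < k. \<alpha> i \<in> S i}"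
proof -
  have "closed ((\<lambda>\<alpha> :: nat \<Rightarrow> nat. \<alpha> i) -` S i)" for i
    by (rule closed_vimage) (auto intro: continuous_on_product_coordinates simp: closed_def open_discrete)
  then have "closed (\<Inter>i\<in>{..<k}. (\<lambda>\<alpha> :: nat \<Rightarrow> nat. \<alpha> i) -` S i)" by (intro closed_INT) auto
  moreover have "(\<Inter>i\<in>{..<k}. (\<lambda>\<alpha> :: nat \<Rightarrow> nat. \<alpha> i) -` S i) = {\<alpha>. \<forall>i < k. \<alpha> i \<in> S i}" by auto
  ultimately show ?thesis by simp
qed

text \<open>Choquet's capacitability argument: the coordinates are bounded one at a time, each time losing
  little outer measure because the outer measure is continuous along increasing unions.\<close>

lemma outer_measure_compact_approx:
  fixes F :: "(nat \<Rightarrow> nat) set" and e :: ennreal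
  assumes M: "finite_measure M" and T: "metrizable_space T" "topspace T = space M"
    and op: "\<And>U. openin T U \<Longrightarrow> U \<in> sets M"
    and F: "closed F" and g: "continuous_map (top_of_set F) T g" and e: "e > 0"
  shows "\<exists>C \<subseteq> F. compact C \<and> outer_measure_of M (g ` F) \<le> emeasure M (g ` C) + e"
proof -
  interpret finite_measure M by fact
  have gF: "g ` F \<subseteq> space M" using continuous_map_image_subset_topspace[OF g] T by auto
  define B where "B b k = {\<alpha> \<in> F. \<forall>i < k. \<alpha> i \<le> b i}" for b :: "nat \<Rightarrow> nat" and k
  define om where "om = outer_measure_of M"
  have omfin: "om A < top" if "A \<subseteq> space M" for A
  proof -
    have "om A \<le> emeasure M (space M)"
      using outer_measure_of_mono[OF that, of M] by (simp add: om_def)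
    then show ?thesis using emeasure_real by (metis ennreal_less_top le_less_trans)
  qed
  \<comment> \<open>Of the bounds f k only the first k entries are in force, and passing to k + 1
    chooses entry k. Since the inequality is kept strict, each step has room to lose something, and
    the tolerance e need not be split.\<close>
  have "\<exists>f. \<forall>k. (om (g ` F) < om (g ` B (f k) k) + e) \<and> (\<exists>n. f (Suc k) = (f k)(k := n))"
  proof (rule dependent_nat_choice)
    have "B b 0 = F" for b by (auto simp: B_def)
    moreover have "om (g ` F) < om (g ` F) + e"
      using omfin[OF gF] e by (metis add.right_neutral ennreal_add_left_cancel_less top.not_eq_extremum infinity_ennreal_def)
    ultimately show "\<exists>b. om (g ` F) < om (g ` B b 0) + e" by auto
  next
    fix b k assume b: "om (g ` F) < om (g ` B b k) + e"
    define A where "A n = g ` B (b(k := n)) (Suc k)" for n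
    have "B b k = (\<Union>n. B (b(k := n)) (Suc k))"
      by (auto simp: B_def less_Suc_eq)
    then have UA: "g ` B b k = (\<Union>n. A n)" by (auto simp: A_def)
    have "incseq A" unfolding A_def incseq_def B_def
      by (intro allI impI image_mono) (force simp: less_Suc_eq)
    moreover have "A n \<subseteq> space M" for n using gF by (auto simp: A_def B_def)
    ultimately have "(SUP n. om (A n)) = om (\<Union>n. A n)"
      unfolding om_def using SUP_outer_measure_of_incseq[of A M] by auto
    then have "om (g ` F) < (SUP n. om (A n) + e)" using b UA by (simp add: ennreal_SUP_add_left)
    then obtain n where "om (g ` F) < om (A n) + e" by (auto simp: less_SUP_iff)
    then show "\<exists>b'. om (g ` F) < om (g ` B b' (Suc k)) + e \<and> (\<exists>n. b' = b(k := n))"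
      unfolding A_def by blast
  qed
  then obtain f where f: "\<And>k. om (g ` F) < om (g ` B (f k) k) + e"
    "\<And>k. \<exists>n. f (Suc k) = (f k)(k := n)" by blast
  define b where "b i = f (Suc i) i" for i
  have fb: "i < k \<Longrightarrow> f k i = b i" for i k
  proof (induction k)
    case (Suc k)
    obtain n where "f (Suc k) = (f k)(k := n)" using f(2) by blast
    then show ?case using Suc by (cases "i = k") (auto simp: b_def)
  qed simp
  have Bb: "om (g ` F) < om (g ` B b k) + e" for k
  proof -
    have "B (f k) k = B b k" by (auto simp: B_def fb)
    then show ?thesis using f(1)[of k] by simp
  qed
  define C where "C = F \<inter> {\<alpha>. \<forall>i. \<alpha> i \<le> b i}"
  have C: "compact C" unfolding C_def using F compact_bounded_sequences by (intro closed_Int_compact)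
  have gC: "closedin T (g ` C)"
  proof (intro compactin_imp_closedin)
    show "Hausdorff_space T" using T(1) by (rule metrizable_imp_Hausdorff_space)
    have "compactin (top_of_set F) C" using C by (simp add: compactin_subtopology C_def)
    then show "compactin T (g ` C)" using g by (rule image_compactin)
  qed
  have approx: "\<exists>k. g ` B b k \<subseteq> G" if G: "openin T G" "g ` C \<subseteq> G" for G
  proof (rule ccontr)
    assume "\<not> ?thesis"
    then have "\<forall>k. \<exists>\<alpha>. \<alpha> \<in> B b k \<and> g \<alpha> \<notin> G" by blast
    then obtain \<alpha> where \<alpha>: "\<And>k. \<alpha> k \<in> B b k" "\<And>k. g (\<alpha> k) \<notin> G" by metis
    define D where "D k = {\<beta> \<in> B b k. g \<beta> \<notin> G}" for k
    have "closedin (top_of_set F) {\<beta> \<in> topspace (top_of_set F). g \<beta> \<in> topspace T - G}"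
      using g G(1) by (intro closedin_continuous_map_preimage) auto
    moreover have "{\<beta> \<in> topspace (top_of_set F). g \<beta> \<in> topspace T - G} = {\<beta> \<in> F. g \<beta> \<notin> G}"
      using gF T(2) by auto
    ultimately have "closed {\<beta> \<in> F. g \<beta> \<notin> G}" using F closedin_closed_trans by fastforce
    then have "closed ({\<beta> \<in> F. g \<beta> \<notin> G} \<inter> {\<beta>. \<forall>i < k. \<beta> i \<in> {.. b i}})" for k
      using closed_prefix by (intro closed_Int)
    moreover have "D k = {\<beta> \<in> F. g \<beta> \<notin> G} \<inter> {\<beta>. \<forall>i < k. \<beta> i \<in> {.. b i}}" for k
      by (auto simp: D_def B_def)
    ultimately have Dcl: "closed (D k)" for k by simp
    \<comment> \<open>The point \<alpha> k respects the bounds b only below k. At entry i there are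
      finitely many earlier points to dominate as well, so the enlarged bounds place all of them in
      one compact box, where the closed sets \<open>D k\<close> have a common point.\<close>
    define b' where "b' i = max (b i) (Max ((\<lambda>k. \<alpha> k i) ` {..i}))" for i
    let ?K = "{\<beta> :: nat \<Rightarrow> nat. \<forall>i. \<beta> i \<le> b' i}"
    have \<alpha>K: "\<alpha> k \<in> ?K" for k
    proof -
      have "\<alpha> k i \<le> b' i" for i
      proof (cases "k \<le> i")
        case True
        then have "\<alpha> k i \<le> Max ((\<lambda>k. \<alpha> k i) ` {..i})" by (intro Max_ge) auto
        then show ?thesis by (simp add: b'_def)
      next
        case False
        then show ?thesis using \<alpha>(1)[of k] by (auto simp: B_def b'_def intro: max.coboundedI1)
      qed
      then show ?thesis by simp
    qed
    have "?K \<inter> (\<Inter>k\<in>UNIV. D k) \<noteq> {}"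
    proof (rule compact_imp_fip_image[OF compact_bounded_sequences])
      show "closed (D k)" for k by (rule Dcl)
      fix I :: "nat set" assume I: "finite I"
      then obtain m where m: "\<forall>k\<in>I. k \<le> m" by (meson finite_nat_set_iff_bounded_le)
      have "\<alpha> m \<in> D k" if "k \<in> I" for k
        using \<alpha>[of m] m that by (force simp: D_def B_def)
      then show "?K \<inter> (\<Inter>k\<in>I. D k) \<noteq> {}" using \<alpha>K[of m] by blast
    qed
    then obtain \<beta> where \<beta>: "\<And>k. \<beta> \<in> D k" by blast
    have "\<beta> i \<le> b i" for i using \<beta>[of "Suc i"] by (auto simp: D_def B_def)
    then have "\<beta> \<in> C" using \<beta>[of 0] by (auto simp: C_def D_def B_def)
    then show False using \<beta>[of 0] G(2) by (auto simp: D_def)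
  qed
  have open_bound: "om (g ` F) \<le> emeasure M G + e" if G: "openin T G" "g ` C \<subseteq> G" for G
  proof -
    obtain k where "g ` B b k \<subseteq> G" using approx[OF G] by blast
    then have "om (g ` B b k) \<le> emeasure M G"
      using outer_measure_of_mono op[OF G(1)] outer_measure_of_eq unfolding om_def by metis
    then show ?thesis using Bb[of k] by (meson add_right_mono less_imp_le order_trans)
  qed
  \<comment> \<open>The sets in the estimate need not be measurable, so the bound passes through
    open supersets. The compact image is a decreasing intersection of open sets, and finiteness of
    the measure gives continuity from above.\<close>
  have "gdelta_in T (g ` C)" using closed_imp_gdelta_in[OF T(1) gC] .
  then have "fsigma_in T (topspace T - g ` C)"
    using gdelta_in_fsigma_in by blast
  then obtain Z where Z: "\<And>n :: nat. closedin T (Z n)" "\<And>n. Z n \<subseteq> Z (Suc n)" "\<Union> (range Z) = topspace T - g ` C"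
    unfolding fsigma_in_ascending by blast
  define U where "U n = topspace T - Z n" for n
  have U: "openin T (U n)" for n using Z(1) by (auto simp: U_def)
  have gCs: "g ` C \<subseteq> topspace T" using closedin_subset[OF gC] .
  have UC: "g ` C \<subseteq> U n" for n using Z(3) gCs by (auto simp: U_def)
  have inter: "(\<Inter>n. U n) = g ` C" using Z(3) gCs by (auto simp: U_def)
  have "decseq U" unfolding decseq_Suc_iff using Z(2) by (auto simp: U_def)
  then have "(INF n. emeasure M (U n)) = emeasure M (\<Inter>n. U n)"
    using U op by (intro INF_emeasure_decseq) auto
  moreover have "om (g ` F) \<le> (INF n. emeasure M (U n) + e)"
    using open_bound[OF U UC] by (rule INF_greatest)
  ultimately have "om (g ` F) \<le> emeasure M (g ` C) + e"
    by (simp add: INF_ennreal_add_const inter)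
  then show ?thesis using C by (intro exI[of _ C]) (auto simp: om_def C_def)
qed

text \<open>The prefix of length \<open>k\<close> of the lexicographically least element of \<open>D\<close>.\<close>

fun lex_least :: "(nat \<Rightarrow> nat) set \<Rightarrow> nat \<Rightarrow> nat list" where
  "lex_least D 0 = []"
| "lex_least D (Suc k) = (let s = lex_least D k in
     s @ [LEAST n. \<exists>\<alpha>\<in>D. map \<alpha> [0..<k] = s \<and> \<alpha> k = n])"

lemma map_upt_eq_iff:
  "length s = k \<Longrightarrow> map \<alpha> [0..<k] = s \<longleftrightarrow> (\<forall>i<k. \<alpha> i \<in> {s ! i})"
  unfolding list_eq_iff_nth_eq[of "map \<alpha> [0..<k]"] by simp

text \<open>Each finite prefix of the greedy choice is attained in D by construction; compactness
  yields a single point of D having all these prefixes.\<close>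

lemma lex_least_in:
  assumes "compact D" "D \<noteq> {}"
  shows "\<exists>\<alpha>\<in>D. \<forall>k. map \<alpha> [0..<k] = lex_least D k"
proof -
  have ex: "\<exists>\<alpha>\<in>D. map \<alpha> [0..<k] = lex_least D k" for k
  proof (induction k)
    case 0
    then show ?case using assms by auto
  next
    case (Suc k)
    let ?P = "\<lambda>n. \<exists>\<alpha>\<in>D. map \<alpha> [0..<k] = lex_least D k \<and> \<alpha> k = n"
    have "\<exists>n. ?P n" using Suc by blast
    then have "?P (LEAST n. ?P n)" by (rule LeastI_ex)
    then show ?case by (auto simp: Let_def)
  qed
  have pre: "\<exists>l. lex_least D m = lex_least D k @ l" if "k \<le> m" for k m
    using that by (induction m rule: dec_induct) (auto simp: Let_def)
  have len: "length (lex_least D k) = k" for k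
    by (induction k) (auto simp: Let_def)
  have cl: "closed {\<alpha> :: nat \<Rightarrow> nat. map \<alpha> [0..<k] = s}" for k s
  proof (cases "length s = k")
    case True
    then have "{\<alpha> :: nat \<Rightarrow> nat. map \<alpha> [0..<k] = s} = {\<alpha>. \<forall>i<k. \<alpha> i \<in> {s ! i}}"
      by (simp only: map_upt_eq_iff)
    then show ?thesis using closed_prefix[of k "\<lambda>i. {s ! i}"] by simp
  next
    case False
    then have "{\<alpha> :: nat \<Rightarrow> nat. map \<alpha> [0..<k] = s} = {}" by auto
    then show ?thesis by simp
  qed
  have "D \<inter> (\<Inter>k\<in>UNIV. {\<alpha>. map \<alpha> [0..<k] = lex_least D k}) \<noteq> {}"
  proof (rule compact_imp_fip_image[OF assms(1) cl])
    fix I :: "nat set" assume "finite I"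
    then obtain m where m: "\<forall>k\<in>I. k \<le> m" by (meson finite_nat_set_iff_bounded_le)
    obtain \<alpha> where \<alpha>: "\<alpha> \<in> D" "map \<alpha> [0..<m] = lex_least D m" using ex by blast
    have "map \<alpha> [0..<k] = lex_least D k" if "k \<in> I" for k
    proof -
      have "k \<le> m" using m that by simp
      from pre[OF this] obtain l where l: "lex_least D m = lex_least D k @ l" by (elim exE)
      have "map \<alpha> [0..<k] = take k (map \<alpha> [0..<m])" using m that by (simp add: take_map)
      also have "\<dots> = lex_least D k" using \<alpha>(2) l len[of k] by simp
      finally show ?thesis .
    qed
    then have "\<alpha> \<in> (\<Inter>k\<in>I. {\<alpha>. map \<alpha> [0..<k] = lex_least D k})" by (intro INT_I CollectI)
    then have "\<alpha> \<in> D \<inter> (\<Inter>k\<in>I. {\<alpha>. map \<alpha> [0..<k] = lex_least D k})" using \<alpha>(1) by (rule IntI[rotated])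
    then show "D \<inter> (\<Inter>k\<in>I. {\<alpha>. map \<alpha> [0..<k] = lex_least D k}) \<noteq> {}" by (metis empty_iff)
  qed
  then obtain \<alpha> where "\<alpha> \<in> D \<inter> (\<Inter>k\<in>UNIV. {\<alpha>. map \<alpha> [0..<k] = lex_least D k})"
    unfolding ex_in_conv[symmetric] by (elim exE)
  then have "\<alpha> \<in> D" "\<And>k. \<alpha> \<in> {\<alpha>. map \<alpha> [0..<k] = lex_least D k}"
    by (auto simp del: map_eq_conv)
  then show ?thesis unfolding mem_Collect_eq by (intro bexI[of _ \<alpha>] allI)
qed

section \<open>Measurable sections over compact images and selection\<close>

text \<open>The section picks the lexicographically least point of each fibre. After the prefix s
  its next entry is n exactly if the fibre meets the cylinder of s @ [n] but that of no s @ [m] with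
  m < n, and the points whose fibre meets a given cylinder (\<open>Q\<close>) form the image of a
  compact set, hence a closed set.\<close>

lemma compact_measurable_section:
  fixes C :: "(nat \<Rightarrow> nat) set"
  assumes T: "Hausdorff_space T"
    and cl: "\<And>A. closedin T A \<Longrightarrow> A \<in> sets M"
    and C: "compact C" and g: "continuous_map (top_of_set C) T g"
  shows "\<exists>\<sigma>. (\<forall>x\<in>g ` C. \<sigma> x \<in> C \<and> g (\<sigma> x) = x) \<and> \<sigma> \<in> borel_measurable (restrict_space M (g ` C))"
proof -
  define D where "D x = {\<alpha> \<in> C. g \<alpha> = x}" for x
  have gC: "g ` A \<in> sets M" if "compact A" "A \<subseteq> C" for A
  proof -
    have "compactin (top_of_set C) A" using that by (simp add: compactin_subtopology)
    then have "compactin T (g ` A)" using g by (rule image_compactin)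
    then show ?thesis using T cl compactin_imp_closedin by blast
  qed
  have Dc: "compact (D x)" if "x \<in> topspace T" for x
  proof -
    have "closedin (top_of_set C) {\<alpha> \<in> topspace (top_of_set C). g \<alpha> \<in> {x}}"
      using T that by (intro closedin_continuous_map_preimage[OF g]) (simp add: closedin_Hausdorff_singleton)
    then have "closedin (top_of_set C) (D x)" by (simp add: D_def)
    then show ?thesis using C closedin_compact by blast
  qed
  have gs: "g ` C \<subseteq> topspace T" using continuous_map_image_subset_topspace[OF g] by simp
  have "\<forall>x\<in>g ` C. \<exists>\<alpha>\<in>D x. \<forall>k. map \<alpha> [0..<k] = lex_least (D x) k"
  proof
    fix x assume "x \<in> g ` C"
    then show "\<exists>\<alpha>\<in>D x. \<forall>k. map \<alpha> [0..<k] = lex_least (D x) k"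
      using gs by (intro lex_least_in Dc) (auto simp: D_def)
  qed
  then obtain \<sigma> where \<sigma>': "\<forall>x\<in>g ` C. \<sigma> x \<in> D x \<and> (\<forall>k. map (\<sigma> x) [0..<k] = lex_least (D x) k)"
    unfolding Bex_def by (rule bchoice[THEN exE])
  have \<sigma>1: "\<sigma> x \<in> D x" if "x \<in> g ` C" for x
    using bspec[OF \<sigma>' that] by (rule conjunct1)
  have \<sigma>2: "map (\<sigma> x) [0..<k] = lex_least (D x) k" if "x \<in> g ` C" for x k
    using bspec[OF \<sigma>' that] by (elim conjE allE)
  note \<sigma> = \<sigma>1 \<sigma>2
  define Q where "Q s = {x \<in> g ` C. \<exists>\<alpha>\<in>D x. map \<alpha> [0..<length s] = s}" for s
  have Q: "Q s \<in> sets M" for s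
  proof -
    have "{\<alpha> :: nat \<Rightarrow> nat. map \<alpha> [0..<length s] = s} = {\<alpha>. \<forall>i<length s. \<alpha> i \<in> {s ! i}}"
      by (simp only: map_upt_eq_iff[OF refl])
    then have "compact (C \<inter> {\<alpha>. map \<alpha> [0..<length s] = s})"
      using closed_prefix[of "length s" "\<lambda>i. {s ! i}"] C by auto
    moreover have "Q s = g ` (C \<inter> {\<alpha>. map \<alpha> [0..<length s] = s})" by (auto simp: Q_def D_def intro: rev_image_eqI)
    ultimately show ?thesis using gC by simp
  qed
  have pref: "{x \<in> g ` C. map (\<sigma> x) [0..<length s] = s} \<in> sets M" for s
  proof (induction s rule: rev_induct)
    case Nil
    then show ?case using gC[OF C] by simp
  next
    case (snoc n s)
    let ?k = "length s"
    have "{x \<in> g ` C. map (\<sigma> x) [0..<length (s @ [n])] = s @ [n]} =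
      {x \<in> g ` C. map (\<sigma> x) [0..<length s] = s} \<inter> (Q (s @ [n]) - (\<Union>m\<in>{..<n}. Q (s @ [m])))"
      (is "?L = ?R")
    proof (intro equalityI subsetI)
      fix x assume x: "x \<in> ?L"
      then have xg: "x \<in> g ` C" and s: "map (\<sigma> x) [0..<?k] = s" and n: "\<sigma> x ?k = n" by auto
      have "lex_least (D x) (Suc ?k) = s @ [n]" using \<sigma>(2)[OF xg, of "Suc ?k"] s n by simp
      moreover have l: "lex_least (D x) ?k = s" using \<sigma>(2)[OF xg, of ?k] s by simp
      ultimately have L: "(LEAST n. \<exists>\<alpha>\<in>D x. map \<alpha> [0..<?k] = s \<and> \<alpha> ?k = n) = n"
        by (simp add: Let_def)
      have "x \<notin> Q (s @ [m])" if "m < n" for m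
        using not_less_Least[of m "\<lambda>n. \<exists>\<alpha>\<in>D x. map \<alpha> [0..<?k] = s \<and> \<alpha> ?k = n"] that L
        by (auto simp: Q_def)
      moreover have "x \<in> Q (s @ [n])" using \<sigma>(1)[OF xg] xg s n by (auto simp: Q_def)
      ultimately show "x \<in> ?R" using xg s by auto
    next
      fix x assume x: "x \<in> ?R"
      then have xg: "x \<in> g ` C" and s: "map (\<sigma> x) [0..<?k] = s" by auto
      have l: "lex_least (D x) ?k = s" using \<sigma>(2)[OF xg, of ?k] s by simp
      have "(LEAST n. \<exists>\<alpha>\<in>D x. map \<alpha> [0..<?k] = s \<and> \<alpha> ?k = n) = n"
        using x xg by (intro Least_equality) (force simp: Q_def linorder_not_less[symmetric])+
      then have "lex_least (D x) (Suc ?k) = s @ [n]" using l by (simp add: Let_def)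
      then show "x \<in> ?L" using \<sigma>(2)[OF xg, of "Suc ?k"] xg by simp
    qed
    then show ?case using snoc Q by auto
  qed
  have "(\<lambda>x. \<sigma> x i) \<in> borel_measurable (restrict_space M (g ` C))" for i
  proof -
    have "(\<lambda>x. \<sigma> x i) -` {n} \<inter> space (restrict_space M (g ` C)) \<in> sets (restrict_space M (g ` C))" for n
    proof -
      have "(\<lambda>x. \<sigma> x i) -` {n} \<inter> g ` C =
        (\<Union>s\<in>{s. length s = Suc i \<and> s ! i = n}. {x \<in> g ` C. map (\<sigma> x) [0..<length s] = s})"
        by (auto simp del: upt_Suc)
      also have "\<dots> \<in> sets M" by (intro sets.countable_UN'') (simp, rule pref)
      finally have "(\<lambda>x. \<sigma> x i) -` {n} \<inter> g ` C \<in> sets M" .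
      moreover have "g ` C \<in> sets M" using gC[OF C] by simp
      ultimately show ?thesis
        by (subst sets_restrict_space_iff) (auto simp: space_restrict_space Int_absorb1 sets.sets_into_space
              dest: sets.sets_into_space intro: arg_cong2[where f="(\<in>)", THEN iffD1, rotated -1])
    qed
    then have "(\<lambda>x. \<sigma> x i) \<in> measurable (restrict_space M (g ` C)) (count_space UNIV)"
      by (simp add: measurable_count_space_eq2_countable)
    then show ?thesis by (rule measurable_compose) simp
  qed
  then have "\<sigma> \<in> borel_measurable (restrict_space M (g ` C))"
    by (rule measurable_coordinatewise_then_product)
  then show ?thesis using \<sigma>(1) by (intro exI[of _ \<sigma>]) (auto simp: D_def)
qed

text \<open>Both projections are continuous, hence measurable for the Borel sets of the product
  topology, and so is their pairing, the identity. This allows the description of Borel sets of a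
  Polish space to be applied to product-measurable sets.\<close>

lemma sets_pair_subset_borel:
  assumes "sets M = sigma_sets (space M) {U. openin S U}" "topspace S = space M"
    and "sets N = sigma_sets (space N) {U. openin T U}" "topspace T = space N"
  shows "sets (M \<Otimes>\<^sub>M N) \<subseteq> sigma_sets (space M \<times> space N) {U. openin (prod_topology S T) U}"
proof -
  let ?\<Omega> = "space M \<times> space N" let ?P = "prod_topology S T"
  have sub: "{U. openin ?P U} \<subseteq> Pow ?\<Omega>" using openin_subset[of ?P] assms by auto
  define B where "B = sigma ?\<Omega> {U. openin ?P U}"
  have B: "space B = ?\<Omega>" "sets B = sigma_sets ?\<Omega> {U. openin ?P U}"
    using sub by (auto simp: B_def)
  have "fst \<in> measurable B M"
  proof (rule measurable_sigma_sets[OF assms(1)])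
    show "{U. openin S U} \<subseteq> Pow (space M)" using openin_subset assms(2) by auto
    show "fst \<in> space B \<rightarrow> space M" using B by auto
    fix U assume "U \<in> {U. openin S U}"
    then have "openin ?P {p \<in> topspace ?P. fst p \<in> U}"
      by (intro openin_continuous_map_preimage[OF continuous_map_fst]) auto
    moreover have "{p \<in> topspace ?P. fst p \<in> U} = fst -` U \<inter> space B" using B assms by auto
    ultimately show "fst -` U \<inter> space B \<in> sets B" using B(2) by auto
  qed
  moreover have "snd \<in> measurable B N"
  proof (rule measurable_sigma_sets[OF assms(3)])
    show "{U. openin T U} \<subseteq> Pow (space N)" using openin_subset assms(4) by auto
    show "snd \<in> space B \<rightarrow> space N" using B by auto
    fix U assume "U \<in> {U. openin T U}"
    then have "openin ?P {p \<in> topspace ?P. snd p \<in> U}"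
      by (intro openin_continuous_map_preimage[OF continuous_map_snd]) auto
    moreover have "{p \<in> topspace ?P. snd p \<in> U} = snd -` U \<inter> space B" using B assms by auto
    ultimately show "snd -` U \<inter> space B \<in> sets B" using B(2) by auto
  qed
  ultimately have id: "(\<lambda>p. (fst p, snd p)) \<in> measurable B (M \<Otimes>\<^sub>M N)"
    by (rule measurable_Pair)
  show ?thesis
  proof
    fix K assume K: "K \<in> sets (M \<Otimes>\<^sub>M N)"
    then have "(\<lambda>p. (fst p, snd p)) -` K \<inter> space B = K"
      using sets.sets_into_space[OF K] B by (auto simp: space_pair_measure)
    then show "K \<in> sigma_sets ?\<Omega> {U. openin ?P U}" using measurable_sets[OF id K] B by simp
  qed
qed

text \<open>A measure-theoretic form of the Jankov--von Neumann uniformization theorem.\<close>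

theorem measurable_selection:
  assumes M: "standard_borel M" "finite_measure M" and N: "standard_borel N" "space N \<noteq> {}"
    and K: "K \<in> sets (M \<Otimes>\<^sub>M N)"
  obtains A s Z where "A \<in> sets M" "s \<in> measurable M N" "\<And>x. x \<in> A \<Longrightarrow> (x, s x) \<in> K"
    "Z \<in> null_sets M" "fst ` K \<subseteq> A \<union> Z"
proof -
  interpret finite_measure M by fact
  obtain S where S: "topspace S = space M" "completely_metrizable_space S" "separable_space S"
    "sets M = sigma_sets (space M) {U. openin S U}" using M(1) unfolding standard_borel_def by blast
  obtain T where T: "topspace T = space N" "completely_metrizable_space T" "separable_space T"
    "sets N = sigma_sets (space N) {U. openin T U}" using N(1) unfolding standard_borel_def by blast
  have Sm: "metrizable_space S" using S(2) completely_metrizable_imp_metrizable_space by blast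
  have op: "\<And>U. openin S U \<Longrightarrow> U \<in> sets M" using S(4) by auto
  have cl: "A \<in> sets M" if "closedin S A" for A
  proof -
    have "topspace S - A \<in> sets M" using that by (intro op) (rule openin_diff[OF openin_topspace])
    then have "space M - (topspace S - A) \<in> sets M" by (rule sets.compl_sets)
    moreover have "space M - (topspace S - A) = A" using S(1) closedin_subset[OF that] by auto
    ultimately show ?thesis by simp
  qed
  let ?P = "prod_topology S T"
  have "completely_metrizable_space ?P" using S T by (simp add: completely_metrizable_space_prod_topology)
  moreover have "separable_space ?P" using S T by (simp add: separable_space_prod_topology)
  moreover have "K \<in> sigma_sets (topspace ?P) {U. openin ?P U}"
    using sets_pair_subset_borel[OF S(4,1) T(4,1)] K S(1) T(1) by auto
  ultimately have "\<exists>(F :: (nat \<Rightarrow> nat) set) f. closed F \<and> continuous_map (top_of_set F) ?P f \<and> f ` F = K"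
    by (rule borel_image_of_baire)
  then obtain F :: "(nat \<Rightarrow> nat) set" and f where F: "closed F" "continuous_map (top_of_set F) ?P f" "f ` F = K"
    by (elim exE conjE)
  define g where "g = fst \<circ> f"
  have g: "continuous_map (top_of_set F) S g"
    unfolding g_def using F(2) continuous_map_fst by (rule continuous_map_compose)
  have f2: "continuous_map (top_of_set F) T (snd \<circ> f)"
    using F(2) continuous_map_snd by (rule continuous_map_compose)
  have gF: "g ` F = fst ` K" using F(3) by (auto simp: g_def)
  have gFs: "g ` F \<subseteq> space M" using continuous_map_image_subset_topspace[OF g] S(1) by auto
  have "\<forall>n :: nat. \<exists>C\<subseteq>F. compact C \<and> outer_measure_of M (g ` F) \<le> emeasure M (g ` C) + ennreal (1 / Suc n)"
    using outer_measure_compact_approx[OF M(2) Sm S(1) op F(1) g] by simp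
  then obtain C where C: "\<And>n. C n \<subseteq> F" "\<And>n. compact (C n)"
    "\<And>n. outer_measure_of M (g ` F) \<le> emeasure M (g ` C n) + ennreal (1 / Suc n)" by metis
  have gC: "continuous_map (top_of_set (C n)) S g" for n
    using g C(1) by (rule continuous_map_from_subtopology_mono)
  have "\<forall>n. \<exists>\<sigma>. (\<forall>x\<in>g ` C n. \<sigma> x \<in> C n \<and> g (\<sigma> x) = x) \<and> \<sigma> \<in> borel_measurable (restrict_space M (g ` C n))"
    using compact_measurable_section[OF metrizable_imp_Hausdorff_space[OF Sm] cl C(2) gC] by blast
  then obtain \<sigma> where \<sigma>: "\<And>n x. x \<in> g ` C n \<Longrightarrow> \<sigma> n x \<in> C n \<and> g (\<sigma> n x) = x"
    "\<And>n. \<sigma> n \<in> borel_measurable (restrict_space M (g ` C n))" by metis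
  have gCm: "g ` C n \<in> sets M" for n
  proof -
    have "compactin (top_of_set (C n)) (C n)" using C(2) by (simp add: compactin_subtopology)
    then have "compactin S (g ` C n)" using gC by (rule image_compactin)
    then show ?thesis using metrizable_imp_Hausdorff_space[OF Sm] cl compactin_imp_closedin by blast
  qed
  define A where "A = (\<Union>n. g ` C n)"
  have A: "A \<in> sets M" using gCm by (auto simp: A_def)
  have AF: "A \<subseteq> g ` F" using C(1) by (auto simp: A_def)
  define r where "r n x = snd (f (\<sigma> n x))" for n x
  have r: "r n \<in> measurable (restrict_space M (g ` C n)) N" for n
  proof (rule measurable_sigma_sets[OF T(4)])
    have "(snd \<circ> f) \<alpha> \<in> space N" if "\<alpha> \<in> F" for \<alpha>
      using continuous_map_image_subset_topspace[OF f2] that T(1) by auto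
    then show "r n \<in> space (restrict_space M (g ` C n)) \<rightarrow> space N"
      using \<sigma>(1) C(1) by (fastforce simp: r_def space_restrict_space)
    show "{U. openin T U} \<subseteq> Pow (space N)" using openin_subset T(1) by auto
    fix V assume "V \<in> {U. openin T U}"
    then have "openin (top_of_set F) {\<alpha> \<in> topspace (top_of_set F). (snd \<circ> f) \<alpha> \<in> V}"
      by (intro openin_continuous_map_preimage[OF f2]) auto
    then obtain W where W: "open W" "{\<alpha> \<in> F. (snd \<circ> f) \<alpha> \<in> V} = F \<inter> W"
      by (auto simp: openin_open)
    have "r n -` V \<inter> space (restrict_space M (g ` C n)) = \<sigma> n -` W \<inter> space (restrict_space M (g ` C n))"
    proof (intro equalityI subsetI)
      fix x assume "x \<in> r n -` V \<inter> space (restrict_space M (g ` C n))"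
      then show "x \<in> \<sigma> n -` W \<inter> space (restrict_space M (g ` C n))"
        using W(2) \<sigma>(1)[of x n] C(1)[of n] by (auto simp: r_def space_restrict_space)
    next
      fix x assume x: "x \<in> \<sigma> n -` W \<inter> space (restrict_space M (g ` C n))"
      then have "\<sigma> n x \<in> F \<inter> W" using \<sigma>(1)[of x n] C(1)[of n] by (auto simp: space_restrict_space)
      then have "snd (f (\<sigma> n x)) \<in> V" using W(2) by auto
      then show "x \<in> r n -` V \<inter> space (restrict_space M (g ` C n))" using x by (simp add: r_def)
    qed
    also have "\<dots> \<in> sets (restrict_space M (g ` C n))"
      using \<sigma>(2) W(1) by (intro measurable_sets[of _ _ borel]) auto
    finally show "r n -` V \<inter> space (restrict_space M (g ` C n)) \<in> sets (restrict_space M (g ` C n))" .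
  qed
  obtain y0 where y0: "y0 \<in> space N" using N(2) by blast
  define s where "s x = (if x \<in> A then r (LEAST n. x \<in> g ` C n) x else y0)" for x
  \<comment> \<open>The compact images overlap; the first one that contains x decides which section
    is used at x.\<close>
  define A' where "A' n = g ` C n - (\<Union>m<n. g ` C m)" for n
  have A': "A' n \<in> sets M" for n using gCm by (auto simp: A'_def)
  have least: "(LEAST n. x \<in> g ` C n) = n" if "x \<in> A' n" for x n
    using that by (intro Least_equality) (auto simp: A'_def linorder_not_less[symmetric])
  have UA': "A = (\<Union>n. A' n)"
  proof (intro equalityI subsetI)
    fix x assume "x \<in> A"
    then have "\<exists>n. x \<in> g ` C n" by (auto simp: A_def)
    then have "x \<in> g ` C (LEAST n. x \<in> g ` C n)" by (rule LeastI_ex)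
    moreover have "x \<notin> g ` C m" if "m < (LEAST n. x \<in> g ` C n)" for m
      using that by (rule not_less_Least)
    ultimately have "x \<in> A' (LEAST n. x \<in> g ` C n)"
      unfolding A'_def by (simp only: Diff_iff UN_iff lessThan_iff) blast
    then show "x \<in> (\<Union>n. A' n)" by (rule UN_I[OF UNIV_I])
  qed (auto simp: A_def A'_def)
  have sr: "s x = r n x" if "x \<in> A' n" for x n
    using that UA' least by (auto simp: s_def)
  have "s \<in> measurable M N"
  proof (rule measurable_piecewise_restrict[where C = "insert (space M - A) (range A')"])
    fix \<Omega> assume "\<Omega> \<in> insert (space M - A) (range A')"
    then consider "\<Omega> = space M - A" | n where "\<Omega> = A' n" by auto
    then show "s \<in> measurable (restrict_space M \<Omega>) N"
    proof cases
      case 1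
      have "(\<lambda>x. y0) \<in> measurable (restrict_space M \<Omega>) N" using y0 by simp
      then show ?thesis using 1 by (subst measurable_cong[where g="\<lambda>x. y0"]) (auto simp: s_def space_restrict_space)
    next
      case 2
      have "restrict_space (restrict_space M (g ` C n)) (A' n) = restrict_space M (A' n)"
      proof -
        have "g ` C n \<inter> space M \<in> sets M" "A' n \<inter> space M \<in> sets M" using gCm[of n] A'[of n] by auto
        moreover have "g ` C n \<inter> A' n = A' n" by (auto simp: A'_def)
        ultimately show ?thesis using restrict_restrict_space[of "g ` C n" M "A' n"] by simp
      qed
      then have "r n \<in> measurable (restrict_space M (A' n)) N"
        using measurable_restrict_space1[OF r[of n], of "A' n"] by simp
      then show ?thesis using 2 sr by (subst measurable_cong[where g="r n"]) (auto simp: space_restrict_space)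
    qed
  qed (use A A' UA' in auto)
  moreover have "(x, s x) \<in> K" if xA: "x \<in> A" for x
  proof -
    have "\<exists>n. x \<in> A' n" using UA' xA by simp
    then obtain n where n: "x \<in> A' n" by (elim exE)
    then have "\<sigma> n x \<in> F" "g (\<sigma> n x) = x" using \<sigma>(1)[of x n] C(1) by (auto simp: A'_def)
    then have "f (\<sigma> n x) \<in> K" "f (\<sigma> n x) = (x, s x)"
      using F(3) sr[OF n] by (auto simp: r_def g_def prod_eq_iff)
    then show ?thesis by simp
  qed
  \<comment> \<open>The projection of K is analytic and possibly outside \<open>sets M\<close>, so
    nullity is asserted of E - A for a measurable hull E of the projection.\<close>
  moreover obtain E where E: "E \<in> sets M" "g ` F \<subseteq> E" "outer_measure_of M (g ` F) = emeasure M E"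
    using outer_measure_of_attain[OF gFs] by blast
  moreover have "E - A \<in> null_sets M"
  proof -
    have le: "emeasure M E \<le> emeasure M A + ennreal (1 / Suc n)" for n
    proof -
      have "emeasure M (g ` C n) \<le> emeasure M A" using A by (intro emeasure_mono) (auto simp: A_def)
      then show ?thesis using C(3)[of n] E(3) by (metis add_right_mono order_trans)
    qed
    have "emeasure M E \<le> emeasure M A"
    proof (rule ennreal_le_epsilon)
      fix e :: real assume "0 < e"
      then obtain n where "1 / Suc n < e" using nat_approx_posE by blast
      then show "emeasure M E \<le> emeasure M A + ennreal e"
        using le[of n] by (meson add_left_mono ennreal_leI less_imp_le order_trans)
    qed
    then have "emeasure M (E - A) = 0"
      using E A AF by (subst emeasure_Diff) (auto simp: emeasure_eq_measure ennreal_minus_if)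
    then show ?thesis using E A by auto
  qed
  moreover have "fst ` K \<subseteq> A \<union> (E - A)" using E(2) gF by auto
  ultimately show ?thesis using that A by blast
qed

section \<open>The counting measure of a measured equivalence relation\<close>

text \<open>Balls of radius 1 / (k + 1) about a countable dense set. Such a sequence makes the
  coincidence of measurable maps a measurable condition and tells the points of a fibre apart by
  finite data.\<close>

lemma standard_borel_separating_sequence:
  assumes "standard_borel M"
  shows "\<exists>U :: nat \<Rightarrow> 'a set. (\<forall>n. U n \<in> sets M) \<and>
    (\<forall>x\<in>space M. \<forall>y\<in>space M. x \<noteq> y \<longrightarrow> (\<exists>n. x \<in> U n \<and> y \<notin> U n))"
proof -
  obtain T where T: "topspace T = space M" "completely_metrizable_space T" "separable_space T"
    "sets M = sigma_sets (space M) {U. openin T U}" using assms unfolding standard_borel_def by blast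
  obtain X d where Xd: "Metric_space X d" "T = Metric_space.mtopology X d"
    using T(2) unfolding completely_metrizable_space_def by blast
  interpret Metric_space X d by fact
  have X: "X = space M" using T(1) Xd(2) by simp
  obtain D where D: "countable D" "D \<subseteq> X" "T closure_of D = X"
    using T(3) T(1) X unfolding separable_space_def by metis
  define q where "q = from_nat_into D"
  define U where "U m = mball (q (fst (prod_decode m))) (1 / Suc (snd (prod_decode m)))" for m
  have "U m \<in> sets M" for m using T(4) Xd(2) openin_mball by (auto simp: U_def)
  moreover have "\<exists>m. x \<in> U m \<and> y \<notin> U m" if x: "x \<in> space M" and y: "y \<in> space M" and "x \<noteq> y" for x y
  proof -
    have pos: "d x y > 0" using that X by simp
    then obtain k where k: "1 / real (Suc k) < d x y / 2" using nat_approx_posE[of "d x y / 2"] by auto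
    have "x \<in> mtopology closure_of D" using x X D Xd by simp
    then have "\<exists>z\<in>D. z \<in> mball x (1 / real (Suc k))" unfolding metric_closure_of by simp
    then obtain z where z: "z \<in> D" "d x z < 1 / real (Suc k)" by auto
    obtain n where n: "q n = z" using from_nat_into_surj[OF D(1) z(1)] by (auto simp: q_def)
    have zX: "z \<in> X" using z D by auto
    have "d x y \<le> d x z + d z y" using triangle x y zX X by blast
    then have "\<not> d z y < 1 / real (Suc k)" using z k by simp
    moreover have "d z x < 1 / real (Suc k)" using z commute[of x z] by simp
    ultimately have "x \<in> mball z (1 / real (Suc k))" "y \<notin> mball z (1 / real (Suc k))"
      unfolding in_mball using x zX X by blast+
    then show ?thesis using n by (intro exI[of _ "prod_encode (n, k)"]) (simp add: U_def)
  qed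
  ultimately show ?thesis by blast
qed

lemma sets_Collect_eq_standard_borel:
  assumes "standard_borel M" "f \<in> measurable N M" "g \<in> measurable N M"
  shows "{x \<in> space N. f x = g x} \<in> sets N"
proof -
  obtain U :: "nat \<Rightarrow> 'a set" where U: "\<And>n. U n \<in> sets M"
    "\<And>x y. x \<in> space M \<Longrightarrow> y \<in> space M \<Longrightarrow> x \<noteq> y \<Longrightarrow> \<exists>n. x \<in> U n \<and> y \<notin> U n"
    using standard_borel_separating_sequence[OF assms(1)] by blast
  have "{x \<in> space N. f x = g x} = space N - (\<Union>n. (f -` U n \<inter> space N) - (g -` U n \<inter> space N))"
    using U(2) measurable_space[OF assms(2)] measurable_space[OF assms(3)] by fastforce
  also have "\<dots> \<in> sets N" using measurable_sets[OF assms(2) U(1)] measurable_sets[OF assms(3) U(1)] by auto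
  finally show ?thesis .
qed

text \<open>Any finitely many points of L are told apart by the first k sets once k is large, and
  traces never outnumber points. The cardinality becomes a supremum of counts of possible traces,
  each a subset of a fixed finite set.\<close>

lemma emeasure_count_space_eq_SUP_traces:
  fixes L :: "'a set" and U :: "nat \<Rightarrow> 'a set"
  assumes sep: "\<And>x y. x \<in> L \<Longrightarrow> y \<in> L \<Longrightarrow> x \<noteq> y \<Longrightarrow> \<exists>n. x \<in> U n \<and> y \<notin> U n"
  shows "emeasure (count_space UNIV) L = (SUP k. of_nat (card ((\<lambda>y. {j. j < k \<and> y \<in> U j}) ` L)) :: ennreal)"
proof -
  let ?r = "\<lambda>k y. {j. j < k \<and> y \<in> U j}"
  have finr: "finite (?r k ` L)" for k
    by (rule finite_subset[of _ "Pow {..<k}"]) auto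
  have big: "\<exists>k. card L' \<le> card (?r k ` L)" if L': "finite L'" "L' \<subseteq> L" for L'
  proof -
    have "\<forall>p\<in>L' \<times> L'. \<exists>n. fst p \<noteq> snd p \<longrightarrow> fst p \<in> U n \<and> snd p \<notin> U n"
      using sep L'(2) by force
    then obtain n where n: "\<And>p. p \<in> L' \<times> L' \<Longrightarrow> fst p \<noteq> snd p \<Longrightarrow> fst p \<in> U (n p) \<and> snd p \<notin> U (n p)"
      by metis
    obtain k where k: "\<forall>m \<in> n ` (L' \<times> L'). m < k"
      using L'(1) finite_nat_set_iff_bounded[of "n ` (L' \<times> L')"] by blast
    have "inj_on (?r k) L'"
    proof (rule inj_onI, rule ccontr)
      fix x y assume xy: "x \<in> L'" "y \<in> L'" "?r k x = ?r k y" "x \<noteq> y"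
      then have "x \<in> U (n (x, y))" "y \<notin> U (n (x, y))" "n (x, y) < k" using n[of "(x, y)"] k by auto
      then show False using xy(3) by blast
    qed
    then have "card L' = card (?r k ` L')" by (simp add: card_image)
    also have "\<dots> \<le> card (?r k ` L)" using finr L'(2) by (intro card_mono) auto
    finally show ?thesis by blast
  qed
  show ?thesis
  proof (cases "finite L")
    case True
    obtain k where k: "card L \<le> card (?r k ` L)" using big[OF True] by blast
    have "(SUP k. of_nat (card (?r k ` L)) :: ennreal) = of_nat (card L)"
    proof (rule antisym)
      show "(SUP k. of_nat (card (?r k ` L)) :: ennreal) \<le> of_nat (card L)"
        using True by (intro SUP_least of_nat_mono card_image_le)
      have "of_nat (card L) \<le> (of_nat (card (?r k ` L)) :: ennreal)" using k by (rule of_nat_mono)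
      then show "of_nat (card L) \<le> (SUP k. of_nat (card (?r k ` L)) :: ennreal)"
        by (rule SUP_upper2[OF UNIV_I])
    qed
    then show ?thesis using True by (simp add: emeasure_count_space_finite)
  next
    case False
    have "of_nat n \<le> (SUP k. of_nat (card (?r k ` L)) :: ennreal)" for n
    proof -
      obtain L' where L': "finite L'" "card L' = n" "L' \<subseteq> L" using infinite_arbitrarily_large[OF False] by blast
      obtain k where "n \<le> card (?r k ` L)" using big[OF L'(1,3)] L'(2) by blast
      then have "of_nat n \<le> (of_nat (card (?r k ` L)) :: ennreal)" by (rule of_nat_mono)
      then show ?thesis by (rule SUP_upper2[OF UNIV_I])
    qed
    then have "(SUP n. of_nat n :: ennreal) \<le> (SUP k. of_nat (card (?r k ` L)))" by (rule SUP_least)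
    then have 1: "(SUP k. of_nat (card (?r k ` L)) :: ennreal) = top"
      unfolding ennreal_SUP_of_nat_eq_top by (rule top_le)
    have 2: "emeasure (count_space UNIV) L = top" using False by simp
    show ?thesis unfolding 1 2 ..
  qed
qed

text \<open>A trace I occurs in the fibre over x exactly if x lies in the projection of
  \<open>KI k I\<close>, and selection provides a measurable set equal to this projection up to a
  null set. There are countably many pairs k, I, hence a single exceptional null set.\<close>

lemma AE_section_count_measurable:
  assumes M: "standard_borel M" "finite_measure M" and N: "standard_borel N" "space N \<noteq> {}"
    and K: "K \<in> sets (M \<Otimes>\<^sub>M N)"
  shows "\<exists>f\<in>borel_measurable M. AE x in M. emeasure (count_space UNIV) {y. (x, y) \<in> K} = f x"
proof -
  obtain U :: "nat \<Rightarrow> 'b set" where U: "\<And>n. U n \<in> sets N"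
    "\<And>x y. x \<in> space N \<Longrightarrow> y \<in> space N \<Longrightarrow> x \<noteq> y \<Longrightarrow> \<exists>n. x \<in> U n \<and> y \<notin> U n"
    using standard_borel_separating_sequence[OF N(1)] by blast
  let ?r = "\<lambda>k y. {j. j < k \<and> y \<in> U j}"
  have Ksp: "K \<subseteq> space M \<times> space N" using sets.sets_into_space[OF K] by (simp add: space_pair_measure)
  define KI where "KI k I = K \<inter> (space M \<times> {y \<in> space N. ?r k y = I})" for k I
  have cell: "{y \<in> space N. ?r k y = I} \<in> sets N" for k I
  proof (cases "I \<subseteq> {..<k}")
    case True
    have "{y \<in> space N. ?r k y = I} = {y \<in> space N. \<forall>j\<in>{..<k}. y \<in> U j \<longleftrightarrow> j \<in> I}"
      using True by auto
    also have "\<dots> \<in> sets N"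
    proof (rule sets.sets_Collect_finite_All)
      fix j
      have "{y \<in> space N. y \<in> U j \<longleftrightarrow> j \<in> I} = (if j \<in> I then U j else space N - U j)"
        using sets.sets_into_space[OF U(1)[of j]] by auto
      then show "{y \<in> space N. y \<in> U j \<longleftrightarrow> j \<in> I} \<in> sets N" using U(1) by auto
    qed simp
    finally show ?thesis .
  next
    case False
    then have "{y \<in> space N. ?r k y = I} = {}" by auto
    then show ?thesis by (metis sets.empty_sets)
  qed
  have KI: "KI k I \<in> sets (M \<Otimes>\<^sub>M N)" for k I
    unfolding KI_def by (intro sets.Int K pair_measureI sets.top cell)
  have "\<exists>A\<in>sets M. \<exists>Z\<in>null_sets M. A \<subseteq> fst ` KI k I \<and> fst ` KI k I \<subseteq> A \<union> Z" for k I
  proof -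
    obtain A s Z where AZ: "A \<in> sets M" "s \<in> measurable M N" "\<And>x. x \<in> A \<Longrightarrow> (x, s x) \<in> KI k I" "Z \<in> null_sets M" "fst ` KI k I \<subseteq> A \<union> Z"
      by (rule measurable_selection[OF M N KI[of k I]]) (rule that)
    have "A \<subseteq> fst ` KI k I" using imageI[OF AZ(3), of _ fst] by (simp add: subset_iff)
    then show ?thesis using AZ(1,4,5) by (intro bexI[of _ A] bexI[of _ Z] conjI)
  qed
  then obtain A Z where A: "\<And>k I. A k I \<in> sets M" "\<And>k I. A k I \<subseteq> fst ` KI k I"
    and Z: "\<And>k I. Z k I \<in> null_sets M" "\<And>k I. fst ` KI k I \<subseteq> A k I \<union> Z k I" by metis
  define f where "f x = (SUP k. \<Sum>I\<in>Pow {..<k}. indicator (A k I) x :: ennreal)" for x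
  have "f \<in> borel_measurable M" unfolding f_def using A(1) by simp
  moreover have "AE x in M. emeasure (count_space UNIV) {y. (x, y) \<in> K} = f x"
  proof (rule AE_I')
    have "finite (Pow {..<k})" for k :: nat by simp
    then show "(\<Union>k. \<Union>I\<in>Pow {..<k}. Z k I) \<in> null_sets M"
      using Z(1) by (intro null_sets_UN null_sets_UN') (auto intro: countable_finite)
    show "{x \<in> space M. emeasure (count_space UNIV) {y. (x, y) \<in> K} \<noteq> f x} \<subseteq> (\<Union>k. \<Union>I\<in>Pow {..<k}. Z k I)"
    proof (rule subsetI, rule ccontr)
      fix x assume x: "x \<in> {x \<in> space M. emeasure (count_space UNIV) {y. (x, y) \<in> K} \<noteq> f x}"
        and nZ: "x \<notin> (\<Union>k. \<Union>I\<in>Pow {..<k}. Z k I)"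
      let ?L = "{y. (x, y) \<in> K}"
      have "of_nat (card (?r k ` ?L)) = (\<Sum>I\<in>Pow {..<k}. indicator (A k I) x :: ennreal)" for k
      proof -
        have eq: "x \<in> A k I \<longleftrightarrow> I \<in> ?r k ` ?L" if "I \<in> Pow {..<k}" for I
        proof -
          have "x \<in> A k I \<longleftrightarrow> x \<in> fst ` KI k I" using A(2)[of k I] Z(2)[of k I] nZ that by blast
          also have "\<dots> \<longleftrightarrow> I \<in> ?r k ` ?L" using Ksp by (force simp: KI_def image_iff)
          finally show ?thesis .
        qed
        have "(\<Sum>I\<in>Pow {..<k}. indicator (A k I) x :: ennreal) = (\<Sum>I\<in>Pow {..<k}. indicator (?r k ` ?L) I)"
          using eq by (intro sum.cong) (auto simp: indicator_def)
        also have "\<dots> = of_nat (card (Pow {..<k} \<inter> ?r k ` ?L))"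
          by (simp add: indicator_def of_bool_def sum.If_cases)
        also have "Pow {..<k} \<inter> ?r k ` ?L = ?r k ` ?L" by auto
        finally show ?thesis by simp
      qed
      moreover have "emeasure (count_space UNIV) ?L = (SUP k. of_nat (card (?r k ` ?L)) :: ennreal)"
        using U(2) Ksp by (intro emeasure_count_space_eq_SUP_traces) auto
      ultimately show False using x by (simp add: f_def)
    qed
  qed
  ultimately show ?thesis by blast
qed

section \<open>Null sets and almost everywhere statements on the relation\<close>

lemma measured_eqrel_facts:
  assumes "measured_eqrel M R"
  shows "standard_borel M" "finite_measure M" "emeasure M (space M) = 1" "space M \<noteq> {}"
    "equiv (space M) R" "R \<in> sets (M \<Otimes>\<^sub>M M)" "\<And>N. N \<in> null_sets M \<Longrightarrow> R `` N \<in> null_sets M"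
    "R \<subseteq> space M \<times> space M"
proof -
  show "standard_borel M" and 1: "emeasure M (space M) = 1" and "equiv (space M) R" and R: "R \<in> sets (M \<Otimes>\<^sub>M M)"
    and "\<And>N. N \<in> null_sets M \<Longrightarrow> R `` N \<in> null_sets M"
    using assms by (auto simp: measured_eqrel_def standard_prob_space_def)
  show "finite_measure M" using 1 by (intro finite_measureI) simp
  show "space M \<noteq> {}" using 1 by auto
  show "R \<subseteq> space M \<times> space M" using sets.sets_into_space[OF R] by (simp add: space_pair_measure)
qed

lemma sets_restrict_pair:
  assumes "R \<in> sets P"
  shows "A \<in> sets (restrict_space P R) \<longleftrightarrow> A \<in> sets P \<and> A \<subseteq> R"
  using assms sets_restrict_space_iff[of R P A] by auto

lemma rel_measure_sets:
  assumes "measured_eqrel M R"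
  shows "sets (rel_measure M R) = sets (restrict_space (M \<Otimes>\<^sub>M M) R)" "space (rel_measure M R) = R"
proof -
  have sp: "space (restrict_space (M \<Otimes>\<^sub>M M) R) = R"
    using measured_eqrel_facts(8)[OF assms] by (auto simp: space_restrict_space space_pair_measure)
  then have "sets (restrict_space (M \<Otimes>\<^sub>M M) R) \<subseteq> Pow R" using sets.space_closed by metis
  moreover have "sigma_sets R (sets (restrict_space (M \<Otimes>\<^sub>M M) R)) = sets (restrict_space (M \<Otimes>\<^sub>M M) R)"
    using sets.sigma_sets_eq[of "restrict_space (M \<Otimes>\<^sub>M M) R"] sp by simp
  ultimately show "sets (rel_measure M R) = sets (restrict_space (M \<Otimes>\<^sub>M M) R)" "space (rel_measure M R) = R"
    unfolding rel_measure_def by auto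
qed

text \<open>\<open>measure_of\<close> returns the zero measure unless the set function is countably
  additive, so additivity must come first. The fibre counts are replaced by the measurable functions
  that they equal almost everywhere, for which sum and integral commute.\<close>

lemma emeasure_rel_measure:
  assumes mr: "measured_eqrel M R" and K: "K \<in> sets (M \<Otimes>\<^sub>M M)" "K \<subseteq> R"
  shows "emeasure (rel_measure M R) K = (\<integral>\<^sup>+ x. emeasure (count_space UNIV) {y. (x, y) \<in> K} \<partial>M)"
proof -
  note f = measured_eqrel_facts[OF mr]
  interpret finite_measure M by (rule f(2))
  let ?S = "sets (restrict_space (M \<Otimes>\<^sub>M M) R)"
  let ?\<mu> = "\<lambda>K. \<integral>\<^sup>+ x. emeasure (count_space UNIV) {y. (x, y) \<in> K} \<partial>M"
  have ca: "countably_additive ?S ?\<mu>"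
  proof (rule countably_additiveI)
    fix A :: "nat \<Rightarrow> ('a \<times> 'a) set" assume A: "range A \<subseteq> ?S" "disjoint_family A" "(\<Union>i. A i) \<in> ?S"
    have "\<forall>i. \<exists>g\<in>borel_measurable M. AE x in M. emeasure (count_space UNIV) {y. (x, y) \<in> A i} = g x"
    proof
      fix i
      have "A i \<in> ?S" using A(1) by (rule range_subsetD)
      then show "\<exists>g\<in>borel_measurable M. AE x in M. emeasure (count_space UNIV) {y. (x, y) \<in> A i} = g x"
        using sets_restrict_pair[OF f(6)] by (intro AE_section_count_measurable[OF f(1,2,1,4)]) simp
    qed
    then obtain g where "\<forall>i. g i \<in> borel_measurable M \<and>
        (AE x in M. emeasure (count_space UNIV) {y. (x, y) \<in> A i} = g i x)"
      unfolding Bex_def by (rule choice[THEN exE])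
    then have g: "\<And>i. g i \<in> borel_measurable M"
      "\<And>i. AE x in M. emeasure (count_space UNIV) {y. (x, y) \<in> A i} = g i x" by simp_all
    have "(\<Sum>i. ?\<mu> (A i)) = (\<Sum>i. \<integral>\<^sup>+ x. g i x \<partial>M)"
      using g(2) by (intro suminf_cong nn_integral_cong_AE)
    also have "\<dots> = (\<integral>\<^sup>+ x. (\<Sum>i. g i x) \<partial>M)" using g(1) by (simp add: nn_integral_suminf)
    also have "\<dots> = ?\<mu> (\<Union>i. A i)"
    proof (rule nn_integral_cong_AE)
      have "AE x in M. \<forall>i. emeasure (count_space UNIV) {y. (x, y) \<in> A i} = g i x"
        using g(2) by (simp add: AE_all_countable)
      then show "AE x in M. (\<Sum>i. g i x) = emeasure (count_space UNIV) {y. (x, y) \<in> (\<Union>i. A i)}"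
      proof (rule AE_mp, intro AE_I2 impI)
        fix x assume x: "\<forall>i. emeasure (count_space UNIV) {y. (x, y) \<in> A i} = g i x"
        have "(\<Sum>i. emeasure (count_space UNIV) {y. (x, y) \<in> A i}) =
          emeasure (count_space UNIV) (\<Union>i. {y. (x, y) \<in> A i})"
          using A(2) by (intro suminf_emeasure) (auto simp: disjoint_family_on_def)
        moreover have "(\<Union>i. {y. (x, y) \<in> A i}) = {y. (x, y) \<in> (\<Union>i. A i)}" by auto
        ultimately show "(\<Sum>i. g i x) = emeasure (count_space UNIV) {y. (x, y) \<in> (\<Union>i. A i)}"
          using x by simp
      qed
    qed
    finally show "(\<Sum>i. ?\<mu> (A i)) = ?\<mu> (\<Union>i. A i)" .
  qed
  show ?thesis
  proof (rule emeasure_measure_of[OF rel_measure_def])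
    show "?S \<subseteq> Pow R" using sets_restrict_pair[OF f(6)] by blast
    show "K \<in> sets (rel_measure M R)" using K rel_measure_sets(1)[OF mr] sets_restrict_pair[OF f(6)] by blast
    have "sets (rel_measure M R) = ?S" by (rule rel_measure_sets(1)[OF mr])
    then show "countably_additive (sets (rel_measure M R)) ?\<mu>" using ca by simp
    show "positive (sets (rel_measure M R)) ?\<mu>" by (simp add: positive_def)
  qed
qed

lemma rel_measure_null_projection:
  assumes mr: "measured_eqrel M R" and K: "K \<in> null_sets (rel_measure M R)"
  shows "\<exists>Z\<in>null_sets M. fst ` K \<subseteq> Z"
proof -
  note f = measured_eqrel_facts[OF mr]
  have K': "K \<in> sets (M \<Otimes>\<^sub>M M)" "K \<subseteq> R"
    using K rel_measure_sets(1)[OF mr] sets_restrict_pair[OF f(6)] by (auto simp: null_sets_def)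
  obtain g where g: "g \<in> borel_measurable M" "AE x in M. emeasure (count_space UNIV) {y. (x, y) \<in> K} = g x"
    using AE_section_count_measurable[OF f(1,2,1,4) K'(1)] by blast
  have "(\<integral>\<^sup>+ x. g x \<partial>M) = 0"
    using emeasure_rel_measure[OF mr K'] K nn_integral_cong_AE[OF g(2)] by (auto simp: null_sets_def)
  then have "AE x in M. g x = 0" using g(1) by (simp add: nn_integral_0_iff_AE)
  with g(2) have "AE x in M. emeasure (count_space UNIV) {y. (x, y) \<in> K} = 0" by eventually_elim simp
  then obtain Z where Z: "{x \<in> space M. emeasure (count_space UNIV) {y. (x, y) \<in> K} \<noteq> 0} \<subseteq> Z"
    "emeasure M Z = 0" "Z \<in> sets M" by (rule AE_E)
  have "fst ` K \<subseteq> Z"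
  proof
    fix x assume "x \<in> fst ` K"
    then obtain y where y: "(x, y) \<in> K" by auto
    then have "{y. (x, y) \<in> K} \<noteq> {}" "x \<in> space M" using K' f(8) by auto
    then show "x \<in> Z" using Z(1) by (auto simp: emeasure_count_space_eq_0)
  qed
  then show ?thesis using Z by blast
qed

text \<open>A fibre count vanishes only if the fibre is empty, so a null set of pairs lies over a
  null set of first coordinates. All almost everywhere statements about the relation are read
  through this equivalence.\<close>

lemma AE_rel_measure_iff:
  assumes mr: "measured_eqrel M R"
  shows "(AE p in rel_measure M R. P p) \<longleftrightarrow> (AE x in M. \<forall>y. (x, y) \<in> R \<longrightarrow> P (x, y))"
proof
  note f = measured_eqrel_facts[OF mr]
  assume "AE p in rel_measure M R. P p"
  then obtain K where K: "{p \<in> space (rel_measure M R). \<not> P p} \<subseteq> K" "emeasure (rel_measure M R) K = 0"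
    "K \<in> sets (rel_measure M R)" by (rule AE_E)
  then obtain Z where Z: "Z \<in> null_sets M" "fst ` K \<subseteq> Z"
    using rel_measure_null_projection[OF mr, of K] by (auto simp: null_sets_def)
  show "AE x in M. \<forall>y. (x, y) \<in> R \<longrightarrow> P (x, y)"
  proof (rule AE_I'[OF Z(1)], rule subsetI)
    fix x assume "x \<in> {x \<in> space M. \<not> (\<forall>y. (x, y) \<in> R \<longrightarrow> P (x, y))}"
    then obtain y where "(x, y) \<in> R" "\<not> P (x, y)" by auto
    then have "(x, y) \<in> K" using K(1) rel_measure_sets(2)[OF mr] by auto
    then show "x \<in> Z" using Z(2) by force
  qed
next
  note f = measured_eqrel_facts[OF mr]
  assume "AE x in M. \<forall>y. (x, y) \<in> R \<longrightarrow> P (x, y)"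
  then obtain Z where Z: "{x \<in> space M. \<not> (\<forall>y. (x, y) \<in> R \<longrightarrow> P (x, y))} \<subseteq> Z" "emeasure M Z = 0" "Z \<in> sets M"
    by (rule AE_E)
  define K where "K = R \<inter> (Z \<times> space M)"
  have K: "K \<in> sets (M \<Otimes>\<^sub>M M)" "K \<subseteq> R" using f(6) Z(3) by (auto simp: K_def)
  have "AE x in M. x \<notin> Z" using Z by (intro AE_not_in) auto
  then have "AE x in M. emeasure (count_space UNIV) {y. (x, y) \<in> K} = 0"
    by eventually_elim (auto simp: K_def)
  then have "(\<integral>\<^sup>+ x. emeasure (count_space UNIV) {y. (x, y) \<in> K} \<partial>M) = (\<integral>\<^sup>+ x. 0 \<partial>M)"
    by (rule nn_integral_cong_AE)
  then have "K \<in> null_sets (rel_measure M R)"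
    using emeasure_rel_measure[OF mr K] K rel_measure_sets(1)[OF mr] sets_restrict_pair[OF f(6)]
    by (auto simp: null_sets_def)
  then show "AE p in rel_measure M R. P p"
  proof (rule AE_I', intro subsetI)
    fix p assume p: "p \<in> {p \<in> space (rel_measure M R). \<not> P p}"
    then have "p \<in> R" using rel_measure_sets(2)[OF mr] by simp
    then show "p \<in> K" using p Z(1) f(8) by (cases p) (auto simp: K_def)
  qed
qed

text \<open>Quasi-invariance: the saturation of the exceptional null set is null and its complement
  is saturated. Conditions at almost every point thereby become conditions at all points of whole
  classes.\<close>

lemma conull_invariant_subset:
  assumes mr: "measured_eqrel M R" and "AE x in M. P x"
  obtains X where "X \<in> sets M" "space M - X \<in> null_sets M" "\<And>x. x \<in> X \<Longrightarrow> P x"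
    "\<And>x y. (x, y) \<in> R \<Longrightarrow> x \<in> X \<longleftrightarrow> y \<in> X"
proof -
  note f = measured_eqrel_facts[OF mr]
  obtain Z where Z: "{x \<in> space M. \<not> P x} \<subseteq> Z" "Z \<in> null_sets M"
    using AE_E[OF assms(2)] by (metis null_setsI)
  have RZ: "R `` Z \<in> null_sets M" using f(7) Z(2) by blast
  have "Z \<subseteq> R `` Z" using f(5) sets.sets_into_space[of Z M] Z(2) by (auto simp: equiv_def refl_on_def null_sets_def)
  moreover have "space M - (space M - R `` Z) = R `` Z" using f(8) by auto
  moreover have "x \<in> space M - R `` Z \<longleftrightarrow> y \<in> space M - R `` Z" if "(x, y) \<in> R" for x y
  proof -
    have "sym R" "trans R" using f(5) by (auto simp: equiv_def)
    then have "x \<in> R `` Z \<longleftrightarrow> y \<in> R `` Z" using that by (meson Image_iff symD transD)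
    then show ?thesis using that f(8) by blast
  qed
  moreover have "space M - R `` Z \<in> sets M" using RZ by auto
  ultimately show ?thesis
    using that[of "space M - R `` Z"] Z(1) RZ by (metis (mono_tags, lifting) Diff_iff mem_Collect_eq subset_iff)
qed

section \<open>Enumerations of graphs and stable isomorphisms\<close>

text \<open>Outside a null set, selection removes one neighbour from every nonempty fibre and thus
  lowers the degree bound by one.\<close>

lemma bounded_graph_enumeration_AE:
  assumes M: "standard_borel M" "finite_measure M" "space M \<noteq> {}"
  shows "E \<in> sets (M \<Otimes>\<^sub>M M) \<Longrightarrow>
    (\<And>x. x \<in> space M \<Longrightarrow> finite {y. (x, y) \<in> E} \<and> card {y. (x, y) \<in> E} \<le> n) \<Longrightarrow>
    \<exists>D s Z. (\<forall>i. D i \<in> sets M \<and> s i \<in> measurable M M) \<and> Z \<in> null_sets M \<and>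
      (\<forall>x \<in> space M - Z. bij_betw (\<lambda>i :: nat. s i x) {i. i < n \<and> x \<in> D i} {y. (x, y) \<in> E})"
proof (induction n arbitrary: E)
  case 0
  have "{y. (x, y) \<in> E} = {}" if "x \<in> space M" for x
    using 0(2)[OF that] by (metis card_eq_0_iff le_zero_eq)
  then show ?case
    by (intro exI[of _ "\<lambda>_. {}"] exI[of _ "\<lambda>_ x. x"] exI[of _ "{}"]) (simp add: bij_betw_def)
next
  case (Suc n)
  obtain A s Z where As: "A \<in> sets M" "s \<in> measurable M M" "\<And>x. x \<in> A \<Longrightarrow> (x, s x) \<in> E"
    "Z \<in> null_sets M" "fst ` E \<subseteq> A \<union> Z"
    by (rule measurable_selection[OF M(1,2) M(1,3) Suc.prems(1)]) (rule that)
  have Esp: "E \<subseteq> space M \<times> space M" using sets.sets_into_space[OF Suc.prems(1)] by (simp add: space_pair_measure)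
  \<comment> \<open>The graph of s over A is deleted. The fibres over Z are emptied as well, because
    the induction hypothesis asks for the bound n at every point.\<close>
  define E' where "E' = (E \<inter> ((space M - Z) \<times> space M)) -
    ({p \<in> space (M \<Otimes>\<^sub>M M). snd p = s (fst p)} \<inter> (A \<times> space M))"
  have "{p \<in> space (M \<Otimes>\<^sub>M M). snd p = s (fst p)} \<in> sets (M \<Otimes>\<^sub>M M)"
    using M(1) by (rule sets_Collect_eq_standard_borel) (auto intro: measurable_compose[OF measurable_fst As(2)])
  then have E': "E' \<in> sets (M \<Otimes>\<^sub>M M)"
    using Suc.prems(1) As(1,4) unfolding E'_def
    by (intro sets.Diff sets.Int pair_measureI sets.top) (auto simp: null_sets_def)
  have sec: "{y. (x, y) \<in> E'} = {y. (x, y) \<in> E} - (if x \<in> A then {s x} else {})" if "x \<in> space M - Z" for x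
    using that Esp by (auto simp: E'_def space_pair_measure)
  have bound: "finite {y. (x, y) \<in> E'} \<and> card {y. (x, y) \<in> E'} \<le> n" if x: "x \<in> space M" for x
  proof (cases "x \<in> Z")
    case True
    then have "{y. (x, y) \<in> E'} = {}" by (auto simp: E'_def)
    then show ?thesis by simp
  next
    case False
    note f = Suc.prems(2)[OF x]
    show ?thesis
    proof (cases "x \<in> A")
      case True
      then have "s x \<in> {y. (x, y) \<in> E}" using As(3) by simp
      then have "card ({y. (x, y) \<in> E} - {s x}) = card {y. (x, y) \<in> E} - 1" by (rule card_Diff_singleton)
      moreover have "card {y. (x, y) \<in> E} - 1 \<le> n" using f by linarith
      ultimately show ?thesis using f sec[of x] x False True by simp
    next
      case nA: False
      then have "{y. (x, y) \<in> E} = {}" using As(5) False by force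
      then show ?thesis using sec[of x] x False by simp
    qed
  qed
  have "\<exists>D s Z. (\<forall>i. D i \<in> sets M \<and> s i \<in> measurable M M) \<and> Z \<in> null_sets M \<and>
      (\<forall>x \<in> space M - Z. bij_betw (\<lambda>i :: nat. s i x) {i. i < n \<and> x \<in> D i} {y. (x, y) \<in> E'})"
    by (rule Suc.IH[OF E']) (rule bound)
  then obtain D t Z' where D: "\<forall>i. D i \<in> sets M \<and> t i \<in> measurable M M" "Z' \<in> null_sets M"
    "\<forall>x \<in> space M - Z'. bij_betw (\<lambda>i :: nat. t i x) {i. i < n \<and> x \<in> D i} {y. (x, y) \<in> E'}"
    by (elim exE conjE)
  have "bij_betw (\<lambda>i. (t(n := s)) i x) {i. i < Suc n \<and> x \<in> (D(n := A)) i} {y. (x, y) \<in> E}"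
    if x: "x \<in> space M - (Z \<union> Z')" for x
  proof -
    have b: "bij_betw (\<lambda>i. (t(n := s)) i x) {i. i < n \<and> x \<in> D i} {y. (x, y) \<in> E'}"
      using D(3) x by (subst bij_betw_cong[where g="\<lambda>i. t i x"]) auto
    show ?thesis
    proof (cases "x \<in> A")
      case True
      then have I: "{i. i < Suc n \<and> x \<in> (D(n := A)) i} = insert n {i. i < n \<and> x \<in> D i}" by auto
      have "(x, s x) \<in> E" using True As(3) by blast
      then have Ex: "{y. (x, y) \<in> E} = insert (s x) {y. (x, y) \<in> E'}" and nin: "s x \<notin> {y. (x, y) \<in> E'}"
        using sec[of x] x True by auto
      show ?thesis unfolding I Ex
        using notIn_Un_bij_betw3[of n "{i. i < n \<and> x \<in> D i}" "\<lambda>i. (t(n := s)) i x" "{y. (x, y) \<in> E'}"] b nin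
        by simp
    next
      case False
      then have I: "{i. i < Suc n \<and> x \<in> (D(n := A)) i} = {i. i < n \<and> x \<in> D i}" by (auto simp: less_Suc_eq)
      have "{y. (x, y) \<in> E} = {y. (x, y) \<in> E'}" using sec[of x] x False by auto
      then show ?thesis using b I by simp
    qed
  qed
  moreover have "Z \<union> Z' \<in> null_sets M" using As(4) D(2) by (rule null_sets.Un)
  ultimately show ?case using D(1) As(1,2)
    by (intro exI[of _ "D(n := A)"] exI[of _ "t(n := s)"] exI[of _ "Z \<union> Z'"]) auto
qed

lemma meeting_set_selector:
  assumes mr: "measured_eqrel M R" and A: "A \<in> sets M" "meets_almost_every_class M R A"
  obtains X q where "X \<in> sets M" "space M - X \<in> null_sets M" "q \<in> measurable M M"
    "\<And>x. x \<in> X \<Longrightarrow> q x \<in> A \<and> (x, q x) \<in> R"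
proof -
  note f = measured_eqrel_facts[OF mr]
  have K: "R \<inter> (space M \<times> A) \<in> sets (M \<Otimes>\<^sub>M M)" using f(6) A(1) by auto
  obtain X q Z where X: "X \<in> sets M" "q \<in> measurable M M" "\<And>x. x \<in> X \<Longrightarrow> (x, q x) \<in> R \<inter> (space M \<times> A)"
    "Z \<in> null_sets M" "fst ` (R \<inter> (space M \<times> A)) \<subseteq> X \<union> Z"
    by (rule measurable_selection[OF f(1,2) f(1,4) K]) (rule that)
  obtain Z' where Z': "{x \<in> space M. \<not> (R `` {x} \<inter> A \<noteq> {})} \<subseteq> Z'" "Z' \<in> null_sets M"
    using AE_E[OF A(2)[unfolded meets_almost_every_class_def]] by (metis null_setsI)
  have "space M - X \<subseteq> Z \<union> Z'"
  proof
    fix x assume x: "x \<in> space M - X"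
    show "x \<in> Z \<union> Z'"
    proof (cases "R `` {x} \<inter> A = {}")
      case True
      then show ?thesis using Z'(1) x by auto
    next
      case False
      then have "x \<in> fst ` (R \<inter> (space M \<times> A))" using x by force
      then show ?thesis using X(5) x by blast
    qed
  qed
  moreover have "Z \<union> Z' \<in> null_sets M" using X(4) Z'(2) by (rule null_sets.Un)
  ultimately have "space M - X \<in> null_sets M" using X(1) by (meson null_sets_subset sets.compl_sets)
  then show ?thesis using that X by blast
qed

section \<open>Maps between stably isomorphic relations\<close>

text \<open>The body of \<open>stably_isomorphic\<close> with its witnesses as arguments.\<close>

definition stable_iso_data ::
  "'a measure \<Rightarrow> 'a rel \<Rightarrow> 'b measure \<Rightarrow> 'b rel \<Rightarrow> 'a set \<Rightarrow> 'b set \<Rightarrow> ('a \<Rightarrow> 'b) \<Rightarrow> bool" where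
  "stable_iso_data M R N S A B \<phi> \<longleftrightarrow> A \<in> sets M \<and> B \<in> sets N \<and>
     meets_almost_every_class M R A \<and> meets_almost_every_class N S B \<and>
     bij_betw \<phi> A B \<and>
     \<phi> \<in> measurable (restrict_space M A) (restrict_space N B) \<and>
     the_inv_into A \<phi> \<in> measurable (restrict_space N B) (restrict_space M A) \<and>
     (\<forall>E\<in>sets M. E \<subseteq> A \<longrightarrow> (E \<in> null_sets M \<longleftrightarrow> \<phi> ` E \<in> null_sets N)) \<and>
     (\<forall>x\<in>A. \<forall>y\<in>A. (x, y) \<in> R \<longleftrightarrow> (\<phi> x, \<phi> y) \<in> S)"

text \<open>x and z represent the same point of the quotient. Unlike a map, this relation serves
  both directions of the equivalence.\<close>

definition stably_linked :: "'a rel \<Rightarrow> 'c rel \<Rightarrow> 'b rel \<Rightarrow> 'a set \<Rightarrow> ('a \<Rightarrow> 'c) \<Rightarrow> 'b set \<Rightarrow> ('b \<Rightarrow> 'c) \<Rightarrow> 'a \<Rightarrow> 'b \<Rightarrow> bool" where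
  "stably_linked R R\<^sub>0 S A \<phi> A' \<phi>' x z \<longleftrightarrow>
     (\<exists>a\<in>A. \<exists>a'\<in>A'. (x, a) \<in> R \<and> (\<phi> a, \<phi>' a') \<in> R\<^sub>0 \<and> (a', z) \<in> S)"

lemma total_extension_measurable:
  assumes A: "A \<in> sets M" and B: "B \<in> sets N" and f: "f \<in> measurable (restrict_space M A) (restrict_space N B)"
    and c: "c \<in> space N"
  shows "(\<lambda>x. if x \<in> A then f x else c) \<in> measurable M N"
proof -
  have "f \<in> measurable (restrict_space M A) N" using f by (simp add: measurable_restrict_space2_iff)
  moreover have "{x \<in> space M. x \<in> A} \<in> sets M" using A by simp
  moreover have "(\<lambda>x. c) \<in> measurable (restrict_space M {x. x \<notin> A}) N" using c by simp
  ultimately show ?thesis by (subst measurable_If_restrict_space_iff) auto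
qed

lemma stable_iso_null_preimage:
  assumes d: "stable_iso_data M R N S A B \<phi>" and Z: "Z \<in> null_sets N"
  shows "{a \<in> A. \<phi> a \<in> Z} \<in> null_sets M"
proof -
  have A: "A \<in> sets M" and B: "B \<in> sets N" and b: "bij_betw \<phi> A B"
    and m: "\<phi> \<in> measurable (restrict_space M A) (restrict_space N B)"
    and n: "\<And>E. E \<in> sets M \<Longrightarrow> E \<subseteq> A \<Longrightarrow> E \<in> null_sets M \<longleftrightarrow> \<phi> ` E \<in> null_sets N"
    using d unfolding stable_iso_data_def by blast+
  have sA: "space (restrict_space M A) = A" using sets.sets_into_space[OF A] by (auto simp: space_restrict_space)
  have ZB: "Z \<inter> B \<in> null_sets N" using Z B by (meson null_set_Int2)
  have "\<phi> \<in> measurable (restrict_space M A) N" using m by (simp add: measurable_restrict_space2_iff)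
  then have "\<phi> -` (Z \<inter> B) \<inter> A \<in> sets (restrict_space M A)"
    using measurable_sets[of \<phi> "restrict_space M A" N "Z \<inter> B"] ZB sA by auto
  moreover have eq: "\<phi> -` (Z \<inter> B) \<inter> A = {a \<in> A. \<phi> a \<in> Z}" using b by (auto simp: bij_betw_def)
  ultimately have s: "{a \<in> A. \<phi> a \<in> Z} \<in> sets M" using A by (auto simp: sets_restrict_space)
  moreover have "\<phi> ` {a \<in> A. \<phi> a \<in> Z} = Z \<inter> B" using b by (auto simp: bij_betw_def)
  ultimately show ?thesis using n[of "{a \<in> A. \<phi> a \<in> Z}"] ZB by auto
qed

text \<open>The map moves x inside its class to q x in A, applies \<phi>, moves by p inside the
  class of \<open>R\<^sub>0\<close> into B', and applies the inverse of \<phi>'. It need not be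
  injective, but it respects classes.\<close>

lemma stable_iso_map:
  assumes mr: "measured_eqrel M R" "measured_eqrel N S" "measured_eqrel M\<^sub>0 R\<^sub>0"
    and d: "stable_iso_data M R M\<^sub>0 R\<^sub>0 A B \<phi>" and d': "stable_iso_data N S M\<^sub>0 R\<^sub>0 A' B' \<phi>'"
  obtains X \<Phi> where "X \<in> sets M" "space M - X \<in> null_sets M" "\<Phi> \<in> measurable M N"
    "\<And>x. x \<in> X \<Longrightarrow> stably_linked R R\<^sub>0 S A \<phi> A' \<phi>' x (\<Phi> x)"
    "\<And>Z. Z \<in> null_sets N \<Longrightarrow> \<Phi> -` Z \<inter> X \<in> null_sets M"
proof -
  note f = measured_eqrel_facts[OF mr(1)] note g = measured_eqrel_facts[OF mr(2)]
  note h = measured_eqrel_facts[OF mr(3)]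
  have A: "A \<in> sets M" "meets_almost_every_class M R A" and B: "B \<in> sets M\<^sub>0" and b: "bij_betw \<phi> A B"
    and m: "\<phi> \<in> measurable (restrict_space M A) (restrict_space M\<^sub>0 B)"
    using d unfolding stable_iso_data_def by blast+
  have A': "A' \<in> sets N" and B': "B' \<in> sets M\<^sub>0" "meets_almost_every_class M\<^sub>0 R\<^sub>0 B'" and b': "bij_betw \<phi>' A' B'"
    and m': "the_inv_into A' \<phi>' \<in> measurable (restrict_space M\<^sub>0 B') (restrict_space N A')"
    and n': "\<And>E. E \<in> sets N \<Longrightarrow> E \<subseteq> A' \<Longrightarrow> E \<in> null_sets N \<longleftrightarrow> \<phi>' ` E \<in> null_sets M\<^sub>0"
    using d' unfolding stable_iso_data_def by blast+
  obtain X1 q where q: "X1 \<in> sets M" "space M - X1 \<in> null_sets M" "q \<in> measurable M M"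
    "\<And>x. x \<in> X1 \<Longrightarrow> q x \<in> A \<and> (x, q x) \<in> R"
    by (rule meeting_set_selector[OF mr(1) A]) (rule that)
  obtain Y p where p: "Y \<in> sets M\<^sub>0" "space M\<^sub>0 - Y \<in> null_sets M\<^sub>0" "p \<in> measurable M\<^sub>0 M\<^sub>0"
    "\<And>x. x \<in> Y \<Longrightarrow> p x \<in> B' \<and> (x, p x) \<in> R\<^sub>0"
    by (rule meeting_set_selector[OF mr(3) B']) (rule that)
  obtain m0 n0 where m0: "m0 \<in> space M\<^sub>0" and n0: "n0 \<in> space N" using h(4) g(4) by blast
  define \<phi>t where "\<phi>t x = (if x \<in> A then \<phi> x else m0)" for x
  define \<psi>t where "\<psi>t y = (if y \<in> B' then the_inv_into A' \<phi>' y else n0)" for y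
  have \<phi>t: "\<phi>t \<in> measurable M M\<^sub>0" unfolding \<phi>t_def using A(1) B m m0 by (rule total_extension_measurable)
  have \<psi>t: "\<psi>t \<in> measurable M\<^sub>0 N" unfolding \<psi>t_def using B'(1) A' m' n0 by (rule total_extension_measurable)
  define \<Phi> where "\<Phi> x = \<psi>t (p (\<phi>t (q x)))" for x
  have \<Phi>: "\<Phi> \<in> measurable M N" unfolding \<Phi>_def
    using measurable_compose[OF measurable_compose[OF measurable_compose[OF q(3) \<phi>t] p(3)] \<psi>t] .
  have \<phi>q: "(\<lambda>x. \<phi>t (q x)) \<in> measurable M M\<^sub>0" using measurable_compose[OF q(3) \<phi>t] .
  define X where "X = X1 \<inter> ((\<lambda>x. \<phi>t (q x)) -` Y \<inter> space M)"
  have X: "X \<in> sets M" unfolding X_def using q(1) measurable_sets[OF \<phi>q p(1)] by auto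
  have symR: "sym R" and symR0: "sym R\<^sub>0" using f(5) h(5) by (auto simp: equiv_def)
  have reflS: "refl_on (space N) S" using g(5) by (auto simp: equiv_def)
  have key: "\<exists>a\<in>A. \<Phi> x \<in> A' \<and> (x, a) \<in> R \<and> (\<phi> a, \<phi>' (\<Phi> x)) \<in> R\<^sub>0" if x: "x \<in> X" for x
  proof -
    have qx: "q x \<in> A" "(x, q x) \<in> R" using q(4) x by (auto simp: X_def)
    have "\<phi> (q x) \<in> Y" using x qx by (auto simp: X_def \<phi>t_def)
    then have px: "p (\<phi> (q x)) \<in> B'" "(\<phi> (q x), p (\<phi> (q x))) \<in> R\<^sub>0" using p(4) by auto
    have \<Phi>x: "\<Phi> x = the_inv_into A' \<phi>' (p (\<phi> (q x)))" using qx px by (simp add: \<Phi>_def \<phi>t_def \<psi>t_def)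
    have "\<Phi> x \<in> A'" "\<phi>' (\<Phi> x) = p (\<phi> (q x))"
      using b' px(1) unfolding \<Phi>x bij_betw_def
      by (auto intro!: the_inv_into_into f_the_inv_into_f)
    then show ?thesis using qx px by auto
  qed
  have Xnull: "space M - X \<in> null_sets M"
  proof -
    let ?Z = "{a \<in> A. \<phi> a \<in> space M\<^sub>0 - Y}"
    have "?Z \<in> null_sets M" using stable_iso_null_preimage[OF d p(2)] .
    then have "R `` ?Z \<in> null_sets M" using f(7) by blast
    then have n: "(space M - X1) \<union> R `` ?Z \<in> null_sets M" using q(2) by blast
    have "space M - X \<subseteq> (space M - X1) \<union> R `` ?Z"
    proof
      fix x assume x: "x \<in> space M - X"
      show "x \<in> (space M - X1) \<union> R `` ?Z"
      proof (cases "x \<in> X1")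
        case True
        then have qx: "q x \<in> A" "(x, q x) \<in> R" using q(4) by auto
        then have "\<phi> (q x) \<notin> Y" using x True by (auto simp: X_def \<phi>t_def)
        moreover have "\<phi> (q x) \<in> space M\<^sub>0" using qx b sets.sets_into_space[OF B] by (auto simp: bij_betw_def)
        ultimately have "q x \<in> ?Z" using qx by simp
        then show ?thesis using qx(2) symR by (auto dest: symD)
      qed (use x in simp)
    qed
    then show ?thesis using n X by (meson null_sets_subset sets.compl_sets)
  qed
  have link: "stably_linked R R\<^sub>0 S A \<phi> A' \<phi>' x (\<Phi> x)" if x: "x \<in> X" for x
  proof -
    have "x \<in> space M" using x X sets.sets_into_space by blast
    then have "(\<Phi> x, \<Phi> x) \<in> S" using reflS measurable_space[OF \<Phi>] by (auto simp: refl_on_def)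
    then show ?thesis using key[OF x] unfolding stably_linked_def by blast
  qed
  \<comment> \<open>Points sent into Z lie in the saturation of a null set: the part of Z in A' is
    carried to \<open>M\<^sub>0\<close> by \<phi>', saturated, pulled back by \<phi> and saturated
    again, and each of these operations keeps null sets null.\<close>
  have null: "\<Phi> -` Z \<inter> X \<in> null_sets M" if Z: "Z \<in> null_sets N" for Z
  proof -
    have ZA: "Z \<inter> A' \<in> null_sets N" using Z A' by (meson null_set_Int2)
    then have "\<phi>' ` (Z \<inter> A') \<in> null_sets M\<^sub>0" using n'[of "Z \<inter> A'"] by auto
    then have "R\<^sub>0 `` (\<phi>' ` (Z \<inter> A')) \<in> null_sets M\<^sub>0" using h(7) by blast
    then have "{a \<in> A. \<phi> a \<in> R\<^sub>0 `` (\<phi>' ` (Z \<inter> A'))} \<in> null_sets M" using stable_iso_null_preimage[OF d] by blast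
    then have n: "R `` {a \<in> A. \<phi> a \<in> R\<^sub>0 `` (\<phi>' ` (Z \<inter> A'))} \<in> null_sets M" using f(7) by blast
    have "\<Phi> -` Z \<inter> X \<subseteq> R `` {a \<in> A. \<phi> a \<in> R\<^sub>0 `` (\<phi>' ` (Z \<inter> A'))}"
    proof
      fix x assume x: "x \<in> \<Phi> -` Z \<inter> X"
      then obtain a where a: "a \<in> A" "\<Phi> x \<in> A'" "(x, a) \<in> R" "(\<phi> a, \<phi>' (\<Phi> x)) \<in> R\<^sub>0" using key by blast
      then have "\<phi> a \<in> R\<^sub>0 `` (\<phi>' ` (Z \<inter> A'))" using x symR0 by (auto dest: symD)
      then show "x \<in> R `` {a \<in> A. \<phi> a \<in> R\<^sub>0 `` (\<phi>' ` (Z \<inter> A'))}" using a symR by (auto dest: symD)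
    qed
    moreover have "\<Phi> -` Z \<inter> X \<in> sets M"
    proof -
      have "\<Phi> -` Z \<inter> X = (\<Phi> -` Z \<inter> space M) \<inter> X" using sets.sets_into_space[OF X] by auto
      then show ?thesis using measurable_sets[OF \<Phi>, of Z] Z X by auto
    qed
    ultimately show ?thesis using n by (meson null_sets_subset)
  qed
  show ?thesis using X Xnull \<Phi> link null by (rule that)
qed

text \<open>Each leg of a link either stays inside a class or crosses by a map that respects the
  relations, so lying in a common class passes through the five legs one after another.\<close>

lemma stably_linked_iff:
  assumes eq: "equiv X R" "equiv Y S" "equiv W R\<^sub>0"
    and e: "\<And>x y. x \<in> A \<Longrightarrow> y \<in> A \<Longrightarrow> (x, y) \<in> R \<longleftrightarrow> (\<phi> x, \<phi> y) \<in> R\<^sub>0"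
    and e': "\<And>x y. x \<in> A' \<Longrightarrow> y \<in> A' \<Longrightarrow> (x, y) \<in> S \<longleftrightarrow> (\<phi>' x, \<phi>' y) \<in> R\<^sub>0"
    and L: "stably_linked R R\<^sub>0 S A \<phi> A' \<phi>' x z" "stably_linked R R\<^sub>0 S A \<phi> A' \<phi>' x' z'"
  shows "(x, x') \<in> R \<longleftrightarrow> (z, z') \<in> S"
proof -
  have s: "sym R" "sym S" "sym R\<^sub>0" and t: "trans R" "trans S" "trans R\<^sub>0" using eq by (auto simp: equiv_def)
  have conj: "(u, u') \<in> Q \<longleftrightarrow> (v, v') \<in> Q" if "sym Q" "trans Q" "(u, v) \<in> Q" "(u', v') \<in> Q" for Q :: "'q rel" and u u' v v'
    using that by (meson symD transD)
  obtain a a' where a: "a \<in> A" "a' \<in> A'" "(x, a) \<in> R" "(\<phi> a, \<phi>' a') \<in> R\<^sub>0" "(a', z) \<in> S"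
    using L(1) unfolding stably_linked_def by blast
  obtain c c' where c: "c \<in> A" "c' \<in> A'" "(x', c) \<in> R" "(\<phi> c, \<phi>' c') \<in> R\<^sub>0" "(c', z') \<in> S"
    using L(2) unfolding stably_linked_def by blast
  have "(x, x') \<in> R \<longleftrightarrow> (a, c) \<in> R" using conj[OF s(1) t(1) a(3) c(3)] .
  also have "\<dots> \<longleftrightarrow> (\<phi> a, \<phi> c) \<in> R\<^sub>0" using e a c by blast
  also have "\<dots> \<longleftrightarrow> (\<phi>' a', \<phi>' c') \<in> R\<^sub>0" using conj[OF s(3) t(3) a(4) c(4)] .
  also have "\<dots> \<longleftrightarrow> (a', c') \<in> S" using e' a c by blast
  also have "\<dots> \<longleftrightarrow> (z, z') \<in> S" using conj[OF s(2) t(2) a(5) c(5)] .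
  finally show ?thesis .
qed

lemma stably_linked_swap:
  assumes "sym R" "sym R\<^sub>0" "sym S" "stably_linked R R\<^sub>0 S A \<phi> A' \<phi>' x z"
  shows "stably_linked S R\<^sub>0 R A' \<phi>' A \<phi> z x"
  using assms unfolding stably_linked_def by (meson symD)

text \<open>\<Phi> and \<Psi> are built separately and need not be inverse to each other. The common
  relation L records that x and \<open>\<Phi> x\<close>, and likewise \<open>\<Psi> z\<close> and z,
  represent the same point, so that going back and forth stays inside a class.\<close>

theorem stable_equivalence_maps:
  assumes mr: "measured_eqrel M R" "measured_eqrel N S" "measured_eqrel M\<^sub>0 R\<^sub>0"
    and si: "stably_isomorphic M R M\<^sub>0 R\<^sub>0" "stably_isomorphic N S M\<^sub>0 R\<^sub>0"
  obtains L X \<Phi> Y \<Psi> where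
    "\<And>x z x' z'. L x z \<Longrightarrow> L x' z' \<Longrightarrow> (x, x') \<in> R \<longleftrightarrow> (z, z') \<in> S"
    "X \<in> sets M" "space M - X \<in> null_sets M" "\<Phi> \<in> measurable M N" "\<And>x. x \<in> X \<Longrightarrow> L x (\<Phi> x)"
    "\<And>Z. Z \<in> null_sets N \<Longrightarrow> \<Phi> -` Z \<inter> X \<in> null_sets M"
    "Y \<in> sets N" "space N - Y \<in> null_sets N" "\<Psi> \<in> measurable N M" "\<And>z. z \<in> Y \<Longrightarrow> L (\<Psi> z) z"
    "\<And>Z. Z \<in> null_sets M \<Longrightarrow> \<Psi> -` Z \<inter> Y \<in> null_sets N"
proof -
  obtain A B \<phi> where d: "stable_iso_data M R M\<^sub>0 R\<^sub>0 A B \<phi>"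
    using si(1) unfolding stably_isomorphic_def stable_iso_data_def by blast
  obtain A' B' \<phi>' where d': "stable_iso_data N S M\<^sub>0 R\<^sub>0 A' B' \<phi>'"
    using si(2) unfolding stably_isomorphic_def stable_iso_data_def by blast
  note eqs = measured_eqrel_facts(5)[OF mr(1)] measured_eqrel_facts(5)[OF mr(2)] measured_eqrel_facts(5)[OF mr(3)]
  have s: "sym R" "sym R\<^sub>0" "sym S" using eqs by (auto simp: equiv_def)
  obtain X \<Phi> where X: "X \<in> sets M" "space M - X \<in> null_sets M" "\<Phi> \<in> measurable M N"
    "\<And>x. x \<in> X \<Longrightarrow> stably_linked R R\<^sub>0 S A \<phi> A' \<phi>' x (\<Phi> x)"
    "\<And>Z. Z \<in> null_sets N \<Longrightarrow> \<Phi> -` Z \<inter> X \<in> null_sets M"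
    by (rule stable_iso_map[OF mr d d']) (rule that)
  obtain Y \<Psi> where Y: "Y \<in> sets N" "space N - Y \<in> null_sets N" "\<Psi> \<in> measurable N M"
    "\<And>z. z \<in> Y \<Longrightarrow> stably_linked S R\<^sub>0 R A' \<phi>' A \<phi> z (\<Psi> z)"
    "\<And>Z. Z \<in> null_sets M \<Longrightarrow> \<Psi> -` Z \<inter> Y \<in> null_sets N"
    by (rule stable_iso_map[OF mr(2,1,3) d' d]) (rule that)
  have L: "(x, x') \<in> R \<longleftrightarrow> (z, z') \<in> S"
    if "stably_linked R R\<^sub>0 S A \<phi> A' \<phi>' x z" "stably_linked R R\<^sub>0 S A \<phi> A' \<phi>' x' z'" for x z x' z'
  proof (rule stably_linked_iff[OF eqs _ _ that])
    show "\<And>x y. x \<in> A \<Longrightarrow> y \<in> A \<Longrightarrow> (x, y) \<in> R \<longleftrightarrow> (\<phi> x, \<phi> y) \<in> R\<^sub>0"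
      using d unfolding stable_iso_data_def by blast
    show "\<And>x y. x \<in> A' \<Longrightarrow> y \<in> A' \<Longrightarrow> (x, y) \<in> S \<longleftrightarrow> (\<phi>' x, \<phi>' y) \<in> R\<^sub>0"
      using d' unfolding stable_iso_data_def by blast
  qed
  show ?thesis
    using L X Y(1-3) stably_linked_swap[OF s(3,2,1) Y(4)] Y(5) by (rule that)
qed

section \<open>The spectral gap of a link\<close>

locale finite_graph =
  fixes V :: "'v set" and adj :: "'v \<Rightarrow> 'v \<Rightarrow> bool"
  assumes finV: "finite V" and adj_sym: "adj y z \<Longrightarrow> adj z y"
    and connected: "graph_connected V adj"
    and has_edge: "\<exists>u\<in>V. \<exists>v\<in>V. u \<noteq> v \<and> adj u v"
begin

definition a :: "'v \<Rightarrow> 'v \<Rightarrow> real" where "a y z = of_bool (adj y z)"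

definition \<tau> :: "'v \<Rightarrow> real" where "\<tau> y = (\<Sum>z\<in>V. a y z)"

text \<open>The valency weight makes \<open>graph_laplacian\<close> symmetric with
  \<open>dir\<close> as its form; the factor 1/2 in \<open>dir\<close> compensates for counting
  every edge in both orders.\<close>

definition ip :: "('v \<Rightarrow> real) \<Rightarrow> ('v \<Rightarrow> real) \<Rightarrow> real" where
  "ip f g = (\<Sum>y\<in>V. \<tau> y * f y * g y)"

definition dir :: "('v \<Rightarrow> real) \<Rightarrow> ('v \<Rightarrow> real) \<Rightarrow> real" where
  "dir f g = (1/2) * (\<Sum>y\<in>V. \<Sum>z\<in>V. a y z * ((f y - f z) * (g y - g z)))"

lemma a_sym: "a y z = a z y"
  using adj_sym by (auto simp: a_def of_bool_def)

lemma a_nonneg: "0 \<le> a y z"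
  by (simp add: a_def)

lemma valency_eq: "real (valency V adj y) = \<tau> y"
  using finV by (simp add: valency_def \<tau>_def a_def of_bool_def sum.If_cases Int_def)

lemma const_of_step:
  assumes "\<And>y z. y \<in> V \<Longrightarrow> z \<in> V \<Longrightarrow> adj y z \<Longrightarrow> P y \<Longrightarrow> P z" "u \<in> V" "P u" "v \<in> V"
  shows "P v"
proof -
  have "(u, v) \<in> {(y, z). y \<in> V \<and> z \<in> V \<and> adj y z}\<^sup>*"
    using connected assms(2,4) unfolding graph_connected_def by blast
  then show ?thesis using assms(3) by (induction rule: rtrancl_induct) (use assms(1) in auto)
qed

text \<open>A vertex without neighbours would be all of a connected graph, against
  \<open>has_edge\<close>.\<close>

lemma \<tau>_ge1:
  assumes "y \<in> V"
  shows "\<tau> y \<ge> 1"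
proof -
  obtain v where v: "v \<in> V" "v \<noteq> y" using has_edge by metis
  have "\<exists>z\<in>V. adj y z"
  proof (rule ccontr)
    assume n: "\<not> ?thesis"
    have "v = y"
      by (rule const_of_step[where P = "\<lambda>u. u = y" and u = y]) (use n assms v in blast)+
    then show False using v by simp
  qed
  then obtain z where "z \<in> V" "adj y z" by blast
  then have "a y z = 1" "z \<in> V" by (auto simp: a_def)
  then show ?thesis using member_le_sum[of z V "a y"] finV a_nonneg by (auto simp: \<tau>_def)
qed

lemma laplacian_eq:
  assumes "y \<in> V"
  shows "\<tau> y * graph_laplacian V adj f y = (\<Sum>z\<in>V. a y z * (f y - f z))"
proof -
  have "(\<Sum>z\<in>V. a y z * f z) = (\<Sum>z\<in>V. if adj y z then f z else 0)"
    by (intro sum.cong) (auto simp: a_def)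
  also have "\<dots> = (\<Sum>z\<in>{z\<in>V. adj y z}. f z)" using finV by (simp add: sum.inter_filter)
  finally have "(\<Sum>z\<in>{z\<in>V. adj y z}. f z) = (\<Sum>z\<in>V. a y z * f z)" ..
  then show ?thesis using \<tau>_ge1[OF assms]
    by (simp add: graph_laplacian_def graph_diffusion_def valency_eq right_diff_distrib sum_subtractf)
      (simp add: \<tau>_def sum_distrib_right)
qed

text \<open>Summation by parts: exchanging y and z gives the same sum with - g z in place of g y,
  and the average of the two forms is \<open>dir\<close>.\<close>

lemma green: "(\<Sum>y\<in>V. (\<Sum>z\<in>V. a y z * (f y - f z)) * g y) = dir f g"
proof -
  let ?S = "\<Sum>y\<in>V. \<Sum>z\<in>V. a y z * (f y - f z) * g y"
  have flip: "a z y * (f z - f y) * g z = - (a y z * (f y - f z) * g z)" for y z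
    using a_sym[of z y] by (simp add: algebra_simps)
  have "?S = (\<Sum>y\<in>V. \<Sum>z\<in>V. a z y * (f z - f y) * g z)" by (rule sum.swap)
  also have "\<dots> = (\<Sum>y\<in>V. \<Sum>z\<in>V. - (a y z * (f y - f z) * g z))"
    by (simp only: flip)
  finally have "?S + ?S = (\<Sum>y\<in>V. \<Sum>z\<in>V. a y z * (f y - f z) * g y) + (\<Sum>y\<in>V. \<Sum>z\<in>V. - (a y z * (f y - f z) * g z))"
    by simp
  also have "\<dots> = (\<Sum>y\<in>V. \<Sum>z\<in>V. a y z * ((f y - f z) * (g y - g z)))"
    by (simp add: sum.distrib[symmetric] algebra_simps)
  finally have "?S + ?S = 2 * dir f g" unfolding dir_def by simp
  then show ?thesis by (simp add: sum_distrib_right)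
qed

lemma ip_laplacian: "ip (graph_laplacian V adj f) g = dir f g"
proof -
  have "ip (graph_laplacian V adj f) g = (\<Sum>y\<in>V. (\<Sum>z\<in>V. a y z * (f y - f z)) * g y)"
    unfolding ip_def by (intro sum.cong refl) (simp add: laplacian_eq)
  then show ?thesis by (simp add: green)
qed

lemma dir_commute: "dir f g = dir g f"
  by (simp add: dir_def mult.commute)

lemma ip_commute: "ip f g = ip g f"
  by (simp add: ip_def mult_ac)

lemma dir_nonneg: "0 \<le> dir f f"
  unfolding dir_def by (intro mult_nonneg_nonneg sum_nonneg a_nonneg zero_le_square) simp

lemma ip_nonneg: "0 \<le> ip f f"
  unfolding ip_def using \<tau>_ge1 by (intro sum_nonneg) (smt (verit) mult.assoc mult_nonneg_nonneg zero_le_square)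

lemma ip_eq0: "ip f f = 0 \<Longrightarrow> y \<in> V \<Longrightarrow> f y = 0"
proof -
  assume "ip f f = 0" "y \<in> V"
  moreover have "0 \<le> \<tau> y * f y * f y" if "y \<in> V" for y
    using \<tau>_ge1[OF that] by (simp add: mult.assoc)
  ultimately have "\<tau> y * f y * f y = 0"
    using finV unfolding ip_def by (simp add: sum_nonneg_eq_0_iff)
  then show "f y = 0" using \<tau>_ge1[OF \<open>y \<in> V\<close>] by simp
qed

lemma ip_lin: "ip (\<lambda>y. f y + t * g y) h = ip f h + t * ip g h"
  by (simp add: ip_def algebra_simps sum.distrib sum_distrib_left)

lemma dir_lin: "dir (\<lambda>y. f y + t * g y) h = dir f h + t * dir g h"
  by (simp add: dir_def algebra_simps sum.distrib sum_distrib_left sum_subtractf)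

lemma eigen_ip:
  assumes "\<forall>y\<in>V. graph_laplacian V adj f y = c * f y"
  shows "dir f g = c * ip f g"
proof -
  have "ip (graph_laplacian V adj f) g = (\<Sum>y\<in>V. \<tau> y * (c * f y) * g y)"
    unfolding ip_def using assms by (intro sum.cong) auto
  then show ?thesis by (simp add: ip_laplacian) (simp add: ip_def sum_distrib_left algebra_simps)
qed

text \<open>Bessel's inequality for the point masses bounds the number of orthonormal eigenfunctions.\<close>

lemma finite_eigenvalues: "finite {c. laplacian_eigenvalue V adj c}"
proof (rule ccontr)
  assume "infinite {c. laplacian_eigenvalue V adj c}"
  then obtain C where C: "finite C" "card C = Suc (card V)" "C \<subseteq> {c. laplacian_eigenvalue V adj c}"
    using infinite_arbitrarily_large by blast
  have "\<exists>f. ip f f = 1 \<and> (\<forall>y\<in>V. graph_laplacian V adj f y = c * f y)" if cC: "c \<in> C" for c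
  proof -
    obtain f where f: "\<exists>y\<in>V. f y \<noteq> 0" "\<forall>y\<in>V. graph_laplacian V adj f y = c * f y"
      using subsetD[OF C(3) cC] unfolding laplacian_eigenvalue_def mem_Collect_eq by (elim exE conjE)
    have pos: "ip f f > 0" using f(1) ip_eq0[of f] ip_nonneg[of f] by force
    define r where "r = 1 / sqrt (ip f f)"
    have "ip (\<lambda>y. r * f y) (\<lambda>y. r * f y) = r * r * ip f f"
      by (simp add: ip_def sum_distrib_left algebra_simps)
    also have "\<dots> = 1" using pos by (simp add: r_def)
    moreover have "graph_laplacian V adj (\<lambda>y. r * f y) y = c * (r * f y)" if "y \<in> V" for y
    proof -
      have "\<tau> y * graph_laplacian V adj (\<lambda>y. r * f y) y = r * (\<tau> y * graph_laplacian V adj f y)"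
        using that by (simp add: laplacian_eq sum_distrib_left algebra_simps)
      then show ?thesis using f(2) that \<tau>_ge1[OF that] by (simp add: algebra_simps)
    qed
    ultimately show ?thesis by (intro exI[of _ "\<lambda>y. r * f y"]) auto
  qed
  then have "\<forall>c\<in>C. \<exists>f. ip f f = 1 \<and> (\<forall>y\<in>V. graph_laplacian V adj f y = c * f y)" by (intro ballI)
  from bchoice[OF this] obtain F where F': "\<forall>c\<in>C. ip (F c) (F c) = 1 \<and> (\<forall>y\<in>V. graph_laplacian V adj (F c) y = c * F c y)"
    by (elim exE)
  have F: "ip (F c) (F c) = 1" "\<forall>y\<in>V. graph_laplacian V adj (F c) y = c * F c y" if "c \<in> C" for c
    using bspec[OF F' that] by simp_all
  have orth: "ip (F c) (F c') = 0" if "c \<in> C" "c' \<in> C" "c \<noteq> c'" for c c'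
  proof -
    have "c * ip (F c) (F c') = c' * ip (F c) (F c')"
      using eigen_ip[OF F(2)[OF that(1)], of "F c'"] eigen_ip[OF F(2)[OF that(2)], of "F c"]
      using dir_commute[of "F c" "F c'"] ip_commute[of "F c" "F c'"] by metis
    then show ?thesis using that(3) by simp
  qed
  have bessel: "(\<Sum>c\<in>C. \<tau> v * F c v * F c v) \<le> 1" if v: "v \<in> V" for v
  proof -
    define s where "s = (\<Sum>c\<in>C. F c v * F c v)"
    define u where "u y = (\<Sum>c\<in>C. F c v * F c y)" for y
    \<comment> \<open>A point mass normalized so that pairing with it evaluates at v; u is its
      projection to the span of the eigenfunctions.\<close>
    define e where "e y = (if y = v then 1 / \<tau> v else 0)" for y
    have tv: "\<tau> v \<ge> 1" using \<tau>_ge1[OF v] .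
    have eg: "ip e g = g v" for g
    proof -
      have "ip e g = (\<Sum>y\<in>V. if y = v then g v else 0)"
        unfolding ip_def e_def using tv by (intro sum.cong) auto
      then show ?thesis using v finV by simp
    qed
    have ug: "ip u g = (\<Sum>c\<in>C. F c v * ip (F c) g)" for g
      unfolding ip_def u_def
      by (simp add: sum_distrib_left sum_distrib_right mult_ac sum.swap[of _ V C])
    have "ip (F c) u = F c v" if "c \<in> C" for c
    proof -
      have "ip (F c) u = (\<Sum>c'\<in>C. F c' v * ip (F c') (F c))" using ug[of "F c"] ip_commute[of "F c" u] by simp
      also have "\<dots> = (\<Sum>c'\<in>C. if c' = c then F c v else 0)"
        using orth F(1) that by (intro sum.cong) auto
      finally show ?thesis using that C(1) by simp
    qed
    then have uu: "ip u u = s" using ug[of u] by (simp add: s_def)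
    have "ip (\<lambda>y. e y + (-1) * u y) (\<lambda>y. e y + (-1) * u y) = ip e e - 2 * ip e u + ip u u"
      by (simp add: ip_def algebra_simps sum.distrib sum_subtractf sum_distrib_left)
    also have "\<dots> = 1 / \<tau> v - s" using eg uu by (simp add: e_def u_def s_def)
    finally have "s \<le> 1 / \<tau> v" using ip_nonneg[of "\<lambda>y. e y + (-1) * u y"] by simp
    then have "\<tau> v * s \<le> 1" using tv by (simp add: field_simps)
    then show ?thesis by (simp add: s_def sum_distrib_left mult.assoc)
  qed
  \<comment> \<open>Each normalized eigenfunction contributes 1. Exchanging the sums and adding
    Bessel's inequality over all v bounds their number by \<open>card V\<close>.\<close>
  have "real (card C) = (\<Sum>c\<in>C. ip (F c) (F c))" using F(1) by simp
  also have "\<dots> = (\<Sum>v\<in>V. \<Sum>c\<in>C. \<tau> v * F c v * F c v)" unfolding ip_def by (rule sum.swap)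
  also have "\<dots> \<le> (\<Sum>v\<in>V. 1)" using bessel by (intro sum_mono)
  also have "\<dots> = real (card V)" by simp
  finally show False using C(2) by simp
qed

text \<open>At t = - b / k with k above both c and 0 the expression is (b^2 / k) (c / k - 1), which
  is negative unless b = 0.\<close>

lemma quadratic_nonneg_linear_zero:
  assumes "\<And>t :: real. 0 \<le> t * b + t * t * c"
  shows "b = 0"
proof (rule ccontr)
  assume b: "b \<noteq> 0"
  define k where "k = \<bar>c\<bar> + 1"
  have k: "k > 0" "c < k" by (auto simp: k_def)
  have bb: "b * b > 0" using b by (simp flip: power2_eq_square)
  have "0 \<le> (- b / k) * b + (- b / k) * (- b / k) * c" by (rule assms)
  also have "\<dots> = (b * b / k) * (c / k - 1)" using k by (simp add: field_simps)
  also have "\<dots> < 0" using bb k by (intro mult_pos_neg) auto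
  finally show False by simp
qed

lemma continuous_on_eval: "continuous_on A (\<lambda>f :: 'v \<Rightarrow> real. f y)"
  by (rule continuous_on_subset[OF continuous_on_product_coordinates]) simp

text \<open>\<open>graph_lambda1\<close> is defined through eigenvalues, not variationally. The
  minimum \<kappa> of \<open>dir\<close> over mean zero functions of norm 1 turns out to be an
  eigenvalue, nonzero by connectivity, so the least nonzero eigenvalue is at most \<kappa>;
  \<open>Min\<close> is controlled because there are finitely many eigenvalues.\<close>

lemma rayleigh:
  assumes mean: "(\<Sum>y\<in>V. \<tau> y * g y) = 0"
  shows "graph_lambda1 V adj * ip g g \<le> dir g g"
proof (cases "ip g g = 0")
  case True
  then show ?thesis using dir_nonneg by simp
next
  case False
  then have gpos: "ip g g > 0" using ip_nonneg[of g] by simp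
  define mean where "mean f = (\<Sum>y\<in>V. \<tau> y * f y)" for f
  \<comment> \<open>Functions are pinned to 0 off V, so that K is compact in the product topology
    even over an infinite type. The bound by 1 follows from unit norm and \<open>\<tau>_ge1\<close>,
    so it excludes no competitor.\<close>
  define K where "K = {f :: 'v \<Rightarrow> real. \<forall>y. f y \<in> (if y \<in> V then {-1..1} else {0})} \<inter>
    ({f. ip f f = 1} \<inter> {f. mean f = 0})"
  have "compactin (product_topology (\<lambda>_. euclidean) UNIV) (PiE UNIV (\<lambda>y. if y \<in> V then {-1..1::real} else {0}))"
    by (simp add: compactin_PiE)
  then have "compact (PiE UNIV (\<lambda>y. if y \<in> V then {-1..1::real} else {0}))"
    by (simp add: euclidean_product_topology)
  moreover have "PiE UNIV (\<lambda>y. if y \<in> V then {-1..1::real} else {0}) =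
      {f :: 'v \<Rightarrow> real. \<forall>y. f y \<in> (if y \<in> V then {-1..1} else {0})}"
    by (auto simp: PiE_def Pi_def)
  moreover have "closed ({f. ip f f = 1} \<inter> {f. mean f = 0})"
    unfolding ip_def mean_def
    by (intro closed_Int closed_Collect_eq continuous_intros continuous_on_eval)
  ultimately have K: "compact K" unfolding K_def by (simp add: compact_Int_closed)
  have norm_in: "(\<lambda>y. if y \<in> V then r * f y else 0) \<in> K"
    if f: "mean f = 0" and p: "ip f f > 0" and r: "r = 1 / sqrt (ip f f)" for f r
  proof -
    let ?h = "\<lambda>y. if y \<in> V then r * f y else 0"
    have "ip ?h ?h = r * r * ip f f"
      unfolding ip_def by (simp add: sum_distrib_left algebra_simps cong: sum.cong)
    also have "\<dots> = 1" using p by (simp add: r)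
    finally have 1: "ip ?h ?h = 1" .
    have "mean ?h = r * mean f" by (simp add: mean_def sum_distrib_left algebra_simps cong: sum.cong)
    then have 2: "mean ?h = 0" using f by simp
    have "\<bar>?h y\<bar> \<le> 1" if y: "y \<in> V" for y
    proof -
      have nn: "0 \<le> \<tau> y * ?h y * ?h y" if "y \<in> V" for y using \<tau>_ge1[OF that] by (simp add: mult.assoc)
      have "?h y * ?h y \<le> \<tau> y * ?h y * ?h y" using \<tau>_ge1[OF y]
        by (simp add: mult.assoc mult_le_cancel_right1)
      also have "\<dots> \<le> ip ?h ?h" unfolding ip_def using finV y nn
        by (intro member_le_sum[of y V "\<lambda>y. \<tau> y * ?h y * ?h y"]) auto
      finally have "?h y ^ 2 \<le> 1" using 1 by (simp add: power2_eq_square)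
      then show ?thesis using abs_square_le_1 by blast
    qed
    then show ?thesis using 1 2 by (auto simp: K_def abs_le_iff)
  qed
  have "K \<noteq> {}" using norm_in[of g] mean gpos by (auto simp: mean_def)
  moreover have "continuous_on K (\<lambda>f. dir f f)"
    unfolding dir_def by (intro continuous_intros continuous_on_eval)
  ultimately obtain f0 where f0: "f0 \<in> K" "\<And>f. f \<in> K \<Longrightarrow> dir f0 f0 \<le> dir f f"
    using continuous_attains_inf[OF K] by blast
  define \<kappa> where "\<kappa> = dir f0 f0"
  have f01: "ip f0 f0 = 1" "mean f0 = 0" using f0(1) by (auto simp: K_def)
  have lower: "\<kappa> * ip f f \<le> dir f f" if f: "mean f = 0" for f
  proof (cases "ip f f = 0")
    case True
    then show ?thesis using dir_nonneg by simp
  next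
    case False
    then have p: "ip f f > 0" using ip_nonneg[of f] by simp
    define r where "r = 1 / sqrt (ip f f)"
    let ?h = "\<lambda>y. if y \<in> V then r * f y else 0"
    have "\<kappa> \<le> dir ?h ?h" using f0(2)[OF norm_in[OF f p r_def]] by (simp add: \<kappa>_def)
    also have "dir ?h ?h = dir (\<lambda>y. r * f y) (\<lambda>y. r * f y)"
      unfolding dir_def by (intro arg_cong2[where f="(*)"] refl sum.cong) auto
    also have "\<dots> = r * r * dir f f"
      by (simp add: dir_def sum_distrib_left algebra_simps)
    also have "r * r = 1 / ip f f" using p by (simp add: r_def)
    finally show ?thesis using p by (simp add: field_simps)
  qed
  \<comment> \<open>First variation: f0 is a minimizer and adding multiples of h keeps the mean
    zero, so the term linear in t vanishes.\<close>
  have crit: "dir f0 h = \<kappa> * ip f0 h" if h: "mean h = 0" for h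
  proof -
    have "0 \<le> t * (2 * (dir f0 h - \<kappa> * ip f0 h)) + t * t * (dir h h - \<kappa> * ip h h)" for t
    proof -
      let ?f = "\<lambda>y. f0 y + t * h y"
      have "mean ?f = 0" using h f01(2) by (simp add: mean_def algebra_simps sum.distrib sum_distrib_left[symmetric])
      then have "\<kappa> * ip ?f ?f \<le> dir ?f ?f" by (rule lower)
      moreover have "ip ?f ?f = ip f0 f0 + 2 * t * ip f0 h + t * t * ip h h"
        using ip_lin[of f0 t h ?f] ip_lin[of f0 t h f0] ip_lin[of f0 t h h]
        by (simp add: ip_commute[of f0 ?f] ip_commute[of h ?f] ip_commute[of h f0] algebra_simps)
      moreover have "dir ?f ?f = dir f0 f0 + 2 * t * dir f0 h + t * t * dir h h"
        using dir_lin[of f0 t h ?f] dir_lin[of f0 t h f0] dir_lin[of f0 t h h]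
        by (simp add: dir_commute[of f0 ?f] dir_commute[of h ?f] dir_commute[of h f0] algebra_simps)
      ultimately show ?thesis using f01 by (simp add: \<kappa>_def algebra_simps)
    qed
    then have "2 * (dir f0 h - \<kappa> * ip f0 h) = 0" by (rule quadratic_nonneg_linear_zero)
    then show ?thesis by simp
  qed
  \<comment> \<open>The defect of the eigenvalue equation has mean zero, so it may be tested against
    itself, and this makes it vanish on V.\<close>
  define h where "h y = graph_laplacian V adj f0 y - \<kappa> * f0 y" for y
  have "mean (graph_laplacian V adj f0) = ip (graph_laplacian V adj f0) (\<lambda>_. 1)"
    by (simp add: mean_def ip_def)
  also have "\<dots> = 0" unfolding ip_laplacian by (simp add: dir_def)
  finally have "mean h = 0"
    using f01(2) by (simp add: mean_def h_def right_diff_distrib sum_subtractf mult.left_commute[of _ \<kappa>] sum_distrib_left[symmetric])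
  then have "dir f0 h = \<kappa> * ip f0 h" by (rule crit)
  moreover have hd: "h = (\<lambda>y. graph_laplacian V adj f0 y + (- \<kappa>) * f0 y)" by (simp add: h_def fun_eq_iff)
  have "ip h h = ip (graph_laplacian V adj f0) h - \<kappa> * ip f0 h"
    using ip_lin[of "graph_laplacian V adj f0" "- \<kappa>" f0 h, folded hd] by simp
  ultimately have "ip h h = 0" by (simp add: ip_laplacian)
  then have eig: "\<forall>y\<in>V. graph_laplacian V adj f0 y = \<kappa> * f0 y" using ip_eq0[of h] by (auto simp: h_def)
  have "\<exists>y\<in>V. f0 y \<noteq> 0" using f01(1) by (auto simp: ip_def intro: ccontr)
  then have ev: "laplacian_eigenvalue V adj \<kappa>" using eig unfolding laplacian_eigenvalue_def by blast
  \<comment> \<open>If the form vanished, f0 would be constant along edges, hence constant on V,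
    hence 0 by the mean condition, against unit norm.\<close>
  have "\<kappa> \<noteq> 0"
  proof
    assume "\<kappa> = 0"
    then have 0: "(\<Sum>y\<in>V. \<Sum>z\<in>V. a y z * ((f0 y - f0 z) * (f0 y - f0 z))) = 0"
      by (simp add: \<kappa>_def dir_def)
    have step: "f0 z = c" if "y \<in> V" "z \<in> V" "adj y z" "f0 y = c" for y z c
    proof -
      have nn: "0 \<le> a y z * ((f0 y - f0 z) * (f0 y - f0 z))" for y z using a_nonneg by simp
      have "(\<Sum>z\<in>V. a y z * ((f0 y - f0 z) * (f0 y - f0 z))) = 0"
        using 0 finV that(1) nn by (subst (asm) sum_nonneg_eq_0_iff) (auto intro: sum_nonneg)
      then have "a y z * ((f0 y - f0 z) * (f0 y - f0 z)) = 0"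
        using finV that(2) nn by (subst (asm) sum_nonneg_eq_0_iff) auto
      then show ?thesis using that by (simp add: a_def)
    qed
    obtain u where u: "u \<in> V" using has_edge by blast
    have const: "f0 v = f0 u" if "v \<in> V" for v
      by (rule const_of_step[where P = "\<lambda>v. f0 v = f0 u" and u = u]) (use step u that in blast)+
    have "mean f0 = f0 u * (\<Sum>y\<in>V. \<tau> y)"
      unfolding mean_def sum_distrib_left using const by (intro sum.cong) auto
    moreover have "(\<Sum>y\<in>V. \<tau> y) > 0" using u finV \<tau>_ge1 by (intro sum_pos) (auto intro: less_le_trans[OF zero_less_one])
    ultimately have "f0 u = 0" using f01(2) by simp
    then show False using const f01(1) by (simp add: ip_def)
  qed
  then have "graph_lambda1 V adj \<le> \<kappa>"
    unfolding graph_lambda1_def using ev finite_eigenvalues by (intro Min_le) auto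
  then have "graph_lambda1 V adj * ip g g \<le> \<kappa> * ip g g" using gpos by (intro mult_right_mono) auto
  also have "\<dots> \<le> dir g g" using mean by (intro lower) (simp add: mean_def)
  finally show ?thesis .
qed

section \<open>Vector-valued functions and application to links\<close>

text \<open>Parseval for an orthogonal family that is not normalized; a zero vector in C contributes
  0 because division by zero yields 0.\<close>

lemma orthogonal_expansion:
  fixes C :: "'h::real_inner set"
  assumes C: "finite C" "pairwise orthogonal C" and w: "w \<in> span C"
  shows "w \<bullet> w = (\<Sum>b\<in>C. (w \<bullet> b) * (w \<bullet> b) / (b \<bullet> b))"
proof -
  have "w = (\<Sum>b\<in>C. ((w \<bullet> b) / (b \<bullet> b)) *\<^sub>R b)"
    using w
  proof (induction rule: span_induct)
    case base
    let ?P = "\<lambda>w. \<Sum>b\<in>C. ((w \<bullet> b) / (b \<bullet> b)) *\<^sub>R b"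
    have 0: "?P 0 = 0" by simp
    have add: "?P (v + w) = ?P v + ?P w" for v w
      by (simp add: inner_add_left add_divide_distrib scaleR_add_left sum.distrib)
    have scale: "?P (r *\<^sub>R w) = r *\<^sub>R ?P w" for r w
      by (simp add: scaleR_sum_right)
    show ?case
    proof (rule subspaceI)
      show "0 \<in> {w. w = ?P w}" using 0[symmetric] by (rule CollectI)
      fix v w r
      assume w: "w \<in> {w. w = ?P w}"
      show "r *\<^sub>R w \<in> {w. w = ?P w}"
        unfolding mem_Collect_eq scale by (rule arg_cong[OF CollectD[OF w]])
      assume v: "v \<in> {w. w = ?P w}"
      show "v + w \<in> {w. w = ?P w}"
        unfolding mem_Collect_eq add by (rule arg_cong2[OF CollectD[OF v] CollectD[OF w]])
    qed
  next
    case (step c)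
    have "(\<Sum>b\<in>C. ((c \<bullet> b) / (b \<bullet> b)) *\<^sub>R b) = (\<Sum>b\<in>C. if b = c then c else 0)"
    proof (intro sum.cong refl)
      fix b assume "b \<in> C"
      then show "((c \<bullet> b) / (b \<bullet> b)) *\<^sub>R b = (if b = c then c else 0)"
        using C(2) step by (cases "b = c"; cases "c = 0") (auto simp: pairwise_def orthogonal_def)
    qed
    then show ?case using C(1) step by simp
  qed
  then have "w \<bullet> w = w \<bullet> (\<Sum>b\<in>C. ((w \<bullet> b) / (b \<bullet> b)) *\<^sub>R b)" by simp
  then show ?thesis by (simp add: inner_sum_right)
qed

text \<open>Finitely many vectors have a finite orthogonal set with the same span. The scalar
  inequality is applied to each coordinate, and the results are added with weights 1 / (b \<bullet>
  b).\<close>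

lemma rayleigh_vector:
  fixes u :: "'v \<Rightarrow> 'h::real_inner"
  assumes mean: "(\<Sum>y\<in>V. \<tau> y *\<^sub>R u y) = 0"
  shows "graph_lambda1 V adj * (\<Sum>y\<in>V. \<tau> y * (norm (u y))\<^sup>2)
    \<le> (1/2) * (\<Sum>y\<in>V. \<Sum>z\<in>V. a y z * (norm (u y - u z))\<^sup>2)"
proof -
  obtain C where C: "finite C" "span C = span (u ` V)" "pairwise orthogonal C"
    using basis_orthogonal[of "u ` V"] finV by blast
  have uC: "u y \<in> span C" if "y \<in> V" for y using C(2) that by (simp add: span_base)
  have n: "(norm w)\<^sup>2 = (\<Sum>b\<in>C. (w \<bullet> b) * (w \<bullet> b) / (b \<bullet> b))" if "w \<in> span C" for w
    using orthogonal_expansion[OF C(1,3) that] by (simp add: power2_norm_eq_inner)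
  have scal: "graph_lambda1 V adj * ip (\<lambda>y. u y \<bullet> b) (\<lambda>y. u y \<bullet> b) \<le> dir (\<lambda>y. u y \<bullet> b) (\<lambda>y. u y \<bullet> b)" for b
  proof (rule rayleigh)
    have "(\<Sum>y\<in>V. \<tau> y * (u y \<bullet> b)) = (\<Sum>y\<in>V. \<tau> y *\<^sub>R u y) \<bullet> b" by (simp add: inner_sum_left)
    then show "(\<Sum>y\<in>V. \<tau> y * (u y \<bullet> b)) = 0" using mean by simp
  qed
  have "(\<Sum>y\<in>V. \<tau> y * (norm (u y))\<^sup>2) = (\<Sum>y\<in>V. \<Sum>b\<in>C. \<tau> y * (u y \<bullet> b) * (u y \<bullet> b) / (b \<bullet> b))"
    using uC by (intro sum.cong) (simp_all add: n sum_distrib_left mult.assoc)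
  also have "\<dots> = (\<Sum>b\<in>C. ip (\<lambda>y. u y \<bullet> b) (\<lambda>y. u y \<bullet> b) / (b \<bullet> b))"
    unfolding ip_def sum_divide_distrib by (rule sum.swap)
  finally have 1: "(\<Sum>y\<in>V. \<tau> y * (norm (u y))\<^sup>2) = (\<Sum>b\<in>C. ip (\<lambda>y. u y \<bullet> b) (\<lambda>y. u y \<bullet> b) / (b \<bullet> b))" .
  have "(\<Sum>y\<in>V. \<Sum>z\<in>V. a y z * (norm (u y - u z))\<^sup>2) =
      (\<Sum>y\<in>V. \<Sum>z\<in>V. \<Sum>b\<in>C. a y z * ((u y \<bullet> b - u z \<bullet> b) * (u y \<bullet> b - u z \<bullet> b)) / (b \<bullet> b))"
    using uC by (intro sum.cong) (simp_all add: n span_diff sum_distrib_left inner_diff_left)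
  also have "\<dots> = (\<Sum>y\<in>V. \<Sum>b\<in>C. \<Sum>z\<in>V. a y z * ((u y \<bullet> b - u z \<bullet> b) * (u y \<bullet> b - u z \<bullet> b)) / (b \<bullet> b))"
    by (intro sum.cong refl sum.swap)
  also have "\<dots> = (\<Sum>b\<in>C. \<Sum>y\<in>V. \<Sum>z\<in>V. a y z * ((u y \<bullet> b - u z \<bullet> b) * (u y \<bullet> b - u z \<bullet> b)) / (b \<bullet> b))"
    by (rule sum.swap)
  finally have 2: "(1/2) * (\<Sum>y\<in>V. \<Sum>z\<in>V. a y z * (norm (u y - u z))\<^sup>2) =
      (\<Sum>b\<in>C. dir (\<lambda>y. u y \<bullet> b) (\<lambda>y. u y \<bullet> b) / (b \<bullet> b))"
    by (simp add: dir_def sum_divide_distrib sum_distrib_left)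
  have "graph_lambda1 V adj * (\<Sum>b\<in>C. ip (\<lambda>y. u y \<bullet> b) (\<lambda>y. u y \<bullet> b) / (b \<bullet> b)) =
    (\<Sum>b\<in>C. graph_lambda1 V adj * ip (\<lambda>y. u y \<bullet> b) (\<lambda>y. u y \<bullet> b) / (b \<bullet> b))"
    by (simp add: sum_distrib_left)
  also have "\<dots> \<le> (\<Sum>b\<in>C. dir (\<lambda>y. u y \<bullet> b) (\<lambda>y. u y \<bullet> b) / (b \<bullet> b))"
    using scal by (intro sum_mono divide_right_mono) auto
  finally show ?thesis unfolding 1 2 .
qed

end

lemma link_bij:
  assumes p: "bij_betw p I {y. (x, y) \<in> edge_set \<Sigma>}"
  shows "bij_betw (\<lambda>i. {x, p i}) I (link_vertices \<Sigma> x)"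
proof -
  have "bij_betw (\<lambda>y. {x, y}) {y. (x, y) \<in> edge_set \<Sigma>} (link_vertices \<Sigma> x)"
  proof (rule bij_betw_imageI)
    show "inj_on (\<lambda>y. {x, y}) {y. (x, y) \<in> edge_set \<Sigma>}" by (auto simp: inj_on_def doubleton_eq_iff)
    show "(\<lambda>y. {x, y}) ` {y. (x, y) \<in> edge_set \<Sigma>} = link_vertices \<Sigma> x"
    proof (intro equalityI subsetI)
      fix e assume "e \<in> link_vertices \<Sigma> x"
      then have e: "e \<in> \<Sigma>" "card e = 2" "x \<in> e" by (auto simp: link_vertices_def)
      then obtain y where "e = {x, y}" "x \<noteq> y" by (auto simp: card_2_iff)
      then show "e \<in> (\<lambda>y. {x, y}) ` {y. (x, y) \<in> edge_set \<Sigma>}" using e by (auto simp: edge_set_def)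
    qed (auto simp: edge_set_def link_vertices_def)
  qed
  then show ?thesis using bij_betw_trans[OF p] by (simp add: o_def)
qed

lemma link_adj_iff:
  assumes "(x, y) \<in> edge_set \<Sigma>" "(x, z) \<in> edge_set \<Sigma>"
  shows "link_adj \<Sigma> x {x, y} {x, z} \<longleftrightarrow> (x, y, z) \<in> triangle_set \<Sigma>"
  using assms by (auto simp: link_adj_def link_vertices_def edge_set_def triangle_set_def doubleton_eq_iff insert_commute)

text \<open>Stated over an index set because the neighbours of a vertex will be the values of
  finitely many measurable maps. The centre m is the valency-weighted mean of c, which makes c - m
  orthogonal to the constants.\<close>

lemma link_spectral_gap:
  fixes c :: "'i \<Rightarrow> 'h::real_inner"
  assumes I: "finite I" and p: "bij_betw p I {y. (x, y) \<in> edge_set \<Sigma>}"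
    and link: "link_connected \<Sigma> x" "\<exists>e f. link_adj \<Sigma> x e f" "link_lambda1 \<Sigma> x \<ge> l"
    and A: "\<And>i j. i \<in> I \<Longrightarrow> j \<in> I \<Longrightarrow> A i j = (of_bool ((x, p i, p j) \<in> triangle_set \<Sigma>) :: real)"
    and t: "\<And>i. i \<in> I \<Longrightarrow> t i = (\<Sum>j\<in>I. A i j)"
  shows "I \<noteq> {}" "\<And>i. i \<in> I \<Longrightarrow> t i \<ge> 1"
    "\<exists>m. l * (\<Sum>i\<in>I. t i * (norm (c i - m))\<^sup>2) \<le> (1/2) * (\<Sum>i\<in>I. \<Sum>j\<in>I. A i j * (norm (c i - c j))\<^sup>2)"
proof -
  let ?V = "link_vertices \<Sigma> x"
  define q where "q i = {x, p i}" for i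
  have q: "bij_betw q I ?V" unfolding q_def by (rule link_bij[OF p])
  have pE: "(x, p i) \<in> edge_set \<Sigma>" if "i \<in> I" for i using p that by (auto simp: bij_betw_def)
  interpret finite_graph ?V "link_adj \<Sigma> x"
  proof
    show "finite ?V" using q I bij_betw_finite by blast
    show "link_adj \<Sigma> x z y" if "link_adj \<Sigma> x y z" for y z using that by (auto simp: link_adj_def Un_commute)
    show "graph_connected ?V (link_adj \<Sigma> x)" using link(1) by (simp add: link_connected_def)
    show "\<exists>u\<in>?V. \<exists>v\<in>?V. u \<noteq> v \<and> link_adj \<Sigma> x u v" using link(2) by (auto simp: link_adj_def)
  qed
  have re: "(\<Sum>e\<in>?V. F e) = (\<Sum>i\<in>I. F (q i))" for F :: "'a set \<Rightarrow> 'z::comm_monoid_add"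
    using sum.reindex_bij_betw[OF q, of F] by simp
  have aA: "a (q i) (q j) = A i j" if "i \<in> I" "j \<in> I" for i j
    using link_adj_iff[OF pE pE] that by (simp add: a_def A q_def)
  have tt: "\<tau> (q i) = t i" if "i \<in> I" for i
    unfolding \<tau>_def re t[OF that] using aA that by (intro sum.cong) auto
  show "I \<noteq> {}" using has_edge q by (auto simp: bij_betw_def)
  show t1: "t i \<ge> 1" if "i \<in> I" for i
    using \<tau>_ge1[of "q i"] q that tt by (auto simp: bij_betw_def)
  define r where "r = inv_into I q"
  have r: "r (q i) = i" if "i \<in> I" for i using q that by (simp add: r_def bij_betw_def)
  define W where "W = (\<Sum>i\<in>I. t i)"
  have W: "W > 0" unfolding W_def using \<open>I \<noteq> {}\<close> I t1 by (intro sum_pos) (auto intro: less_le_trans[OF zero_less_one])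
  define m where "m = (1 / W) *\<^sub>R (\<Sum>i\<in>I. t i *\<^sub>R c i)"
  define u where "u e = c (r e) - m" for e
  have "(\<Sum>e\<in>?V. \<tau> e *\<^sub>R u e) = (\<Sum>i\<in>I. t i *\<^sub>R (c i - m))"
    unfolding re using tt r by (intro sum.cong) (auto simp: u_def)
  also have "\<dots> = (\<Sum>i\<in>I. t i *\<^sub>R c i) - W *\<^sub>R m"
    by (simp add: scaleR_diff_right sum_subtractf W_def scaleR_left.sum)
  also have "\<dots> = 0" using W by (simp add: m_def)
  finally have mean: "(\<Sum>e\<in>?V. \<tau> e *\<^sub>R u e) = 0" .
  have e1: "(\<Sum>e\<in>?V. \<tau> e * (norm (u e))\<^sup>2) = (\<Sum>i\<in>I. t i * (norm (c i - m))\<^sup>2)"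
    unfolding re using tt r by (intro sum.cong) (auto simp: u_def)
  have e2: "(\<Sum>e\<in>?V. \<Sum>f\<in>?V. a e f * (norm (u e - u f))\<^sup>2) = (\<Sum>i\<in>I. \<Sum>j\<in>I. A i j * (norm (c i - c j))\<^sup>2)"
    unfolding re using aA r by (intro sum.cong) (auto simp: u_def)
  have "l * (\<Sum>i\<in>I. t i * (norm (c i - m))\<^sup>2) \<le> graph_lambda1 ?V (link_adj \<Sigma> x) * (\<Sum>i\<in>I. t i * (norm (c i - m))\<^sup>2)"
    using link(3) t1 by (intro mult_right_mono sum_nonneg)
      (auto simp: link_lambda1_def intro!: mult_nonneg_nonneg intro: order_trans[OF zero_le_one])
  also have "\<dots> \<le> (1/2) * (\<Sum>i\<in>I. \<Sum>j\<in>I. A i j * (norm (c i - c j))\<^sup>2)"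
    using rayleigh_vector[OF mean] unfolding e1 e2 .
  finally show "\<exists>m. l * (\<Sum>i\<in>I. t i * (norm (c i - m))\<^sup>2) \<le> (1/2) * (\<Sum>i\<in>I. \<Sum>j\<in>I. A i j * (norm (c i - c j))\<^sup>2)"
    by (rule exI)
qed

section \<open>Measurable sections of a representation\<close>

lemma norm_eq_cinner: "(norm x)\<^sup>2 = Re (cinner x x)" for x :: "'h::chilbert_space"
  by (simp add: Re_cinner power2_norm_eq_inner)

text \<open>Reduces the imaginary part to the real inner product, so that limits and measurability
  of \<open>cinner\<close> follow from the real case.\<close>

lemma Im_cinner: "Im (cinner x y) = - inner (scaleC (- \<i>) y) x" for x y :: "'h::chilbert_space"
proof -
  have "Im (cinner x y) = - Im (cinner y x)" using cinner_commute[of x y] by simp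
  moreover have "inner (scaleC (- \<i>) y) x = Im (cinner y x)"
    using Re_cinner[of "scaleC (- \<i>) y" x] by (simp add: cinner_scaleC_left)
  ultimately show ?thesis by simp
qed

lemma norm_scaleC: "norm (scaleC a x) = cmod a * norm x" for x :: "'h::chilbert_space"
proof -
  have "cinner x (scaleC a x) = cnj a * cinner x x"
    using cinner_commute[of x "scaleC a x"] cinner_commute[of x x] by (simp add: cinner_scaleC_left)
  then have "cinner (scaleC a x) (scaleC a x) = (a * cnj a) * cinner x x"
    by (simp add: cinner_scaleC_left)
  then have "(norm (scaleC a x))\<^sup>2 = (cmod a * norm x)\<^sup>2"
    unfolding norm_eq_cinner[of x] norm_eq_cinner[of "scaleC a x"] power_mult_distrib
    by (simp add: complex_norm_square[symmetric] flip: of_real_power)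
  then show ?thesis by (simp add: power2_eq_iff_nonneg)
qed

lemma scaleC_zero_right: "scaleC a (0 :: 'h::chilbert_space) = 0"
  using norm_scaleC[of a "0 :: 'h"] by simp

lemma scaleC_zero_left: "scaleC 0 x = 0" for x :: "'h::chilbert_space"
  using norm_scaleC[of 0 x] by simp

lemma scaleC_minus: "scaleC a (x - y) = scaleC a x - scaleC a y" for x y :: "'h::chilbert_space"
  using scaleC_add_right[of a "x - y" y] by (simp add: algebra_simps)

lemma scaleC_minus_left: "scaleC (a - b) x = scaleC a x - scaleC b x" for x :: "'h::chilbert_space"
  using scaleC_add_left[of "a - b" b x] by (simp add: algebra_simps)

lemma tendsto_scaleC:
  fixes u :: "nat \<Rightarrow> 'h::chilbert_space"
  assumes "a \<longlonglongrightarrow> b" "u \<longlonglongrightarrow> w"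
  shows "(\<lambda>n. scaleC (a n) (u n)) \<longlonglongrightarrow> scaleC b w"
proof -
  have "(\<lambda>n. scaleC (a n) (u n) - scaleC b w) \<longlonglongrightarrow> 0"
  proof (rule Lim_null_comparison)
    have "scaleC (a n) (u n) - scaleC b w = scaleC (a n) (u n - w) + scaleC (a n - b) w" for n
      by (simp add: scaleC_minus scaleC_minus_left)
    then show "\<forall>\<^sub>F n in sequentially. norm (scaleC (a n) (u n) - scaleC b w)
        \<le> cmod (a n) * norm (u n - w) + cmod (a n - b) * norm w"
      by (intro always_eventually allI) (metis norm_scaleC norm_triangle_ineq)
    have "(\<lambda>n. cmod (a n) * norm (u n - w) + cmod (a n - b) * norm w) \<longlonglongrightarrow>
        cmod b * norm (w - w) + cmod (b - b) * norm w"
      by (intro tendsto_intros assms)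
    then show "(\<lambda>n. cmod (a n) * norm (u n - w) + cmod (a n - b) * norm w) \<longlonglongrightarrow> 0" by simp
  qed
  then show ?thesis by (simp add: LIM_zero_iff)
qed

lemma tendsto_cinner:
  fixes u w :: "nat \<Rightarrow> 'h::chilbert_space"
  assumes "u \<longlonglongrightarrow> u'" "w \<longlonglongrightarrow> w'"
  shows "(\<lambda>n. cinner (u n) (w n)) \<longlonglongrightarrow> cinner u' w'"
  unfolding tendsto_complex_iff Re_cinner Im_cinner
  by (intro conjI tendsto_intros assms tendsto_scaleC)

lemma closed_csubspace_facts:
  assumes W: "closed_csubspace (W :: 'h::chilbert_space set)"
  shows "0 \<in> W" "\<And>u v. u \<in> W \<Longrightarrow> v \<in> W \<Longrightarrow> u + v \<in> W" "\<And>a u. u \<in> W \<Longrightarrow> scaleC a u \<in> W"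
    "\<And>r u. u \<in> W \<Longrightarrow> r *\<^sub>R u \<in> W" "\<And>u v. u \<in> W \<Longrightarrow> v \<in> W \<Longrightarrow> u - v \<in> W"
    "\<And>u l. (\<And>n. u n \<in> W) \<Longrightarrow> u \<longlonglongrightarrow> l \<Longrightarrow> l \<in> W"
proof -
  show 0: "0 \<in> W" and add: "\<And>u v. u \<in> W \<Longrightarrow> v \<in> W \<Longrightarrow> u + v \<in> W"
    and s: "\<And>a u. u \<in> W \<Longrightarrow> scaleC a u \<in> W" using W by (auto simp: closed_csubspace_def)
  show sr: "\<And>r u. u \<in> W \<Longrightarrow> r *\<^sub>R u \<in> W" using s scaleC_of_real by metis
  show "u - v \<in> W" if "u \<in> W" "v \<in> W" for u v
    using add[OF that(1) sr[OF that(2), of "-1"]] by simp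
  show "\<And>u l. (\<And>n. u n \<in> W) \<Longrightarrow> u \<longlonglongrightarrow> l \<Longrightarrow> l \<in> W"
    using W closed_sequentially unfolding closed_csubspace_def by blast
qed

lemma unitary_real:
  assumes U: "unitary_between V W U" and V: "closed_csubspace V"
  shows "\<And>u. u \<in> V \<Longrightarrow> U u \<in> W" "\<And>u v. u \<in> V \<Longrightarrow> v \<in> V \<Longrightarrow> U (u + v) = U u + U v"
    "\<And>r u. u \<in> V \<Longrightarrow> U (r *\<^sub>R u) = r *\<^sub>R U u" "\<And>u v. u \<in> V \<Longrightarrow> v \<in> V \<Longrightarrow> U (u - v) = U u - U v"
    "\<And>u v. u \<in> V \<Longrightarrow> v \<in> V \<Longrightarrow> inner (U u) (U v) = inner u v" "\<And>u. u \<in> V \<Longrightarrow> norm (U u) = norm u"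
proof -
  show "\<And>u. u \<in> V \<Longrightarrow> U u \<in> W" using U by (auto simp: unitary_between_def bij_betw_def)
  show add: "\<And>u v. u \<in> V \<Longrightarrow> v \<in> V \<Longrightarrow> U (u + v) = U u + U v" using U by (auto simp: unitary_between_def)
  have "\<And>a u. u \<in> V \<Longrightarrow> U (scaleC a u) = scaleC a (U u)" using U by (auto simp: unitary_between_def)
  then show s: "\<And>r u. u \<in> V \<Longrightarrow> U (r *\<^sub>R u) = r *\<^sub>R U u" by (metis scaleC_of_real)
  show "U (u - v) = U u - U v" if "u \<in> V" "v \<in> V" for u v
    using add[of u "(-1) *\<^sub>R v"] s[of v "-1"] that closed_csubspace_facts(4)[OF V, of v "-1"] by simp
  show i: "inner (U u) (U v) = inner u v" if "u \<in> V" "v \<in> V" for u v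
  proof -
    have "cinner (U u) (U v) = cinner u v" using U that by (auto simp: unitary_between_def)
    then show ?thesis by (metis Re_cinner)
  qed
  show "norm (U u) = norm u" if "u \<in> V" for u using i[OF that that] by (simp add: norm_eq_sqrt_inner)
qed

section \<open>Sections of a representation along a map\<close>

locale rep =
  fixes N :: "'b measure" and S :: "'b rel" and H :: "'b \<Rightarrow> 'h::chilbert_space set"
    and Sec :: "('b \<Rightarrow> 'h) set" and \<pi> :: "'b \<Rightarrow> 'b \<Rightarrow> 'h \<Rightarrow> 'h"
  assumes rep: "representation N S H Sec \<pi>"
    and S_sets: "S \<in> sets (N \<Otimes>\<^sub>M N)" and S_equiv: "equiv (space N) S"
begin

lemma field: "measurable_field N H Sec"
  using rep by (simp add: representation_def)

lemma H: "x \<in> space N \<Longrightarrow> closed_csubspace (H x)"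
  using field by (simp add: measurable_field_def)

lemma Sec_in: "s \<in> Sec \<Longrightarrow> x \<in> space N \<Longrightarrow> s x \<in> H x"
  using field by (auto simp: measurable_field_def)

lemma Sec_add: "s \<in> Sec \<Longrightarrow> t \<in> Sec \<Longrightarrow> (\<lambda>x. s x + t x) \<in> Sec"
  using field by (simp add: measurable_field_def)

lemma Sec_scaleC: "s \<in> Sec \<Longrightarrow> (\<lambda>x. scaleC a (s x)) \<in> Sec"
  using field by (simp add: measurable_field_def)

lemma Sec_norm: "s \<in> Sec \<Longrightarrow> (\<lambda>x. norm (s x)) \<in> borel_measurable N"
  using field by (simp add: measurable_field_def)

lemma \<pi>: "(x, y) \<in> S \<Longrightarrow> unitary_between (H y) (H x) (\<pi> x y)"
  using rep by (auto simp: representation_def)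

lemma S_space: "(x, y) \<in> S \<Longrightarrow> x \<in> space N" "(x, y) \<in> S \<Longrightarrow> y \<in> space N"
  using sets.sets_into_space[OF S_sets] by (auto simp: space_pair_measure)

lemmas \<pi>_facts = unitary_real[OF \<pi> H[OF S_space(2)]]

lemma \<pi>_id: "x \<in> space N \<Longrightarrow> u \<in> H x \<Longrightarrow> \<pi> x x u = u"
  using rep by (simp add: representation_def)

lemma \<pi>_comp: "(x, y) \<in> S \<Longrightarrow> (y, z) \<in> S \<Longrightarrow> u \<in> H z \<Longrightarrow> \<pi> x z u = \<pi> x y (\<pi> y z u)"
  using rep by (simp add: representation_def)

lemma \<pi>_measurable: "\<xi> \<in> Sec \<Longrightarrow> \<eta> \<in> Sec \<Longrightarrow>
    (\<lambda>(x, y). cinner (\<pi> x y (\<xi> y)) (\<eta> x)) \<in> borel_measurable (restrict_space (N \<Otimes>\<^sub>M N) S)"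
  using rep by (simp add: representation_def)

text \<open>A measurable field supplies measurable norms; polarization gives the real inner product,
  and multiplication by -i the imaginary part.\<close>

lemma Sec_cinner:
  assumes s: "s \<in> Sec" "t \<in> Sec"
  shows "(\<lambda>x. cinner (s x) (t x)) \<in> borel_measurable N"
proof -
  have in': "(\<lambda>x. inner (s x) (t x)) \<in> borel_measurable N" if "s \<in> Sec" "t \<in> Sec" for s t
  proof -
    note [measurable] = Sec_norm[OF that(1)] Sec_norm[OF that(2)] Sec_norm[OF Sec_add[OF that]]
    have eq: "inner (s x) (t x) = ((norm (s x + t x))\<^sup>2 - (norm (s x))\<^sup>2 - (norm (t x))\<^sup>2) / 2" for x
      by (simp add: power2_norm_eq_inner inner_add_left inner_add_right inner_commute)
    show ?thesis unfolding eq by measurable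
  qed
  have [measurable]: "(\<lambda>x. inner (s x) (t x)) \<in> borel_measurable N"
    "(\<lambda>x. inner (scaleC (- \<i>) (t x)) (s x)) \<in> borel_measurable N"
    using in' s Sec_scaleC by auto
  show ?thesis unfolding borel_measurable_complex_iff Re_cinner Im_cinner by simp
qed

text \<open>Finite combinations of the total sequence with coefficients in the Gaussian rationals,
  coded by lists so that there are countably many. Their closure is a closed complex subspace, hence
  contains the hull of the sequence, which is the fibre.\<close>

lemma dense_sections:
  obtains v :: "nat \<Rightarrow> 'b \<Rightarrow> 'h" where "\<And>n. v n \<in> Sec"
    "\<And>x. x \<in> space N \<Longrightarrow> H x \<subseteq> closure (range (\<lambda>n. v n x))"
proof -
  obtain e :: "nat \<Rightarrow> 'b \<Rightarrow> 'h" where e: "\<And>n. e n \<in> Sec"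
    "\<And>x. x \<in> space N \<Longrightarrow> closed_csubspace hull (range (\<lambda>n. e n x)) = H x"
    using field unfolding measurable_field_def by blast
  define comb where "comb l x = foldr (\<lambda>(p, q, n) w. scaleC (Complex (of_rat p) (of_rat q)) (e n x) + w) l 0"
    for l :: "(rat \<times> rat \<times> nat) list" and x
  have combS: "comb l \<in> Sec" for l
  proof (induction l)
    case Nil
    have "(\<lambda>x. scaleC 0 (e 0 x)) \<in> Sec" using Sec_scaleC e(1) by blast
    then show ?case by (simp add: comb_def[abs_def] scaleC_zero_left)
  next
    case (Cons a l)
    obtain p q n where a: "a = (p, q, n)" by (cases a) auto
    have "(\<lambda>x. scaleC (Complex (of_rat p) (of_rat q)) (e n x) + comb l x) \<in> Sec"
      by (intro Sec_add Sec_scaleC e Cons)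
    then show ?case by (simp add: comb_def[abs_def] a)
  qed
  have dense: "H x \<subseteq> closure (range (\<lambda>l. comb l x))" if x: "x \<in> space N" for x
  proof -
    let ?D = "range (\<lambda>l. comb l x)"
    have app: "comb (l @ l') x = comb l x + comb l' x" for l l'
      by (induction l) (auto simp: comb_def add.assoc)
    have scal: "scaleC (Complex (of_rat p) (of_rat q)) w \<in> ?D" if "w \<in> ?D" for p q w
    proof -
      have "\<exists>l'. scaleC (Complex (of_rat p) (of_rat q)) (comb l x) = comb l' x" for l
      proof (induction l)
        case Nil
        show ?case by (intro exI[of _ "[]"]) (simp add: comb_def scaleC_zero_right)
      next
        case (Cons a l)
        obtain p' q' n where a: "a = (p', q', n)" by (cases a) auto
        obtain l' where l': "scaleC (Complex (of_rat p) (of_rat q)) (comb l x) = comb l' x" using Cons by blast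
        have "Complex (of_rat p) (of_rat q) * Complex (of_rat p') (of_rat q') =
          Complex (of_rat (p * p' - q * q')) (of_rat (p * q' + q * p'))"
          by (simp add: complex_eq_iff of_rat_mult of_rat_add of_rat_diff)
        then have "scaleC (Complex (of_rat p) (of_rat q)) (comb (a # l) x) = comb ((p * p' - q * q', p * q' + q * p', n) # l') x"
          using l' by (simp add: comb_def a scaleC_add_right scaleC_scaleC)
        then show ?case by blast
      qed
      then show ?thesis using that by auto
    qed
    have "closed_csubspace (closure ?D)"
      unfolding closed_csubspace_def
    proof (intro conjI ballI allI)
      show "closed (closure ?D)" by simp
      have "comb [] x \<in> ?D" by blast
      then show "0 \<in> closure ?D" using closure_subset by (fastforce simp: comb_def)
      fix u assume "u \<in> closure ?D"
      then obtain f where f: "\<And>n. f n \<in> ?D" "f \<longlonglongrightarrow> u" unfolding closure_sequential by blast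
      {
        fix w assume "w \<in> closure ?D"
        then obtain g where g: "\<And>n. g n \<in> ?D" "g \<longlonglongrightarrow> w" unfolding closure_sequential by blast
        have "f n + g n \<in> ?D" for n
        proof -
          obtain l l' where "f n = comb l x" "g n = comb l' x" using f(1)[of n] g(1)[of n] by (elim imageE)
          then have "f n + g n = comb (l @ l') x" using app by simp
          then show ?thesis by (rule range_eqI)
        qed
        moreover have "(\<lambda>n. f n + g n) \<longlonglongrightarrow> u + w" using f g by (intro tendsto_add)
        ultimately show "u + w \<in> closure ?D" unfolding closure_sequential by (intro exI[of _ "\<lambda>n. f n + g n"] conjI allI)
      }
      fix a :: complex
      have rat: "\<exists>q. \<forall>n :: nat. \<bar>of_rat (q n) - r\<bar> < 1 / Suc n" for r :: real
      proof -
        have "\<exists>q. \<bar>of_rat q - r\<bar> < 1 / Suc n" for n :: nat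
        proof -
          obtain q where "r < of_rat q" "of_rat q < r + 1 / Suc n" using of_rat_dense[of r "r + 1 / Suc n"] by auto
          then show ?thesis by (intro exI[of _ q]) auto
        qed
        then have "\<forall>n :: nat. \<exists>q. \<bar>of_rat q - r\<bar> < 1 / Suc n" by (intro allI)
        from choice[OF this] show ?thesis .
      qed
      have lim: "(\<lambda>n. of_rat (q n) :: real) \<longlonglongrightarrow> r" if "\<forall>n :: nat. \<bar>of_rat (q n) - r\<bar> < 1 / Suc n" for q r
      proof -
        have "(\<lambda>n. of_rat (q n) - r) \<longlonglongrightarrow> 0"
        proof (rule Lim_null_comparison)
          show "\<forall>\<^sub>F n in sequentially. norm (of_rat (q n) - r) \<le> 1 / real (Suc n)"
            using that by (intro always_eventually allI) (simp add: less_imp_le)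
          show "(\<lambda>n. 1 / real (Suc n)) \<longlonglongrightarrow> 0" by (rule LIMSEQ_Suc[OF lim_1_over_n])
        qed
        then show ?thesis by (simp add: LIM_zero_iff)
      qed
      from rat[of "Re a"] obtain p where p: "\<forall>n :: nat. \<bar>of_rat (p n) - Re a\<bar> < 1 / Suc n" by (elim exE)
      from rat[of "Im a"] obtain q where q: "\<forall>n :: nat. \<bar>of_rat (q n) - Im a\<bar> < 1 / Suc n" by (elim exE)
      have "(\<lambda>n. Complex (of_rat (p n)) (of_rat (q n))) \<longlonglongrightarrow> a"
        unfolding tendsto_complex_iff using lim[OF p] lim[OF q] by simp
      then have "(\<lambda>n. scaleC (Complex (of_rat (p n)) (of_rat (q n))) (f n)) \<longlonglongrightarrow> scaleC a u"
        using f(2) by (rule tendsto_scaleC)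
      then show "scaleC a u \<in> closure ?D" unfolding closure_sequential
        by (intro exI[of _ "\<lambda>n. scaleC (Complex (of_rat (p n)) (of_rat (q n))) (f n)"] conjI allI scal f(1))
    qed
    moreover have "range (\<lambda>n. e n x) \<subseteq> closure ?D"
    proof (rule subsetI)
      fix u assume "u \<in> range (\<lambda>n. e n x)"
      then obtain n where u: "u = e n x" by blast
      have "Complex 1 0 = complex_of_real 1" by (simp add: complex_eq_iff)
      then have "comb [(1, 0, n)] x = u" using u scaleC_of_real[of 1 u] by (simp add: comb_def)
      then have "u \<in> ?D" by (metis rangeI)
      then show "u \<in> closure ?D" using closure_subset by (rule subsetD[rotated])
    qed
    ultimately have "closed_csubspace hull (range (\<lambda>n. e n x)) \<subseteq> closure ?D" by (rule hull_minimal[rotated])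
    then show ?thesis using e(2)[OF x] by simp
  qed
  have r: "range (\<lambda>n. comb (from_nat n) x) = range (\<lambda>l. comb l x)" for x
    using image_image[of "\<lambda>l. comb l x" from_nat UNIV] surj_from_nat[where 'a = "(rat \<times> rat \<times> nat) list"] by simp
  show ?thesis
  proof (rule that[of "\<lambda>n. comb (from_nat n)"])
    show "comb (from_nat n) \<in> Sec" for n by (rule combS)
    show "H x \<subseteq> closure (range (\<lambda>n. comb (from_nat n) x))" if "x \<in> space N" for x
      using dense[OF that] r by simp
  qed
qed

text \<open>A measurable section of the pullback of the field along \<open>\<beta>\<close>.\<close>

definition along :: "'p measure \<Rightarrow> ('p \<Rightarrow> 'b) \<Rightarrow> ('p \<Rightarrow> 'h) \<Rightarrow> bool" where
  "along P \<beta> u \<longleftrightarrow> \<beta> \<in> measurable P N \<and> (\<forall>p\<in>space P. u p \<in> H (\<beta> p)) \<and>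
     (\<forall>s\<in>Sec. (\<lambda>p. cinner (u p) (s (\<beta> p))) \<in> borel_measurable P)"

lemma along_in: "along P \<beta> u \<Longrightarrow> p \<in> space P \<Longrightarrow> u p \<in> H (\<beta> p)"
  by (simp add: along_def)

lemma along_space: "along P \<beta> u \<Longrightarrow> p \<in> space P \<Longrightarrow> closed_csubspace (H (\<beta> p))"
  by (auto simp: along_def dest: measurable_space intro: H)

lemma along_Sec: "s \<in> Sec \<Longrightarrow> \<beta> \<in> measurable P N \<Longrightarrow> along P \<beta> (\<lambda>p. s (\<beta> p))"
  unfolding along_def using Sec_in Sec_cinner
  by (auto dest: measurable_space intro: measurable_compose)

text \<open>From right to left this is the maximality clause of \<open>measurable_field\<close>: a
  section whose products with all of \<open>Sec\<close> are measurable belongs to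
  \<open>Sec\<close>.\<close>

lemma Sec_iff_along: "s \<in> Sec \<longleftrightarrow> s \<in> Pi (space N) H \<and> along N (\<lambda>x. x) s"
proof
  assume s: "s \<in> Sec"
  then show "s \<in> Pi (space N) H \<and> along N (\<lambda>x. x) s" using Sec_in along_Sec[OF s, of "\<lambda>x. x" N] by auto
next
  assume "s \<in> Pi (space N) H \<and> along N (\<lambda>x. x) s"
  then show "s \<in> Sec" using field unfolding measurable_field_def along_def by blast
qed

lemma along_compose:
  assumes "along P \<beta> u" "\<gamma> \<in> measurable Q P"
  shows "along Q (\<lambda>q. \<beta> (\<gamma> q)) (\<lambda>q. u (\<gamma> q))"
  using assms unfolding along_def by (auto dest: measurable_space intro: measurable_compose)

lemma along_add:
  assumes u: "along P \<beta> u" and w: "along P \<beta> w"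
  shows "along P \<beta> (\<lambda>p. u p + w p)"
  using assms closed_csubspace_facts(2)[OF along_space[OF u]]
  unfolding along_def by (auto simp: cinner_add_left intro!: borel_measurable_add)

lemma along_scaleC:
  assumes u: "along P \<beta> u" and f: "f \<in> borel_measurable P"
  shows "along P \<beta> (\<lambda>p. scaleC (f p) (u p))"
  using assms closed_csubspace_facts(3)[OF along_space[OF u]]
  unfolding along_def by (auto simp: cinner_scaleC_left)

lemma along_scaleR:
  assumes u: "along P \<beta> u" and f: "f \<in> borel_measurable P"
  shows "along P \<beta> (\<lambda>p. f p *\<^sub>R u p)"
proof -
  have "(\<lambda>p. complex_of_real (f p)) \<in> borel_measurable P" using f by simp
  from along_scaleC[OF u this] show ?thesis by (simp add: scaleC_of_real)
qed

lemma along_diff: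
  assumes u: "along P \<beta> u" and w: "along P \<beta> w"
  shows "along P \<beta> (\<lambda>p. u p - w p)"
  using along_add[OF u along_scaleR[OF w, of "\<lambda>_. -1"]] by simp

lemma along_lim:
  assumes u: "\<And>n :: nat. along P \<beta> (u n)" and l: "\<And>p. p \<in> space P \<Longrightarrow> (\<lambda>n. u n p) \<longlonglongrightarrow> w p"
  shows "along P \<beta> w"
  unfolding along_def
proof (intro conjI ballI)
  show "\<beta> \<in> measurable P N" using u[of 0] by (simp add: along_def)
  show "w p \<in> H (\<beta> p)" if "p \<in> space P" for p
    using closed_csubspace_facts(6)[OF along_space[OF u that] along_in[OF u that] l[OF that]] .
  fix s assume s: "s \<in> Sec"
  show "(\<lambda>p. cinner (w p) (s (\<beta> p))) \<in> borel_measurable P"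
  proof (rule borel_measurable_LIMSEQ_metric)
    show "(\<lambda>p. cinner (u n p) (s (\<beta> p))) \<in> borel_measurable P" for n using u[of n] s by (simp add: along_def)
    show "(\<lambda>n. cinner (u n p) (s (\<beta> p))) \<longlonglongrightarrow> cinner (w p) (s (\<beta> p))" if "p \<in> space P" for p
      using tendsto_cinner[OF l[OF that] tendsto_const] .
  qed
qed

text \<open>Measurability is given for products of u with sections of the field. The squared norm is
  the supremum over a dense sequence v of 2 Re <u, v> - |v|^2, a quantity that falls short of |u|^2
  by exactly |u - v|^2.\<close>

lemma along_norm:
  assumes u: "along P \<beta> u"
  shows "(\<lambda>p. norm (u p)) \<in> borel_measurable P"
proof -
  obtain v :: "nat \<Rightarrow> 'b \<Rightarrow> 'h" where v: "\<And>n. v n \<in> Sec"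
    "\<And>x. x \<in> space N \<Longrightarrow> H x \<subseteq> closure (range (\<lambda>n. v n x))" by (rule dense_sections) (rule that)
  have \<beta>: "\<beta> \<in> measurable P N" using u by (simp add: along_def)
  define F where "F n p = 2 * Re (cinner (u p) (v n (\<beta> p))) - (norm (v n (\<beta> p)))\<^sup>2" for n p
  have Feq: "F n p = (norm (u p))\<^sup>2 - (norm (u p - v n (\<beta> p)))\<^sup>2" for n p
    by (simp add: F_def Re_cinner power2_norm_eq_inner inner_diff_left inner_diff_right inner_commute)
  have F: "F n \<in> borel_measurable P" for n
  proof -
    have [measurable]: "(\<lambda>p. cinner (u p) (v n (\<beta> p))) \<in> borel_measurable P" using u v(1) by (simp add: along_def)
    have [measurable]: "(\<lambda>p. norm (v n (\<beta> p))) \<in> borel_measurable P"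
      using measurable_compose[OF \<beta> Sec_norm[OF v(1)]] .
    show ?thesis unfolding F_def by measurable
  qed
  have bdd: "bdd_above (range (\<lambda>n. F n p))" for p
    by (rule bdd_aboveI[of _ "(norm (u p))\<^sup>2"]) (auto simp: Feq)
  have eq: "(norm (u p))\<^sup>2 = (SUP n. F n p)" if p: "p \<in> space P" for p
  proof (rule antisym)
    show "(SUP n. F n p) \<le> (norm (u p))\<^sup>2" by (rule cSUP_least) (auto simp: Feq)
    show "(norm (u p))\<^sup>2 \<le> (SUP n. F n p)"
    proof (rule field_le_epsilon)
      fix e :: real assume e: "e > 0"
      have "u p \<in> closure (range (\<lambda>n. v n (\<beta> p)))" using v(2)[OF measurable_space[OF \<beta> p]] along_in[OF u p] by blast
      then have "\<exists>y\<in>range (\<lambda>n. v n (\<beta> p)). dist y (u p) < sqrt e" using e unfolding closure_approachable by simp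
      then obtain n where "dist (v n (\<beta> p)) (u p) < sqrt e" by blast
      then have "norm (u p - v n (\<beta> p)) < sqrt e" by (simp add: dist_norm norm_minus_commute)
      then have "(norm (u p - v n (\<beta> p)))\<^sup>2 < (sqrt e)\<^sup>2" by (intro power_strict_mono) auto
      then have "(norm (u p - v n (\<beta> p)))\<^sup>2 \<le> e" using e by simp
      then have "(norm (u p))\<^sup>2 \<le> F n p + e" by (simp add: Feq)
      also have "F n p \<le> (SUP n. F n p)" using bdd by (intro cSUP_upper) auto
      finally show "(norm (u p))\<^sup>2 \<le> (SUP n. F n p) + e" by simp
    qed
  qed
  have "(\<lambda>p. SUP n. F n p) \<in> borel_measurable P"
    using F bdd by (intro borel_measurable_cSUP) auto
  then have "(\<lambda>p. sqrt (SUP n. F n p)) \<in> borel_measurable P" by simp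
  moreover have "sqrt (SUP n. F n p) = norm (u p)" if "p \<in> space P" for p using eq[OF that, symmetric] by simp
  ultimately show ?thesis by (subst (asm) measurable_cong) auto
qed

lemma along_inner:
  assumes u: "along P \<beta> u" and w: "along P \<beta> w"
  shows "(\<lambda>p. inner (u p) (w p)) \<in> borel_measurable P"
proof -
  note [measurable] = along_norm[OF u] along_norm[OF w] along_norm[OF along_add[OF u w]]
  have eq: "inner (u p) (w p) = ((norm (u p + w p))\<^sup>2 - (norm (u p))\<^sup>2 - (norm (w p))\<^sup>2) / 2" for p
    by (simp add: power2_norm_eq_inner inner_add_left inner_add_right inner_commute)
  show ?thesis unfolding eq by measurable
qed

text \<open>The representation is measurable on sections of the field. The first dense section
  within 1 / (k + 1) of u is a measurable choice, and as every \<pi> is isometric, the transports of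
  these choices converge to the transport of u.\<close>

lemma along_transport:
  assumes u: "along P \<beta> u" and \<alpha>: "\<alpha> \<in> measurable P N" and S: "\<And>p. p \<in> space P \<Longrightarrow> (\<alpha> p, \<beta> p) \<in> S"
  shows "along P \<alpha> (\<lambda>p. \<pi> (\<alpha> p) (\<beta> p) (u p))"
  unfolding along_def
proof (intro conjI ballI)
  show "\<alpha> \<in> measurable P N" by fact
  show "\<pi> (\<alpha> p) (\<beta> p) (u p) \<in> H (\<alpha> p)" if "p \<in> space P" for p
    using \<pi>_facts(1)[OF S[OF that] S[OF that]] along_in[OF u that] by blast
  fix s assume s: "s \<in> Sec"
  obtain v :: "nat \<Rightarrow> 'b \<Rightarrow> 'h" where v: "\<And>n. v n \<in> Sec"
    "\<And>x. x \<in> space N \<Longrightarrow> H x \<subseteq> closure (range (\<lambda>n. v n x))" by (rule dense_sections) (rule that)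
  have \<beta>: "\<beta> \<in> measurable P N" using u by (simp add: along_def)
  have vin: "v n (\<beta> p) \<in> H (\<beta> p)" if "p \<in> space P" for n p
    using Sec_in[OF v(1) measurable_space[OF \<beta> that]] .
  define J where "J k p = (LEAST n. norm (u p - v n (\<beta> p)) < 1 / Suc k)" for k p
  have J: "norm (u p - v (J k p) (\<beta> p)) < 1 / Suc k" if p: "p \<in> space P" for k p
  proof -
    have "u p \<in> closure (range (\<lambda>n. v n (\<beta> p)))" using v(2)[OF measurable_space[OF \<beta> p]] along_in[OF u p] by blast
    then have "\<exists>y\<in>range (\<lambda>n. v n (\<beta> p)). dist y (u p) < 1 / Suc k" unfolding closure_approachable by simp
    then have "\<exists>n. norm (u p - v n (\<beta> p)) < 1 / Suc k" by (auto simp: dist_norm norm_minus_commute)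
    then show ?thesis unfolding J_def by (rule LeastI_ex)
  qed
  have [measurable]: "(\<lambda>p. norm (u p - v n (\<beta> p))) \<in> borel_measurable P" for n
    by (rule along_norm[OF along_diff[OF u along_Sec[OF v(1) \<beta>]]])
  have Jm: "J k \<in> measurable P (count_space UNIV)" for k
    unfolding J_def by measurable
  have vm: "(\<lambda>p. cinner (\<pi> (\<alpha> p) (\<beta> p) (v n (\<beta> p))) (s (\<alpha> p))) \<in> borel_measurable P" for n
  proof -
    have "(\<lambda>p. (\<alpha> p, \<beta> p)) \<in> measurable P (restrict_space (N \<Otimes>\<^sub>M N) S)"
      using \<alpha> \<beta> S by (intro measurable_restrict_space2) auto
    from measurable_compose[OF this \<pi>_measurable[OF v(1) s]] show ?thesis by simp
  qed
  show "(\<lambda>p. cinner (\<pi> (\<alpha> p) (\<beta> p) (u p)) (s (\<alpha> p))) \<in> borel_measurable P"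
  proof (rule borel_measurable_LIMSEQ_metric)
    show "(\<lambda>p. cinner (\<pi> (\<alpha> p) (\<beta> p) (v (J k p) (\<beta> p))) (s (\<alpha> p))) \<in> borel_measurable P" for k
      by (rule measurable_compose_countable[OF vm Jm])
    fix p assume p: "p \<in> space P"
    have "(\<lambda>k. \<pi> (\<alpha> p) (\<beta> p) (v (J k p) (\<beta> p)) - \<pi> (\<alpha> p) (\<beta> p) (u p)) \<longlonglongrightarrow> 0"
    proof (rule Lim_null_comparison)
      have "norm (\<pi> (\<alpha> p) (\<beta> p) (v (J k p) (\<beta> p)) - \<pi> (\<alpha> p) (\<beta> p) (u p)) \<le> 1 / real (Suc k)" for k
      proof -
        note S' = S[OF p]
        have d: "v (J k p) (\<beta> p) - u p \<in> H (\<beta> p)"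
          using closed_csubspace_facts(5)[OF along_space[OF u p] vin[OF p] along_in[OF u p]] .
        have "norm (\<pi> (\<alpha> p) (\<beta> p) (v (J k p) (\<beta> p)) - \<pi> (\<alpha> p) (\<beta> p) (u p)) =
          norm (\<pi> (\<alpha> p) (\<beta> p) (v (J k p) (\<beta> p) - u p))"
          using \<pi>_facts(4)[OF S' S' vin[OF p] along_in[OF u p]] by simp
        also have "\<dots> = norm (v (J k p) (\<beta> p) - u p)" using \<pi>_facts(6)[OF S' S' d] .
        also have "\<dots> \<le> 1 / real (Suc k)" using J[OF p, of k] by (simp add: norm_minus_commute)
        finally show ?thesis .
      qed
      then show "\<forall>\<^sub>F k in sequentially. norm (\<pi> (\<alpha> p) (\<beta> p) (v (J k p) (\<beta> p)) - \<pi> (\<alpha> p) (\<beta> p) (u p)) \<le> 1 / real (Suc k)"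
        by (intro always_eventually allI)
      show "(\<lambda>k. 1 / real (Suc k)) \<longlonglongrightarrow> 0" by (rule LIMSEQ_Suc[OF lim_1_over_n])
    qed
    then have "(\<lambda>k. \<pi> (\<alpha> p) (\<beta> p) (v (J k p) (\<beta> p))) \<longlonglongrightarrow> \<pi> (\<alpha> p) (\<beta> p) (u p)" by (simp add: LIM_zero_iff)
    then show "(\<lambda>k. cinner (\<pi> (\<alpha> p) (\<beta> p) (v (J k p) (\<beta> p))) (s (\<alpha> p))) \<longlonglongrightarrow> cinner (\<pi> (\<alpha> p) (\<beta> p) (u p)) (s (\<alpha> p))"
      by (rule tendsto_cinner[OF _ tendsto_const])
  qed
qed

lemma along_restrict:
  assumes "along P \<beta> u"
  shows "along (restrict_space P A) \<beta> u"
  using assms unfolding along_def by (auto simp: space_restrict_space measurable_restrict_space1)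

lemma along_extend:
  assumes \<beta>: "\<beta> \<in> measurable P N" and A: "A \<in> sets P" and u: "along (restrict_space P A) \<beta> u"
  shows "along P \<beta> (\<lambda>p. if p \<in> A then u p else 0)"
  unfolding along_def
proof (intro conjI ballI)
  show "\<beta> \<in> measurable P N" by fact
  show "(if p \<in> A then u p else 0) \<in> H (\<beta> p)" if p: "p \<in> space P" for p
    using along_in[OF u, of p] closed_csubspace_facts(1)[OF H[OF measurable_space[OF \<beta> p]]] p
    by (auto simp: space_restrict_space)
  fix s assume "s \<in> Sec"
  then have "(\<lambda>p. cinner (u p) (s (\<beta> p))) \<in> borel_measurable (restrict_space P A)" using u by (simp add: along_def)
  then have "(\<lambda>p. if p \<in> A then cinner (u p) (s (\<beta> p)) else 0) \<in> borel_measurable P"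
    using A by (subst measurable_If_restrict_space_iff) auto
  moreover have "(if p \<in> A then cinner (u p) (s (\<beta> p)) else 0) = cinner (if p \<in> A then u p else 0) (s (\<beta> p))" for p
    using cinner_scaleC_left[of 0 "u p" "s (\<beta> p)"] by (simp add: scaleC_zero_left)
  ultimately show "(\<lambda>p. cinner (if p \<in> A then u p else 0) (s (\<beta> p))) \<in> borel_measurable P" by simp
qed

end

section \<open>The energy of a section and its gradient\<close>

text \<open>\<open>g\<close> is the Radon--Nikodym cocycle of the flipped edge: integrating a function of the flipped
  edge amounts to integrating it against the weight \<open>g\<close>.\<close>

locale periodic_complex = rep N S H Sec \<pi>
  for N :: "'b measure" and S :: "'b rel" and H :: "'b \<Rightarrow> 'h::chilbert_space set"
    and Sec :: "('b \<Rightarrow> 'h) set" and \<pi> :: "'b \<Rightarrow> 'b \<Rightarrow> 'h \<Rightarrow> 'h" +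
  fixes M :: "'a measure" and \<Phi> :: "'a \<Rightarrow> 'b" and E :: "'a rel" and d :: nat
    and D :: "nat \<Rightarrow> 'a set" and \<phi> :: "nat \<Rightarrow> 'a \<Rightarrow> 'a" and Tri :: "('a \<times> 'a \<times> 'a) set"
    and g :: "'a \<times> 'a \<Rightarrow> real" and \<delta> l :: real
  assumes finM: "finite_measure M" and massM: "measure M (space M) \<le> 1"
    and \<Phi>: "\<Phi> \<in> measurable M N"
    and E_sets: "E \<in> sets (M \<Otimes>\<^sub>M M)" and E_sym: "(x, y) \<in> E \<Longrightarrow> (y, x) \<in> E"
    and E_S: "(x, y) \<in> E \<Longrightarrow> (\<Phi> x, \<Phi> y) \<in> S"
    and D: "D i \<in> sets M" and \<phi>: "\<phi> i \<in> measurable M M"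
    and enum: "x \<in> space M \<Longrightarrow> bij_betw (\<lambda>i. \<phi> i x) {i. i < d \<and> x \<in> D i} {y. (x, y) \<in> E}"
    and Tri_sets: "Tri \<in> sets (M \<Otimes>\<^sub>M (M \<Otimes>\<^sub>M M))"
    and Tri_E: "(x, y, z) \<in> Tri \<Longrightarrow> (x, z) \<in> E"
    and Tri_swap: "(x, y, z) \<in> Tri \<Longrightarrow> (x, z, y) \<in> Tri"
    and Tri_flip: "(x, y, z) \<in> Tri \<Longrightarrow> (y, x, z) \<in> Tri"
    and g_meas: "g \<in> borel_measurable (M \<Otimes>\<^sub>M M)" and g_pos: "0 \<le> g p" and g_le: "g p \<le> \<delta>" and \<delta>1: "1 \<le> \<delta>"
    and flip: "A \<in> sets (M \<Otimes>\<^sub>M M) \<Longrightarrow>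
      (\<Sum>i<d. \<integral>\<^sup>+x. indicator (D i) x * indicator A (\<phi> i x, x) \<partial>M) =
      (\<Sum>i<d. \<integral>\<^sup>+x. indicator (D i) x * (ennreal (g (x, \<phi> i x)) * indicator A (x, \<phi> i x)) \<partial>M)"
    and link_ne: "x \<in> space M \<Longrightarrow> {i. i < d \<and> x \<in> D i} \<noteq> {}"
    and link_valency: "x \<in> space M \<Longrightarrow> i < d \<Longrightarrow> x \<in> D i \<Longrightarrow>
      1 \<le> (\<Sum>j | j < d \<and> x \<in> D j. of_bool ((x, \<phi> i x, \<phi> j x) \<in> Tri) :: real)"
    and link_gap: "x \<in> space M \<Longrightarrow> \<exists>m. l * (\<Sum>i | i < d \<and> x \<in> D i.
        (\<Sum>j | j < d \<and> x \<in> D j. of_bool ((x, \<phi> i x, \<phi> j x) \<in> Tri)) * (norm (c i - m :: 'h))\<^sup>2)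
      \<le> (1/2) * (\<Sum>i | i < d \<and> x \<in> D i. \<Sum>j | j < d \<and> x \<in> D j.
        of_bool ((x, \<phi> i x, \<phi> j x) \<in> Tri) * (norm (c i - c j))\<^sup>2)"
    and gap: "l > \<delta> ^ 3 / 2"
begin

abbreviation "MM \<equiv> M \<Otimes>\<^sub>M M"

abbreviation "Ix x \<equiv> {i. i < d \<and> x \<in> D i}"

lemma E_space: "(x, y) \<in> E \<Longrightarrow> x \<in> space M" "(x, y) \<in> E \<Longrightarrow> y \<in> space M"
  using sets.sets_into_space[OF E_sets] by (auto simp: space_pair_measure)

lemma \<phi>_space: "x \<in> space M \<Longrightarrow> \<phi> i x \<in> space M"
  using measurable_space[OF \<phi>] .

lemma \<phi>_E: "x \<in> space M \<Longrightarrow> i \<in> Ix x \<Longrightarrow> (x, \<phi> i x) \<in> E"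
  using bij_betwE[OF enum] by blast

lemma sum_Ix: "(\<Sum>i<d. indicator (D i) x * f i) = (\<Sum>i\<in>Ix x. f i)" for f :: "nat \<Rightarrow> real"
proof -
  have "(\<Sum>i<d. indicator (D i) x * f i) = (\<Sum>i<d. if x \<in> D i then f i else 0)"
    by (intro sum.cong) auto
  also have "\<dots> = (\<Sum>i\<in>Ix x. f i)"
    using sum.inter_filter[of "{..<d}" f "\<lambda>i. x \<in> D i"] by simp
  finally show ?thesis .
qed

lemma sum_nb: "x \<in> space M \<Longrightarrow> (\<Sum>i\<in>Ix x. f (\<phi> i x)) = (\<Sum>y | (x, y) \<in> E. f y)"
  using sum.reindex_bij_betw[OF enum] by blast

section \<open>Integration over edges\<close>

text \<open>The counting measure on E: \<phi> enumerates each fibre bijectively, so every edge at x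
  comes from exactly one index.\<close>

definition edge_measure :: "('a \<times> 'a) measure" where
  "edge_measure = distr (density (count_space {..<d} \<Otimes>\<^sub>M M) (\<lambda>p. ennreal (indicator (D (fst p)) (snd p))))
     MM (\<lambda>p. (snd p, \<phi> (fst p) (snd p)))"

lemma sets_edge_measure [simp, measurable_cong]: "sets edge_measure = sets MM"
  by (simp add: edge_measure_def)

lemma space_edge_measure [simp]: "space edge_measure = space MM"
  by (simp add: edge_measure_def)

lemma edge_map_measurable: "(\<lambda>p. (snd p, \<phi> (fst p) (snd p))) \<in> measurable (count_space {..<d} \<Otimes>\<^sub>M M) MM"
proof (rule measurable_pair_measure_countable1)
  show "(\<lambda>y. (snd (i, y), \<phi> (fst (i, y)) (snd (i, y)))) \<in> measurable M MM" for i
    using \<phi>[of i] by simp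
qed simp

lemma edge_weight_measurable:
  "(\<lambda>p. indicator (D (fst p)) (snd p) :: real) \<in> borel_measurable (count_space {..<d} \<Otimes>\<^sub>M M)"
  by (rule measurable_pair_measure_countable1) (use D in auto)

lemma edge_measure_nn_integral:
  assumes F: "F \<in> borel_measurable MM"
  shows "integral\<^sup>N edge_measure F = (\<Sum>i<d. \<integral>\<^sup>+x. indicator (D i) x * F (x, \<phi> i x) \<partial>M)"
proof -
  interpret M: finite_measure M by (rule finM)
  let ?C = "count_space {..<d} \<Otimes>\<^sub>M M"
  note [measurable] = edge_map_measurable edge_weight_measurable F
  have "integral\<^sup>N edge_measure F = (\<integral>\<^sup>+p. ennreal (indicator (D (fst p)) (snd p)) * F (snd p, \<phi> (fst p) (snd p)) \<partial>?C)"
    unfolding edge_measure_def by (simp add: nn_integral_distr nn_integral_density)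
  also have "\<dots> = (\<integral>\<^sup>+i. \<integral>\<^sup>+x. ennreal (indicator (D i) x) * F (x, \<phi> i x) \<partial>M \<partial>count_space {..<d})"
    by (subst M.nn_integral_fst[symmetric]) auto
  finally show ?thesis by (simp add: nn_integral_count_space_finite ennreal_indicator)
qed

lemma finite_edge_measure: "finite_measure edge_measure"
proof
  interpret M: finite_measure M by (rule finM)
  have "emeasure edge_measure (space edge_measure) = (\<integral>\<^sup>+p. 1 \<partial>edge_measure)" by simp
  also have "\<dots> = (\<Sum>i<d. \<integral>\<^sup>+x. indicator (D i) x * 1 \<partial>M)" by (subst edge_measure_nn_integral) auto
  also have "\<dots> = (\<Sum>i<d. emeasure M (D i))" using D by simp
  finally show "emeasure edge_measure (space edge_measure) \<noteq> \<infinity>" by (simp add: M.emeasure_eq_measure)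
qed

text \<open>The edge measure is finite, so such functions are integrable; closure under the
  algebraic operations and the flip then settles integrability throughout.\<close>

definition bdd_meas :: "('a \<times> 'a \<Rightarrow> real) \<Rightarrow> bool" where
  "bdd_meas F \<longleftrightarrow> F \<in> borel_measurable MM \<and> (\<exists>B. \<forall>p\<in>space MM. \<bar>F p\<bar> \<le> B)"

lemma bdd_measI: "F \<in> borel_measurable MM \<Longrightarrow> (\<And>p. p \<in> space MM \<Longrightarrow> \<bar>F p\<bar> \<le> B) \<Longrightarrow> bdd_meas F"
  unfolding bdd_meas_def by blast

lemma bdd_meas_measurable: "bdd_meas F \<Longrightarrow> F \<in> borel_measurable MM"
  by (simp add: bdd_meas_def)

lemma bdd_meas_add: "bdd_meas F \<Longrightarrow> bdd_meas G \<Longrightarrow> bdd_meas (\<lambda>p. F p + G p)"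
  unfolding bdd_meas_def by (auto intro!: exI[of _ "_ + _"] abs_triangle_ineq[THEN order_trans] add_mono)

lemma bdd_meas_mult: assumes "bdd_meas F" "bdd_meas G" shows "bdd_meas (\<lambda>p. F p * G p)"
proof -
  obtain B C where B: "\<And>p. p \<in> space MM \<Longrightarrow> \<bar>F p\<bar> \<le> B" and C: "\<And>p. p \<in> space MM \<Longrightarrow> \<bar>G p\<bar> \<le> C"
    using assms unfolding bdd_meas_def by blast
  have "\<bar>F p * G p\<bar> \<le> \<bar>B\<bar> * \<bar>C\<bar>" if "p \<in> space MM" for p
    using B[OF that] C[OF that] by (simp add: abs_mult) (intro mult_mono, auto)
  then show ?thesis using assms bdd_meas_measurable by (intro bdd_measI) auto
qed

lemma bdd_meas_const: "bdd_meas (\<lambda>_. c)"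
  by (rule bdd_measI) auto

lemma bdd_meas_cmult: "bdd_meas F \<Longrightarrow> bdd_meas (\<lambda>p. c * F p)"
  using bdd_meas_mult[OF bdd_meas_const] .

lemma bdd_meas_sum: "(\<And>i. i \<in> I \<Longrightarrow> bdd_meas (F i)) \<Longrightarrow> bdd_meas (\<lambda>p. \<Sum>i\<in>I. F i p)"
  by (induction I rule: infinite_finite_induct) (auto intro: bdd_meas_const bdd_meas_add)

lemma bdd_meas_swap: assumes "bdd_meas F" shows "bdd_meas (\<lambda>p. F (snd p, fst p))"
proof -
  obtain B where B: "\<And>p. p \<in> space MM \<Longrightarrow> \<bar>F p\<bar> \<le> B" using assms unfolding bdd_meas_def by blast
  have "(\<lambda>p. F (snd p, fst p)) \<in> borel_measurable MM"
    using measurable_compose[OF _ bdd_meas_measurable[OF assms], of "\<lambda>p. (snd p, fst p)"] by simp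
  then show ?thesis using B by (intro bdd_measI[of _ B]) (auto simp: space_pair_measure)
qed

lemma bdd_meas_g: "bdd_meas g"
  using g_meas g_pos g_le by (intro bdd_measI) (auto simp: abs_of_nonneg)

lemma bdd_meas_integrable: "bdd_meas F \<Longrightarrow> integrable edge_measure F"
proof -
  assume F: "bdd_meas F"
  then obtain B where B: "\<And>p. p \<in> space MM \<Longrightarrow> \<bar>F p\<bar> \<le> B" unfolding bdd_meas_def by blast
  show ?thesis
    using bdd_meas_measurable[OF F] B
    by (intro finite_measure.integrable_const_bound[OF finite_edge_measure, of F B]) (auto simp: measurable_cong_sets[OF sets_edge_measure refl])
qed

lemma edge_measure_integral:
  assumes F: "bdd_meas F"
  shows "integral\<^sup>L edge_measure F = (\<integral>x. (\<Sum>i\<in>Ix x. F (x, \<phi> i x)) \<partial>M)"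
    "integrable M (\<lambda>x. \<Sum>i\<in>Ix x. F (x, \<phi> i x))"
proof -
  interpret M: finite_measure M by (rule finM)
  interpret C: finite_measure "count_space {..<d}" by (rule finite_measure_count_space) simp
  interpret CM: pair_sigma_finite "count_space {..<d}" M ..
  let ?C = "count_space {..<d} \<Otimes>\<^sub>M M"
  obtain B where B: "\<And>p. p \<in> space MM \<Longrightarrow> \<bar>F p\<bar> \<le> B" using F unfolding bdd_meas_def by blast
  have Fm: "F \<in> borel_measurable MM" using F by (rule bdd_meas_measurable)
  note [measurable] = edge_map_measurable edge_weight_measurable Fm
  have intF: "integrable M (\<lambda>x. indicator (D i) x * F (x, \<phi> i x))" for i
  proof (rule M.integrable_const_bound[of _ B])
    have [measurable]: "(\<lambda>x. (x, \<phi> i x)) \<in> measurable M MM" using \<phi>[of i] by simp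
    show "(\<lambda>x. indicator (D i) x * F (x, \<phi> i x)) \<in> borel_measurable M"
      using D[of i] measurable_compose[OF \<open>(\<lambda>x. (x, \<phi> i x)) \<in> measurable M MM\<close> Fm] by simp
    show "AE x in M. norm (indicator (D i) x * F (x, \<phi> i x)) \<le> B"
    proof (rule AE_I2)
      fix x assume x: "x \<in> space M"
      have "\<bar>F (x, \<phi> i x)\<bar> \<le> B" using B \<phi>_space[OF x] x by (simp add: space_pair_measure)
      then show "norm (indicator (D i) x * F (x, \<phi> i x)) \<le> B" by (auto simp: indicator_def)
    qed
  qed
  have "integral\<^sup>L edge_measure F = (\<integral>p. indicator (D (fst p)) (snd p) *\<^sub>R F (snd p, \<phi> (fst p) (snd p)) \<partial>?C)"
    unfolding edge_measure_def by (subst integral_distr, simp, simp, subst integral_density) auto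
  also have "\<dots> = (\<integral>p. (\<lambda>(i, x). indicator (D i) x * F (x, \<phi> i x)) p \<partial>?C)" by (simp add: case_prod_unfold)
  also have "\<dots> = (\<integral>i. \<integral>x. indicator (D i) x * F (x, \<phi> i x) \<partial>M \<partial>count_space {..<d})"
  proof (rule CM.integral_fst[symmetric, simplified])
    interpret P: finite_measure ?C by (rule finite_measure_pair_measure) (unfold_locales)
    show "integrable ?C (\<lambda>p. (\<lambda>(i, x). indicator (D i) x * F (x, \<phi> i x)) p)"
    proof (rule P.integrable_const_bound[of _ "\<bar>B\<bar>"])
      show "AE p in ?C. norm ((\<lambda>(i, x). indicator (D i) x * F (x, \<phi> i x)) p) \<le> \<bar>B\<bar>"
      proof (rule AE_I2)
        fix p assume "p \<in> space ?C"
        then obtain i x where p: "p = (i, x)" "x \<in> space M" by (auto simp: space_pair_measure)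
        have "\<bar>F (x, \<phi> i x)\<bar> \<le> B" using B \<phi>_space[OF p(2)] p by (simp add: space_pair_measure)
        then show "norm ((\<lambda>(i, x). indicator (D i) x * F (x, \<phi> i x)) p) \<le> \<bar>B\<bar>" by (auto simp: indicator_def p)
      qed
      show "(\<lambda>p. (\<lambda>(i, x). indicator (D i) x * F (x, \<phi> i x)) p) \<in> borel_measurable ?C"
        unfolding case_prod_unfold by measurable
    qed
  qed
  also have "\<dots> = (\<Sum>i<d. \<integral>x. indicator (D i) x * F (x, \<phi> i x) \<partial>M)"
    by (simp add: lebesgue_integral_count_space_finite)
  also have "\<dots> = (\<integral>x. (\<Sum>i<d. indicator (D i) x * F (x, \<phi> i x)) \<partial>M)"
    by (rule Bochner_Integration.integral_sum[symmetric]) (rule intF)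
  finally show "integral\<^sup>L edge_measure F = (\<integral>x. (\<Sum>i\<in>Ix x. F (x, \<phi> i x)) \<partial>M)" by (simp add: sum_Ix)
  have "integrable M (\<lambda>x. \<Sum>i<d. indicator (D i) x * F (x, \<phi> i x))"
    by (rule Bochner_Integration.integrable_sum) (rule intF)
  then show "integrable M (\<lambda>x. \<Sum>i\<in>Ix x. F (x, \<phi> i x))" unfolding sum_Ix .
qed

lemma edge_measure_null_iff:
  assumes A: "A \<in> sets MM"
  shows "emeasure edge_measure A = 0 \<longleftrightarrow> (AE x in M. \<forall>y. (x, y) \<in> E \<longrightarrow> (x, y) \<notin> A)"
proof -
  have meas: "(\<lambda>x. indicator (D i) x * indicator A (x, \<phi> i x) :: ennreal) \<in> borel_measurable M" for i
  proof -
    have "(\<lambda>x. (x, \<phi> i x)) \<in> measurable M MM" using \<phi>[of i] by simp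
    from measurable_compose[OF this borel_measurable_indicator[OF A]] show ?thesis
      using D[of i] by (intro borel_measurable_times_ennreal borel_measurable_indicator)
  qed
  have "emeasure edge_measure A = (\<integral>\<^sup>+p. indicator A p \<partial>edge_measure)" using A by simp
  also have "\<dots> = (\<Sum>i<d. \<integral>\<^sup>+x. indicator (D i) x * indicator A (x, \<phi> i x) \<partial>M)"
    using A by (subst edge_measure_nn_integral) auto
  finally have "emeasure edge_measure A = 0 \<longleftrightarrow> (\<forall>i\<in>{..<d}. AE x in M. indicator (D i) x * indicator A (x, \<phi> i x) = (0::ennreal))"
    using meas by (simp add: nn_integral_0_iff_AE)
  also have "\<dots> \<longleftrightarrow> (AE x in M. \<forall>i\<in>{..<d}. indicator (D i) x * indicator A (x, \<phi> i x) = (0::ennreal))"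
    by (rule AE_ball_countable[symmetric]) simp
  also have "\<dots> \<longleftrightarrow> (AE x in M. \<forall>y. (x, y) \<in> E \<longrightarrow> (x, y) \<notin> A)"
  proof (rule AE_cong)
    fix x assume x: "x \<in> space M"
    have "{y. (x, y) \<in> E} = (\<lambda>i. \<phi> i x) ` Ix x" using enum[OF x] by (simp add: bij_betw_def)
    then have "(\<forall>y. (x, y) \<in> E \<longrightarrow> (x, y) \<notin> A) \<longleftrightarrow> (\<forall>y\<in>(\<lambda>i. \<phi> i x) ` Ix x. (x, y) \<notin> A)" by blast
    then show "(\<forall>i\<in>{..<d}. indicator (D i) x * indicator A (x, \<phi> i x) = (0::ennreal)) \<longleftrightarrow>
        (\<forall>y. (x, y) \<in> E \<longrightarrow> (x, y) \<notin> A)" by (auto simp: indicator_def)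
  qed
  finally show ?thesis .
qed

lemma AE_edge_measure:
  assumes "{p \<in> space MM. P p} \<in> sets MM"
  shows "(AE p in edge_measure. P p) \<longleftrightarrow> (AE x in M. \<forall>y. (x, y) \<in> E \<longrightarrow> P (x, y))"
proof -
  have s: "space MM - {p \<in> space MM. P p} \<in> sets MM" using assms by auto
  have eq: "{p \<in> space edge_measure. \<not> P p} = space MM - {p \<in> space MM. P p}" by auto
  have "(AE p in edge_measure. P p) \<longleftrightarrow> emeasure edge_measure (space MM - {p \<in> space MM. P p}) = 0"
    using AE_iff_measurable[OF _ eq] s by simp
  also have "\<dots> \<longleftrightarrow> (AE x in M. \<forall>y. (x, y) \<in> E \<longrightarrow> (x, y) \<notin> space MM - {p \<in> space MM. P p})"
    by (rule edge_measure_null_iff[OF s])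
  also have "\<dots> \<longleftrightarrow> (AE x in M. \<forall>y. (x, y) \<in> E \<longrightarrow> P (x, y))"
    by (rule AE_cong) (use E_space in \<open>auto simp: space_pair_measure\<close>)
  finally show ?thesis .
qed

lemma AE_edge_measure_E: "AE p in edge_measure. p \<in> E"
proof -
  have "{p \<in> space MM. p \<in> E} = E" using sets.sets_into_space[OF E_sets] by auto
  then show ?thesis using AE_edge_measure[of "\<lambda>p. p \<in> E"] E_sets by simp
qed

lemma edge_measure_cong: "bdd_meas F \<Longrightarrow> bdd_meas G \<Longrightarrow> (\<And>p. p \<in> E \<Longrightarrow> F p = G p) \<Longrightarrow> integral\<^sup>L edge_measure F = integral\<^sup>L edge_measure G"
  using AE_edge_measure_E by (intro integral_cong_AE) (auto simp: bdd_meas_def measurable_cong_sets[OF sets_edge_measure refl])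

lemma edge_measure_mono: "bdd_meas F \<Longrightarrow> bdd_meas G \<Longrightarrow> (\<And>p. p \<in> E \<Longrightarrow> F p \<le> G p) \<Longrightarrow> integral\<^sup>L edge_measure F \<le> integral\<^sup>L edge_measure G"
  using AE_edge_measure_E by (intro integral_mono_AE bdd_meas_integrable) auto

text \<open>The axiom \<open>flip\<close> concerns sets; as an equality of measures it serves both
  for integrals and for null sets of edges.\<close>

lemma edge_measure_flip_measure: "distr edge_measure MM (\<lambda>p. (snd p, fst p)) = density edge_measure (\<lambda>p. ennreal (g p))"
proof (rule measure_eqI)
  have sw: "(\<lambda>p. (snd p, fst p)) \<in> measurable edge_measure MM" by simp
  show "sets (distr edge_measure MM (\<lambda>p. (snd p, fst p))) = sets (density edge_measure (\<lambda>p. ennreal (g p)))" by simp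
  fix A assume "A \<in> sets (distr edge_measure MM (\<lambda>p. (snd p, fst p)))"
  then have A: "A \<in> sets MM" by simp
  have gm: "(\<lambda>p. ennreal (g p)) \<in> borel_measurable edge_measure" using g_meas by simp
  have "emeasure (distr edge_measure MM (\<lambda>p. (snd p, fst p))) A = (\<integral>\<^sup>+p. indicator A p \<partial>distr edge_measure MM (\<lambda>p. (snd p, fst p)))"
    using A by simp
  also have "\<dots> = (\<integral>\<^sup>+p. indicator A (snd p, fst p) \<partial>edge_measure)"
    using A by (subst nn_integral_distr[OF sw]) auto
  also have "\<dots> = (\<Sum>i<d. \<integral>\<^sup>+x. indicator (D i) x * indicator A (\<phi> i x, x) \<partial>M)"
    using measurable_compose[of "\<lambda>p. (snd p, fst p)" MM MM "indicator A" borel] A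
    by (subst edge_measure_nn_integral) auto
  also have "\<dots> = (\<integral>\<^sup>+p. ennreal (g p) * indicator A p \<partial>edge_measure)"
    using g_meas A by (subst edge_measure_nn_integral) (auto simp: flip[OF A])
  also have "\<dots> = emeasure (density edge_measure (\<lambda>p. ennreal (g p))) A"
    using A gm by (subst emeasure_density) auto
  finally show "emeasure (distr edge_measure MM (\<lambda>p. (snd p, fst p))) A = emeasure (density edge_measure (\<lambda>p. ennreal (g p))) A" .
qed

lemma edge_measure_flip:
  assumes F: "bdd_meas F"
  shows "(\<integral>p. F (snd p, fst p) \<partial>edge_measure) = (\<integral>p. g p * F p \<partial>edge_measure)"
proof -
  have Fm: "F \<in> borel_measurable MM" using F by (rule bdd_meas_measurable)
  have "(\<integral>p. F (snd p, fst p) \<partial>edge_measure) = integral\<^sup>L (distr edge_measure MM (\<lambda>p. (snd p, fst p))) F"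
    using Fm by (subst integral_distr) auto
  also have "\<dots> = (\<integral>p. g p * F p \<partial>edge_measure)"
    unfolding edge_measure_flip_measure using Fm g_meas g_pos by (subst integral_density) auto
  finally show ?thesis .
qed

section \<open>Triangle counts and the flip-invariant weight\<close>

text \<open>Written through the enumeration instead of as a cardinality, which makes it measurable
  on all pairs; on E it is the valency of the edge as a vertex of the link.\<close>

definition \<tau> :: "'a \<times> 'a \<Rightarrow> real" where
  "\<tau> p = (\<Sum>j<d. indicator (D j) (fst p) * of_bool ((fst p, snd p, \<phi> j (fst p)) \<in> Tri))"

lemma bdd_meas_sum_triangles:
  assumes f: "\<And>j. bdd_meas (f j)"
  shows "bdd_meas (\<lambda>p. \<Sum>j<d. indicator (D j) (fst p) * (of_bool ((fst p, snd p, \<phi> j (fst p)) \<in> Tri) * f j p))"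
proof (intro bdd_meas_sum bdd_meas_mult f)
  fix j
  show "bdd_meas (\<lambda>p. indicator (D j) (fst p))"
    using D[of j] by (intro bdd_measI[of _ 1]) (auto simp: indicator_def)
  have "(\<lambda>p. (fst p, snd p, \<phi> j (fst p))) \<in> measurable MM (M \<Otimes>\<^sub>M (M \<Otimes>\<^sub>M M))"
    using measurable_compose[OF measurable_fst \<phi>[of j]] by (intro measurable_Pair measurable_fst measurable_snd)
  moreover have "(indicator Tri :: _ \<Rightarrow> real) \<in> borel_measurable (M \<Otimes>\<^sub>M (M \<Otimes>\<^sub>M M))"
    using Tri_sets by simp
  ultimately have "(\<lambda>p. indicator Tri (fst p, snd p, \<phi> j (fst p)) :: real) \<in> borel_measurable MM"
    by (rule measurable_compose)
  then show "bdd_meas (\<lambda>p. of_bool ((fst p, snd p, \<phi> j (fst p)) \<in> Tri))"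
    by (intro bdd_measI[of _ 1]) (auto simp: indicator_def of_bool_def)
qed

lemma bdd_meas_\<tau>: "bdd_meas \<tau>"
  using bdd_meas_sum_triangles[of "\<lambda>_ _. 1"] bdd_meas_const by (simp add: \<tau>_def[abs_def])

lemma \<tau>_Ix: "\<tau> (x, y) = (\<Sum>j\<in>Ix x. of_bool ((x, y, \<phi> j x) \<in> Tri))"
  by (simp add: \<tau>_def sum_Ix)

lemma nb_finite: "x \<in> space M \<Longrightarrow> finite {z. (x, z) \<in> E}"
  using bij_betw_finite[OF enum] by auto

text \<open>Both sides sum f over the third vertices of the triangles on x and y, enumerated once
  from x and once from y.\<close>

lemma triangle_sum_flip:
  fixes f :: "'a \<Rightarrow> real"
  assumes x: "x \<in> space M" "y \<in> space M"
  shows "(\<Sum>j\<in>Ix x. of_bool ((x, y, \<phi> j x) \<in> Tri) * f (\<phi> j x)) =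
    (\<Sum>j\<in>Ix y. of_bool ((y, x, \<phi> j y) \<in> Tri) * f (\<phi> j y))"
proof -
  have *: "(\<Sum>j\<in>Ix x. of_bool ((x, y, \<phi> j x) \<in> Tri) * f (\<phi> j x)) = (\<Sum>z\<in>{z. (x, y, z) \<in> Tri}. f z)"
    if x: "x \<in> space M" for x y
  proof -
    have "(\<Sum>j\<in>Ix x. of_bool ((x, y, \<phi> j x) \<in> Tri) * f (\<phi> j x)) =
        (\<Sum>z | (x, z) \<in> E. of_bool ((x, y, z) \<in> Tri) * f z)"
      using sum_nb[OF x, of "\<lambda>z. of_bool ((x, y, z) \<in> Tri) * f z"] .
    also have "\<dots> = (\<Sum>z\<in>{z. (x, y, z) \<in> Tri}. f z)"
      using nb_finite[OF x] Tri_E by (intro sum.mono_neutral_cong_right) auto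
    finally show ?thesis .
  qed
  have "{z. (x, y, z) \<in> Tri} = {z. (y, x, z) \<in> Tri}" using Tri_flip by blast
  then show ?thesis using *[OF x(1)] *[OF x(2)] by simp
qed

lemma \<tau>_sym:
  assumes "(x, y) \<in> E"
  shows "\<tau> (y, x) = \<tau> (x, y)"
  using triangle_sum_flip[OF E_space[OF assms], of "\<lambda>_. 1"] by (simp add: \<tau>_Ix)

lemma \<tau>_ge1: "p \<in> E \<Longrightarrow> 1 \<le> \<tau> p"
proof -
  assume p: "p \<in> E"
  obtain x y where xy: "p = (x, y)" by (cases p)
  have x: "x \<in> space M" using p xy E_space by blast
  have "y \<in> (\<lambda>i. \<phi> i x) ` Ix x" using bij_betw_imp_surj_on[OF enum[OF x]] p xy by simp
  then obtain i where "i \<in> Ix x" "\<phi> i x = y" by (elim imageE) simp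
  then show ?thesis using link_valency[OF x, of i] by (simp add: xy \<tau>_Ix)
qed

text \<open>Since \<tau> is symmetric on E, the flip of the weight \<tau> has density \<tau> g; w is
  the average of the two.\<close>

definition w :: "'a \<times> 'a \<Rightarrow> real" where
  "w p = \<tau> p * (1 + g p) / 2"

lemma bdd_meas_w: "bdd_meas w"
proof -
  have "bdd_meas (\<lambda>p. (1/2) * (\<tau> p * (1 + g p)))" by (intro bdd_meas_cmult bdd_meas_mult bdd_meas_\<tau> bdd_meas_add bdd_meas_const bdd_meas_g)
  then show ?thesis by (simp add: w_def[abs_def])
qed

lemma w_bounds: "p \<in> E \<Longrightarrow> 1/2 \<le> w p" "p \<in> E \<Longrightarrow> w p \<le> \<tau> p * (1 + \<delta>) / 2"
proof -
  assume p: "p \<in> E"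
  note t = \<tau>_ge1[OF p]
  have "1 * 1 \<le> \<tau> p * (1 + g p)" using t g_pos[of p] by (intro mult_mono) auto
  then show "1/2 \<le> w p" by (simp add: w_def)
  show "w p \<le> \<tau> p * (1 + \<delta>) / 2" unfolding w_def using t g_le[of p]
    by (intro divide_right_mono mult_left_mono) auto
qed

text \<open>The weight \<open>w\<close> makes the edge measure invariant under the flip.\<close>

lemma w_integral:
  assumes F: "bdd_meas F"
  shows "(\<integral>p. w p * F p \<partial>edge_measure) = ((\<integral>p. \<tau> p * F p \<partial>edge_measure) + (\<integral>p. \<tau> p * F (snd p, fst p) \<partial>edge_measure)) / 2"
proof -
  have b: "bdd_meas (\<lambda>p. \<tau> p * F p)" by (intro bdd_meas_mult bdd_meas_\<tau> F)
  have bg: "bdd_meas (\<lambda>p. g p * (\<tau> p * F p))" by (intro bdd_meas_mult bdd_meas_g b)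
  have "(\<integral>p. \<tau> p * F (snd p, fst p) \<partial>edge_measure) = (\<integral>p. (\<lambda>p. \<tau> p * F p) (snd p, fst p) \<partial>edge_measure)"
  proof (rule edge_measure_cong)
    show "bdd_meas (\<lambda>p. \<tau> p * F (snd p, fst p))" by (intro bdd_meas_mult bdd_meas_\<tau> bdd_meas_swap F)
    show "bdd_meas (\<lambda>p. \<tau> (snd p, fst p) * F (snd p, fst p))" by (rule bdd_meas_swap[OF b])
    show "\<tau> p * F (snd p, fst p) = \<tau> (snd p, fst p) * F (snd p, fst p)" if "p \<in> E" for p
      using \<tau>_sym[of "fst p" "snd p"] that by simp
  qed
  also have "\<dots> = (\<integral>p. g p * (\<tau> p * F p) \<partial>edge_measure)" by (rule edge_measure_flip[OF b])
  finally have 1: "(\<integral>p. \<tau> p * F (snd p, fst p) \<partial>edge_measure) = (\<integral>p. g p * (\<tau> p * F p) \<partial>edge_measure)" .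
  have "(\<integral>p. w p * F p \<partial>edge_measure) = (\<integral>p. (1/2) * (\<tau> p * F p + g p * (\<tau> p * F p)) \<partial>edge_measure)"
    by (intro arg_cong2[where f = "integral\<^sup>L"] refl ext) (simp add: w_def algebra_simps)
  also have "\<dots> = (1/2) * ((\<integral>p. \<tau> p * F p \<partial>edge_measure) + (\<integral>p. g p * (\<tau> p * F p) \<partial>edge_measure))"
    using bdd_meas_integrable[OF b] bdd_meas_integrable[OF bg] by simp
  finally show ?thesis using 1 by simp
qed

lemma w_integral_swap:
  assumes F: "bdd_meas F"
  shows "(\<integral>p. w p * F (snd p, fst p) \<partial>edge_measure) = (\<integral>p. w p * F p \<partial>edge_measure)"
  using w_integral[OF F] w_integral[OF bdd_meas_swap[OF F]] by simp

section \<open>Coboundaries, energy and gradient\<close>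

definition \<rho> :: "'a \<Rightarrow> 'a \<Rightarrow> 'h \<Rightarrow> 'h" where
  "\<rho> x y = \<pi> (\<Phi> x) (\<Phi> y)"

definition cobd :: "('a \<Rightarrow> 'h) \<Rightarrow> 'a \<times> 'a \<Rightarrow> 'h" where
  "cobd \<xi> p = \<rho> (fst p) (snd p) (\<xi> (snd p)) - \<xi> (fst p)"

text \<open>The pointwise bound B makes the edge integrands bounded and provides the dominating
  constant in the limits.\<close>

definition sec :: "('a \<Rightarrow> 'h) \<Rightarrow> real \<Rightarrow> bool" where
  "sec \<xi> B \<longleftrightarrow> along M \<Phi> \<xi> \<and> (\<forall>x\<in>space M. norm (\<xi> x) \<le> B)"

lemma sec_along: "sec \<xi> B \<Longrightarrow> along M \<Phi> \<xi>"
  by (simp add: sec_def)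

lemma sec_norm: "sec \<xi> B \<Longrightarrow> x \<in> space M \<Longrightarrow> norm (\<xi> x) \<le> B"
  by (simp add: sec_def)

lemma sec_in: "sec \<xi> B \<Longrightarrow> x \<in> space M \<Longrightarrow> \<xi> x \<in> H (\<Phi> x)"
  by (rule along_in[OF sec_along])

lemmas \<rho>_facts = \<pi>_facts[OF E_S E_S, folded \<rho>_def]

lemma \<rho>_inv:
  assumes E: "(x, y) \<in> E" and u: "u \<in> H (\<Phi> y)"
  shows "\<rho> y x (\<rho> x y u) = u"
  using \<pi>_comp[OF E_S[OF E_sym[OF E]] E_S[OF E] u] \<pi>_id[OF S_space(2)[OF E_S[OF E]] u]
  by (simp add: \<rho>_def)

lemma \<rho>_comp:
  assumes "(x, y) \<in> E" "(y, z) \<in> E" "u \<in> H (\<Phi> z)"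
  shows "\<rho> x y (\<rho> y z u) = \<rho> x z u"
  using \<pi>_comp[OF E_S[OF assms(1)] E_S[OF assms(2)] assms(3)] by (simp add: \<rho>_def)

lemma cobd_in:
  assumes \<xi>: "sec \<xi> B" and E: "(x, y) \<in> E"
  shows "cobd \<xi> (x, y) \<in> H (\<Phi> x)"
  using closed_csubspace_facts(5)[OF H[OF S_space(1)[OF E_S[OF E]]] \<rho>_facts(1)[OF E E sec_in[OF \<xi> E_space(2)[OF E]]]
      sec_in[OF \<xi> E_space(1)[OF E]]]
  by (simp add: cobd_def)

lemma cobd_along:
  assumes \<xi>: "along M \<Phi> \<xi>"
  shows "along (restrict_space MM E) (\<lambda>p. \<Phi> (fst p)) (\<lambda>p. \<rho> (fst p) (snd p) (\<xi> (snd p)))"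
    "along (restrict_space MM E) (\<lambda>p. \<Phi> (fst p)) (\<lambda>p. \<xi> (fst p))"
    "along (restrict_space MM E) (\<lambda>p. \<Phi> (fst p)) (cobd \<xi>)"
proof -
  let ?P = "restrict_space MM E"
  have f: "fst \<in> measurable ?P M" and s: "snd \<in> measurable ?P M" by (auto intro: measurable_restrict_space1)
  show 1: "along ?P (\<lambda>p. \<Phi> (fst p)) (\<lambda>p. \<xi> (fst p))" using along_compose[OF \<xi> f] .
  show 2: "along ?P (\<lambda>p. \<Phi> (fst p)) (\<lambda>p. \<rho> (fst p) (snd p) (\<xi> (snd p)))"
    unfolding \<rho>_def
    by (rule along_transport[OF along_compose[OF \<xi> s] measurable_compose[OF f \<Phi>]])
      (auto simp: space_restrict_space intro: E_S)
  show "along ?P (\<lambda>p. \<Phi> (fst p)) (cobd \<xi>)" unfolding cobd_def[abs_def] by (rule along_diff[OF 2 1])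
qed

text \<open>Transport is meaningful only inside classes, so quantities built from it are measured on
  E and set to 0 elsewhere.\<close>

lemma bdd_meas_edge_function:
  assumes "F \<in> borel_measurable (restrict_space MM E)" "\<And>p. p \<in> E \<Longrightarrow> \<bar>F p\<bar> \<le> B"
  shows "bdd_meas (\<lambda>p. if p \<in> E then F p else 0)"
proof (rule bdd_measI[of _ "\<bar>B\<bar>"])
  show "(\<lambda>p. if p \<in> E then F p else 0) \<in> borel_measurable MM"
    using assms(1) E_sets sets.sets_into_space[OF E_sets] by (subst measurable_If_restrict_space_iff) (auto simp: Int_absorb1 Collect_conj_eq)
  show "\<bar>if p \<in> E then F p else 0\<bar> \<le> \<bar>B\<bar>" for p using assms(2)[of p] by auto
qed

definition q :: "('a \<Rightarrow> 'h) \<Rightarrow> 'a \<times> 'a \<Rightarrow> real" where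
  "q \<xi> p = (if p \<in> E then (norm (cobd \<xi> p))\<^sup>2 else 0)"

lemma q_nonneg: "0 \<le> q \<xi> p"
  by (simp add: q_def)

lemma norm_cobd:
  assumes \<xi>: "sec \<xi> B" and E: "p \<in> E"
  shows "norm (cobd \<xi> p) \<le> 2 * B"
proof -
  obtain x y where p: "p = (x, y)" by (cases p)
  have E': "(x, y) \<in> E" using E p by simp
  have "norm (cobd \<xi> p) \<le> norm (\<rho> x y (\<xi> y)) + norm (\<xi> x)" by (simp add: cobd_def p norm_triangle_ineq4)
  also have "norm (\<rho> x y (\<xi> y)) = norm (\<xi> y)" using \<rho>_facts(6)[OF E' E' sec_in[OF \<xi> E_space(2)[OF E']]] .
  finally show ?thesis using sec_norm[OF \<xi> E_space(1)[OF E']] sec_norm[OF \<xi> E_space(2)[OF E']] by simp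
qed

lemma bdd_meas_q:
  assumes \<xi>: "sec \<xi> B"
  shows "bdd_meas (q \<xi>)"
proof -
  have "(\<lambda>p. (norm (cobd \<xi> p))\<^sup>2) \<in> borel_measurable (restrict_space MM E)"
    using along_norm[OF cobd_along(3)[OF sec_along[OF \<xi>]]] by simp
  moreover have "\<bar>(norm (cobd \<xi> p))\<^sup>2\<bar> \<le> (2 * B)\<^sup>2" if "p \<in> E" for p
    using power_mono[OF norm_cobd[OF \<xi> that] norm_ge_zero, of 2] by simp
  ultimately show ?thesis unfolding q_def[abs_def] by (rule bdd_meas_edge_function)
qed

lemma cobd_flip:
  assumes \<xi>: "sec \<xi> B" and E: "(x, y) \<in> E"
  shows "cobd \<xi> (y, x) = - \<rho> y x (cobd \<xi> (x, y))"
proof -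
  have in': "\<rho> x y (\<xi> y) \<in> H (\<Phi> x)" "\<xi> x \<in> H (\<Phi> x)" "\<xi> y \<in> H (\<Phi> y)"
    using \<rho>_facts(1)[OF E E] sec_in[OF \<xi>] E_space[OF E] by auto
  show ?thesis
    using \<rho>_facts(4)[OF E_sym[OF E] E_sym[OF E] in'(1,2)] \<rho>_inv[OF E in'(3)] by (simp add: cobd_def)
qed

lemma q_sym:
  assumes \<xi>: "sec \<xi> B"
  shows "q \<xi> (snd p, fst p) = q \<xi> p"
proof (cases "p \<in> E")
  case True
  then obtain x y where p: "p = (x, y)" and E: "(x, y) \<in> E" by (cases p) auto
  show ?thesis using cobd_flip[OF \<xi> E] \<rho>_facts(6)[OF E_sym[OF E] E_sym[OF E] cobd_in[OF \<xi> E]] E E_sym[OF E]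
    by (simp add: q_def p)
next
  case False
  then have "(snd p, fst p) \<notin> E" using E_sym by fastforce
  then show ?thesis using False by (simp add: q_def)
qed

definition energy :: "('a \<Rightarrow> 'h) \<Rightarrow> real" where
  "energy \<xi> = (\<integral>p. \<tau> p * q \<xi> p \<partial>edge_measure)"

text \<open>\<open>q\<close> is symmetric, so averaging the weight with its flip leaves the integral
  unchanged. The energy thus carries either weight: \<tau> for the links, w for the
  gradient.\<close>

lemma energy_w:
  assumes \<xi>: "sec \<xi> B"
  shows "(\<integral>p. w p * q \<xi> p \<partial>edge_measure) = energy \<xi>"
  using w_integral[OF bdd_meas_q[OF \<xi>]] by (simp add: q_sym[OF \<xi>] energy_def)

lemma energy_nonneg: "0 \<le> energy \<xi>"
proof -
  have "AE p in edge_measure. 0 \<le> \<tau> p * q \<xi> p"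
    using AE_edge_measure_E by eventually_elim (use \<tau>_ge1 q_nonneg in \<open>force intro: mult_nonneg_nonneg\<close>)
  then show ?thesis unfolding energy_def by (rule integral_nonneg_AE)
qed

definition W :: "'a \<Rightarrow> real" where
  "W x = (\<Sum>i\<in>Ix x. w (x, \<phi> i x))"

lemma W_ge: "x \<in> space M \<Longrightarrow> 1/2 \<le> W x"
proof -
  assume x: "x \<in> space M"
  obtain i where i: "i \<in> Ix x" using link_ne[OF x] by blast
  have "0 \<le> w (x, \<phi> j x)" if "j \<in> Ix x" for j using w_bounds(1)[OF \<phi>_E[OF x that]] by simp
  then have "w (x, \<phi> i x) \<le> W x" unfolding W_def using i by (intro member_le_sum) auto
  then show ?thesis using w_bounds(1)[OF \<phi>_E[OF x i]] by simp
qed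

lemma W_measurable: "W \<in> borel_measurable M"
proof -
  have "(\<lambda>x. w (x, \<phi> i x)) \<in> borel_measurable M" for i
  proof -
    have "(\<lambda>x. (x, \<phi> i x)) \<in> measurable M MM" using \<phi>[of i] by simp
    from measurable_compose[OF this bdd_meas_measurable[OF bdd_meas_w]] show ?thesis .
  qed
  then have "(\<lambda>x. \<Sum>i<d. indicator (D i) x * w (x, \<phi> i x)) \<in> borel_measurable M"
    by (intro borel_measurable_sum borel_measurable_times borel_measurable_indicator D)
  then show ?thesis unfolding W_def[abs_def] sum_Ix .
qed

text \<open>The w-mean of the coboundary over the edges at x; hence
  \<open>\<xi> x + grad \<xi> x\<close> is the w-average of the transported values at the
  neighbours.\<close>

definition grad :: "('a \<Rightarrow> 'h) \<Rightarrow> 'a \<Rightarrow> 'h" where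
  "grad \<xi> x = (1 / W x) *\<^sub>R (\<Sum>i\<in>Ix x. w (x, \<phi> i x) *\<^sub>R cobd \<xi> (x, \<phi> i x))"

lemma W_grad: "x \<in> space M \<Longrightarrow> W x *\<^sub>R grad \<xi> x = (\<Sum>i\<in>Ix x. w (x, \<phi> i x) *\<^sub>R cobd \<xi> (x, \<phi> i x))"
  using W_ge[of x] by (simp add: grad_def)

text \<open>An average of vectors of norm at most B again has norm at most B, and a half step along
  the gradient is the midpoint of two such vectors. The descent therefore never leaves the ball of
  radius B.\<close>

lemma grad_shift_norm:
  assumes \<xi>: "sec \<xi> B" and x: "x \<in> space M"
  shows "norm (grad \<xi> x + \<xi> x) \<le> B"
proof -
  have "(\<Sum>i\<in>Ix x. w (x, \<phi> i x) *\<^sub>R \<xi> x) = W x *\<^sub>R \<xi> x" by (simp add: W_def scaleR_left.sum)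
  then have "W x *\<^sub>R (grad \<xi> x + \<xi> x) = (\<Sum>i\<in>Ix x. w (x, \<phi> i x) *\<^sub>R \<rho> x (\<phi> i x) (\<xi> (\<phi> i x)))"
    unfolding scaleR_add_right W_grad[OF x] by (simp add: cobd_def scaleR_diff_right sum_subtractf)
  then have "W x * norm (grad \<xi> x + \<xi> x) = norm (\<Sum>i\<in>Ix x. w (x, \<phi> i x) *\<^sub>R \<rho> x (\<phi> i x) (\<xi> (\<phi> i x)))"
    using W_ge[OF x] by (metis abs_of_nonneg norm_scaleR order_trans zero_le_divide_1_iff zero_le_numeral)
  also have "\<dots> \<le> (\<Sum>i\<in>Ix x. w (x, \<phi> i x) * B)"
  proof (rule sum_norm_le)
    fix i assume i: "i \<in> Ix x"
    note E = \<phi>_E[OF x i]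
    have "norm (\<rho> x (\<phi> i x) (\<xi> (\<phi> i x))) \<le> B"
      using \<rho>_facts(6)[OF E E sec_in[OF \<xi>]] sec_norm[OF \<xi>] E_space[OF E] by simp
    then show "norm (w (x, \<phi> i x) *\<^sub>R \<rho> x (\<phi> i x) (\<xi> (\<phi> i x))) \<le> w (x, \<phi> i x) * B"
      using w_bounds(1)[OF E] by (simp add: mult_left_mono)
  qed
  also have "\<dots> = W x * B" by (simp add: W_def sum_distrib_right)
  finally show ?thesis using W_ge[OF x] by (simp add: mult_le_cancel_left)
qed

lemma along_sum: "finite I \<Longrightarrow> \<Phi>' \<in> measurable P N \<Longrightarrow> (\<And>i. i \<in> I \<Longrightarrow> along P \<Phi>' (u i)) \<Longrightarrow> along P \<Phi>' (\<lambda>p. \<Sum>i\<in>I. u i p)"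
proof (induction I rule: finite_induct)
  case empty
  obtain v :: "nat \<Rightarrow> 'b \<Rightarrow> 'h" where "\<And>n. v n \<in> Sec"
    "\<And>x. x \<in> space N \<Longrightarrow> H x \<subseteq> closure (range (\<lambda>n. v n x))" by (rule dense_sections) (rule that)
  then have "along P \<Phi>' (\<lambda>p. v 0 (\<Phi>' p))" using empty by (intro along_Sec)
  from along_scaleR[OF this, of "\<lambda>_. 0"] show ?case by simp
next
  case (insert i I)
  then show ?case using along_add[of P \<Phi>' "u i" "\<lambda>p. \<Sum>i\<in>I. u i p"] by simp
qed

lemma grad_along:
  assumes \<xi>: "along M \<Phi> \<xi>"
  shows "along M \<Phi> (grad \<xi>)"
proof -
  have "along M \<Phi> (\<lambda>x. if x \<in> D i then w (x, \<phi> i x) *\<^sub>R cobd \<xi> (x, \<phi> i x) else 0)" if "i < d" for i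
  proof (rule along_extend[OF \<Phi> D])
    have sp: "space (restrict_space M (D i)) = D i" using sets.sets_into_space[OF D[of i]] by (auto simp: space_restrict_space)
    have m0: "(\<lambda>x. (x, \<phi> i x)) \<in> measurable (restrict_space M (D i)) MM"
      using \<phi>[of i] by (intro measurable_restrict_space1) simp
    then have m: "(\<lambda>x. (x, \<phi> i x)) \<in> measurable (restrict_space M (D i)) (restrict_space MM E)"
      using sets.sets_into_space[OF D[of i]] that \<phi>_E
      by (intro measurable_restrict_space2) (auto simp: sp)
    show "along (restrict_space M (D i)) \<Phi> (\<lambda>x. w (x, \<phi> i x) *\<^sub>R cobd \<xi> (x, \<phi> i x))"
      using along_compose[OF cobd_along(3)[OF \<xi>] m] measurable_compose[OF m0 bdd_meas_measurable[OF bdd_meas_w]]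
      by (intro along_scaleR) simp_all
  qed
  then have "along M \<Phi> (\<lambda>x. \<Sum>i<d. if x \<in> D i then w (x, \<phi> i x) *\<^sub>R cobd \<xi> (x, \<phi> i x) else 0)"
    by (intro along_sum \<Phi>) auto
  moreover have "(\<Sum>i<d. if x \<in> D i then w (x, \<phi> i x) *\<^sub>R cobd \<xi> (x, \<phi> i x) else 0) =
      (\<Sum>i\<in>Ix x. w (x, \<phi> i x) *\<^sub>R cobd \<xi> (x, \<phi> i x))" for x
    using sum.inter_filter[of "{..<d}" "\<lambda>i. w (x, \<phi> i x) *\<^sub>R cobd \<xi> (x, \<phi> i x)" "\<lambda>i. x \<in> D i"] by simp
  ultimately have "along M \<Phi> (\<lambda>x. \<Sum>i\<in>Ix x. w (x, \<phi> i x) *\<^sub>R cobd \<xi> (x, \<phi> i x))" by simp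
  from along_scaleR[OF this, of "\<lambda>x. 1 / W x"] show ?thesis
    using W_measurable by (simp add: grad_def[abs_def])
qed

lemma grad_sec:
  assumes \<xi>: "sec \<xi> B"
  shows "sec (grad \<xi>) (2 * B)" "sec (\<lambda>x. \<xi> x + (1/2) *\<^sub>R grad \<xi> x) B"
proof -
  have a: "along M \<Phi> (grad \<xi>)" using grad_along[OF sec_along[OF \<xi>]] .
  have "norm (grad \<xi> x) \<le> 2 * B" if x: "x \<in> space M" for x
    using norm_triangle_ineq4[of "grad \<xi> x + \<xi> x" "\<xi> x"] grad_shift_norm[OF \<xi> x] sec_norm[OF \<xi> x] by simp
  then show "sec (grad \<xi>) (2 * B)" using a by (simp add: sec_def)
  have "norm (\<xi> x + (1/2) *\<^sub>R grad \<xi> x) \<le> B" if x: "x \<in> space M" for x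
  proof -
    have "\<xi> x + (1/2) *\<^sub>R grad \<xi> x = (1/2) *\<^sub>R \<xi> x + (1/2) *\<^sub>R (grad \<xi> x + \<xi> x)"
      by (simp add: scaleR_add_right) (simp flip: scaleR_add_left)
    then have "norm (\<xi> x + (1/2) *\<^sub>R grad \<xi> x) \<le> (1/2) * norm (\<xi> x) + (1/2) * norm (grad \<xi> x + \<xi> x)"
      by (metis abs_of_nonneg norm_scaleR norm_triangle_ineq zero_le_divide_1_iff zero_le_numeral)
    then show ?thesis using grad_shift_norm[OF \<xi> x] sec_norm[OF \<xi> x] by simp
  qed
  moreover have "along M \<Phi> (\<lambda>x. \<xi> x + (1/2) *\<^sub>R grad \<xi> x)"
    by (intro along_add along_scaleR a sec_along[OF \<xi>]) simp
  ultimately show "sec (\<lambda>x. \<xi> x + (1/2) *\<^sub>R grad \<xi> x) B" by (simp add: sec_def)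
qed

text \<open>The square of an L^2 norm, without root, so that it compares directly with
  \<open>energy\<close>.\<close>

definition grad_norm :: "('a \<Rightarrow> 'h) \<Rightarrow> real" where
  "grad_norm \<xi> = (\<integral>x. W x * (norm (grad \<xi> x))\<^sup>2 \<partial>M)"

end

section \<open>Spectral gap and descent\<close>

text \<open>The limit of the descent is the sum of an absolutely convergent series of vectors, which
  takes completeness.\<close>

instance chilbert_space \<subseteq> banach ..

context periodic_complex
begin

section \<open>Garland's inequality for the energy\<close>

text \<open>The gradient is the w-mean of the coboundary at x, so this is the decomposition of a
  second moment about v into the variance and the squared distance of v from the mean.\<close>

lemma variance:
  assumes x: "x \<in> space M"
  shows "(\<Sum>i\<in>Ix x. w (x, \<phi> i x) * (norm (cobd \<xi> (x, \<phi> i x) - v))\<^sup>2) =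
    (\<Sum>i\<in>Ix x. w (x, \<phi> i x) * (norm (cobd \<xi> (x, \<phi> i x)))\<^sup>2) - W x * (norm (grad \<xi> x))\<^sup>2
    + W x * (norm (grad \<xi> x - v))\<^sup>2"
proof -
  let ?w = "\<lambda>i. w (x, \<phi> i x)" and ?c = "\<lambda>i. cobd \<xi> (x, \<phi> i x)" and ?m = "grad \<xi> x"
  have "(\<Sum>i\<in>Ix x. ?w i * (norm (?c i - v))\<^sup>2) = (\<Sum>i\<in>Ix x. ?w i * (norm (?c i))\<^sup>2 - 2 * ((?w i *\<^sub>R ?c i) \<bullet> v) + ?w i * (norm v)\<^sup>2)"
    by (intro sum.cong refl) (simp add: power2_norm_eq_inner inner_diff_left inner_diff_right inner_commute algebra_simps)
  also have "\<dots> = (\<Sum>i\<in>Ix x. ?w i * (norm (?c i))\<^sup>2) - 2 * ((\<Sum>i\<in>Ix x. ?w i *\<^sub>R ?c i) \<bullet> v) + W x * (norm v)\<^sup>2"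
    by (simp add: sum.distrib sum_subtractf inner_sum_left sum_distrib_left W_def sum_distrib_right)
  also have "(\<Sum>i\<in>Ix x. ?w i *\<^sub>R ?c i) = W x *\<^sub>R ?m" using W_grad[OF x] by simp
  finally show ?thesis
    by (simp add: power2_norm_eq_inner inner_diff_left inner_diff_right inner_commute algebra_simps)
qed

lemma W_grad_le:
  assumes x: "x \<in> space M"
  shows "W x * (norm (grad \<xi> x))\<^sup>2 \<le> (\<Sum>i\<in>Ix x. w (x, \<phi> i x) * q \<xi> (x, \<phi> i x))"
proof -
  have "0 \<le> (\<Sum>i\<in>Ix x. w (x, \<phi> i x) * (norm (cobd \<xi> (x, \<phi> i x) - grad \<xi> x))\<^sup>2)"
    by (intro sum_nonneg mult_nonneg_nonneg order_trans[OF _ w_bounds(1)[OF \<phi>_E[OF x]]]) auto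
  moreover have "(\<Sum>i\<in>Ix x. w (x, \<phi> i x) * (norm (cobd \<xi> (x, \<phi> i x)))\<^sup>2) = (\<Sum>i\<in>Ix x. w (x, \<phi> i x) * q \<xi> (x, \<phi> i x))"
    using \<phi>_E[OF x] by (intro sum.cong) (auto simp: q_def)
  ultimately show ?thesis using variance[OF x, of \<xi> "grad \<xi> x"] by simp
qed

lemma grad_norm_integrable:
  assumes \<xi>: "sec \<xi> B"
  shows "integrable M (\<lambda>x. W x * (norm (grad \<xi> x))\<^sup>2)"
proof (rule Bochner_Integration.integrable_bound)
  show "integrable M (\<lambda>x. \<Sum>i\<in>Ix x. w (x, \<phi> i x) * q \<xi> (x, \<phi> i x))"
    using edge_measure_integral(2)[OF bdd_meas_mult[OF bdd_meas_w bdd_meas_q[OF \<xi>]]] .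
  show "(\<lambda>x. W x * (norm (grad \<xi> x))\<^sup>2) \<in> borel_measurable M"
    using W_measurable along_norm[OF grad_along[OF sec_along[OF \<xi>]]] by simp
  show "AE x in M. norm (W x * (norm (grad \<xi> x))\<^sup>2) \<le> norm (\<Sum>i\<in>Ix x. w (x, \<phi> i x) * q \<xi> (x, \<phi> i x))"
  proof (rule AE_I2)
    fix x assume x: "x \<in> space M"
    have "0 \<le> W x * (norm (grad \<xi> x))\<^sup>2" using W_ge[OF x] by simp
    then show "norm (W x * (norm (grad \<xi> x))\<^sup>2) \<le> norm (\<Sum>i\<in>Ix x. w (x, \<phi> i x) * q \<xi> (x, \<phi> i x))"
      using W_grad_le[OF x, of \<xi>] by simp
  qed
qed

lemma grad_norm_le_energy:
  assumes \<xi>: "sec \<xi> B"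
  shows "grad_norm \<xi> \<le> energy \<xi>"
proof -
  have b: "bdd_meas (\<lambda>p. w p * q \<xi> p)" using bdd_meas_mult[OF bdd_meas_w bdd_meas_q[OF \<xi>]] .
  have "grad_norm \<xi> \<le> (\<integral>x. (\<Sum>i\<in>Ix x. w (x, \<phi> i x) * q \<xi> (x, \<phi> i x)) \<partial>M)"
    unfolding grad_norm_def by (rule integral_mono[OF grad_norm_integrable[OF \<xi>] edge_measure_integral(2)[OF b]]) (rule W_grad_le)
  also have "\<dots> = energy \<xi>" using edge_measure_integral(1)[OF b] energy_w[OF \<xi>] by simp
  finally show ?thesis .
qed

text \<open>Transports compose on a triangle and \<open>\<rho> x y\<close> is isometric, so the
  difference of the coboundary on two edges at x is, up to transport and sign, its value on the
  opposite edge.\<close>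

lemma cobd_difference:
  assumes \<xi>: "sec \<xi> B" and T: "(x, y, z) \<in> Tri"
  shows "(norm (cobd \<xi> (x, y) - cobd \<xi> (x, z)))\<^sup>2 = q \<xi> (y, z)"
proof -
  have xz: "(x, z) \<in> E" using Tri_E[OF T] .
  have xy: "(x, y) \<in> E" using Tri_E[OF Tri_swap[OF T]] .
  have yz: "(y, z) \<in> E" using Tri_E[OF Tri_flip[OF T]] .
  have iy: "\<xi> y \<in> H (\<Phi> y)" and iz: "\<xi> z \<in> H (\<Phi> z)" using sec_in[OF \<xi>] E_space[OF yz] by auto
  have rz: "\<rho> y z (\<xi> z) \<in> H (\<Phi> y)" using \<rho>_facts(1)[OF yz yz iz] .
  have "cobd \<xi> (x, y) - cobd \<xi> (x, z) = \<rho> x y (\<xi> y) - \<rho> x y (\<rho> y z (\<xi> z))"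
    using \<rho>_comp[OF xy yz iz] by (simp add: cobd_def)
  also have "\<dots> = \<rho> x y (\<xi> y - \<rho> y z (\<xi> z))" using \<rho>_facts(4)[OF xy xy iy rz] by simp
  finally have "norm (cobd \<xi> (x, y) - cobd \<xi> (x, z)) = norm (\<xi> y - \<rho> y z (\<xi> z))"
    using \<rho>_facts(6)[OF xy xy closed_csubspace_facts(5)[OF H[OF S_space(1)[OF E_S[OF yz]]] iy rz]] by simp
  then show ?thesis using yz by (simp add: q_def cobd_def norm_minus_commute)
qed

text \<open>The link inequality weighs by \<tau>, the gradient by w \<le> \<tau> (1 + \<delta>) / 2;
  l' is what this comparison leaves of the gap.\<close>

definition l' :: real where "l' = 2 * l / (1 + \<delta>)"

text \<open>The cube of \<delta> enters through 1 + \<delta> \<le> 2 \<delta>^2, multiplied by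
  \<delta>.\<close>

lemma l_pos: "0 < l" "\<delta> / 2 < l'"
proof -
  have d3: "\<delta> ^ 3 \<ge> 1" using \<delta>1 by (simp add: one_le_power)
  then show "0 < l" using gap by simp
  have "\<delta> * (1 + \<delta>) / 2 \<le> \<delta> ^ 3"
  proof -
    have "1 + \<delta> \<le> 2 * \<delta>\<^sup>2" using \<delta>1 self_le_power[of \<delta> 2] one_le_power[of \<delta> 2] by simp
    then have "\<delta> * (1 + \<delta>) \<le> \<delta> * (2 * \<delta>\<^sup>2)" using \<delta>1 by (intro mult_left_mono) auto
    then show ?thesis by (simp add: power3_eq_cube power2_eq_square)
  qed
  then have "\<delta> * (1 + \<delta>) / 2 < 2 * l" using gap by simp
  then show "\<delta> / 2 < l'" unfolding l'_def using \<delta>1 by (simp add: field_simps)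
qed

text \<open>The gradient minimizes the w-variance, so the centre m supplied by the link can only
  increase it. Then w is compared with \<tau>, the gap of the link is applied, and differences
  become values on opposite edges.\<close>

lemma link_inequality:
  assumes \<xi>: "sec \<xi> B" and x: "x \<in> space M"
  shows "l' * ((\<Sum>i\<in>Ix x. w (x, \<phi> i x) * q \<xi> (x, \<phi> i x)) - W x * (norm (grad \<xi> x))\<^sup>2) \<le>
    (1/2) * (\<Sum>i\<in>Ix x. \<Sum>j\<in>Ix x. of_bool ((x, \<phi> i x, \<phi> j x) \<in> Tri) * q \<xi> (\<phi> i x, \<phi> j x))"
proof -
  let ?c = "\<lambda>i. cobd \<xi> (x, \<phi> i x)"
  obtain m where m: "l * (\<Sum>i\<in>Ix x. \<tau> (x, \<phi> i x) * (norm (?c i - m))\<^sup>2) \<le>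
      (1/2) * (\<Sum>i\<in>Ix x. \<Sum>j\<in>Ix x. of_bool ((x, \<phi> i x, \<phi> j x) \<in> Tri) * (norm (?c i - ?c j))\<^sup>2)"
    using link_gap[OF x, of ?c] unfolding \<tau>_Ix by blast
  have e1: "(\<Sum>i\<in>Ix x. w (x, \<phi> i x) * q \<xi> (x, \<phi> i x)) = (\<Sum>i\<in>Ix x. w (x, \<phi> i x) * (norm (?c i))\<^sup>2)"
    using \<phi>_E[OF x] by (intro sum.cong) (auto simp: q_def)
  have "0 \<le> W x * (norm (grad \<xi> x - m))\<^sup>2" using W_ge[OF x] by simp
  then have "(\<Sum>i\<in>Ix x. w (x, \<phi> i x) * q \<xi> (x, \<phi> i x)) - W x * (norm (grad \<xi> x))\<^sup>2 \<le>
      (\<Sum>i\<in>Ix x. w (x, \<phi> i x) * (norm (?c i - m))\<^sup>2)"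
    using variance[OF x, of \<xi> m] e1 by simp
  also have "\<dots> \<le> (\<Sum>i\<in>Ix x. (\<tau> (x, \<phi> i x) * (1 + \<delta>) / 2) * (norm (?c i - m))\<^sup>2)"
    using w_bounds(2)[OF \<phi>_E[OF x]] by (intro sum_mono mult_right_mono) auto
  also have "\<dots> = ((1 + \<delta>) / 2) * (\<Sum>i\<in>Ix x. \<tau> (x, \<phi> i x) * (norm (?c i - m))\<^sup>2)"
    by (simp add: sum_distrib_left mult_ac)
  finally have "l' * ((\<Sum>i\<in>Ix x. w (x, \<phi> i x) * q \<xi> (x, \<phi> i x)) - W x * (norm (grad \<xi> x))\<^sup>2) \<le>
      l' * (((1 + \<delta>) / 2) * (\<Sum>i\<in>Ix x. \<tau> (x, \<phi> i x) * (norm (?c i - m))\<^sup>2))"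
    using l_pos(2) \<delta>1 by (intro mult_left_mono) auto
  also have "\<dots> = (l' * ((1 + \<delta>) / 2)) * (\<Sum>i\<in>Ix x. \<tau> (x, \<phi> i x) * (norm (?c i - m))\<^sup>2)"
    by (simp only: mult.assoc)
  also have "l' * ((1 + \<delta>) / 2) = l" using \<delta>1 by (simp add: l'_def)
  also note m
  also have "(\<Sum>i\<in>Ix x. \<Sum>j\<in>Ix x. of_bool ((x, \<phi> i x, \<phi> j x) \<in> Tri) * (norm (?c i - ?c j))\<^sup>2) =
      (\<Sum>i\<in>Ix x. \<Sum>j\<in>Ix x. of_bool ((x, \<phi> i x, \<phi> j x) \<in> Tri) * q \<xi> (\<phi> i x, \<phi> j x))"
    using cobd_difference[OF \<xi>] by (intro sum.cong refl) (auto simp: of_bool_def)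
  finally show ?thesis .
qed

text \<open>The sum at x runs over the edges opposite to x. Flipping the edge from x to its i-th
  neighbour moves the base point onto the opposite edge, at the cost of g \<le> \<delta>. Afterwards
  every edge is counted once for each triangle that contains it, that is \<tau> times.\<close>

lemma triangle_transport:
  assumes \<xi>: "sec \<xi> B"
  shows "integrable M (\<lambda>x. \<Sum>i\<in>Ix x. \<Sum>j\<in>Ix x. of_bool ((x, \<phi> i x, \<phi> j x) \<in> Tri) * q \<xi> (\<phi> i x, \<phi> j x))" (is "integrable M ?L")
    and "(\<integral>x. (\<Sum>i\<in>Ix x. \<Sum>j\<in>Ix x. of_bool ((x, \<phi> i x, \<phi> j x) \<in> Tri) * q \<xi> (\<phi> i x, \<phi> j x)) \<partial>M) \<le> \<delta> * energy \<xi>"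
proof -
  \<comment> \<open>\<open>G (y, x)\<close> sums \<open>q\<close> over the edges at y that span a
    triangle with x; by \<open>triangle_sum_flip\<close> this is the inner sum at x belonging to the
    neighbour y.\<close>
  define G where "G p = (\<Sum>j<d. indicator (D j) (fst p) * (of_bool ((fst p, snd p, \<phi> j (fst p)) \<in> Tri) * q \<xi> (fst p, \<phi> j (fst p))))" for p
  have bG: "bdd_meas G"
    unfolding G_def[abs_def]
  proof (rule bdd_meas_sum_triangles)
    fix j
    obtain C where C: "\<And>p. p \<in> space MM \<Longrightarrow> \<bar>q \<xi> p\<bar> \<le> C" using bdd_meas_q[OF \<xi>] unfolding bdd_meas_def by blast
    have "(\<lambda>p. (fst p, \<phi> j (fst p))) \<in> measurable MM MM"
      using measurable_compose[OF measurable_fst \<phi>[of j]] by (intro measurable_Pair measurable_fst)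
    from measurable_compose[OF this bdd_meas_measurable[OF bdd_meas_q[OF \<xi>]]]
    show "bdd_meas (\<lambda>p. q \<xi> (fst p, \<phi> j (fst p)))"
      using C \<phi>_space by (intro bdd_measI[of _ C]) (auto simp: space_pair_measure)
  qed
  have G: "G (x, y) = (\<Sum>j\<in>Ix x. of_bool ((x, y, \<phi> j x) \<in> Tri) * q \<xi> (x, \<phi> j x))" for x y
    unfolding G_def fst_conv snd_conv by (rule sum_Ix)
  have G0: "0 \<le> G p" for p
    unfolding G_def by (intro sum_nonneg mult_nonneg_nonneg q_nonneg) auto
  have sw: "(\<Sum>i\<in>Ix x. G (\<phi> i x, x)) = ?L x" if x: "x \<in> space M" for x
  proof (intro sum.cong refl)
    fix i
    show "G (\<phi> i x, x) = (\<Sum>j\<in>Ix x. of_bool ((x, \<phi> i x, \<phi> j x) \<in> Tri) * q \<xi> (\<phi> i x, \<phi> j x))"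
      unfolding G using triangle_sum_flip[OF x \<phi>_space[OF x], of i "\<lambda>z. q \<xi> (\<phi> i x, z)"] by simp
  qed
  have "integrable M (\<lambda>x. \<Sum>i\<in>Ix x. G (\<phi> i x, x))" using edge_measure_integral(2)[OF bdd_meas_swap[OF bG]] by simp
  then show int: "integrable M ?L" using sw by (subst (asm) Bochner_Integration.integrable_cong[OF refl]) auto
  have "(\<integral>x. ?L x \<partial>M) = (\<integral>x. (\<Sum>i\<in>Ix x. G (\<phi> i x, x)) \<partial>M)" using sw by (intro Bochner_Integration.integral_cong) auto
  also have "\<dots> = (\<integral>p. G (snd p, fst p) \<partial>edge_measure)" using edge_measure_integral(1)[OF bdd_meas_swap[OF bG]] by simp
  also have "\<dots> = (\<integral>p. g p * G p \<partial>edge_measure)" by (rule edge_measure_flip[OF bG])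
  also have "\<dots> \<le> (\<integral>p. \<delta> * G p \<partial>edge_measure)"
    using g_le G0 by (intro edge_measure_mono bdd_meas_mult bdd_meas_g bG bdd_meas_cmult mult_right_mono) auto
  also have "\<dots> = \<delta> * (\<integral>p. G p \<partial>edge_measure)" by simp
  also have "(\<integral>p. G p \<partial>edge_measure) = (\<integral>x. (\<Sum>i\<in>Ix x. G (x, \<phi> i x)) \<partial>M)" by (rule edge_measure_integral(1)[OF bG])
  also have "\<dots> = (\<integral>x. (\<Sum>j\<in>Ix x. \<tau> (x, \<phi> j x) * q \<xi> (x, \<phi> j x)) \<partial>M)"
  proof (intro Bochner_Integration.integral_cong refl)
    fix x
    have "(\<Sum>i\<in>Ix x. G (x, \<phi> i x)) = (\<Sum>j\<in>Ix x. \<Sum>i\<in>Ix x. of_bool ((x, \<phi> i x, \<phi> j x) \<in> Tri) * q \<xi> (x, \<phi> j x))"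
      unfolding G by (rule sum.swap)
    also have "\<dots> = (\<Sum>j\<in>Ix x. \<tau> (x, \<phi> j x) * q \<xi> (x, \<phi> j x))"
    proof (intro sum.cong refl)
      fix j
      have "(x, \<phi> i x, \<phi> j x) \<in> Tri \<longleftrightarrow> (x, \<phi> j x, \<phi> i x) \<in> Tri" for i using Tri_swap by blast
      then show "(\<Sum>i\<in>Ix x. of_bool ((x, \<phi> i x, \<phi> j x) \<in> Tri) * q \<xi> (x, \<phi> j x)) = \<tau> (x, \<phi> j x) * q \<xi> (x, \<phi> j x)"
        by (simp add: \<tau>_Ix sum_distrib_right)
    qed
    finally show "(\<Sum>i\<in>Ix x. G (x, \<phi> i x)) = (\<Sum>j\<in>Ix x. \<tau> (x, \<phi> j x) * q \<xi> (x, \<phi> j x))" .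
  qed
  also have "\<dots> = energy \<xi>" unfolding energy_def using edge_measure_integral(1)[OF bdd_meas_mult[OF bdd_meas_\<tau> bdd_meas_q[OF \<xi>]]] by simp
  finally show "(\<integral>x. ?L x \<partial>M) \<le> \<delta> * energy \<xi>" .
qed

lemma energy_gap:
  assumes \<xi>: "sec \<xi> B"
  shows "l' * (energy \<xi> - grad_norm \<xi>) \<le> (\<delta> / 2) * energy \<xi>"
proof -
  have b: "bdd_meas (\<lambda>p. w p * q \<xi> p)" using bdd_meas_mult[OF bdd_meas_w bdd_meas_q[OF \<xi>]] .
  have iN: "integrable M (\<lambda>x. W x * (norm (grad \<xi> x))\<^sup>2)" by (rule grad_norm_integrable[OF \<xi>])
  have iE: "integrable M (\<lambda>x. \<Sum>i\<in>Ix x. w (x, \<phi> i x) * q \<xi> (x, \<phi> i x))" by (rule edge_measure_integral(2)[OF b])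
  have "l' * (energy \<xi> - grad_norm \<xi>) = l' * ((\<integral>x. (\<Sum>i\<in>Ix x. w (x, \<phi> i x) * q \<xi> (x, \<phi> i x)) \<partial>M) - (\<integral>x. W x * (norm (grad \<xi> x))\<^sup>2 \<partial>M))"
    using edge_measure_integral(1)[OF b] energy_w[OF \<xi>] by (simp add: grad_norm_def)
  also have "\<dots> = (\<integral>x. l' * ((\<Sum>i\<in>Ix x. w (x, \<phi> i x) * q \<xi> (x, \<phi> i x)) - W x * (norm (grad \<xi> x))\<^sup>2) \<partial>M)"
    using iN iE by (simp add: Bochner_Integration.integral_diff)
  also have "\<dots> \<le> (\<integral>x. (1/2) * (\<Sum>i\<in>Ix x. \<Sum>j\<in>Ix x. of_bool ((x, \<phi> i x, \<phi> j x) \<in> Tri) * q \<xi> (\<phi> i x, \<phi> j x)) \<partial>M)"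
  proof (rule integral_mono)
    show "integrable M (\<lambda>x. l' * ((\<Sum>i\<in>Ix x. w (x, \<phi> i x) * q \<xi> (x, \<phi> i x)) - W x * (norm (grad \<xi> x))\<^sup>2))"
      by (intro integrable_mult_right Bochner_Integration.integrable_diff iN iE)
    show "integrable M (\<lambda>x. (1/2) * (\<Sum>i\<in>Ix x. \<Sum>j\<in>Ix x. of_bool ((x, \<phi> i x, \<phi> j x) \<in> Tri) * q \<xi> (\<phi> i x, \<phi> j x)))"
      by (intro integrable_mult_right triangle_transport(1)[OF \<xi>])
  qed (rule link_inequality[OF \<xi>])
  also have "\<dots> = (1/2) * (\<integral>x. (\<Sum>i\<in>Ix x. \<Sum>j\<in>Ix x. of_bool ((x, \<phi> i x, \<phi> j x) \<in> Tri) * q \<xi> (\<phi> i x, \<phi> j x)) \<partial>M)"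
    by (rule integral_mult_right_zero)
  also have "\<dots> \<le> (1/2) * (\<delta> * energy \<xi>)" by (intro mult_left_mono triangle_transport(2)[OF \<xi>]) simp
  finally show ?thesis by simp
qed

section \<open>Decay of the energy along the descent\<close>

text \<open>Write N for \<open>grad_norm \<xi>\<close>. Adding t times the gradient changes the
  energy by at most - 4 t N + 4 t^2 N: by summation by parts the product of the two coboundaries
  integrates to - 2 N, and the coboundary of the gradient has squared norm at most 4 N. The choice t
  = 1/2 minimizes this bound and gives - N.\<close>

lemma energy_step:
  assumes \<xi>: "sec \<xi> B"
  shows "energy (\<lambda>x. \<xi> x + (1/2) *\<^sub>R grad \<xi> x) \<le> energy \<xi> - grad_norm \<xi>"
proof -
  let ?\<eta> = "grad \<xi>" and ?\<zeta> = "\<lambda>x. \<xi> x + (1/2) *\<^sub>R grad \<xi> x"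
  note \<eta> = grad_sec(1)[OF \<xi>] and \<zeta> = grad_sec(2)[OF \<xi>]
  let ?F0 = "\<lambda>p. cobd \<xi> p \<bullet> ?\<eta> (fst p)"
  define F where "F p = (if p \<in> E then ?F0 p else 0)" for p
  define K where "K p = (norm (?\<eta> (fst p)))\<^sup>2" for p :: "'a \<times> 'a"
  have bF: "bdd_meas F"
    unfolding F_def[abs_def]
  proof (rule bdd_meas_edge_function[where B = "(2 * B) * (2 * B)"])
    show "?F0 \<in> borel_measurable (restrict_space MM E)"
      by (rule along_inner[OF cobd_along(3)[OF sec_along[OF \<xi>]] cobd_along(2)[OF sec_along[OF \<eta>]]])
    fix p assume p: "p \<in> E"
    have e: "norm (?\<eta> (fst p)) \<le> 2 * B" using sec_norm[OF \<eta>] E_space(1)[of "fst p" "snd p"] p by simp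
    have "\<bar>?F0 p\<bar> \<le> norm (cobd \<xi> p) * norm (?\<eta> (fst p))" by (rule Cauchy_Schwarz_ineq2)
    also have "\<dots> \<le> (2 * B) * (2 * B)" using norm_cobd[OF \<xi> p] e order_trans[OF norm_ge_zero e]
      by (intro mult_mono) auto
    finally show "\<bar>?F0 p\<bar> \<le> (2 * B) * (2 * B)" .
  qed
  have bK: "bdd_meas K"
  proof (rule bdd_measI[where B = "(2 * B)\<^sup>2"])
    show "K \<in> borel_measurable MM"
      unfolding K_def[abs_def]
      by (intro borel_measurable_power measurable_compose[OF measurable_fst along_norm[OF sec_along[OF \<eta>]]])
    show "\<bar>K p\<bar> \<le> (2 * B)\<^sup>2" if "p \<in> space MM" for p
    proof -
      have "norm (?\<eta> (fst p)) \<le> 2 * B" using sec_norm[OF \<eta>] that by (auto simp: space_pair_measure)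
      from power_mono[OF this norm_ge_zero, of 2] show ?thesis by (simp add: K_def)
    qed
  qed
  have wF: "(\<integral>p. w p * F p \<partial>edge_measure) = grad_norm \<xi>"
  proof -
    have "(\<integral>p. w p * F p \<partial>edge_measure) = (\<integral>x. (\<Sum>i\<in>Ix x. w (x, \<phi> i x) * F (x, \<phi> i x)) \<partial>M)"
      by (rule edge_measure_integral(1)[OF bdd_meas_mult[OF bdd_meas_w bF]])
    also have "\<dots> = grad_norm \<xi>"
      unfolding grad_norm_def
    proof (intro Bochner_Integration.integral_cong refl)
      fix x assume x: "x \<in> space M"
      have "(\<Sum>i\<in>Ix x. w (x, \<phi> i x) * F (x, \<phi> i x)) = (\<Sum>i\<in>Ix x. (w (x, \<phi> i x) *\<^sub>R cobd \<xi> (x, \<phi> i x)) \<bullet> ?\<eta> x)"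
        using \<phi>_E[OF x] by (intro sum.cong) (auto simp: F_def)
      also have "\<dots> = (W x *\<^sub>R ?\<eta> x) \<bullet> ?\<eta> x" by (simp add: W_grad[OF x] inner_sum_left)
      finally show "(\<Sum>i\<in>Ix x. w (x, \<phi> i x) * F (x, \<phi> i x)) = W x * (norm (?\<eta> x))\<^sup>2"
        by (simp add: power2_norm_eq_inner)
    qed
    finally show ?thesis .
  qed
  have wK: "(\<integral>p. w p * K p \<partial>edge_measure) = grad_norm \<xi>"
    using edge_measure_integral(1)[OF bdd_meas_mult[OF bdd_meas_w bK]] by (simp add: K_def grad_norm_def W_def sum_distrib_right)
  have expand: "q ?\<zeta> p \<le> q \<xi> p - F p - F (snd p, fst p) + (1/2) * (K p + K (snd p, fst p))" if p: "p \<in> E" for p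
  proof -
    obtain x y where xy: "p = (x, y)" by (cases p)
    have E: "(x, y) \<in> E" and E': "(y, x) \<in> E" using p xy E_sym by auto
    note sx = E_space(1)[OF E] and sy = E_space(2)[OF E]
    have i: "\<xi> y \<in> H (\<Phi> y)" "?\<eta> y \<in> H (\<Phi> y)" "?\<eta> x \<in> H (\<Phi> x)" "(1/2) *\<^sub>R ?\<eta> y \<in> H (\<Phi> y)"
      using sec_in[OF \<xi>] sec_in[OF \<eta>] sx sy closed_csubspace_facts(4)[OF H[OF S_space(2)[OF E_S[OF E]]]] by auto
    have ccz: "cobd ?\<zeta> p = cobd \<xi> p + (1/2) *\<^sub>R cobd ?\<eta> p"
      using \<rho>_facts(2)[OF E E i(1,4)] \<rho>_facts(3)[OF E E i(2)] by (simp add: cobd_def xy scaleR_diff_right)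
    have r: "\<rho> x y (?\<eta> y) \<in> H (\<Phi> x)" using \<rho>_facts(1)[OF E E i(2)] .
    \<comment> \<open>Isometry of the transport rewrites the product at y as one at x, where it
      combines with \<open>F p\<close> into the product of the two coboundaries.\<close>
    have "cobd \<xi> (y, x) \<bullet> ?\<eta> y = - (\<rho> y x (cobd \<xi> (x, y)) \<bullet> \<rho> y x (\<rho> x y (?\<eta> y)))"
      using cobd_flip[OF \<xi> E] \<rho>_inv[OF E i(2)] by simp
    also have "\<dots> = - (cobd \<xi> (x, y) \<bullet> \<rho> x y (?\<eta> y))"
      using \<rho>_facts(5)[OF E' E' cobd_in[OF \<xi> E] r] by simp
    finally have in1: "cobd \<xi> p \<bullet> cobd ?\<eta> p = - F (snd p, fst p) - F p"
      using E E' by (simp add: F_def xy) (simp add: cobd_def[of ?\<eta>] inner_diff_right)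
    have "(norm (cobd ?\<eta> p))\<^sup>2 \<le> 2 * ((norm (\<rho> x y (?\<eta> y)))\<^sup>2 + (norm (?\<eta> x))\<^sup>2)"
    proof -
      have "(norm (u - v))\<^sup>2 + (norm (u + v))\<^sup>2 = 2 * ((norm u)\<^sup>2 + (norm v)\<^sup>2)" for u v :: 'h
        by (simp add: power2_norm_eq_inner inner_diff_left inner_diff_right inner_add_left inner_add_right inner_commute)
      then show ?thesis by (simp add: cobd_def xy) (smt (verit) zero_le_power2)
    qed
    also have "norm (\<rho> x y (?\<eta> y)) = norm (?\<eta> y)" using \<rho>_facts(6)[OF E E i(2)] .
    finally have in2: "(norm (cobd ?\<eta> p))\<^sup>2 \<le> 2 * (K (snd p, fst p) + K p)" by (simp add: K_def xy)
    have "q ?\<zeta> p = (norm (cobd \<xi> p))\<^sup>2 + cobd \<xi> p \<bullet> cobd ?\<eta> p + (1/4) * (norm (cobd ?\<eta> p))\<^sup>2"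
      using p by (simp add: q_def ccz power2_norm_eq_inner inner_add_left inner_add_right inner_commute algebra_simps)
    then show ?thesis using in1 in2 p by (simp add: q_def)
  qed
  let ?R = "\<lambda>p. w p * q \<xi> p + (-1) * (w p * F p) + (-1) * (w p * F (snd p, fst p)) + (1/2) * (w p * K p + w p * K (snd p, fst p))"
  have bs: "bdd_meas (\<lambda>p. w p * q \<xi> p)" "bdd_meas (\<lambda>p. w p * F p)" "bdd_meas (\<lambda>p. w p * F (snd p, fst p))" "bdd_meas (\<lambda>p. w p * K p)"
    "bdd_meas (\<lambda>p. w p * K (snd p, fst p))"
    by (intro bdd_meas_mult bdd_meas_w bdd_meas_q[OF \<xi>] bF bK bdd_meas_swap)+
  have "energy ?\<zeta> = (\<integral>p. w p * q ?\<zeta> p \<partial>edge_measure)" using energy_w[OF \<zeta>] by simp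
  also have "\<dots> \<le> integral\<^sup>L edge_measure ?R"
  proof (rule edge_measure_mono)
    show "bdd_meas (\<lambda>p. w p * q ?\<zeta> p)" by (intro bdd_meas_mult bdd_meas_w bdd_meas_q[OF \<zeta>])
    show "bdd_meas ?R" by (intro bdd_meas_add bdd_meas_cmult bs)
    fix p assume p: "p \<in> E"
    have "w p * q ?\<zeta> p \<le> w p * (q \<xi> p - F p - F (snd p, fst p) + (1/2) * (K p + K (snd p, fst p)))"
      using expand[OF p] w_bounds(1)[OF p] by (intro mult_left_mono) auto
    then show "w p * q ?\<zeta> p \<le> ?R p" by (simp add: algebra_simps)
  qed
  also have "integral\<^sup>L edge_measure ?R = energy \<xi> - grad_norm \<xi> - grad_norm \<xi> + (1/2) * (grad_norm \<xi> + grad_norm \<xi>)"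
    using bs[THEN bdd_meas_integrable] energy_w[OF \<xi>] wF wK w_integral_swap[OF bF] w_integral_swap[OF bK] by simp
  finally show ?thesis by simp
qed

text \<open>\<open>energy_gap\<close> solved for the gradient: \<kappa> times the energy is at most
  \<open>grad_norm\<close>. In r only half of \<kappa> is spent, which keeps r at least 1/2 and
  \<open>sqrt r\<close> positive.\<close>

definition \<kappa> :: real where "\<kappa> = (l' - \<delta> / 2) / l'"

definition r :: real where "r = 1 - \<kappa> / 2"

lemma l'_pos: "0 < l'"
  using l_pos(2) \<delta>1 by simp

lemma \<kappa>: "0 < \<kappa>" "\<kappa> \<le> 1"
  using l'_pos l_pos(2) \<delta>1 by (simp_all add: \<kappa>_def field_simps)

lemma r: "1/2 \<le> r" "r < 1"
  using \<kappa> by (simp_all add: r_def)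

lemma energy_contraction:
  assumes \<xi>: "sec \<xi> B"
  shows "energy (\<lambda>x. \<xi> x + (1/2) *\<^sub>R grad \<xi> x) \<le> r * energy \<xi>"
proof -
  have "(l' - \<delta> / 2) * energy \<xi> \<le> l' * grad_norm \<xi>" using energy_gap[OF \<xi>] by (simp add: algebra_simps)
  then have "\<kappa> * energy \<xi> \<le> grad_norm \<xi>" using l'_pos by (simp add: \<kappa>_def field_simps)
  moreover have "0 \<le> \<kappa> * energy \<xi>" using \<kappa> energy_nonneg by (intro mult_nonneg_nonneg) auto
  ultimately have "energy \<xi> - grad_norm \<xi> \<le> r * energy \<xi>" by (simp add: r_def algebra_simps)
  then show ?thesis using energy_step[OF \<xi>] by simp
qed

definition descent :: "('a \<Rightarrow> 'h) \<Rightarrow> nat \<Rightarrow> 'a \<Rightarrow> 'h" where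
  "descent \<xi> k = ((\<lambda>\<xi> x. \<xi> x + (1/2) *\<^sub>R grad \<xi> x) ^^ k) \<xi>"

lemma descent_Suc: "descent \<xi> (Suc k) = (\<lambda>x. descent \<xi> k x + (1/2) *\<^sub>R grad (descent \<xi> k) x)"
  by (simp add: descent_def)

lemma descent_sec: "sec \<xi> B \<Longrightarrow> sec (descent \<xi> k) B"
  by (induction k) (simp_all add: descent_Suc grad_sec(2), simp add: descent_def)

lemma descent_energy:
  assumes \<xi>: "sec \<xi> B"
  shows "energy (descent \<xi> k) \<le> r ^ k * energy \<xi>"
proof (induction k)
  case 0
  then show ?case by (simp add: descent_def)
next
  case (Suc k)
  have "energy (descent \<xi> (Suc k)) \<le> r * energy (descent \<xi> k)"
    unfolding descent_Suc by (rule energy_contraction[OF descent_sec[OF \<xi>]])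
  also have "\<dots> \<le> r * (r ^ k * energy \<xi>)" using Suc r by (intro mult_left_mono) auto
  finally show ?case by simp
qed

text \<open>The inequality 2 n s \<le> n^2 + s^2 converts a bound in L^2 into one in L^1. Together
  with 1 \<le> 2 W and total mass at most 1 it yields s/4 + s/2.\<close>

lemma grad_L1:
  assumes \<xi>: "sec \<xi> B" and s: "s > 0" and e: "energy \<xi> \<le> s\<^sup>2"
  shows "(\<integral>\<^sup>+x. ennreal (norm ((1/2) *\<^sub>R grad \<xi> x)) \<partial>M) \<le> ennreal (3/4 * s)"
proof -
  interpret M: finite_measure M by (rule finM)
  let ?f = "\<lambda>x. s / 4 + (W x * (norm (grad \<xi> x))\<^sup>2) * (1 / (2 * s))"
  have int: "integrable M ?f" using grad_norm_integrable[OF \<xi>] by simp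
  have le: "norm ((1/2) *\<^sub>R grad \<xi> x) \<le> ?f x" if x: "x \<in> space M" for x
  proof -
    let ?n = "norm (grad \<xi> x)"
    have "0 \<le> (?n - s)\<^sup>2" by simp
    then have "2 * ?n * s \<le> ?n\<^sup>2 + s\<^sup>2" by (simp add: power2_diff)
    also have "?n\<^sup>2 \<le> (2 * W x) * ?n\<^sup>2" using mult_right_mono[of 1 "2 * W x" "?n\<^sup>2"] W_ge[OF x] by simp
    finally have "2 * ?n * s / (4 * s) \<le> (2 * (W x * ?n\<^sup>2) + s\<^sup>2) / (4 * s)" using s by (intro divide_right_mono) auto
    then show ?thesis using s by (simp add: field_simps power2_eq_square)
  qed
  have f0: "0 \<le> ?f x" if x: "x \<in> space M" for x using le[OF x] norm_ge_zero order_trans by blast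
  have "(\<integral>\<^sup>+x. ennreal (norm ((1/2) *\<^sub>R grad \<xi> x)) \<partial>M) \<le> (\<integral>\<^sup>+x. ennreal (?f x) \<partial>M)"
    using le by (intro nn_integral_mono ennreal_leI)
  also have "\<dots> = ennreal (\<integral>x. ?f x \<partial>M)" using int f0 by (intro nn_integral_eq_integral AE_I2) auto
  also have "(\<integral>x. ?f x \<partial>M) = s / 4 * measure M (space M) + grad_norm \<xi> * (1 / (2 * s))"
    using grad_norm_integrable[OF \<xi>] by (simp add: grad_norm_def)
  also have "\<dots> \<le> s / 4 * 1 + s\<^sup>2 * (1 / (2 * s))"
    using s massM grad_norm_le_energy[OF \<xi>] e by (intro add_mono mult_left_mono mult_right_mono) auto
  also have "\<dots> = 3/4 * s" using s by (simp add: field_simps power2_eq_square)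
  finally show ?thesis by (simp add: ennreal_leI)
qed

section \<open>Limits and invariant sections\<close>

text \<open>The edges that start in a null set are null, and the flip of the edge measure has a
  density, so the edges that end in it are null too.\<close>

lemma AE_neighbours:
  assumes "AE x in M. P x"
  shows "AE x in M. \<forall>y. (x, y) \<in> E \<longrightarrow> P y"
proof -
  obtain Z where Z: "{x \<in> space M. \<not> P x} \<subseteq> Z" "emeasure M Z = 0" "Z \<in> sets M" using assms by (rule AE_E)
  have Zsp: "Z \<subseteq> space M" using sets.sets_into_space[OF Z(3)] .
  define A where "A = Z \<times> space M"
  define A' where "A' = space M \<times> Z"
  have A: "A \<in> sets MM" and A': "A' \<in> sets MM" using Z(3) by (auto simp: A_def A'_def)
  have "AE x in M. x \<notin> Z" using Z by (intro AE_not_in) auto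
  then have "AE x in M. \<forall>y. (x, y) \<in> E \<longrightarrow> (x, y) \<notin> A" by eventually_elim (auto simp: A_def)
  then have "emeasure edge_measure A = 0" using edge_measure_null_iff[OF A] by simp
  then have "A \<in> null_sets edge_measure" using A by auto
  then have "(\<integral>\<^sup>+p. ennreal (g p) * indicator A p \<partial>edge_measure) = 0" by (rule nn_integral_null_set)
  then have "emeasure (density edge_measure (\<lambda>p. ennreal (g p))) A = 0"
    using A g_meas by (subst emeasure_density) auto
  then have "emeasure (distr edge_measure MM (\<lambda>p. (snd p, fst p))) A = 0" unfolding edge_measure_flip_measure .
  then have "emeasure edge_measure ((\<lambda>p. (snd p, fst p)) -` A \<inter> space edge_measure) = 0" using A by (subst (asm) emeasure_distr) auto
  moreover have "(\<lambda>p. (snd p, fst p)) -` A \<inter> space edge_measure = A'" using Zsp by (auto simp: A_def A'_def space_pair_measure)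
  ultimately have "AE x in M. \<forall>y. (x, y) \<in> E \<longrightarrow> (x, y) \<notin> A'" using edge_measure_null_iff[OF A'] by simp
  then show ?thesis
  proof eventually_elim
    case (elim x)
    show ?case
    proof (intro allI impI)
      fix y assume E: "(x, y) \<in> E"
      then have "y \<notin> Z" using elim E_space(1)[OF E] by (auto simp: A'_def)
      then show "P y" using Z(1) E_space(2)[OF E] by blast
    qed
  qed
qed

text \<open>Dominated convergence with majorant \<tau> (2 B)^2. It serves twice: for the descent
  towards its limit, and for almost invariant sections, whose energies are compared with that of the
  zero section.\<close>

lemma energy_limit:
  assumes \<xi>: "\<And>k. sec (\<xi> k) B" and \<zeta>: "sec \<zeta> B"
    and lim: "AE x in M. \<forall>y. (x, y) \<in> E \<longrightarrow> (\<lambda>k. q (\<xi> k) (x, y)) \<longlonglongrightarrow> q \<zeta> (x, y)"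
  shows "(\<lambda>k. energy (\<xi> k)) \<longlonglongrightarrow> energy \<zeta>"
  unfolding energy_def
proof (rule integral_dominated_convergence)
  have b: "bdd_meas (\<lambda>p. \<tau> p * q \<eta> p)" if "sec \<eta> B" for \<eta> by (intro bdd_meas_mult bdd_meas_\<tau> bdd_meas_q[OF that])
  show "(\<lambda>p. \<tau> p * q \<zeta> p) \<in> borel_measurable edge_measure" "\<And>k. (\<lambda>p. \<tau> p * q (\<xi> k) p) \<in> borel_measurable edge_measure"
    using bdd_meas_measurable[OF b] \<xi> \<zeta> by auto
  show "integrable edge_measure (\<lambda>p. \<tau> p * (2 * B)\<^sup>2)" by (intro bdd_meas_integrable bdd_meas_mult bdd_meas_\<tau> bdd_meas_const)
  have ms: "{p \<in> space MM. (\<lambda>k. q (\<xi> k) p) \<longlonglongrightarrow> q \<zeta> p} \<in> sets MM"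
  proof -
    have "q (\<xi> k) \<in> borel_measurable MM" for k using bdd_meas_measurable[OF bdd_meas_q[OF \<xi>]] .
    moreover have "q \<zeta> \<in> borel_measurable MM" using bdd_meas_measurable[OF bdd_meas_q[OF \<zeta>]] .
    ultimately have "{p \<in> space MM. (\<lambda>k. q (\<xi> k) p - q \<zeta> p) \<longlonglongrightarrow> 0} \<in> sets MM" by measurable
    then show ?thesis by (simp add: LIM_zero_iff)
  qed
  have "AE p in edge_measure. (\<lambda>k. q (\<xi> k) p) \<longlonglongrightarrow> q \<zeta> p" using AE_edge_measure[OF ms] lim by simp
  then show "AE p in edge_measure. (\<lambda>k. \<tau> p * q (\<xi> k) p) \<longlonglongrightarrow> \<tau> p * q \<zeta> p" by eventually_elim (rule tendsto_mult_left)
  show "AE p in edge_measure. norm (\<tau> p * q (\<xi> k) p) \<le> \<tau> p * (2 * B)\<^sup>2" for k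
    using AE_edge_measure_E
  proof eventually_elim
    fix p assume p: "p \<in> E"
    have "q (\<xi> k) p \<le> (2 * B)\<^sup>2" using power_mono[OF norm_cobd[OF \<xi> p] norm_ge_zero, of k 2] p by (simp add: q_def)
    then show "norm (\<tau> p * q (\<xi> k) p) \<le> \<tau> p * (2 * B)\<^sup>2"
      using \<tau>_ge1[OF p] q_nonneg[of "\<xi> k" p] by (simp add: abs_mult mult_left_mono)
  qed
qed

lemma energy_zero:
  assumes \<xi>: "sec \<xi> B" and 0: "energy \<xi> = 0"
  shows "AE x in M. \<forall>y. (x, y) \<in> E \<longrightarrow> cobd \<xi> (x, y) = 0"
proof -
  have b: "bdd_meas (\<lambda>p. \<tau> p * q \<xi> p)" by (intro bdd_meas_mult bdd_meas_\<tau> bdd_meas_q[OF \<xi>])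
  have nn: "AE p in edge_measure. 0 \<le> \<tau> p * q \<xi> p"
    using AE_edge_measure_E by eventually_elim (use \<tau>_ge1 q_nonneg in \<open>force intro: mult_nonneg_nonneg\<close>)
  have "AE p in edge_measure. \<tau> p * q \<xi> p = 0"
    using integral_nonneg_eq_0_iff_AE[OF bdd_meas_integrable[OF b] nn] 0 by (simp add: energy_def)
  moreover have "{p \<in> space MM. \<tau> p * q \<xi> p = 0} \<in> sets MM"
    using bdd_meas_measurable[OF b] by measurable
  ultimately have "AE x in M. \<forall>y. (x, y) \<in> E \<longrightarrow> \<tau> (x, y) * q \<xi> (x, y) = 0" using AE_edge_measure by simp
  then show ?thesis
  proof eventually_elim
    case (elim x)
    show ?case
    proof (intro allI impI)
      fix y assume E: "(x, y) \<in> E"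
      then have "q \<xi> (x, y) = 0" using elim \<tau>_ge1[OF E] by fastforce
      then show "cobd \<xi> (x, y) = 0" using E by (simp add: q_def)
    qed
  qed
qed

text \<open>The sum of the geometric series of increments: 3/4 comes from \<open>grad_L1\<close>,
  and the ratio is \<open>sqrt r\<close> because the energies shrink by r.\<close>

definition C :: real where "C = 3/4 / (1 - sqrt r)"

text \<open>The increments of the descent are summable in \<open>L\<^sup>1\<close>, since the energies decay geometrically; its
  pointwise limit is the invariant section.\<close>

lemma invariant_section_near:
  assumes \<xi>: "sec \<xi> B" and e: "0 < e" "energy \<xi> \<le> e"
  shows "\<exists>\<zeta>. sec \<zeta> B \<and> (AE x in M. \<forall>y. (x, y) \<in> E \<longrightarrow> cobd \<zeta> (x, y) = 0) \<and>
    (\<integral>\<^sup>+x. ennreal (norm (\<zeta> x - \<xi> x)) \<partial>M) \<le> ennreal (C * sqrt e)"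
proof -
  let ?D = "descent \<xi>"
  note Ds = descent_sec[OF \<xi>]
  define inc where "inc k x = ?D (Suc k) x - ?D k x" for k x
  have inc_grad: "inc k x = (1/2) *\<^sub>R grad (?D k) x" for k x by (simp add: inc_def descent_Suc)
  have sr: "0 < sqrt r" "sqrt r < 1" using r by auto
  have incL1: "(\<integral>\<^sup>+x. ennreal (norm (inc k x)) \<partial>M) \<le> ennreal (3/4 * (sqrt e * sqrt r ^ k))" for k
    unfolding inc_grad
  proof (rule grad_L1[OF Ds])
    show "0 < sqrt e * sqrt r ^ k" using e sr by simp
    have "energy (?D k) \<le> r ^ k * energy \<xi>" by (rule descent_energy[OF \<xi>])
    also have "\<dots> \<le> r ^ k * e" using e r by (intro mult_left_mono) auto
    also have "\<dots> = (sqrt e * sqrt r ^ k)\<^sup>2"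
      using e r by (simp add: power_mult_distrib power_mult[symmetric] mult.commute[of k 2]) (simp add: power_mult)
    finally show "energy (?D k) \<le> (sqrt e * sqrt r ^ k)\<^sup>2" .
  qed
  define T where "T x = (\<Sum>k. ennreal (norm (inc k x)))" for x
  have incm: "(\<lambda>x. norm (inc k x)) \<in> borel_measurable M" for k
    unfolding inc_def by (rule along_norm[OF along_diff[OF sec_along[OF Ds] sec_along[OF Ds]]])
  have Tm: "T \<in> borel_measurable M" unfolding T_def using incm by measurable
  have "integral\<^sup>N M T = (\<Sum>k. \<integral>\<^sup>+x. ennreal (norm (inc k x)) \<partial>M)"
    unfolding T_def using incm by (intro nn_integral_suminf) auto
  also have "\<dots> \<le> (\<Sum>k. ennreal (3/4 * (sqrt e * sqrt r ^ k)))" by (intro suminf_le incL1) auto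
  also have "\<dots> = ennreal (C * sqrt e)"
  proof (rule suminf_ennreal_eq)
    show "0 \<le> 3/4 * (sqrt e * sqrt r ^ k)" for k using e sr by simp
    have "(\<lambda>k. (3/4 * sqrt e) * sqrt r ^ k) sums ((3/4 * sqrt e) * (1 / (1 - sqrt r)))"
      using sr by (intro sums_mult geometric_sums) simp
    then show "(\<lambda>k. 3/4 * (sqrt e * sqrt r ^ k)) sums (C * sqrt e)" by (simp add: C_def mult_ac)
  qed
  finally have Tint: "integral\<^sup>N M T \<le> ennreal (C * sqrt e)" .
  then have "integral\<^sup>N M T \<noteq> \<infinity>" by (auto simp: top_unique)
  then have Tfin: "AE x in M. T x \<noteq> \<infinity>" using nn_integral_PInf_AE[OF Tm] by simp
  \<comment> \<open>The conull set where the increments are absolutely summable; elsewhere the limit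
    is set to 0.\<close>
  define X2 where "X2 = {x \<in> space M. T x \<noteq> \<infinity>}"
  have X2: "X2 \<in> sets M" unfolding X2_def using Tm by measurable
  have tele: "?D k x = \<xi> x + (\<Sum>j<k. inc j x)" for k x
    unfolding inc_def by (subst sum_lessThan_telescope) (simp add: descent_def)
  have conv: "convergent (\<lambda>k. ?D k x)" if "x \<in> X2" for x
  proof -
    have "summable (\<lambda>k. norm (inc k x))"
      using that by (intro summable_suminf_not_top) (auto simp: X2_def T_def)
    then have "summable (\<lambda>k. inc k x)" by (rule summable_norm_cancel)
    then have "(\<lambda>k. \<Sum>j<k. inc j x) \<longlonglongrightarrow> (\<Sum>k. inc k x)" by (rule summable_LIMSEQ)
    then have "(\<lambda>k. \<xi> x + (\<Sum>j<k. inc j x)) \<longlonglongrightarrow> \<xi> x + (\<Sum>k. inc k x)" by (intro tendsto_intros)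
    then show ?thesis unfolding tele convergent_def by blast
  qed
  define \<zeta> where "\<zeta> x = (if x \<in> X2 then lim (\<lambda>k. ?D k x) else 0)" for x
  have \<zeta>lim: "(\<lambda>k. ?D k x) \<longlonglongrightarrow> \<zeta> x" if "x \<in> X2" for x
    using conv[OF that] that by (simp add: \<zeta>_def convergent_LIMSEQ_iff)
  have "along M \<Phi> \<zeta>"
  proof (rule along_lim)
    show "along M \<Phi> (\<lambda>x. indicator X2 x *\<^sub>R ?D k x)" for k
      using X2 by (intro along_scaleR sec_along[OF Ds]) simp
    show "(\<lambda>k. indicator X2 x *\<^sub>R ?D k x) \<longlonglongrightarrow> \<zeta> x" for x
      using \<zeta>lim[of x] by (cases "x \<in> X2") (auto simp: \<zeta>_def)
  qed
  moreover have "norm (\<zeta> x) \<le> B" if x: "x \<in> space M" for x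
  proof (cases "x \<in> X2")
    case True
    show ?thesis
      by (rule Lim_bounded[OF tendsto_norm[OF \<zeta>lim[OF True]], of 0]) (use sec_norm[OF Ds x] in simp)
  next
    case False
    have "0 \<le> B" using sec_norm[OF \<xi> x] norm_ge_zero order_trans by blast
    then show ?thesis using False by (simp add: \<zeta>_def)
  qed
  ultimately have \<zeta>s: "sec \<zeta> B" by (simp add: sec_def)
  have X2ae: "AE x in M. x \<in> X2" using Tfin by (rule AE_mp) (auto simp: X2_def)
  have dist: "ennreal (norm (\<zeta> x - \<xi> x)) \<le> T x" if x: "x \<in> X2" for x
  proof (rule Lim_bounded)
    show "(\<lambda>k. ennreal (norm (?D k x - \<xi> x))) \<longlonglongrightarrow> ennreal (norm (\<zeta> x - \<xi> x))"
      by (intro tendsto_intros \<zeta>lim[OF x])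
    show "\<forall>k\<ge>0. ennreal (norm (?D k x - \<xi> x)) \<le> T x"
    proof (intro allI impI)
      fix k
      have "norm (?D k x - \<xi> x) \<le> (\<Sum>j<k. norm (inc j x))" by (simp add: tele norm_sum)
      then have "ennreal (norm (?D k x - \<xi> x)) \<le> (\<Sum>j<k. ennreal (norm (inc j x)))"
        by (simp add: ennreal_leI sum_ennreal)
      also have "\<dots> \<le> T x" unfolding T_def by (intro sum_le_suminf) auto
      finally show "ennreal (norm (?D k x - \<xi> x)) \<le> T x" .
    qed
  qed
  have "(\<integral>\<^sup>+x. ennreal (norm (\<zeta> x - \<xi> x)) \<partial>M) \<le> integral\<^sup>N M T"
    by (rule nn_integral_mono_AE) (use X2ae dist in \<open>auto elim: eventually_mono\<close>)
  then have close: "(\<integral>\<^sup>+x. ennreal (norm (\<zeta> x - \<xi> x)) \<partial>M) \<le> ennreal (C * sqrt e)" using Tint by (rule order_trans)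
  \<comment> \<open>The coboundary on an edge involves both ends, so almost every x needs all its
    neighbours in \<open>X2\<close> as well.\<close>
  have qlim: "AE x in M. \<forall>y. (x, y) \<in> E \<longrightarrow> (\<lambda>k. q (?D k) (x, y)) \<longlonglongrightarrow> q \<zeta> (x, y)"
    using X2ae AE_neighbours[OF X2ae]
  proof eventually_elim
    case (elim x)
    show ?case
    proof (intro allI impI)
      fix y assume E: "(x, y) \<in> E"
      then have y: "y \<in> X2" using elim by blast
      note sy = E_space(2)[OF E]
      have "(\<lambda>k. \<rho> x y (?D k y) - \<rho> x y (\<zeta> y)) \<longlonglongrightarrow> 0"
      proof (rule Lim_null_comparison)
        have "norm (\<rho> x y (?D k y) - \<rho> x y (\<zeta> y)) = norm (?D k y - \<zeta> y)" for k
          using \<rho>_facts(4)[OF E E sec_in[OF Ds sy] sec_in[OF \<zeta>s sy], of k]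
            \<rho>_facts(6)[OF E E closed_csubspace_facts(5)[OF H[OF S_space(2)[OF E_S[OF E]]] sec_in[OF Ds sy] sec_in[OF \<zeta>s sy]], of k]
          by simp
        then show "\<forall>\<^sub>F k in sequentially. norm (\<rho> x y (?D k y) - \<rho> x y (\<zeta> y)) \<le> norm (?D k y - \<zeta> y)"
          by (intro always_eventually allI) simp
        show "(\<lambda>k. norm (?D k y - \<zeta> y)) \<longlonglongrightarrow> 0" using tendsto_norm_zero[OF LIM_zero[OF \<zeta>lim[OF y]]] .
      qed
      then have "(\<lambda>k. \<rho> x y (?D k y)) \<longlonglongrightarrow> \<rho> x y (\<zeta> y)" by (simp add: LIM_zero_iff)
      then have "(\<lambda>k. cobd (?D k) (x, y)) \<longlonglongrightarrow> cobd \<zeta> (x, y)"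
        unfolding cobd_def fst_conv snd_conv by (intro tendsto_diff \<zeta>lim[OF elim(1)])
      then have "(\<lambda>k. (norm (cobd (?D k) (x, y)))\<^sup>2) \<longlonglongrightarrow> (norm (cobd \<zeta> (x, y)))\<^sup>2" by (intro tendsto_intros)
      then show "(\<lambda>k. q (?D k) (x, y)) \<longlonglongrightarrow> q \<zeta> (x, y)" using E by (simp add: q_def)
    qed
  qed
  have "(\<lambda>k. energy (?D k)) \<longlonglongrightarrow> energy \<zeta>" by (rule energy_limit[OF Ds \<zeta>s qlim])
  moreover have "(\<lambda>k. energy (?D k)) \<longlonglongrightarrow> 0"
  proof (rule Lim_null_comparison)
    show "\<forall>\<^sub>F k in sequentially. norm (energy (?D k)) \<le> r ^ k * energy \<xi>"
      using descent_energy[OF \<xi>] energy_nonneg by (intro always_eventually allI) simp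
    have "(\<lambda>k. r ^ k) \<longlonglongrightarrow> 0" using r by (intro LIMSEQ_realpow_zero) auto
    then show "(\<lambda>k. r ^ k * energy \<xi>) \<longlonglongrightarrow> 0" by (rule tendsto_mult_left_zero)
  qed
  ultimately have "energy \<zeta> = 0" by (rule LIMSEQ_unique)
  then show ?thesis using \<zeta>s close energy_zero[OF \<zeta>s] by blast
qed

lemma along_choice:
  assumes u: "\<And>n :: nat. along P \<beta> (u n)" and J: "J \<in> measurable P (count_space UNIV)"
  shows "along P \<beta> (\<lambda>p. u (J p) p)"
  unfolding along_def
proof (intro conjI ballI)
  show "\<beta> \<in> measurable P N" using u[of 0] by (simp add: along_def)
  show "u (J p) p \<in> H (\<beta> p)" if "p \<in> space P" for p using along_in[OF u that] .
  fix s assume "s \<in> Sec"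
  then have "(\<lambda>p. cinner (u n p) (s (\<beta> p))) \<in> borel_measurable P" for n using u[of n] by (simp add: along_def)
  then show "(\<lambda>p. cinner (u (J p) p) (s (\<beta> p))) \<in> borel_measurable P"
    by (rule measurable_compose_countable[OF _ J])
qed

text \<open>The nearby invariant sections may vanish somewhere, but almost every point where all of
  them vanish is at distance 1 from every \<open>\<upsilon> n\<close>, so such points form a null
  set. Norms of invariant sections agree along edges, hence so does the first index J with a nonzero
  value, and normalizing the value chosen by J keeps invariance.\<close>

theorem invariant_unit_section:
  assumes \<xi>: "\<And>n. along M \<Phi> (\<xi> n)" and unit: "\<And>n. AE x in M. norm (\<xi> n x) = 1"
    and ai: "AE x in M. \<forall>y. (x, y) \<in> E \<longrightarrow> (\<lambda>n :: nat. norm (cobd (\<xi> n) (x, y))) \<longlonglongrightarrow> 0"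
  shows "\<exists>\<zeta>. along M \<Phi> \<zeta> \<and> (AE x in M. norm (\<zeta> x) = 1) \<and> (AE x in M. \<forall>y. (x, y) \<in> E \<longrightarrow> \<rho> x y (\<zeta> y) = \<zeta> x)"
proof -
  interpret M: finite_measure M by (rule finM)
  \<comment> \<open>The norm is 1 only almost everywhere; setting the section to 0 elsewhere
    provides the bound 1 at every point.\<close>
  define \<upsilon> where "\<upsilon> n x = indicator {x \<in> space M. norm (\<xi> n x) = 1} x *\<^sub>R \<xi> n x" for n x
  have \<upsilon>: "sec (\<upsilon> n) 1" for n
  proof -
    have "{x \<in> space M. norm (\<xi> n x) = 1} \<in> sets M" using along_norm[OF \<xi>[of n]] by measurable
    then have "along M \<Phi> (\<upsilon> n)" unfolding \<upsilon>_def[abs_def] by (intro along_scaleR \<xi>) simp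
    then show ?thesis by (simp add: sec_def \<upsilon>_def indicator_def)
  qed
  have eqae: "AE x in M. \<forall>n. \<upsilon> n x = \<xi> n x \<and> norm (\<xi> n x) = 1"
    unfolding AE_all_countable
  proof
    fix n
    show "AE x in M. \<upsilon> n x = \<xi> n x \<and> norm (\<xi> n x) = 1"
      using unit[of n] AE_space by eventually_elim (simp add: \<upsilon>_def)
  qed
  define z where "z = (\<lambda>x :: 'a. 0 :: 'h)"
  have z: "sec z 1"
    using along_scaleR[OF \<xi>[of 0], of "\<lambda>_. 0"] by (simp add: sec_def z_def)
  have qz: "q z p = 0" for p
  proof (cases "p \<in> E")
    case True
    then obtain x y where p: "p = (x, y)" "(x, y) \<in> E" by (cases p) auto
    have "\<rho> x y (0 *\<^sub>R 0) = 0 *\<^sub>R \<rho> x y 0"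
      by (rule \<rho>_facts(3)[OF p(2) p(2) closed_csubspace_facts(1)[OF H[OF S_space(2)[OF E_S[OF p(2)]]]]])
    then show ?thesis by (simp add: q_def cobd_def z_def p)
  qed (simp add: q_def)
  have "(\<lambda>n. energy (\<upsilon> n)) \<longlonglongrightarrow> energy z"
  proof (rule energy_limit[OF \<upsilon> z])
    show "AE x in M. \<forall>y. (x, y) \<in> E \<longrightarrow> (\<lambda>n. q (\<upsilon> n) (x, y)) \<longlonglongrightarrow> q z (x, y)"
      using ai eqae AE_neighbours[OF eqae]
    proof eventually_elim
      case (elim x)
      show ?case
      proof (intro allI impI)
        fix y assume E: "(x, y) \<in> E"
        then have "cobd (\<upsilon> n) (x, y) = cobd (\<xi> n) (x, y)" for n using elim by (simp add: cobd_def)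
        moreover have "(\<lambda>n. (norm (cobd (\<xi> n) (x, y)))\<^sup>2) \<longlonglongrightarrow> 0\<^sup>2" using elim E by (intro tendsto_power) blast
        ultimately show "(\<lambda>n. q (\<upsilon> n) (x, y)) \<longlonglongrightarrow> q z (x, y)" using E qz by (simp add: q_def[of "\<upsilon> _"])
      qed
    qed
  qed
  moreover have "energy z = 0" by (simp add: energy_def qz)
  ultimately have En0: "(\<lambda>n. energy (\<upsilon> n)) \<longlonglongrightarrow> 0" by simp
  \<comment> \<open>The summand 1 / (n + 1) keeps e n positive, as
    \<open>invariant_section_near\<close> requires, even when the energy is 0.\<close>
  define e where "e n = energy (\<upsilon> n) + 1 / real (Suc n)" for n
  have e: "0 < e n" "energy (\<upsilon> n) \<le> e n" for n using energy_nonneg[of "\<upsilon> n"] by (auto simp: e_def add_nonneg_pos)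
  have "(\<lambda>n. e n) \<longlonglongrightarrow> 0 + 0" unfolding e_def by (intro tendsto_add En0 LIMSEQ_Suc[OF lim_1_over_n])
  then have "(\<lambda>n. C * sqrt (e n)) \<longlonglongrightarrow> C * sqrt 0" by (intro tendsto_intros) simp
  then have small: "(\<lambda>n. ennreal (C * sqrt (e n))) \<longlonglongrightarrow> 0" using tendsto_ennrealI by fastforce
  have "\<forall>n. \<exists>\<zeta>. sec \<zeta> 1 \<and> (AE x in M. \<forall>y. (x, y) \<in> E \<longrightarrow> cobd \<zeta> (x, y) = 0) \<and>
    (\<integral>\<^sup>+x. ennreal (norm (\<zeta> x - \<upsilon> n x)) \<partial>M) \<le> ennreal (C * sqrt (e n))"
    by (intro allI invariant_section_near[OF \<upsilon> e])
  from choice[OF this] obtain Z where Z': "\<forall>n. sec (Z n) 1 \<and> (AE x in M. \<forall>y. (x, y) \<in> E \<longrightarrow> cobd (Z n) (x, y) = 0) \<and>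
    (\<integral>\<^sup>+x. ennreal (norm (Z n x - \<upsilon> n x)) \<partial>M) \<le> ennreal (C * sqrt (e n))" by (elim exE)
  have Zs: "sec (Z n) 1" and Zinv: "AE x in M. \<forall>y. (x, y) \<in> E \<longrightarrow> cobd (Z n) (x, y) = 0"
    and Zclose: "(\<integral>\<^sup>+x. ennreal (norm (Z n x - \<upsilon> n x)) \<partial>M) \<le> ennreal (C * sqrt (e n))" for n
    using Z' by simp_all
  have Zm: "(\<lambda>x. norm (Z n x)) \<in> borel_measurable M" for n using along_norm[OF sec_along[OF Zs]] .
  define bad where "bad = {x \<in> space M. \<forall>n. norm (Z n x) = 0}"
  have badm: "bad \<in> sets M" unfolding bad_def using Zm by measurable
  have "emeasure M bad \<le> ennreal (C * sqrt (e n))" for n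
  proof -
    have "emeasure M bad = (\<integral>\<^sup>+x. indicator bad x \<partial>M)" using badm by simp
    also have "\<dots> \<le> (\<integral>\<^sup>+x. ennreal (norm (Z n x - \<upsilon> n x)) \<partial>M)"
      by (rule nn_integral_mono_AE) (use eqae in eventually_elim, auto simp: bad_def indicator_def)
    also note Zclose[of n]
    finally show ?thesis .
  qed
  then have "emeasure M bad \<le> 0" using small by (intro LIMSEQ_le_const[OF small]) auto
  then have "bad \<in> null_sets M" using badm by auto
  then have good: "AE x in M. x \<notin> bad" by (rule AE_not_in)
  define J where "J x = (LEAST n. norm (Z n x) \<noteq> 0)" for x
  have Jm: "J \<in> measurable M (count_space UNIV)" unfolding J_def using Zm by measurable
  define \<zeta> where "\<zeta> x = (1 / norm (Z (J x) x)) *\<^sub>R Z (J x) x" for x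
  have aJ: "along M \<Phi> (\<lambda>x. Z (J x) x)" by (rule along_choice[OF sec_along[OF Zs] Jm])
  have "along M \<Phi> \<zeta>" unfolding \<zeta>_def[abs_def]
    using along_norm[OF aJ] by (intro along_scaleR aJ) simp
  moreover have "AE x in M. norm (\<zeta> x) = 1"
    using good AE_space
  proof eventually_elim
    case (elim x)
    then have "\<exists>n. norm (Z n x) \<noteq> 0" by (auto simp: bad_def)
    then have "norm (Z (J x) x) \<noteq> 0" unfolding J_def by (rule LeastI_ex)
    then show ?case by (simp add: \<zeta>_def)
  qed
  moreover have "AE x in M. \<forall>y. (x, y) \<in> E \<longrightarrow> \<rho> x y (\<zeta> y) = \<zeta> x"
  proof -
    have "AE x in M. \<forall>n. \<forall>y. (x, y) \<in> E \<longrightarrow> cobd (Z n) (x, y) = 0" using Zinv by (simp add: AE_all_countable)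
    then show ?thesis
    proof eventually_elim
      case (elim x)
      show ?case
      proof (intro allI impI)
        fix y assume E: "(x, y) \<in> E"
        have eq: "\<rho> x y (Z n y) = Z n x" for n using elim E by (simp add: cobd_def)
        have inH: "Z n y \<in> H (\<Phi> y)" for n using sec_in[OF Zs E_space(2)[OF E]] .
        have nrm: "norm (Z n y) = norm (Z n x)" for n
          using \<rho>_facts(6)[OF E E inH, of n] eq[of n] by simp
        then have "J y = J x" by (simp add: J_def)
        then show "\<rho> x y (\<zeta> y) = \<zeta> x"
          using \<rho>_facts(3)[OF E E inH] eq nrm by (simp add: \<zeta>_def)
      qed
    qed
  qed
  ultimately show ?thesis by blast
qed

end

section \<open>Edges of a periodic complex\<close>

lemma ulf_complex_facts:
  assumes mr: "measured_eqrel M R" and \<Sigma>: "ulf_periodic_complex_2 M R \<Sigma>"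
  shows "edge_set \<Sigma> \<subseteq> R" "(x, y) \<in> edge_set \<Sigma> \<Longrightarrow> (y, x) \<in> edge_set \<Sigma>"
    "edge_set \<Sigma> \<in> sets (M \<Otimes>\<^sub>M M)" "triangle_set \<Sigma> \<in> sets (M \<Otimes>\<^sub>M (M \<Otimes>\<^sub>M M))"
    "\<exists>n. \<forall>x\<in>space M. finite {y. (x, y) \<in> edge_set \<Sigma>} \<and> card {y. (x, y) \<in> edge_set \<Sigma>} \<le> n"
    "R \<subseteq> (edge_set \<Sigma>)\<^sup>*"
    "(x, y, z) \<in> triangle_set \<Sigma> \<Longrightarrow> (x, z) \<in> edge_set \<Sigma>"
    "(x, y, z) \<in> triangle_set \<Sigma> \<Longrightarrow> (x, z, y) \<in> triangle_set \<Sigma>"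
    "(x, y, z) \<in> triangle_set \<Sigma> \<Longrightarrow> (y, x, z) \<in> triangle_set \<Sigma>"
proof -
  note d = \<Sigma>[unfolded ulf_periodic_complex_2_def simplicial_complex_2_def]
  have "\<forall>s\<in>\<Sigma>. \<forall>t. t \<noteq> {} \<and> t \<subseteq> s \<longrightarrow> t \<in> \<Sigma>" using d by (elim conjE)
  then have sub: "t \<in> \<Sigma>" if "s \<in> \<Sigma>" "t \<noteq> {}" "t \<subseteq> s" for s t using that by simp
  have sR: "s \<times> s \<subseteq> R" if "s \<in> \<Sigma>" for s using d that by simp
  show "edge_set \<Sigma> \<subseteq> R"
  proof
    fix p assume p: "p \<in> edge_set \<Sigma>"
    obtain x y where xy: "p = (x, y)" by (cases p)
    then have "{x, y} \<in> \<Sigma>" using p by (simp add: edge_set_def)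
    from sR[OF this] show "p \<in> R" by (simp add: xy)
  qed
  show sym: "(y, x) \<in> edge_set \<Sigma>" if "(x, y) \<in> edge_set \<Sigma>" for x y
    using that by (auto simp: edge_set_def insert_commute)
  show "edge_set \<Sigma> \<in> sets (M \<Otimes>\<^sub>M M)" "triangle_set \<Sigma> \<in> sets (M \<Otimes>\<^sub>M (M \<Otimes>\<^sub>M M))" using d by auto
  have "\<exists>n. \<forall>x\<in>space M. finite {s\<in>\<Sigma>. x \<in> s} \<and> card {s\<in>\<Sigma>. x \<in> s} \<le> n" using d by (elim conjE)
  then obtain n where n': "\<forall>x\<in>space M. finite {s\<in>\<Sigma>. x \<in> s} \<and> card {s\<in>\<Sigma>. x \<in> s} \<le> n" by (elim exE)
  note n = bspec[OF n']
  have "finite {y. (x, y) \<in> edge_set \<Sigma>} \<and> card {y. (x, y) \<in> edge_set \<Sigma>} \<le> n" if x: "x \<in> space M" for x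
  proof -
    have inj: "inj_on (\<lambda>y. {x, y}) {y. (x, y) \<in> edge_set \<Sigma>}" by (auto simp: inj_on_def doubleton_eq_iff)
    have im: "(\<lambda>y. {x, y}) ` {y. (x, y) \<in> edge_set \<Sigma>} \<subseteq> {s\<in>\<Sigma>. x \<in> s}" by (auto simp: edge_set_def)
    have "finite {y. (x, y) \<in> edge_set \<Sigma>}" using inj_on_finite[OF inj im] n[OF x] by simp
    moreover have "card {y. (x, y) \<in> edge_set \<Sigma>} \<le> card {s\<in>\<Sigma>. x \<in> s}"
      using card_inj_on_le[OF inj im] n[OF x] by simp
    ultimately show ?thesis using n[OF x] by linarith
  qed
  then show "\<exists>n. \<forall>x\<in>space M. finite {y. (x, y) \<in> edge_set \<Sigma>} \<and> card {y. (x, y) \<in> edge_set \<Sigma>} \<le> n" by blast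
  have "(edge_set \<Sigma>)\<inverse> = edge_set \<Sigma>" using sym by auto
  moreover have "R = (edge_set \<Sigma> \<union> (edge_set \<Sigma>)\<inverse>)\<^sup>* \<inter> (space M \<times> space M)" using d by (simp add: generates_def)
  ultimately show "R \<subseteq> (edge_set \<Sigma>)\<^sup>*" by auto
  show "(x, z) \<in> edge_set \<Sigma>" if "(x, y, z) \<in> triangle_set \<Sigma>" for x y z
  proof -
    have "{x, y, z} \<in> \<Sigma>" "x \<noteq> z" using that by (auto simp: triangle_set_def)
    then show ?thesis using sub[of "{x, y, z}" "{x, z}"] by (simp add: edge_set_def)
  qed
  show "(x, z, y) \<in> triangle_set \<Sigma>" "(y, x, z) \<in> triangle_set \<Sigma>" if "(x, y, z) \<in> triangle_set \<Sigma>" for x y z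
    using that by (auto simp: triangle_set_def insert_commute)
qed

section \<open>The counting measure and its flip\<close>

text \<open>For indicators both sides count neighbours fibre by fibre; the rest is the standard
  extension to nonnegative functions. It identifies the restriction of the counting measure to E
  with the measure given by the enumeration.\<close>

lemma rel_measure_nn_integral:
  fixes d :: nat
  assumes mr: "measured_eqrel M R" and E: "E \<in> sets (M \<Otimes>\<^sub>M M)" "E \<subseteq> R"
    and D: "\<And>i. D i \<in> sets M" and \<phi>: "\<And>i. \<phi> i \<in> measurable M M"
    and enum: "\<And>x. x \<in> X \<Longrightarrow> bij_betw (\<lambda>i. \<phi> i x) {i. i < d \<and> x \<in> D i} {y. (x, y) \<in> E}"
    and X: "E \<subseteq> X \<times> UNIV" "\<And>i. D i \<subseteq> X"
    and F: "F \<in> borel_measurable (M \<Otimes>\<^sub>M M)"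
  shows "(\<integral>\<^sup>+p. indicator E p * F p \<partial>rel_measure M R) =
    (\<Sum>i<d. \<integral>\<^sup>+x. indicator (D i) x * F (x, \<phi> i x) \<partial>M)"
proof -
  note f = measured_eqrel_facts[OF mr]
  let ?h = "rel_measure M R" and ?MM = "M \<Otimes>\<^sub>M M"
  have hm: "u \<in> borel_measurable ?h" if "u \<in> borel_measurable ?MM" for u :: "_ \<Rightarrow> ennreal"
    using measurable_restrict_space1[OF that, of R] measurable_cong_sets[OF rel_measure_sets(1)[OF mr] refl] by blast
  have Em: "(indicator E :: _ \<Rightarrow> ennreal) \<in> borel_measurable ?h" using hm[OF borel_measurable_indicator[OF E(1)]] .
  have pm: "(\<lambda>x. (x, \<phi> i x)) \<in> measurable M ?MM" for i using \<phi>[of i] by simp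
  have Dm: "(\<lambda>x. indicator (D i) x * u (x, \<phi> i x)) \<in> borel_measurable M"
    if "u \<in> borel_measurable ?MM" for u :: "_ \<Rightarrow> ennreal" and i
    using measurable_compose[OF pm that, of i] D[of i] by (intro borel_measurable_times_ennreal borel_measurable_indicator) auto
  show ?thesis
    using F
  proof (induction F rule: borel_measurable_induct)
    case (cong u v)
    have "(\<integral>\<^sup>+p. indicator E p * v p \<partial>?h) = (\<integral>\<^sup>+p. indicator E p * u p \<partial>?h)"
      using cong(3) rel_measure_sets(2)[OF mr] f(8) by (intro nn_integral_cong) (auto simp: space_pair_measure)
    moreover have "(\<integral>\<^sup>+x. indicator (D i) x * v (x, \<phi> i x) \<partial>M) = (\<integral>\<^sup>+x. indicator (D i) x * u (x, \<phi> i x) \<partial>M)" for i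
      using cong(3) measurable_space[OF \<phi>] by (intro nn_integral_cong) (auto simp: space_pair_measure)
    ultimately show ?case using cong(4) by simp
  next
    case (set A)
    have EA: "E \<inter> A \<in> sets ?MM" "E \<inter> A \<subseteq> R" using E set by auto
    have "(\<integral>\<^sup>+p. indicator E p * indicator A p \<partial>?h) = (\<integral>\<^sup>+p. indicator (E \<inter> A) p \<partial>?h)"
      by (intro nn_integral_cong) (auto simp: indicator_def)
    also have "\<dots> = emeasure ?h (E \<inter> A)"
      using EA rel_measure_sets(1)[OF mr] sets_restrict_pair[OF f(6)] by (intro nn_integral_indicator) auto
    also have "\<dots> = (\<integral>\<^sup>+x. emeasure (count_space UNIV) {y. (x, y) \<in> E \<inter> A} \<partial>M)" by (rule emeasure_rel_measure[OF mr EA])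
    also have "\<dots> = (\<integral>\<^sup>+x. (\<Sum>i<d. indicator (D i) x * indicator A (x, \<phi> i x)) \<partial>M)"
    proof (intro nn_integral_cong)
      fix x assume "x \<in> space M"
      show "emeasure (count_space UNIV) {y. (x, y) \<in> E \<inter> A} = (\<Sum>i<d. indicator (D i) x * indicator A (x, \<phi> i x))"
      proof (cases "x \<in> X")
        case True
        let ?I = "{i. i < d \<and> x \<in> D i}"
        let ?J = "{i. i < d \<and> x \<in> D i \<and> (x, \<phi> i x) \<in> A}"
        have J: "bij_betw (\<lambda>i. \<phi> i x) ?J {y. (x, y) \<in> E \<inter> A}"
        proof -
          have "inj_on (\<lambda>i. \<phi> i x) ?J" using enum[OF True] by (auto simp: bij_betw_def inj_on_def)
          moreover have "(\<lambda>i. \<phi> i x) ` ?J = {y. (x, y) \<in> E \<inter> A}"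
          proof -
            have im: "(\<lambda>i. \<phi> i x) ` ?I = {y. (x, y) \<in> E}" by (rule bij_betw_imp_surj_on[OF enum[OF True]])
            have "(\<lambda>i. \<phi> i x) ` ?J = (\<lambda>i. \<phi> i x) ` ?I \<inter> {y. (x, y) \<in> A}" by auto
            then show ?thesis using im by auto
          qed
          ultimately show ?thesis by (simp add: bij_betw_def)
        qed
        have "finite ?J" by (rule finite_subset[of _ "{..<d}"]) auto
        then have fin: "finite {y. (x, y) \<in> E \<inter> A}" by (rule bij_betw_finite[OF J, THEN iffD1])
        have "emeasure (count_space UNIV) {y. (x, y) \<in> E \<inter> A} = of_nat (card {y. (x, y) \<in> E \<inter> A})"
          using fin by (simp add: emeasure_count_space_finite)
        also have "card {y. (x, y) \<in> E \<inter> A} = card ?J" using bij_betw_same_card[OF J] by simp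
        also have "(of_nat (card ?J) :: ennreal) = (\<Sum>i<d. if x \<in> D i \<and> (x, \<phi> i x) \<in> A then 1 else 0)"
        proof -
          have "{..<d} \<inter> {i. x \<in> D i \<and> (x, \<phi> i x) \<in> A} = ?J" by auto
          then show ?thesis by (simp add: sum.If_cases)
        qed
        also have "\<dots> = (\<Sum>i<d. indicator (D i) x * indicator A (x, \<phi> i x))"
          by (intro sum.cong) (auto simp: indicator_def)
        finally show ?thesis .
      next
        case False
        then have e: "{y. (x, y) \<in> E \<inter> A} = {}" and "\<And>i. x \<notin> D i" using X by auto
        then show ?thesis unfolding e by simp
      qed
    qed
    also have "\<dots> = (\<Sum>i<d. \<integral>\<^sup>+x. indicator (D i) x * indicator A (x, \<phi> i x) \<partial>M)"
      using Dm[of "indicator A"] set by (intro nn_integral_sum) simp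
    finally show ?case .
  next
    case (mult u c)
    have "(\<integral>\<^sup>+p. indicator E p * (c * u p) \<partial>?h) = c * (\<integral>\<^sup>+p. indicator E p * u p \<partial>?h)"
      using Em hm[OF mult(2)] by (subst nn_integral_cmult[symmetric]) (auto simp: mult_ac)
    moreover have "(\<integral>\<^sup>+x. indicator (D i) x * (c * u (x, \<phi> i x)) \<partial>M) = c * (\<integral>\<^sup>+x. indicator (D i) x * u (x, \<phi> i x) \<partial>M)" for i
      using Dm[OF mult(2), of i] by (subst nn_integral_cmult[symmetric]) (auto simp: mult_ac)
    ultimately show ?case using mult.IH by (simp add: sum_distrib_left)
  next
    case (add u v)
    have "(\<integral>\<^sup>+p. indicator E p * (v p + u p) \<partial>?h) = (\<integral>\<^sup>+p. indicator E p * v p \<partial>?h) + (\<integral>\<^sup>+p. indicator E p * u p \<partial>?h)"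
      using Em hm[OF add(1)] hm[OF add(3)] by (subst nn_integral_add[symmetric]) (auto simp: distrib_left)
    moreover have "(\<integral>\<^sup>+x. indicator (D i) x * (v (x, \<phi> i x) + u (x, \<phi> i x)) \<partial>M) =
        (\<integral>\<^sup>+x. indicator (D i) x * v (x, \<phi> i x) \<partial>M) + (\<integral>\<^sup>+x. indicator (D i) x * u (x, \<phi> i x) \<partial>M)" for i
      using Dm[OF add(1), of i] Dm[OF add(3), of i] by (subst nn_integral_add[symmetric]) (auto simp: distrib_left)
    ultimately show ?case using add.IH by (simp add: sum.distrib)
  next
    case (seq U)
    have mono: "U i p \<le> U j p" if "i \<le> j" for i j p using le_funD[OF incseqD[OF seq(3) that]] .
    have "(\<integral>\<^sup>+p. indicator E p * (SUP n. U n) p \<partial>?h) = (\<integral>\<^sup>+p. (SUP n. indicator E p * U n p) \<partial>?h)"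
      by (simp add: SUP_mult_left_ennreal image_comp)
    also have "\<dots> = (SUP n. \<integral>\<^sup>+p. indicator E p * U n p \<partial>?h)"
      using Em hm[OF seq(1)] mono by (intro nn_integral_monotone_convergence_SUP) (auto simp: incseq_def le_fun_def intro!: mult_left_mono)
    also have "\<dots> = (SUP n. \<Sum>i<d. \<integral>\<^sup>+x. indicator (D i) x * U n (x, \<phi> i x) \<partial>M)" using seq.IH by simp
    also have "\<dots> = (\<Sum>i<d. SUP n. \<integral>\<^sup>+x. indicator (D i) x * U n (x, \<phi> i x) \<partial>M)"
      using mono by (intro ennreal_SUP_sum) (auto simp: incseq_def intro!: nn_integral_mono mult_left_mono)
    also have "\<dots> = (\<Sum>i<d. \<integral>\<^sup>+x. indicator (D i) x * (SUP n. U n) (x, \<phi> i x) \<partial>M)"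
    proof (intro sum.cong refl)
      fix i
      have "(SUP n. \<integral>\<^sup>+x. indicator (D i) x * U n (x, \<phi> i x) \<partial>M) = (\<integral>\<^sup>+x. (SUP n. indicator (D i) x * U n (x, \<phi> i x)) \<partial>M)"
        using Dm[OF seq(1)] mono by (intro nn_integral_monotone_convergence_SUP[symmetric]) (auto simp: incseq_def le_fun_def intro!: mult_left_mono)
      then show "(SUP n. \<integral>\<^sup>+x. indicator (D i) x * U n (x, \<phi> i x) \<partial>M) = (\<integral>\<^sup>+x. indicator (D i) x * (SUP n. U n) (x, \<phi> i x) \<partial>M)"
        by (simp add: SUP_mult_left_ennreal image_comp)
    qed
    finally show ?case .
  qed
qed

text \<open>If no density existed, the cocycle would be the junk value \<open>0\<close>, contradicting its lower bound
  on the edges.\<close>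

lemma density_RN_cocycle:
  assumes mr: "measured_eqrel M R" and E: "E \<subseteq> R" and c: "c > 0"
    and bound: "AE p in rel_measure M R. p \<in> E \<longrightarrow> ennreal c \<le> RN_cocycle M R p"
    and ne: "\<not> (AE x in M. \<forall>y. (x, y) \<notin> E)"
  shows "density (rel_measure_inv M R) (RN_cocycle M R) = rel_measure M R"
proof (cases "\<exists>f. f \<in> borel_measurable (rel_measure_inv M R) \<and> density (rel_measure_inv M R) f = rel_measure M R")
  case True
  then show ?thesis unfolding RN_cocycle_def by (auto intro: RN_derivI)
next
  case False
  then have "RN_cocycle M R = (\<lambda>_. 0)" by (auto simp: RN_cocycle_def RN_deriv_def)
  then have "AE p in rel_measure M R. p \<notin> E" using bound c by simp
  then have "AE x in M. \<forall>y. (x, y) \<in> R \<longrightarrow> (x, y) \<notin> E" by (simp add: AE_rel_measure_iff[OF mr])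
  then have "AE x in M. \<forall>y. (x, y) \<notin> E" by eventually_elim (use E in blast)
  then show ?thesis using ne by contradiction
qed

lemma swap_rel_measurable:
  assumes mr: "measured_eqrel M R"
  shows "prod.swap \<in> measurable (rel_measure M R) (rel_measure M R)"
proof -
  note f = measured_eqrel_facts[OF mr]
  have "sym R" using f(5) by (simp add: equiv_def)
  moreover have "prod.swap \<in> measurable (M \<Otimes>\<^sub>M M) (M \<Otimes>\<^sub>M M)" unfolding prod.swap_def by simp
  ultimately have "prod.swap \<in> measurable (restrict_space (M \<Otimes>\<^sub>M M) R) (restrict_space (M \<Otimes>\<^sub>M M) R)"
    by (intro measurable_restrict_space3) (auto dest: symD)
  then show ?thesis using measurable_cong_sets[OF rel_measure_sets(1)[OF mr] rel_measure_sets(1)[OF mr]] by blast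
qed

text \<open>Integrating over the inverse measure is integrating the swapped function over the
  counting measure, so flipped edges have as density the cocycle at the reversed pair.\<close>

lemma rel_measure_flip:
  assumes mr: "measured_eqrel M R"
    and dens: "density (rel_measure_inv M R) (RN_cocycle M R) = rel_measure M R"
    and B: "B \<in> sets (M \<Otimes>\<^sub>M M)" "B \<subseteq> R"
  shows "emeasure (rel_measure M R) B = (\<integral>\<^sup>+p. RN_cocycle M R (prod.swap p) * indicator B (prod.swap p) \<partial>rel_measure M R)"
proof -
  note f = measured_eqrel_facts[OF mr]
  let ?h = "rel_measure M R"
  have Bh: "B \<in> sets ?h" using B rel_measure_sets(1)[OF mr] sets_restrict_pair[OF f(6)] by blast
  have sinv: "sets (rel_measure_inv M R) = sets ?h" by (simp add: rel_measure_inv_def)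
  have rm: "RN_cocycle M R \<in> borel_measurable (rel_measure_inv M R)" unfolding RN_cocycle_def by simp
  then have rm': "RN_cocycle M R \<in> borel_measurable ?h" using measurable_cong_sets[OF sinv refl] by blast
  have "emeasure ?h B = emeasure (density (rel_measure_inv M R) (RN_cocycle M R)) B" by (simp only: dens)
  also have "\<dots> = (\<integral>\<^sup>+p. RN_cocycle M R p * indicator B p \<partial>rel_measure_inv M R)"
    using rm Bh sinv by (intro emeasure_density) auto
  also have "\<dots> = (\<integral>\<^sup>+p. RN_cocycle M R (prod.swap p) * indicator B (prod.swap p) \<partial>?h)"
    unfolding rel_measure_inv_def using rm' Bh by (subst nn_integral_distr[OF swap_rel_measurable[OF mr]]) auto
  finally show ?thesis .
qed

text \<open>A measurable retraction e of M onto X exhibits A as a preimage cut down to X \<times>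
  X.\<close>

lemma sets_pair_restrict_space:
  assumes X: "X \<in> sets M" and A: "A \<in> sets (restrict_space M X \<Otimes>\<^sub>M restrict_space M X)"
  shows "A \<in> sets (M \<Otimes>\<^sub>M M)"
proof (cases "X = {}")
  case True
  then have "A = {}" using sets.sets_into_space[OF A] by (auto simp: space_pair_measure space_restrict_space)
  then show ?thesis by simp
next
  case False
  then obtain x0 where x0: "x0 \<in> X" by blast
  have Xs: "X \<subseteq> space M" using sets.sets_into_space[OF X] .
  define e where "e x = (if x \<in> X then x else x0)" for x
  have "e \<in> measurable M (restrict_space M X)"
  proof (rule measurable_restrict_space2)
    show "e \<in> space M \<rightarrow> X" using x0 by (auto simp: e_def)
    show "e \<in> measurable M M" unfolding e_def using X x0 Xs by (intro measurable_If_set) auto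
  qed
  then have "(\<lambda>p. (e (fst p), e (snd p))) \<in> measurable (M \<Otimes>\<^sub>M M) (restrict_space M X \<Otimes>\<^sub>M restrict_space M X)"
    by (intro measurable_Pair measurable_compose[OF measurable_fst] measurable_compose[OF measurable_snd])
  from sets.Int[OF measurable_sets[OF this A] pair_measureI[OF X X]]
  have "(\<lambda>p. (e (fst p), e (snd p))) -` A \<inter> space (M \<Otimes>\<^sub>M M) \<inter> (X \<times> X) \<in> sets (M \<Otimes>\<^sub>M M)" .
  moreover have "(\<lambda>p. (e (fst p), e (snd p))) -` A \<inter> space (M \<Otimes>\<^sub>M M) \<inter> (X \<times> X) = A"
  proof -
    have "A \<subseteq> X \<times> X" using sets.sets_into_space[OF A] by (auto simp: space_pair_measure space_restrict_space)
    then show ?thesis using Xs by (auto simp: e_def space_pair_measure)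
  qed
  ultimately show ?thesis by simp
qed

section \<open>Invariant sections from almost invariant ones\<close>

text \<open>The descent wants its conditions at every point, the hypotheses give them almost
  everywhere. Exceptional points are removed together with their classes, which leaves the links of
  the remaining vertices unchanged. Invariance along edges extends to classes because the edges
  generate R.\<close>

theorem (in rep) invariant_section_on_complex:
  fixes M :: "'a measure"
  assumes mr: "measured_eqrel M R" and \<Sigma>: "ulf_periodic_complex_2 M R \<Sigma>" and \<delta>1: "\<delta> \<ge> 1"
    and cocycle: "AE p in rel_measure M R. p \<in> edge_set \<Sigma> \<longrightarrow>
           ennreal (inverse \<delta>) \<le> RN_cocycle M R p \<and> RN_cocycle M R p \<le> ennreal \<delta>"
    and links: "AE x in M. link_connected \<Sigma> x \<and> (\<exists>e f. link_adj \<Sigma> x e f) \<and> link_lambda1 \<Sigma> x \<ge> l"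
    and gap: "l > \<delta> ^ 3 / 2"
    and X: "space M - X \<in> null_sets M" and \<Phi>: "\<Phi> \<in> measurable M N"
    and \<Phi>_S: "\<And>x y. x \<in> X \<Longrightarrow> y \<in> X \<Longrightarrow> (x, y) \<in> R \<Longrightarrow> (\<Phi> x, \<Phi> y) \<in> S"
    and \<Phi>_null: "\<And>Z. Z \<in> null_sets N \<Longrightarrow> \<Phi> -` Z \<inter> X \<in> null_sets M"
    and \<xi>: "\<And>n :: nat. \<xi> n \<in> Sec" and unit: "\<And>n. AE z in N. norm (\<xi> n z) = 1"
    and ai: "AE z in N. \<forall>v. (z, v) \<in> S \<longrightarrow> (\<lambda>n. norm (\<pi> z v (\<xi> n v) - \<xi> n z)) \<longlonglongrightarrow> 0"
  obtains X' \<zeta> where "X' \<in> sets M" "space M - X' \<in> null_sets M" "X' \<subseteq> X"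
    "\<And>x y. (x, y) \<in> R \<Longrightarrow> x \<in> X' \<longleftrightarrow> y \<in> X'"
    "along (restrict_space M X') \<Phi> \<zeta>" "\<And>x. x \<in> X' \<Longrightarrow> norm (\<zeta> x) = 1"
    "\<And>x y. x \<in> X' \<Longrightarrow> (x, y) \<in> R \<Longrightarrow> \<pi> (\<Phi> x) (\<Phi> y) (\<zeta> y) = \<zeta> x"
proof -
  note f = measured_eqrel_facts[OF mr] and c = ulf_complex_facts[OF mr \<Sigma>]
  let ?E = "edge_set \<Sigma>"
  interpret M: finite_measure M by (rule f(2))
  have Esp: "(x, y) \<in> ?E \<Longrightarrow> x \<in> space M \<and> y \<in> space M" for x y using c(1) f(8) by blast
  obtain d where d: "\<And>x. x \<in> space M \<Longrightarrow> finite {y. (x, y) \<in> ?E} \<and> card {y. (x, y) \<in> ?E} \<le> d" using c(5) by blast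
  have "\<exists>D s Z. (\<forall>i. D i \<in> sets M \<and> s i \<in> measurable M M) \<and> Z \<in> null_sets M \<and>
      (\<forall>x \<in> space M - Z. bij_betw (\<lambda>i :: nat. s i x) {i. i < d \<and> x \<in> D i} {y. (x, y) \<in> ?E})"
    by (rule bounded_graph_enumeration_AE[OF f(1,2,4) c(3)]) (rule d)
  then obtain D0 s Z where D0: "\<forall>i. D0 i \<in> sets M \<and> s i \<in> measurable M M" and Z: "Z \<in> null_sets M"
    and en0: "\<forall>x \<in> space M - Z. bij_betw (\<lambda>i :: nat. s i x) {i. i < d \<and> x \<in> D0 i} {y. (x, y) \<in> ?E}"
    by (elim exE conjE)
  have aeX: "AE x in M. x \<in> X" using AE_not_in[OF X] AE_space by eventually_elim simp
  have "AE x in M. x \<in> X \<and> x \<notin> Z \<and> x \<in> space M \<and>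
      (link_connected \<Sigma> x \<and> (\<exists>e f. link_adj \<Sigma> x e f) \<and> link_lambda1 \<Sigma> x \<ge> l)"
    using aeX AE_not_in[OF Z] AE_space links by eventually_elim simp
  then obtain X1 where X1: "X1 \<in> sets M" "space M - X1 \<in> null_sets M"
    "\<And>x. x \<in> X1 \<Longrightarrow> x \<in> X \<and> x \<notin> Z \<and> x \<in> space M \<and>
      (link_connected \<Sigma> x \<and> (\<exists>e f. link_adj \<Sigma> x e f) \<and> link_lambda1 \<Sigma> x \<ge> l)"
    "\<And>x y. (x, y) \<in> R \<Longrightarrow> x \<in> X1 \<longleftrightarrow> y \<in> X1"
    by (rule conull_invariant_subset[OF mr]) (rule that)
  let ?M1 = "restrict_space M X1"
  have sp1: "space ?M1 = X1" using sets.sets_into_space[OF X1(1)] by (auto simp: space_restrict_space)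
  have inc1: "(\<lambda>x. x) \<in> measurable ?M1 M" by (intro measurable_restrict_space1) simp
  have inc2: "(\<lambda>p. p) \<in> measurable (?M1 \<Otimes>\<^sub>M ?M1) (M \<Otimes>\<^sub>M M)"
    using measurable_Pair[OF measurable_compose[OF measurable_fst inc1] measurable_compose[OF measurable_snd inc1]] by simp
  have inc3: "(\<lambda>p. p) \<in> measurable (?M1 \<Otimes>\<^sub>M (?M1 \<Otimes>\<^sub>M ?M1)) (M \<Otimes>\<^sub>M (M \<Otimes>\<^sub>M M))"
    using measurable_Pair[OF measurable_compose[OF measurable_fst inc1] measurable_compose[OF measurable_snd inc2]] by simp
  define E1 where "E1 = ?E \<inter> (X1 \<times> X1)"
  define Tri where "Tri = triangle_set \<Sigma> \<inter> (X1 \<times> (X1 \<times> X1))"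
  define D where "D i = D0 i \<inter> X1" for i
  \<comment> \<open>The fallback value x makes every \<phi> i map \<open>X1\<close> to itself, also
    off \<open>D i\<close>, as measurability for the restricted space requires.\<close>
  define \<phi> where "\<phi> i x = (if s i x \<in> X1 then s i x else x)" for i x
  have E1sec: "{y. (x, y) \<in> E1} = {y. (x, y) \<in> ?E}" if "x \<in> X1" for x
    using that c(1) X1(4) by (auto simp: E1_def)
  have E1R: "E1 \<subseteq> R" using c(1) by (auto simp: E1_def)
  have E1_sets: "E1 \<in> sets (M \<Otimes>\<^sub>M M)" using c(3) X1(1) by (auto simp: E1_def)
  have E1_sets1: "E1 \<in> sets (?M1 \<Otimes>\<^sub>M ?M1)"
    using measurable_sets[OF inc2 c(3)] by (simp add: E1_def space_pair_measure sp1)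
  have Tri_sets1: "Tri \<in> sets (?M1 \<Otimes>\<^sub>M (?M1 \<Otimes>\<^sub>M ?M1))"
    using measurable_sets[OF inc3 c(4)] by (simp add: Tri_def space_pair_measure sp1)
  have E1_sym: "(y, x) \<in> E1" if "(x, y) \<in> E1" for x y using that c(2) by (auto simp: E1_def)
  have D_sets: "D i \<in> sets M" for i using D0 X1(1) by (auto simp: D_def)
  have D_sets1: "D i \<in> sets ?M1" for i
    using D_sets[of i] X1(1) by (subst sets_restrict_space_iff) (auto simp: D_def)
  have \<phi>m: "\<phi> i \<in> measurable M M" for i
  proof -
    have "s i \<in> measurable M M" using D0 by blast
    moreover have "{x \<in> space M. s i x \<in> X1} \<in> sets M"
      using measurable_sets[OF \<open>s i \<in> measurable M M\<close> X1(1)] by (simp add: vimage_def Int_def conj_commute)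
    ultimately show ?thesis unfolding \<phi>_def[abs_def] by (intro measurable_If) auto
  qed
  have \<phi>m1: "\<phi> i \<in> measurable ?M1 ?M1" for i
    using \<phi>m[of i] by (intro measurable_restrict_space3) (auto simp: \<phi>_def)
  have enum: "bij_betw (\<lambda>i. \<phi> i x) {i. i < d \<and> x \<in> D i} {y. (x, y) \<in> E1}" if x: "x \<in> X1" for x
  proof -
    have I: "{i. i < d \<and> x \<in> D i} = {i. i < d \<and> x \<in> D0 i}" using x by (auto simp: D_def)
    have b: "bij_betw (\<lambda>i. s i x) {i. i < d \<and> x \<in> D i} {y. (x, y) \<in> E1}"
      unfolding I E1sec[OF x] using en0 X1(3)[OF x] by blast
    then have "s i x \<in> X1" if "i \<in> {i. i < d \<and> x \<in> D i}" for i
      using bij_betwE[OF b] that by (auto simp: E1_def)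
    then show ?thesis using b by (subst bij_betw_cong[where g = "\<lambda>i. s i x"]) (auto simp: \<phi>_def)
  qed
  have ex_edge: "\<exists>y. (x, y) \<in> ?E" if x: "x \<in> X1" for x
  proof -
    obtain e where e: "e \<in> link_vertices \<Sigma> x" using X1(3)[OF x] by (auto simp: link_adj_def)
    then obtain y where "e = {x, y}" "x \<noteq> y" by (auto simp: link_vertices_def card_2_iff)
    then show ?thesis using e by (auto simp: link_vertices_def edge_set_def)
  qed
  \<comment> \<open>Almost every vertex has an edge, so the lower bound on the cocycle is not
    vacuous and a density must exist.\<close>
  have X1ne: "\<not> (AE x in M. \<forall>y. (x, y) \<notin> ?E)"
  proof
    assume "AE x in M. \<forall>y. (x, y) \<notin> ?E"
    moreover have "AE x in M. x \<in> X1" using AE_not_in[OF X1(2)] AE_space by eventually_elim simp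
    ultimately have "AE x in M. False" by eventually_elim (use ex_edge in blast)
    then show False using f(3) by (simp add: AE_iff_measurable[OF sets.top])
  qed
  have dens: "density (rel_measure_inv M R) (RN_cocycle M R) = rel_measure M R"
  proof (rule density_RN_cocycle[OF mr c(1) _ _ X1ne])
    show "0 < inverse \<delta>" using \<delta>1 by simp
    show "AE p in rel_measure M R. p \<in> ?E \<longrightarrow> ennreal (inverse \<delta>) \<le> RN_cocycle M R p"
      using cocycle by eventually_elim simp
  qed
  \<comment> \<open>The cocycle at the reversed pair, as \<open>rel_measure_flip\<close> produces
    it. Truncation at \<delta> and the value 0 off \<open>E1\<close> secure the bounds at every
    pair; almost everywhere on \<open>E1\<close> they change nothing.\<close>
  define g where "g p = (if p \<in> E1 then min \<delta> (enn2real (RN_cocycle M R (prod.swap p))) else 0)" for p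
  have sinv: "sets (rel_measure_inv M R) = sets (restrict_space (M \<Otimes>\<^sub>M M) R)"
    by (simp add: rel_measure_inv_def rel_measure_sets(1)[OF mr])
  have RNm: "RN_cocycle M R \<in> borel_measurable (restrict_space (M \<Otimes>\<^sub>M M) R)"
    using measurable_cong_sets[OF sinv refl] borel_measurable_RN_deriv unfolding RN_cocycle_def by blast
  have g_on: "g \<in> borel_measurable (M \<Otimes>\<^sub>M M)"
  proof -
    have sw: "prod.swap \<in> measurable (restrict_space (M \<Otimes>\<^sub>M M) E1) (restrict_space (M \<Otimes>\<^sub>M M) R)"
    proof (rule measurable_restrict_space3)
      show "prod.swap \<in> measurable (M \<Otimes>\<^sub>M M) (M \<Otimes>\<^sub>M M)" unfolding prod.swap_def by simp
      show "prod.swap \<in> E1 \<rightarrow> R" using E1_sym E1R by auto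
    qed
    have "(\<lambda>p. min \<delta> (enn2real (RN_cocycle M R (prod.swap p)))) \<in> borel_measurable (restrict_space (M \<Otimes>\<^sub>M M) E1)"
      using measurable_compose[OF sw RNm] by simp
    then show ?thesis
      unfolding g_def[abs_def] using E1_sets sets.sets_into_space[OF E1_sets]
      by (subst measurable_If_restrict_space_iff) (auto simp: Int_absorb1 Collect_conj_eq)
  qed
  have g_on1: "g \<in> borel_measurable (?M1 \<Otimes>\<^sub>M ?M1)" using measurable_compose[OF inc2 g_on] by simp
  have g_eq: "AE p in rel_measure M R. p \<in> E1 \<longrightarrow> ennreal (g p) = RN_cocycle M R (prod.swap p)"
  proof -
    have "AE x in M. \<forall>y. (x, y) \<in> R \<longrightarrow> (x, y) \<in> ?E \<longrightarrow> RN_cocycle M R (x, y) \<le> ennreal \<delta>"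
      using cocycle unfolding AE_rel_measure_iff[OF mr] by eventually_elim blast
    \<comment> \<open>The bound is needed at the reversed pair (y, x), hence on a saturated conull
      set.\<close>
    then obtain X3 where X3: "X3 \<in> sets M" "space M - X3 \<in> null_sets M"
      "\<And>x. x \<in> X3 \<Longrightarrow> \<forall>y. (x, y) \<in> R \<longrightarrow> (x, y) \<in> ?E \<longrightarrow> RN_cocycle M R (x, y) \<le> ennreal \<delta>"
      "\<And>x y. (x, y) \<in> R \<Longrightarrow> x \<in> X3 \<longleftrightarrow> y \<in> X3" by (rule conull_invariant_subset[OF mr]) (rule that)
    have "AE x in M. x \<in> X3" using AE_not_in[OF X3(2)] AE_space by eventually_elim simp
    then show ?thesis
      unfolding AE_rel_measure_iff[OF mr]
    proof eventually_elim
      case (elim x)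
      show ?case
      proof (intro allI impI)
        fix y assume R: "(x, y) \<in> R" and E: "(x, y) \<in> E1"
        then have y: "y \<in> X3" "(y, x) \<in> E1" using X3(4) elim E1_sym by auto
        then have "RN_cocycle M R (y, x) \<le> ennreal \<delta>" using X3(3) E1R by (auto simp: E1_def)
        then show "ennreal (g (x, y)) = RN_cocycle M R (prod.swap (x, y))"
          using E \<delta>1 by (cases "RN_cocycle M R (y, x)") (auto simp: g_def top_unique)
      qed
    qed
  qed
  have M1int: "(\<integral>\<^sup>+x. indicator (D i) x * u x \<partial>?M1) = (\<integral>\<^sup>+x. indicator (D i) x * u x \<partial>M)" for i and u :: "'a \<Rightarrow> ennreal"
    using X1(1) by (subst nn_integral_restrict_space) (auto intro!: nn_integral_cong simp: D_def indicator_def)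
  have flip: "(\<Sum>i<d. \<integral>\<^sup>+x. indicator (D i) x * indicator A (\<phi> i x, x) \<partial>?M1) =
      (\<Sum>i<d. \<integral>\<^sup>+x. indicator (D i) x * (ennreal (g (x, \<phi> i x)) * indicator A (x, \<phi> i x)) \<partial>?M1)"
    if A1: "A \<in> sets (?M1 \<Otimes>\<^sub>M ?M1)" for A
  proof -
    have A: "A \<in> sets (M \<Otimes>\<^sub>M M)" using sets_pair_restrict_space[OF X1(1) A1] .
    have E1X: "E1 \<subseteq> X1 \<times> UNIV" and DX: "D i \<subseteq> X1" for i by (auto simp: E1_def D_def)
    note rn = rel_measure_nn_integral[OF mr E1_sets E1R D_sets \<phi>m enum E1X DX]
    define A' where "A' = prod.swap -` A \<inter> space (M \<Otimes>\<^sub>M M)"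
    have swm: "prod.swap \<in> measurable (M \<Otimes>\<^sub>M M) (M \<Otimes>\<^sub>M M)" unfolding prod.swap_def by simp
    have A': "A' \<in> sets (M \<Otimes>\<^sub>M M)" unfolding A'_def using measurable_sets[OF swm A] .
    have "(\<Sum>i<d. \<integral>\<^sup>+x. indicator (D i) x * indicator A (\<phi> i x, x) \<partial>?M1) =
        (\<Sum>i<d. \<integral>\<^sup>+x. indicator (D i) x * indicator A' (x, \<phi> i x) \<partial>M)"
      unfolding M1int using measurable_space[OF \<phi>m]
      by (intro sum.cong nn_integral_cong refl) (auto simp: A'_def indicator_def space_pair_measure)
    also have "\<dots> = (\<integral>\<^sup>+p. indicator E1 p * indicator A' p \<partial>rel_measure M R)"
      using A' by (intro rn[symmetric]) auto
    also have "\<dots> = (\<integral>\<^sup>+p. indicator (E1 \<inter> A') p \<partial>rel_measure M R)"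
      by (intro nn_integral_cong) (auto simp: indicator_def)
    also have "\<dots> = emeasure (rel_measure M R) (E1 \<inter> A')"
      using E1_sets A' E1R rel_measure_sets(1)[OF mr] sets_restrict_pair[OF f(6)] by (intro nn_integral_indicator) auto
    also have "\<dots> = (\<integral>\<^sup>+p. RN_cocycle M R (prod.swap p) * indicator (E1 \<inter> A') (prod.swap p) \<partial>rel_measure M R)"
      using E1_sets A' E1R by (intro rel_measure_flip[OF mr dens]) auto
    also have "\<dots> = (\<integral>\<^sup>+p. indicator E1 p * (ennreal (g p) * indicator A p) \<partial>rel_measure M R)"
    proof (rule nn_integral_cong_AE)
      show "AE p in rel_measure M R. RN_cocycle M R (prod.swap p) * indicator (E1 \<inter> A') (prod.swap p) =
          indicator E1 p * (ennreal (g p) * indicator A p)"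
        using g_eq
      proof eventually_elim
        case (elim p)
        obtain x y where p: "p = (x, y)" by (cases p)
        have "(y, x) \<in> E1 \<inter> A' \<longleftrightarrow> (x, y) \<in> E1 \<and> (x, y) \<in> A"
          using E1_sym Esp by (auto simp: A'_def space_pair_measure E1_def)
        then show ?case using elim p by (auto simp: indicator_def)
      qed
    qed
    also have "\<dots> = (\<Sum>i<d. \<integral>\<^sup>+x. indicator (D i) x * (ennreal (g (x, \<phi> i x)) * indicator A (x, \<phi> i x)) \<partial>M)"
      using g_on A by (intro rn) auto
    finally show ?thesis unfolding M1int .
  qed
  have link: "{i. i < d \<and> x \<in> D i} \<noteq> {}"
    "\<And>i. i < d \<Longrightarrow> x \<in> D i \<Longrightarrow> 1 \<le> (\<Sum>j | j < d \<and> x \<in> D j. of_bool ((x, \<phi> i x, \<phi> j x) \<in> Tri) :: real)"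
    "\<exists>m. l * (\<Sum>i | i < d \<and> x \<in> D i. (\<Sum>j | j < d \<and> x \<in> D j. of_bool ((x, \<phi> i x, \<phi> j x) \<in> Tri)) * (norm (u i - m :: 'h))\<^sup>2)
      \<le> (1/2) * (\<Sum>i | i < d \<and> x \<in> D i. \<Sum>j | j < d \<and> x \<in> D j. of_bool ((x, \<phi> i x, \<phi> j x) \<in> Tri) * (norm (u i - u j))\<^sup>2)"
    if x: "x \<in> X1" for x u
  proof -
    let ?I = "{i. i < d \<and> x \<in> D i}"
    let ?A = "\<lambda>i j. of_bool ((x, \<phi> i x, \<phi> j x) \<in> Tri) :: real"
    have b: "bij_betw (\<lambda>i. \<phi> i x) ?I {y. (x, y) \<in> ?E}" using enum[OF x] E1sec[OF x] by simp
    have inX: "\<phi> i x \<in> X1" if "i \<in> ?I" for i using bij_betwE[OF enum[OF x]] that by (auto simp: E1_def)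
    have A: "?A i j = of_bool ((x, \<phi> i x, \<phi> j x) \<in> triangle_set \<Sigma>)" if "i \<in> ?I" "j \<in> ?I" for i j
      using inX[OF that(1)] inX[OF that(2)] x by (simp add: Tri_def)
    have fin: "finite ?I" by simp
    have lk: "link_connected \<Sigma> x" "\<exists>e f. link_adj \<Sigma> x e f" "link_lambda1 \<Sigma> x \<ge> l" using X1(3)[OF x] by auto
    note lsg = link_spectral_gap[OF fin b lk A refl]
    show "?I \<noteq> {}" by (rule lsg(1))
    show "1 \<le> (\<Sum>j\<in>?I. ?A i j)" if "i < d" "x \<in> D i" for i using lsg(2)[of i] that by simp
    show "\<exists>m. l * (\<Sum>i\<in>?I. (\<Sum>j\<in>?I. ?A i j) * (norm (u i - m :: 'h))\<^sup>2) \<le> (1/2) * (\<Sum>i\<in>?I. \<Sum>j\<in>?I. ?A i j * (norm (u i - u j))\<^sup>2)"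
      by (rule lsg(3))
  qed
  have \<Phi>1: "\<Phi> \<in> measurable ?M1 N" using \<Phi> by (rule measurable_restrict_space1)
  interpret P: periodic_complex N S H Sec \<pi> ?M1 \<Phi> E1 d D \<phi> Tri g \<delta> l
  proof (intro periodic_complex.intro periodic_complex_axioms.intro, goal_cases)
    case 1 show ?case by (rule rep_axioms)
  next
    case 2
    show ?case using X1(1) by (intro finite_measure_restrict_space) (auto simp: f(2))
  next
    case 3
    have "measure ?M1 (space ?M1) = measure M X1" using X1(1) sp1 by (subst measure_restrict_space) (auto dest: sets.sets_into_space)
    also have "\<dots> \<le> measure M (space M)" by (rule M.bounded_measure)
    also have "\<dots> = 1" using f(3) by (simp add: measure_def)
    finally show ?case .
  next
    case 4 show ?case by (rule \<Phi>1)
  next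
    case 5 show ?case by (rule E1_sets1)
  next
    case (6 x y) then show ?case by (rule E1_sym)
  next
    case (7 x y) then show ?case using E1R X1(3) \<Phi>_S by (auto simp: E1_def)
  next
    case (8 i) show ?case by (rule D_sets1)
  next
    case (9 i) show ?case by (rule \<phi>m1)
  next
    case (10 x) then show ?case using enum sp1 by simp
  next
    case 11 show ?case by (rule Tri_sets1)
  next
    case (12 x y z) then show ?case using c(7) by (auto simp: Tri_def E1_def)
  next
    case (13 x y z) then show ?case using c(8) by (auto simp: Tri_def)
  next
    case (14 x y z) then show ?case using c(9) by (auto simp: Tri_def)
  next
    case 15 show ?case by (rule g_on1)
  next
    case (16 p) show ?case using \<delta>1 by (simp add: g_def)
  next
    case (17 p) show ?case using \<delta>1 by (simp add: g_def)
  next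
    case 18 show ?case by (rule \<delta>1)
  next
    case (19 A) then show ?case by (rule flip)
  next
    case (20 x) then show ?case using link(1) sp1 by simp
  next
    case (21 x i) then show ?case using link(2) sp1 by simp
  next
    case (22 x u) then show ?case using link(3) sp1 by simp
  next
    case 23 show ?case by (rule gap)
  qed
  \<comment> \<open>Conditions over N come back along \<Phi> because preimages of null sets meet X
    in null sets.\<close>
  have pull: "AE x in ?M1. P (\<Phi> x)" if P: "AE z in N. P z" for P
  proof -
    obtain Z where Z: "{z \<in> space N. \<not> P z} \<subseteq> Z" "Z \<in> null_sets N" using AE_E[OF P] by (metis null_setsI)
    have "AE x in M. x \<notin> \<Phi> -` Z \<inter> X" by (rule AE_not_in[OF \<Phi>_null[OF Z(2)]])
    then have "AE x in M. x \<in> X1 \<longrightarrow> P (\<Phi> x)"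
    proof eventually_elim
      case (elim x)
      show ?case
      proof
        assume "x \<in> X1"
        then have "\<Phi> x \<notin> Z" "\<Phi> x \<in> space N" using elim X1(3) measurable_space[OF \<Phi>] by auto
        then show "P (\<Phi> x)" using Z(1) by blast
      qed
    qed
    then show ?thesis using X1(1) by (subst AE_restrict_space_iff) auto
  qed
  have "\<exists>\<zeta>. along ?M1 \<Phi> \<zeta> \<and> (AE x in ?M1. norm (\<zeta> x) = 1) \<and> (AE x in ?M1. \<forall>y. (x, y) \<in> E1 \<longrightarrow> P.\<rho> x y (\<zeta> y) = \<zeta> x)"
  proof (rule P.invariant_unit_section[of "\<lambda>n x. \<xi> n (\<Phi> x)"])
    show "along ?M1 \<Phi> (\<lambda>x. \<xi> n (\<Phi> x))" for n by (rule along_Sec[OF \<xi> \<Phi>1])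
    show "AE x in ?M1. norm (\<xi> n (\<Phi> x)) = 1" for n by (rule pull[OF unit])
    show "AE x in ?M1. \<forall>y. (x, y) \<in> E1 \<longrightarrow> (\<lambda>n. norm (P.cobd (\<lambda>x. \<xi> n (\<Phi> x)) (x, y))) \<longlonglongrightarrow> 0"
      using pull[OF ai] by eventually_elim (auto simp: P.cobd_def P.\<rho>_def dest: P.E_S)
  qed
  then obtain \<zeta> where \<zeta>: "along ?M1 \<Phi> \<zeta>" "AE x in ?M1. norm (\<zeta> x) = 1"
    "AE x in ?M1. \<forall>y. (x, y) \<in> E1 \<longrightarrow> P.\<rho> x y (\<zeta> y) = \<zeta> x" by (elim exE conjE)
  have r: "(AE x in ?M1. Q x) \<longleftrightarrow> (AE x in M. x \<in> X1 \<longrightarrow> Q x)" for Q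
    using X1(1) by (subst AE_restrict_space_iff) auto
  have "AE x in M. x \<in> X1" using AE_not_in[OF X1(2)] AE_space by eventually_elim simp
  then have "AE x in M. x \<in> X1 \<and> norm (\<zeta> x) = 1 \<and> (\<forall>y. (x, y) \<in> E1 \<longrightarrow> P.\<rho> x y (\<zeta> y) = \<zeta> x)"
    using \<zeta>(2,3)[unfolded r] by eventually_elim blast
  then obtain X' where X': "X' \<in> sets M" "space M - X' \<in> null_sets M"
    "\<And>x. x \<in> X' \<Longrightarrow> x \<in> X1 \<and> norm (\<zeta> x) = 1 \<and> (\<forall>y. (x, y) \<in> E1 \<longrightarrow> P.\<rho> x y (\<zeta> y) = \<zeta> x)"
    "\<And>x y. (x, y) \<in> R \<Longrightarrow> x \<in> X' \<longleftrightarrow> y \<in> X'" by (rule conull_invariant_subset[OF mr]) (rule that)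
  have \<zeta>in: "\<zeta> x \<in> H (\<Phi> x)" if "x \<in> X'" for x using along_in[OF \<zeta>(1), of x] X'(3)[OF that] sp1 by simp
  have inv: "\<pi> (\<Phi> x) (\<Phi> y) (\<zeta> y) = \<zeta> x" if x: "x \<in> X'" and xy: "(x, y) \<in> R" for x y
  proof -
    have xX: "x \<in> X1" "x \<in> space M" using X'(3)[OF x] X1(3) by auto
    have "(x, y) \<in> ?E\<^sup>*" using c(6) xy by blast
    \<comment> \<open>Induction along a path of edges. Membership in X' and in the class is carried
      along, since the cocycle identity needs it at the next edge.\<close>
    then have "y \<in> X' \<and> (\<Phi> x, \<Phi> y) \<in> S \<and> \<pi> (\<Phi> x) (\<Phi> y) (\<zeta> y) = \<zeta> x"
    proof (induction rule: rtrancl_induct)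
      case base
      have "(\<Phi> x, \<Phi> x) \<in> S" using S_equiv measurable_space[OF \<Phi> xX(2)] by (auto simp: equiv_def refl_on_def)
      then show ?case using x \<pi>_id[OF measurable_space[OF \<Phi> xX(2)] \<zeta>in[OF x]] by simp
    next
      case (step y z)
      then have y: "y \<in> X'" "(\<Phi> x, \<Phi> y) \<in> S" and eq: "\<pi> (\<Phi> x) (\<Phi> y) (\<zeta> y) = \<zeta> x" by auto
      have z: "z \<in> X'" using y(1) step(2) c(1) X'(4) by blast
      have yz: "(y, z) \<in> E1" using step(2) X'(3)[OF y(1)] X'(3)[OF z] by (simp add: E1_def)
      have S: "(\<Phi> y, \<Phi> z) \<in> S" by (rule P.E_S[OF yz])
      have "\<pi> (\<Phi> y) (\<Phi> z) (\<zeta> z) = \<zeta> y" using X'(3)[OF y(1)] yz by (simp add: P.\<rho>_def)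
      then have "\<pi> (\<Phi> x) (\<Phi> z) (\<zeta> z) = \<zeta> x" using \<pi>_comp[OF y(2) S \<zeta>in[OF z]] eq by simp
      moreover have "(\<Phi> x, \<Phi> z) \<in> S" using y(2) S S_equiv by (meson equiv_def transD)
      ultimately show ?case using z by simp
    qed
    then show ?thesis by blast
  qed
  have sub: "X' \<subseteq> X1" using X'(3) by blast
  have "restrict_space ?M1 X' = restrict_space M X'"
  proof -
    have "X1 \<inter> space M \<in> sets M" "X' \<inter> space M \<in> sets M" using X1(1) X'(1) by auto
    moreover have "X1 \<inter> X' = X'" using sub by blast
    ultimately show ?thesis using restrict_restrict_space[of X1 M X'] by simp
  qed
  then have "along (restrict_space M X') \<Phi> \<zeta>" using along_restrict[OF \<zeta>(1), of X'] by simp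
  moreover have "X' \<subseteq> X" using X'(3) X1(3) by blast
  ultimately show ?thesis using X' inv by (intro that) auto
qed

section \<open>Transport to an arbitrary desingularization\<close>

text \<open>The sets \<open>K n\<close> increase and exhaust the relation up to a null set, so
  almost every pair lies in all but finitely many of them, and the bounds \<epsilon> n give
  pointwise convergence.\<close>

lemma almost_invariant_pointwise:
  assumes mr: "measured_eqrel N S" and ai: "has_almost_invariant_unit_sections N S Sec \<pi>"
  obtains \<xi> :: "nat \<Rightarrow> 'b \<Rightarrow> 'h::chilbert_space" where "\<And>n. \<xi> n \<in> Sec" "\<And>n. AE z in N. norm (\<xi> n z) = 1"
    "AE z in N. \<forall>v. (z, v) \<in> S \<longrightarrow> (\<lambda>n. norm (\<pi> z v (\<xi> n v) - \<xi> n z)) \<longlonglongrightarrow> 0"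
proof -
  obtain \<xi> K \<epsilon> where \<xi>: "\<forall>n. \<xi> n \<in> Sec \<and> (AE x in N. norm (\<xi> n x) = 1)"
    and K: "incseq K" "S - (\<Union>n. K n) \<in> null_sets (rel_measure N S)" and \<epsilon>: "\<epsilon> \<longlonglongrightarrow> 0"
    and le: "\<forall>n. AE (x, y) in rel_measure N S. (x, y) \<in> K n \<longrightarrow> norm (\<pi> x y (\<xi> n y) - \<xi> n x) \<le> \<epsilon> n"
    using ai unfolding has_almost_invariant_unit_sections_def by blast
  have "AE p in rel_measure N S. p \<notin> S - (\<Union>n. K n)" using K(2) by (rule AE_not_in)
  then have 1: "AE z in N. \<forall>v. (z, v) \<in> S \<longrightarrow> (z, v) \<notin> S - (\<Union>n. K n)" unfolding AE_rel_measure_iff[OF mr] .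
  have "AE z in N. \<forall>v. (z, v) \<in> S \<longrightarrow> (z, v) \<in> K n \<longrightarrow> norm (\<pi> z v (\<xi> n v) - \<xi> n z) \<le> \<epsilon> n" for n
    using le[rule_format, of n] unfolding AE_rel_measure_iff[OF mr] by simp
  then have 2: "AE z in N. \<forall>n. \<forall>v. (z, v) \<in> S \<longrightarrow> (z, v) \<in> K n \<longrightarrow> norm (\<pi> z v (\<xi> n v) - \<xi> n z) \<le> \<epsilon> n"
    by (simp add: AE_all_countable)
  have 3: "AE z in N. \<forall>v. (z, v) \<in> S \<longrightarrow> (\<lambda>n. norm (\<pi> z v (\<xi> n v) - \<xi> n z)) \<longlonglongrightarrow> 0"
    using 1 2
  proof eventually_elim
    case (elim z)
    show ?case
    proof (intro allI impI)
      fix v assume S: "(z, v) \<in> S"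
      then obtain m where m: "(z, v) \<in> K m" using elim(1) by blast
      have "norm (norm (\<pi> z v (\<xi> n v) - \<xi> n z)) \<le> \<epsilon> n" if "n \<ge> m" for n
      proof -
        have "(z, v) \<in> K n" using m incseqD[OF K(1) that] by blast
        then show ?thesis using elim(2) S by simp
      qed
      then have "\<forall>\<^sub>F n in sequentially. norm (norm (\<pi> z v (\<xi> n v) - \<xi> n z)) \<le> \<epsilon> n"
        unfolding eventually_sequentially by blast
      then show "(\<lambda>n. norm (\<pi> z v (\<xi> n v) - \<xi> n z)) \<longlonglongrightarrow> 0" using \<epsilon> by (rule Lim_null_comparison)
    qed
  qed
  show ?thesis using \<xi> 3 by (intro that[of \<xi>]) auto
qed

theorem mainTheorem5:
  fixes M\<^sub>0 :: "'c measure" and R\<^sub>0 :: "'c rel"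
    and M :: "'a measure" and R :: "'a rel" and \<Sigma> :: "'a set set"
    and \<delta>\<^sub>\<mu> l :: real
  assumes "measured_eqrel M\<^sub>0 R\<^sub>0"
    and "finite_type TYPE('d) M\<^sub>0 R\<^sub>0"
    and "discrete_desingularization M R M\<^sub>0 R\<^sub>0"
    and "ulf_periodic_complex_2 M R \<Sigma>"
    and "\<delta>\<^sub>\<mu> \<ge> 1"
    and "AE (y, z) in rel_measure M R. (y, z) \<in> edge_set \<Sigma> \<longrightarrow>
           ennreal (inverse \<delta>\<^sub>\<mu>) \<le> RN_cocycle M R (y, z) \<and> RN_cocycle M R (y, z) \<le> ennreal \<delta>\<^sub>\<mu>"
    and "AE x in M. link_connected \<Sigma> x \<and> (\<exists>e f. link_adj \<Sigma> x e f) \<and> link_lambda1 \<Sigma> x \<ge> l"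
    and "l > \<delta>\<^sub>\<mu> ^ 3 / 2"
  shows "singular_property_T TYPE('b) TYPE('h::chilbert_space) M\<^sub>0 R\<^sub>0"
  unfolding singular_property_T_def property_T_def
proof (intro allI impI)
  fix N :: "'b measure" and S and H :: "'b \<Rightarrow> 'h set" and Sec \<pi>
  assume dN: "discrete_desingularization N S M\<^sub>0 R\<^sub>0" and rep: "representation N S H Sec \<pi>"
    and ai: "has_almost_invariant_unit_sections N S Sec \<pi>"
  have mrM: "measured_eqrel M R" and mrN: "measured_eqrel N S"
    and si: "stably_isomorphic M R M\<^sub>0 R\<^sub>0" "stably_isomorphic N S M\<^sub>0 R\<^sub>0"
    using assms(3) dN by (simp_all add: discrete_desingularization_def)
  note fN = measured_eqrel_facts[OF mrN] and fM = measured_eqrel_facts[OF mrM]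
  interpret rep N S H Sec \<pi> using rep fN(5,6) by unfold_locales
  \<comment> \<open>Both relations desingularize the same quotient, so they are linked through it,
    with no isomorphism between them at hand.\<close>
  obtain L X \<Phi> Y \<Psi> where L: "\<And>x z x' z'. L x z \<Longrightarrow> L x' z' \<Longrightarrow> (x, x') \<in> R \<longleftrightarrow> (z, z') \<in> S"
    and X: "X \<in> sets M" "space M - X \<in> null_sets M" and \<Phi>: "\<Phi> \<in> measurable M N" "\<And>x. x \<in> X \<Longrightarrow> L x (\<Phi> x)"
      "\<And>Z. Z \<in> null_sets N \<Longrightarrow> \<Phi> -` Z \<inter> X \<in> null_sets M"
    and Y: "Y \<in> sets N" "space N - Y \<in> null_sets N" and \<Psi>: "\<Psi> \<in> measurable N M" "\<And>z. z \<in> Y \<Longrightarrow> L (\<Psi> z) z"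
      "\<And>Z. Z \<in> null_sets M \<Longrightarrow> \<Psi> -` Z \<inter> Y \<in> null_sets N"
    by (rule stable_equivalence_maps[OF mrM mrN assms(1) si]) (rule that)
  obtain \<xi> where \<xi>: "\<And>n :: nat. \<xi> n \<in> Sec" "\<And>n. AE z in N. norm (\<xi> n z) = 1"
    "AE z in N. \<forall>v. (z, v) \<in> S \<longrightarrow> (\<lambda>n. norm (\<pi> z v (\<xi> n v) - \<xi> n z)) \<longlonglongrightarrow> 0"
    by (rule almost_invariant_pointwise[OF mrN ai]) (rule that)
  have coc: "AE p in rel_measure M R. p \<in> edge_set \<Sigma> \<longrightarrow>
      ennreal (inverse \<delta>\<^sub>\<mu>) \<le> RN_cocycle M R p \<and> RN_cocycle M R p \<le> ennreal \<delta>\<^sub>\<mu>"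
    using assms(6) by (simp add: case_prod_unfold)
  have \<Phi>S: "(\<Phi> x, \<Phi> y) \<in> S" if "x \<in> X" "y \<in> X" "(x, y) \<in> R" for x y
    using L[OF \<Phi>(2)[OF that(1)] \<Phi>(2)[OF that(2)]] that(3) by simp
  obtain X' \<zeta> where X': "X' \<in> sets M" "space M - X' \<in> null_sets M" "X' \<subseteq> X"
    "\<And>x y. (x, y) \<in> R \<Longrightarrow> x \<in> X' \<longleftrightarrow> y \<in> X'"
    "along (restrict_space M X') \<Phi> \<zeta>" "\<And>x. x \<in> X' \<Longrightarrow> norm (\<zeta> x) = 1"
    "\<And>x y. x \<in> X' \<Longrightarrow> (x, y) \<in> R \<Longrightarrow> \<pi> (\<Phi> x) (\<Phi> y) (\<zeta> y) = \<zeta> x"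
    by (rule invariant_section_on_complex[OF mrM assms(4,5) coc assms(7,8) X(2) \<Phi>(1) \<Phi>S \<Phi>(3) \<xi>]) (assumption | rule that)+
  have spX': "space (restrict_space M X') = X'" using sets.sets_into_space[OF X'(1)] by (auto simp: space_restrict_space)
  have \<zeta>in: "\<zeta> x \<in> H (\<Phi> x)" if "x \<in> X'" for x using along_in[OF X'(5)] that spX' by simp
  define Y' where "Y' = Y \<inter> (\<Psi> -` X' \<inter> space N)"
  have Y': "Y' \<in> sets N" unfolding Y'_def using Y(1) measurable_sets[OF \<Psi>(1) X'(1)] by auto
  have Y'null: "space N - Y' \<in> null_sets N"
  proof -
    have "(space N - Y) \<union> (\<Psi> -` (space M - X') \<inter> Y) \<in> null_sets N" using Y(2) \<Psi>(3)[OF X'(2)] by (rule null_sets.Un)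
    moreover have "space N - Y' \<subseteq> (space N - Y) \<union> (\<Psi> -` (space M - X') \<inter> Y)"
      using measurable_space[OF \<Psi>(1)] by (auto simp: Y'_def)
    ultimately show ?thesis using Y' by (meson null_sets_subset sets.compl_sets)
  qed
  have spY': "space (restrict_space N Y') = Y'" using sets.sets_into_space[OF Y'] by (auto simp: space_restrict_space)
  \<comment> \<open>z and \<open>\<Phi> (\<Psi> z)\<close> are both linked to
    \<open>\<Psi> z\<close>, so reflexivity of R puts them into one class of S.\<close>
  have zS: "(z, \<Phi> (\<Psi> z)) \<in> S" if z: "z \<in> Y'" for z
  proof -
    have "\<Psi> z \<in> X'" "L (\<Psi> z) z" using z \<Psi>(2) by (auto simp: Y'_def)
    moreover have "(\<Psi> z, \<Psi> z) \<in> R" using fM(5) \<open>\<Psi> z \<in> X'\<close> sets.sets_into_space[OF X'(1)] by (auto simp: equiv_def refl_on_def)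
    ultimately show ?thesis using L[of "\<Psi> z" z "\<Psi> z" "\<Phi> (\<Psi> z)"] \<Phi>(2) X'(3) by blast
  qed
  \<comment> \<open>The value of \<zeta> at \<open>\<Psi> z\<close> lives in the fibre over
    \<open>\<Phi> (\<Psi> z)\<close> and is transported to z; the value 0 off Y' makes \<theta> a
    section of the whole field.\<close>
  define \<theta> where "\<theta> z = (if z \<in> Y' then \<pi> z (\<Phi> (\<Psi> z)) (\<zeta> (\<Psi> z)) else 0)" for z
  have "\<Psi> \<in> measurable (restrict_space N Y') (restrict_space M X')"
    using \<Psi>(1) by (intro measurable_restrict_space3) (auto simp: Y'_def)
  from along_compose[OF X'(5) this]
  have "along (restrict_space N Y') (\<lambda>z. z) (\<lambda>z. \<pi> z (\<Phi> (\<Psi> z)) (\<zeta> (\<Psi> z)))"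
    by (rule along_transport) (use zS spY' in \<open>auto intro: measurable_restrict_space1\<close>)
  then have a\<theta>: "along N (\<lambda>z. z) \<theta>" unfolding \<theta>_def by (intro along_extend Y') auto
  then have "\<theta> \<in> Sec" unfolding Sec_iff_along by (auto dest: along_in)
  moreover have aeY': "AE z in N. z \<in> Y'" using AE_not_in[OF Y'null] AE_space by eventually_elim simp
  then have "AE z in N. norm (\<theta> z) = 1"
  proof eventually_elim
    case (elim z)
    have x: "\<Psi> z \<in> X'" using elim by (auto simp: Y'_def)
    show ?case using \<pi>_facts(6)[OF zS[OF elim] zS[OF elim] \<zeta>in[OF x]] X'(6)[OF x] elim by (simp add: \<theta>_def)
  qed
  moreover have "AE (z, v) in rel_measure N S. \<pi> z v (\<theta> v) = \<theta> z"
  proof -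
    \<comment> \<open>Both ends of a pair have to lie in Y', which takes a saturated conull
      set.\<close>
    obtain Y3 where Y3: "Y3 \<in> sets N" "space N - Y3 \<in> null_sets N" "\<And>z. z \<in> Y3 \<Longrightarrow> z \<in> Y'"
      "\<And>z v. (z, v) \<in> S \<Longrightarrow> z \<in> Y3 \<longleftrightarrow> v \<in> Y3" by (rule conull_invariant_subset[OF mrN aeY']) (rule that)
    have "AE z in N. z \<in> Y3" using AE_not_in[OF Y3(2)] AE_space by eventually_elim simp
    then have "AE z in N. \<forall>v. (z, v) \<in> S \<longrightarrow> \<pi> z v (\<theta> v) = \<theta> z"
    proof eventually_elim
      case (elim z)
      show ?case
      proof (intro allI impI)
        fix v assume S: "(z, v) \<in> S"
        have z: "z \<in> Y'" and v: "v \<in> Y'" using elim Y3(3,4) S by auto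
        then have x: "\<Psi> z \<in> X'" "\<Psi> v \<in> X'" "L (\<Psi> z) z" "L (\<Psi> v) v" using \<Psi>(2) by (auto simp: Y'_def)
        then have R: "(\<Psi> z, \<Psi> v) \<in> R" using L S by blast
        have SS: "(\<Phi> (\<Psi> z), \<Phi> (\<Psi> v)) \<in> S" using \<Phi>S R x X'(3) by blast
        have "\<pi> z v (\<theta> v) = \<pi> z v (\<pi> v (\<Phi> (\<Psi> v)) (\<zeta> (\<Psi> v)))" using v by (simp add: \<theta>_def)
        also have "\<dots> = \<pi> z (\<Phi> (\<Psi> v)) (\<zeta> (\<Psi> v))" using \<pi>_comp[OF S zS[OF v] \<zeta>in[OF x(2)]] by simp
        also have "\<dots> = \<pi> z (\<Phi> (\<Psi> z)) (\<pi> (\<Phi> (\<Psi> z)) (\<Phi> (\<Psi> v)) (\<zeta> (\<Psi> v)))" by (rule \<pi>_comp[OF zS[OF z] SS \<zeta>in[OF x(2)]])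
        also have "\<dots> = \<theta> z" using X'(7)[OF x(1) R] z by (simp add: \<theta>_def)
        finally show "\<pi> z v (\<theta> v) = \<theta> z" .
      qed
    qed
    then have "AE p in rel_measure N S. case p of (z, v) \<Rightarrow> \<pi> z v (\<theta> v) = \<theta> z"
      unfolding AE_rel_measure_iff[OF mrN] by simp
    then show ?thesis .
  qed
  ultimately show "has_invariant_unit_section N S Sec \<pi>" unfolding has_invariant_unit_section_def by blast
qed

end
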